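(* Suppose that $\mathsf{g}:\mathbb{R}^d\setminus\{0\}\to\mathbb{R}$ satisfies: (1) $\mathsf{g}\in C^\infty(\mathbb{R}^d\setminus\{0\})$; (2) $\mathsf{g}$ is radially symmetric; (3) $\mathsf{g}$ is conditionally positive definite and $\hat{\mathsf{g}}$ is nonincreasing (as a function of $|\xi|$). Fix $t>0$ and $p\in[1,\infty]$. Assume furthermore that $$r^2\hat{\mathsf{g}}(r)\to0\qquad\text{as } r\to\infty,$$ and that $\sigma:[0,\infty)\to[0,\infty]$ satisfies $$\lim_{r\to\infty}\sqrt{\hat{\mathsf{g}}(tr)}\,\|\sigma\|_{L^\infty([r-1,r+1])}=0\qquad\text{if } 2\le p\le\infty,$$ $$\lim_{r\to\infty}\sqrt{\hat{\mathsf{g}}(tr)}\,\max_{n\le d+1}\|\partial_r^n\sigma\|_{L^\infty([r-1,r+1])}=0\qquad\text{if } 1\le p<2.$$ Then for every $M\ge0$, there exist a $C^\infty$ vector field $v:\mathbb{R}^d\to\mathbb{R}^d$ and zero-mean Schwartz functions $f,g$ on $\mathbb{R}^d$ such that $$\frac{\displaystyle\left|\int_{(\mathbb{R}^d)^2}(v(x)-v(y))\cdot\nabla\mathsf{g}(x-y)f(x)g(y)\,dx\,dy\right|}{\displaystyle\Big(\|\nabla v\|_{L^\infty}+\|\sigma(|\nabla|)v\|_{L^p}\Big)\|f\|_{\mathsf{g}_t}\|g\|_{\mathsf{g}_t}}\ \ge\ M .$$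
   Context: A kernel $k:\mathbb{R}^d\times\mathbb{R}^d\to\mathbb{R}$ is conditionally positive definite if $\int_{(\mathbb{R}^d)^2}k(x,y)\,d\rho(x)d\rho(y)\ge0$ for every signed Borel measure $\rho$ with zero mass; $\mathsf{g}$ is conditionally positive definite if $k(x,y)=\mathsf{g}(x-y)$ is. The Fourier transform is $\hat f(\xi)=\int_{\mathbb{R}^d}f(x)e^{-2\pi i\xi\cdot x}dx$. By radial symmetry one writes $\mathsf{g}(|x|)=\mathsf{g}(x)$ and $\hat{\mathsf{g}}(|\xi|)=\hat{\mathsf{g}}(\xi)$. For $t>0$, $\mathsf{g}_t(x)=\mathsf{g}(x/t)$. The energy seminorm associated with a potential $\mathsf{g}$ is $\|f\|_{\mathsf{g}}^2=\int_{(\mathbb{R}^d)^2}\mathsf{g}(x-y)f(x)f(y)\,dx\,dy=\int_{\mathbb{R}^d}\hat{\mathsf{g}}|\hat f|^2$, nonnegative (possibly $+\infty$) for zero-mean $f$; $\|f\|_{\mathsf{g}_t}$ is this seminorm for the potential $\mathsf{g}_t$. For $\sigma:[0,\infty)\to[0,\infty]$, $\sigma(|\nabla|)f=\mathcal{F}^{-1}(\sigma(|\xi|)\hat f(\xi))$, applied componentwise to vector fields. Zero mean means integral zero.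
   Formalization: The potential g is additionally assumed not to be constant on R^d minus the origin; for constant g (such as g = 0) the numerator and denominator both vanish for all v, f, g, so the quotient is 0/0. *)

theory Defs
  imports "HOL-Probability.Essential_Supremum"
begin

section \<open>Smooth and Schwartz functions\<close>

text \<open>Iterated directional derivative along the vectors of a list.\<close>

primrec iter_partial ::
  "'a::euclidean_space list \<Rightarrow> ('a \<Rightarrow> 'b::real_normed_vector) \<Rightarrow> 'a \<Rightarrow> 'b" where
  "iter_partial [] f = f"
| "iter_partial (b # bs) f = (\<lambda>x. frechet_derivative (iter_partial bs f) (at x) b)"

text \<open>Meant for open \<open>S\<close>: each partial derivative of every order exists and is differentiable,
  hence continuous, on \<open>S\<close>.\<close>

definition smooth_on :: "'a::euclidean_space set \<Rightarrow> ('a \<Rightarrow> 'b::real_normed_vector) \<Rightarrow> bool" where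
  "smooth_on S f \<longleftrightarrow> (\<forall>bs\<in>lists Basis. \<forall>x\<in>S. iter_partial bs f differentiable (at x))"

definition schwartz :: "('a::euclidean_space \<Rightarrow> 'b::real_normed_vector) \<Rightarrow> bool" where
  "schwartz f \<longleftrightarrow> smooth_on UNIV f \<and>
     (\<forall>bs\<in>lists Basis. \<forall>n::nat. \<exists>C. \<forall>x. (1 + norm x) ^ n * norm (iter_partial bs f x) \<le> C)"

definition gradient :: "('a::euclidean_space \<Rightarrow> real) \<Rightarrow> 'a \<Rightarrow> 'a" where
  "gradient f x = (\<Sum>b\<in>Basis. frechet_derivative f (at x) b *\<^sub>R b)"


section \<open>Fourier transforms\<close>

definition fourier :: "('a::euclidean_space \<Rightarrow> complex) \<Rightarrow> 'a \<Rightarrow> complex" where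
  "fourier f \<xi> = (\<integral>x. f x * exp (- (2 * complex_of_real pi * \<i> * complex_of_real (\<xi> \<bullet> x))) \<partial>lborel)"

text \<open>Functions that define regular tempered distributions.\<close>

definition tempered :: "('a::euclidean_space \<Rightarrow> 'b::{banach, second_countable_topology}) \<Rightarrow> bool" where
  "tempered f \<longleftrightarrow> f \<in> borel_measurable borel \<and>
     (\<exists>N::nat. integrable lborel (\<lambda>x. (1 / (1 + norm x) ^ N) *\<^sub>R f x))"

text \<open>The tempered distribution \<open>f\<close> has a Fourier transform that is again (given by) a
  function, namely \<open>F\<close>.\<close>

definition tempered_fourier :: "('a::euclidean_space \<Rightarrow> complex) \<Rightarrow> ('a \<Rightarrow> complex) \<Rightarrow> bool" where
  "tempered_fourier f F \<longleftrightarrow> tempered f \<and> tempered F \<and>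
     (\<forall>\<phi>. schwartz \<phi> \<longrightarrow> (\<integral>x. f x * fourier \<phi> x \<partial>lborel) = (\<integral>\<xi>. F \<xi> * \<phi> \<xi> \<partial>lborel))"

text \<open>The Fourier transform of a conditionally positive definite potential need not be a function
  near the origin (for a constant it is a Dirac mass) and need not be locally integrable
  there (for the logarithm it is \<open>c / |\<xi>|\<^sup>d\<close> off the origin).  As usual it is therefore tested
  against Schwartz functions vanishing to second order at the origin; these include
  \<open>|f\<^sup>^|\<^sup>2\<close> for every zero-mean Schwartz function \<open>f\<close>, so that the double integral of
  \<open>g (x - y) f(x) f(y)\<close> equals the integral of \<open>G |f\<^sup>^|\<^sup>2\<close>.  The values of \<open>g\<close> and \<open>G\<close> at \<open>0\<close>
  are immaterial.\<close>

definition potential_fourier :: "('a::euclidean_space \<Rightarrow> real) \<Rightarrow> ('a \<Rightarrow> real) \<Rightarrow> bool" where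
  "potential_fourier g G \<longleftrightarrow> tempered g \<and>
     (\<forall>\<phi>::'a \<Rightarrow> complex. schwartz \<phi> \<and> \<phi> 0 = 0 \<and> (\<forall>b\<in>Basis. iter_partial [b] \<phi> 0 = 0) \<longrightarrow>
        integrable lborel (\<lambda>\<xi>. complex_of_real (G \<xi>) * \<phi> \<xi>) \<and>
        (\<integral>x. complex_of_real (g x) * fourier \<phi> x \<partial>lborel) =
        (\<integral>\<xi>. complex_of_real (G \<xi>) * \<phi> \<xi> \<partial>lborel))"

text \<open>\<open>w = \<sigma>(|\<nabla>|) v\<close>, componentwise.  Where \<open>\<sigma>\<close> is infinite the Fourier transform of \<open>v\<close>
  has to vanish, and the product is then \<open>0\<close>.\<close>

definition fourier_multiplier ::
  "(real \<Rightarrow> ennreal) \<Rightarrow> ('a::euclidean_space \<Rightarrow> 'a) \<Rightarrow> ('a \<Rightarrow> 'a) \<Rightarrow> bool" where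
  "fourier_multiplier \<sigma> v w \<longleftrightarrow> (\<forall>b\<in>Basis. \<exists>V.
     tempered_fourier (\<lambda>x. complex_of_real (v x \<bullet> b)) V \<and>
     (AE \<xi> in lborel. \<sigma> (norm \<xi>) = top \<longrightarrow> V \<xi> = 0) \<and>
     tempered_fourier (\<lambda>x. complex_of_real (w x \<bullet> b))
       (\<lambda>\<xi>. complex_of_real (enn2real (\<sigma> (norm \<xi>))) * V \<xi>))"


section \<open>Conditional positive definiteness and energies\<close>

text \<open>A signed Borel measure of zero mass is a difference of two finite measures \<open>\<mu>\<close>, \<open>\<nu>\<close> of equal
  mass.  The kernels of interest, \<open>g (x - y)\<close> with \<open>g\<close> given off the origin, are
  undefined on the diagonal, so only measures that do not charge points, for which the diagonal
  is a null set, and for which the double integral converges absolutely are tested.\<close>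

definition cond_pos_def :: "('a::euclidean_space \<Rightarrow> 'a \<Rightarrow> real) \<Rightarrow> bool" where
  "cond_pos_def k \<longleftrightarrow> (\<forall>\<mu> \<nu>.
     finite_measure \<mu> \<and> finite_measure \<nu> \<and> sets \<mu> = sets borel \<and> sets \<nu> = sets borel \<and>
     emeasure \<mu> UNIV = emeasure \<nu> UNIV \<and>
     (\<forall>x. emeasure \<mu> {x} = 0 \<and> emeasure \<nu> {x} = 0) \<and>
     (\<forall>\<alpha>\<in>{\<mu>, \<nu>}. \<forall>\<beta>\<in>{\<mu>, \<nu>}. integrable (\<alpha> \<Otimes>\<^sub>M \<beta>) (\<lambda>(x, y). k x y)) \<longrightarrow>
     (\<integral>(x, y). k x y \<partial>(\<mu> \<Otimes>\<^sub>M \<mu>)) - (\<integral>(x, y). k x y \<partial>(\<mu> \<Otimes>\<^sub>M \<nu>))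
       - (\<integral>(x, y). k x y \<partial>(\<nu> \<Otimes>\<^sub>M \<mu>)) + (\<integral>(x, y). k x y \<partial>(\<nu> \<Otimes>\<^sub>M \<nu>)) \<ge> 0)"

definition dilate :: "real \<Rightarrow> ('a::euclidean_space \<Rightarrow> real) \<Rightarrow> 'a \<Rightarrow> real" where
  "dilate t g x = g (x /\<^sub>R t)"

text \<open>For tempered \<open>g\<close> and Schwartz \<open>f\<close> the double integral converges absolutely, so the
  seminorm is finite.\<close>

definition energy_norm :: "('a::euclidean_space \<Rightarrow> real) \<Rightarrow> ('a \<Rightarrow> real) \<Rightarrow> real" where
  "energy_norm g f = sqrt (\<integral>(x, y). g (x - y) * f x * f y \<partial>(lborel \<Otimes>\<^sub>M lborel))"

definition commutator_integrand ::
  "('a::euclidean_space \<Rightarrow> real) \<Rightarrow> ('a \<Rightarrow> 'a) \<Rightarrow> ('a \<Rightarrow> real) \<Rightarrow> ('a \<Rightarrow> real) \<Rightarrow> 'a \<times> 'a \<Rightarrow> real" where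
  "commutator_integrand g v f h = (\<lambda>(x, y). ((v x - v y) \<bullet> gradient g (x - y)) * f x * h y)"


section \<open>Lebesgue norms and weak derivatives\<close>

definition Lp_norm :: "ennreal \<Rightarrow> ('a::euclidean_space \<Rightarrow> 'b::real_normed_vector) \<Rightarrow> ennreal" where
  "Lp_norm p f =
     (if p = top then esssup lborel (\<lambda>x. ennreal (norm (f x)))
      else let I = (\<integral>\<^sup>+x. ennreal (norm (f x) powr enn2real p) \<partial>lborel)
           in if I = top then top else ennreal (enn2real I powr (1 / enn2real p)))"

definition Linf_on :: "real set \<Rightarrow> (real \<Rightarrow> ennreal) \<Rightarrow> ennreal" where
  "Linf_on S u = esssup (restrict_space lborel S) u"

text \<open>\<open>w\<close> is the weak derivative of order \<open>n\<close> of \<open>u\<close> on the open set \<open>S\<close>.\<close>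

definition weak_deriv_on :: "real set \<Rightarrow> nat \<Rightarrow> (real \<Rightarrow> real) \<Rightarrow> (real \<Rightarrow> real) \<Rightarrow> bool" where
  "weak_deriv_on S n u w \<longleftrightarrow>
     (\<forall>K. compact K \<and> K \<subseteq> S \<longrightarrow> set_integrable lborel K u \<and> set_integrable lborel K w) \<and>
     (\<forall>\<phi>::real \<Rightarrow> real. smooth_on UNIV \<phi> \<and>
        (\<exists>K. compact K \<and> K \<subseteq> S \<and> (\<forall>x. x \<notin> K \<longrightarrow> \<phi> x = 0)) \<longrightarrow>
        (\<integral>x. u x * (deriv ^^ n) \<phi> x \<partial>lborel) = (-1) ^ n * (\<integral>x. w x * \<phi> x \<partial>lborel))"

text \<open>\<open>sqrt (G (t r)) * N r\<close> tends to \<open>0\<close> as \<open>r \<rightarrow> \<infinity>\<close>.  In \<^typ>\<open>ennreal\<close>, \<open>0 * \<infinity> = 0\<close>; the first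
  conjunct rules this out as a reason for convergence when \<open>G\<close> vanishes far out.\<close>

definition weighted_decay :: "(real \<Rightarrow> real) \<Rightarrow> real \<Rightarrow> (real \<Rightarrow> ennreal) \<Rightarrow> bool" where
  "weighted_decay G t N \<longleftrightarrow>
     (\<forall>\<^sub>F r in at_top. N r < top) \<and>
     ((\<lambda>r. ennreal (sqrt (G (t * r))) * N r) \<longlongrightarrow> 0) at_top"

end

theory Submission
 imports Defs "HOL-Probability.Probability" "HOL-Computational_Algebra.Polynomial"
begin

text \<open>The test field is \<open>v = s e\<close> with \<open>s x = cos (2 pi rho (x \<bullet> e)) beta x / rho\<close>, \<open>rho = r + 1/2\<close>
 and \<open>beta\<close> band-limited. Its Fourier transform lives near \<open>\<plusminus> rho e\<close>, so \<open>\<nabla>v\<close> stays bounded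
 and \<open>rho \<sigma>(|\<nabla>|) v\<close> is controlled by \<open>\<sigma>\<close> on \<open>[r - 1, r + 1]\<close>: by Bessel's inequality and the trivial
 bound if \<open>p \<ge> 2\<close>, and for \<open>p < 2\<close> by the kernel decay that \<open>d + 1\<close> weak derivatives of the symbol give.
 With \<open>f\<close> close to \<open>k x cos (2 pi rho (x \<bullet> e))\<close> the Riemann-Lebesgue lemma shows that \<open>rho\<close> times the
 commutator integral tends to half of \<open>J = \<integral>\<integral> beta x k x \<partial>\<^sub>e g (x - y) h y\<close>, whereas \<open>rho\<close> times
 the denominator tends to \<open>0\<close> as soon as the energy of \<open>f\<close> is \<open>O(ghat (t r))\<close>.

 The choice of \<open>k\<close> and \<open>h\<close> depends on the decay of \<open>ghat\<close>. If \<open>r^(d + 2) ghat (t r)\<close> is bounded,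
 \<open>\<partial>\<^sub>e g\<close> grows at most linearly, being the sine transform of an integrable function, and \<open>k = beta\<close> works.
 Otherwise \<open>r\<close> runs through radii at which \<open>r^(d + 2) ghat (t r)\<close> is within a factor \<open>2\<close> of its running
 maximum, which tames the tails of the transform of \<open>k\<close>; then \<open>k\<close> and \<open>h\<close> can be bumps with disjoint
 supports, which keeps the integral away from the singularity of \<open>g\<close>.\<close>

text \<open>Two demands on \<open>k\<close> and \<open>h\<close> compete. The energy of
  \<open>f\<close> has to be \<open>O(ghat (t * r))\<close> although \<open>ghat\<close> may fall
  off extremely fast and may be huge near 0, so the transform of \<open>k\<close> should be
  concentrated near 0. The limit of the commutator integral wants a bounded, rapidly decaying
  integrand although \<open>dir_deriv e g\<close> may be unbounded at 0, so \<open>k\<close> and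
  \<open>h\<close> should have separated supports. A compactly supported \<open>k\<close> is never
  band-limited, hence the two cases. The exponent \<open>d + 2\<close> is one power for the
  derivative of \<open>g\<close> plus \<open>d + 1\<close> powers for integrability; in the other
  case the same quantity bounds \<open>ghat (t * r)\<close> from below, and this absorbs the tails.

  The shift by 1/2 places balls of radius 1/2 around the two frequencies inside
  \<open>r <= norm xi <= r + 1\<close>, where monotonicity gives
  \<open>ghat (t * norm xi) <= ghat (t * r)\<close>. The hypothesis on \<open>r^2 * ghat r\<close>
  pays for \<open>\<nabla>v\<close>, since \<open>rho * sqrt (ghat (t * r))\<close> then tends to 0.
  The denominator must also be positive: \<open>ghat\<close> is shown to be positive near 0, and
  \<open>f\<close> receives a small multiple of \<open>dir_deriv e k\<close>.\<close>

lemmas integrable_dom = Bochner_Integration.integrable_bound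

notation scaleR (infixr "*R" 75)

abbreviation cor :: "real => complex" where
 "cor == complex_of_real"

abbreviation lborel2 :: "('a::euclidean_space \<times> 'b::euclidean_space) measure" where
 "lborel2 == lborel \<Otimes>\<^sub>M lborel"

section \<open>Calculus of smooth, rapidly decreasing and moderately growing functions\<close>

definition dir_deriv :: "'a::euclidean_space => ('a => 'b::real_normed_vector) => 'a => 'b" where
 "dir_deriv b f x = frechet_derivative f (at x) b"

lemma iter_partial_Cons: "iter_partial (b # bs) f = dir_deriv b (iter_partial bs f)"
 by (simp add: dir_deriv_def fun_eq_iff)

lemma iter_partial_append: "iter_partial (bs @ cs) f = iter_partial bs (iter_partial cs f)"
 by (induction bs) auto

lemma dir_deriv_eq: "(f has_derivative f') (at x) ==> dir_deriv b f x = f' b"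
 unfolding dir_deriv_def by (metis frechet_derivative_at)

lemma has_derivative_dir_deriv:
 "f differentiable (at x) ==> (f has_derivative (%b. dir_deriv b f x)) (at x)"
 unfolding dir_deriv_def by (simp add: frechet_derivative_works)

lemma dir_deriv_sum_Basis:
 assumes "f differentiable (at x)"
 shows "dir_deriv c f x = (\<Sum>b\<in>Basis. (c \<bullet> b) *R dir_deriv b f x)"
proof -
 interpret bounded_linear "%b. dir_deriv b f x"
  using has_derivative_dir_deriv[OF assms] by (rule has_derivative_bounded_linear)
 have "dir_deriv c f x = dir_deriv (\<Sum>b\<in>Basis. (c \<bullet> b) *R b) f x"
  by (simp add: euclidean_representation)
 then show ?thesis by (simp add: sum scaleR)
qed

definition decays :: "('a::real_normed_vector => 'b::real_normed_vector) => bool" where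
 "decays f \<longleftrightarrow> (\<forall>n. \<exists>C. \<forall>x. (1 + norm x) ^ n * norm (f x) <= C)"

lemma decaysE:
 assumes "decays f"
 obtains C where "C > 0" "\<And>x. norm (f x) <= C / (1 + norm x) ^ n"
proof -
 obtain C where C: "\<And>x. (1 + norm x) ^ n * norm (f x) <= C"
  using assms unfolding decays_def by blast
 have "norm (f x) <= (\<bar>C\<bar> + 1) / (1 + norm x) ^ n" for x
 proof -
  have "(1 + norm x) ^ n > 0" by (simp add: add_pos_nonneg)
  then show ?thesis using C[of x] by (simp add: field_simps)
 qed
 then show ?thesis using that[of "\<bar>C\<bar> + 1"] by simp
qed

lemma decaysI:
 assumes "\<And>n. \<exists>C. \<forall>x. norm (f x) <= C / (1 + norm x) ^ n"
 shows "decays f"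
 unfolding decays_def
proof
 fix n
 obtain C where C: "\<And>x. norm (f x) <= C / (1 + norm x) ^ n" using assms by blast
 have "(1 + norm x) ^ n * norm (f x) <= C" for x
 proof -
  have "(1 + norm x) ^ n > 0" by (simp add: add_pos_nonneg)
  then show ?thesis using C[of x] by (simp add: field_simps)
 qed
 then show "\<exists>C. \<forall>x. (1 + norm x) ^ n * norm (f x) <= C" by blast
qed

text \<open>An invariant closed under single partial derivatives reaches every iterated one. The
  criteria for smooth, Schwartz and moderate functions below rest on this, so no formula for a
  higher derivative is ever written down.\<close>

lemma iter_partial_coinduct:
 fixes f :: "'a::euclidean_space => 'b::real_normed_vector" and P :: "('a => 'b) => bool"
 assumes "bs \<in> lists Basis"
  and "P f"
  and "\<And>f b. P f ==> b \<in> Basis ==> P (dir_deriv b f)"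
 shows "P (iter_partial bs f)"
 using assms(1)
proof (induction bs)
 case (Cons b bs)
 then show ?case using assms(3)[of "iter_partial bs f" b] by (simp add: iter_partial_Cons del: iter_partial.simps)
qed (simp add: assms(2))

lemma smooth_on_coinduct:
 fixes f :: "'a::euclidean_space => 'b::real_normed_vector" and P :: "('a => 'b) => bool"
 assumes "P f"
  and "\<And>f x. P f ==> f differentiable (at x)"
  and "\<And>f b. P f ==> b \<in> Basis ==> P (dir_deriv b f)"
 shows "smooth_on UNIV f"
 unfolding smooth_on_def
proof (intro ballI)
 fix bs x assume "bs \<in> lists (Basis::'a set)"
 then have "P (iter_partial bs f)"
  by (rule iter_partial_coinduct[where P = P]) (fact assms)+
 then show "iter_partial bs f differentiable (at x)" by (rule assms(2))
qed

lemma schwartz_coinduct: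
 fixes f :: "'a::euclidean_space => 'b::real_normed_vector" and P :: "('a => 'b) => bool"
 assumes "P f"
  and "\<And>f x. P f ==> f differentiable (at x)"
  and "\<And>f. P f ==> decays f"
  and "\<And>f b. P f ==> b \<in> Basis ==> P (dir_deriv b f)"
 shows "schwartz f"
 unfolding schwartz_def
proof (intro conjI ballI allI)
 show "smooth_on UNIV f" by (rule smooth_on_coinduct[where P = P]) (fact assms)+
 fix bs n assume "bs \<in> lists (Basis::'a set)"
 then have "P (iter_partial bs f)"
  by (rule iter_partial_coinduct[where P = P]) (fact assms)+
 then have "decays (iter_partial bs f)" by (rule assms(3))
 then show "\<exists>C. \<forall>x. (1 + norm x) ^ n * norm (iter_partial bs f x) <= C" unfolding decays_def by blast
qed

lemma smooth_differentiable: "smooth_on UNIV f ==> f differentiable (at x)"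
 unfolding smooth_on_def by (drule bspec[of _ _ "[]"]) auto

lemma smooth_dir_deriv:
 fixes f :: "'a::euclidean_space => 'b::real_normed_vector"
 shows "smooth_on UNIV f ==> b \<in> Basis ==> smooth_on UNIV (dir_deriv b f)"
 unfolding smooth_on_def
proof (intro ballI)
 fix bs :: "'a list" and x :: 'a assume *: "\<forall>bs\<in>lists (Basis::'a set). \<forall>x\<in>UNIV. iter_partial bs f differentiable at x" "b \<in> Basis" "bs \<in> lists Basis"
 \<comment> \<open>\<open>iter_partial\<close> applies the last vector of the list first, so the
   derivative already taken is appended at the end.\<close>
 then have "bs @ [b] \<in> lists Basis" by simp
 with * have "iter_partial (bs @ [b]) f differentiable at x" by blast
 then show "iter_partial bs (dir_deriv b f) differentiable at x"
  by (simp add: iter_partial_append dir_deriv_def[abs_def])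
qed

lemma schwartz_smooth: "schwartz f ==> smooth_on UNIV f"
 by (simp add: schwartz_def)

lemma schwartz_differentiable: "schwartz f ==> f differentiable (at x)"
 by (intro smooth_differentiable schwartz_smooth)

lemma schwartz_decays: "schwartz f ==> decays f"
 unfolding schwartz_def decays_def by (drule conjunct2, drule bspec[of _ _ "[]"]) auto

lemma schwartz_dir_deriv: "schwartz f ==> b \<in> Basis ==> schwartz (dir_deriv b f)"
proof -
 assume f: "schwartz f" and b: "b \<in> Basis"
 have "\<exists>C. \<forall>x. (1 + norm x) ^ n * norm (iter_partial bs (dir_deriv b f) x) <= C" if "bs \<in> lists Basis" for bs n
 proof -
  have "bs @ [b] \<in> lists Basis" using b that by simp
  then have "\<exists>C. \<forall>x. (1 + norm x) ^ n * norm (iter_partial (bs @ [b]) f x) <= C"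
   using f unfolding schwartz_def by blast
  then show ?thesis by (simp add: iter_partial_append dir_deriv_def[abs_def])
 qed
 then show ?thesis using smooth_dir_deriv[OF schwartz_smooth[OF f] b] unfolding schwartz_def by blast
qed

lemma schwartz_isCont: "schwartz f ==> isCont f x"
 using schwartz_differentiable differentiable_imp_continuous_within by blast

lemma schwartz_continuous_on: "schwartz f ==> continuous_on S f"
 by (simp add: schwartz_isCont continuous_at_imp_continuous_on)

lemma schwartz_measurable [measurable_dest]: "schwartz f ==> f \<in> borel_measurable borel"
 by (intro borel_measurable_continuous_onI schwartz_continuous_on)

text \<open>These are the pointwise multipliers of the Schwartz space: smooth, every derivative of
  polynomial growth.\<close>

definition moderate :: "('a::euclidean_space => 'b::real_normed_vector) => bool" where
 "moderate f \<longleftrightarrow> smooth_on UNIV f \<and>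
  (\<forall>bs\<in>lists Basis. \<exists>n C. \<forall>x. norm (iter_partial bs f x) <= C * (1 + norm x) ^ n)"

lemma moderate_coinduct:
 fixes f :: "'a::euclidean_space => 'b::real_normed_vector" and P :: "('a => 'b) => bool"
 assumes "P f"
  and "\<And>f x. P f ==> f differentiable (at x)"
  and "\<And>f. P f ==> \<exists>n C. \<forall>x. norm (f x) <= C * (1 + norm x) ^ n"
  and "\<And>f b. P f ==> b \<in> Basis ==> P (dir_deriv b f)"
 shows "moderate f"
 unfolding moderate_def
proof (intro conjI ballI)
 show "smooth_on UNIV f" by (rule smooth_on_coinduct[where P = P]) (fact assms)+
 fix bs assume "bs \<in> lists (Basis::'a set)"
 then have "P (iter_partial bs f)"
  by (rule iter_partial_coinduct[where P = P]) (fact assms)+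
 then show "\<exists>n C. \<forall>x. norm (iter_partial bs f x) <= C * (1 + norm x) ^ n" by (rule assms(3))
qed

lemma moderate_bound: "moderate f ==> \<exists>n C. \<forall>x. norm (f x) <= C * (1 + norm x) ^ n"
 unfolding moderate_def by (drule conjunct2, drule bspec[of _ _ "[]"]) auto

lemma moderate_differentiable: "moderate f ==> f differentiable (at x)"
 unfolding moderate_def using smooth_differentiable by blast

lemma moderate_dir_deriv: "moderate f ==> b \<in> Basis ==> moderate (dir_deriv b f)"
proof -
 assume f: "moderate f" and b: "b \<in> Basis"
 have "\<exists>n C. \<forall>x. norm (iter_partial bs (dir_deriv b f) x) <= C * (1 + norm x) ^ n" if "bs \<in> lists Basis" for bs
 proof -
  have "bs @ [b] \<in> lists Basis" using b that by simp
  then have "\<exists>n C. \<forall>x. norm (iter_partial (bs @ [b]) f x) <= C * (1 + norm x) ^ n"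
   using f unfolding moderate_def by blast
  then show ?thesis by (simp add: iter_partial_append dir_deriv_def[abs_def])
 qed
 then show ?thesis using f smooth_dir_deriv[of f b] b unfolding moderate_def by blast
qed

lemma decays_add: "decays f ==> decays g ==> decays (%x. f x + g x)"
proof (rule decaysI)
 fix n assume "decays f" "decays g"
 obtain C D where C: "\<And>x. norm (f x) <= C / (1 + norm x) ^ n" and D: "\<And>x. norm (g x) <= D / (1 + norm x) ^ n"
  using decaysE[OF \<open>decays f\<close>, of n] decaysE[OF \<open>decays g\<close>, of n] by metis
 have "norm (f x + g x) <= (C + D) / (1 + norm x) ^ n" for x
  using norm_triangle_ineq[of "f x" "g x"] C[of x] D[of x] by (simp add: add_divide_distrib)
 then show "\<exists>C. \<forall>x. norm (f x + g x) <= C / (1 + norm x) ^ n" by blast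
qed

lemma decays_bounded_linear:
 assumes "bounded_linear L" "decays f"
 shows "decays (%x. L (f x))"
proof (rule decaysI)
 fix n
 obtain K where K: "K > 0" "\<And>y. norm (L y) <= norm y * K" using bounded_linear.pos_bounded[OF assms(1)] by blast
 obtain C where C: "C > 0" "\<And>x. norm (f x) <= C / (1 + norm x) ^ n" using decaysE[OF assms(2), of n] by metis
 have "norm (L (f x)) <= (C * K) / (1 + norm x) ^ n" for x
  using K(2)[of "f x"] mult_right_mono[OF C(2)[of x], of K] K(1) by simp
 then show "\<exists>C. \<forall>x. norm (L (f x)) <= C / (1 + norm x) ^ n" by blast
qed

lemma decays_moderate_mult:
 fixes f g :: "'a::real_normed_vector => 'b::real_normed_algebra"
 assumes "\<exists>n C. \<forall>x. norm (f x) <= C * (1 + norm x) ^ n" "decays g"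
 shows "decays (%x. f x * g x)"
proof (rule decaysI)
 fix n
 obtain m C where C: "\<And>x. norm (f x) <= C * (1 + norm x) ^ m" using assms(1) by blast
 obtain D where D: "D > 0" "\<And>x. norm (g x) <= D / (1 + norm x) ^ (m + n)" using decaysE[OF assms(2)] by metis
 have "norm (f x * g x) <= (C * D) / (1 + norm x) ^ n" for x
 proof -
  have p: "1 + norm x > 0" by (simp add: add_pos_nonneg)
  have "norm (f x * g x) <= norm (f x) * norm (g x)" by (rule norm_mult_ineq)
  also have "... <= (C * (1 + norm x) ^ m) * (D / (1 + norm x) ^ (m + n))"
   using C[of x] D(2)[of x] order_trans[OF norm_ge_zero C[of x]] by (intro mult_mono) auto
  also have "... = (C * D) / (1 + norm x) ^ n" using p by (simp add: power_add)
  finally show ?thesis .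
 qed
 then show "\<exists>C. \<forall>x. norm (f x * g x) <= C / (1 + norm x) ^ n" by blast
qed

lemma dir_deriv_add:
 "f differentiable (at x) ==> g differentiable (at x) ==>
  dir_deriv b (%x. f x + g x) x = dir_deriv b f x + dir_deriv b g x"
 by (rule dir_deriv_eq[OF has_derivative_add[OF has_derivative_dir_deriv has_derivative_dir_deriv]])

lemma dir_deriv_bounded_linear:
 "bounded_linear L ==> f differentiable (at x) ==> dir_deriv b (%x. L (f x)) x = L (dir_deriv b f x)"
 by (rule dir_deriv_eq[OF bounded_linear.has_derivative[OF _ has_derivative_dir_deriv]])

lemma dir_deriv_mult:
 fixes f g :: "'a::euclidean_space => 'b::real_normed_algebra"
 shows "f differentiable (at x) ==> g differentiable (at x) ==>
  dir_deriv b (%x. f x * g x) x = f x * dir_deriv b g x + dir_deriv b f x * g x"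
 by (rule dir_deriv_eq[OF has_derivative_mult[OF has_derivative_dir_deriv has_derivative_dir_deriv]])

lemma differentiable_bounded_linear:
 "bounded_linear L ==> f differentiable (at x) ==> (%x. L (f x)) differentiable (at x)"
 unfolding differentiable_def using bounded_linear.has_derivative by blast

lemma has_derivative_affine:
 assumes "f differentiable (at (c *R x + a))"
 shows "((%x. f (c *R x + a)) has_derivative (%b. c *R dir_deriv b f (c *R x + a))) (at x)"
proof -
 have 1: "((%x. c *R x + a) has_derivative (%b. c *R b)) (at x)"
  by (auto intro!: derivative_eq_intros)
 have "((%x. f (c *R x + a)) has_derivative (%b. dir_deriv (c *R b) f (c *R x + a))) (at x)"
  using has_derivative_compose[OF 1 has_derivative_dir_deriv[OF assms]] .
 moreover have "dir_deriv (c *R b) f (c *R x + a) = c *R dir_deriv b f (c *R x + a)" for b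
  using linear_cmul[OF bounded_linear.linear[OF has_derivative_bounded_linear[OF has_derivative_dir_deriv[OF assms]]]] .
 ultimately show ?thesis by simp
qed

lemma schwartz_add:
 assumes "schwartz f" "schwartz g"
 shows "schwartz (%x. f x + g x)"
proof (rule schwartz_coinduct[where P = "%h. \<exists>f g. schwartz f \<and> schwartz g \<and> h = (%x. f x + g x)"])
 fix h :: "'a => 'b" and b :: 'a and x
 assume "\<exists>f g. schwartz f \<and> schwartz g \<and> h = (%x. f x + g x)"
 then obtain f g where h: "schwartz f" "schwartz g" "h = (%x. f x + g x)" by blast
 show "h differentiable (at x)" "decays h"
  using h by (auto intro: differentiable_add schwartz_differentiable decays_add schwartz_decays)
 assume b: "b \<in> Basis"
 have "dir_deriv b h = (%x. dir_deriv b f x + dir_deriv b g x)"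
  using h by (auto simp: dir_deriv_add schwartz_differentiable)
 then show "\<exists>f g. schwartz f \<and> schwartz g \<and> dir_deriv b h = (%x. f x + g x)"
  using h b schwartz_dir_deriv by blast
qed (use assms in blast)

lemma schwartz_bounded_linear:
 fixes f :: "'a::euclidean_space => 'b::real_normed_vector" and L :: "'b => 'c::real_normed_vector"
 assumes L: "bounded_linear L" and "schwartz f"
 shows "schwartz (%x. L (f x))"
proof (rule schwartz_coinduct[where P = "%h. \<exists>f. schwartz f \<and> h = (%x. L (f x))"])
 fix h :: "'a => 'c" and b :: 'a and x
 assume "\<exists>f. schwartz f \<and> h = (%x. L (f x))"
 then obtain f where h: "schwartz f" "h = (%x. L (f x))" by blast
 show "h differentiable (at x)" "decays h"
  using h by (auto intro: L differentiable_bounded_linear schwartz_differentiable decays_bounded_linear schwartz_decays)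
 assume b: "b \<in> Basis"
 have "dir_deriv b h = (%x. L (dir_deriv b f x))"
  using h by (auto simp: dir_deriv_bounded_linear[OF L] schwartz_differentiable)
 then show "\<exists>f. schwartz f \<and> dir_deriv b h = (%x. L (f x))"
  using h b schwartz_dir_deriv by blast
qed (use assms in blast)

lemma schwartz_cmult:
 fixes f :: "'a::euclidean_space => 'b::real_normed_algebra"
 shows "schwartz f ==> schwartz (%x. c * f x)"
 by (rule schwartz_bounded_linear[OF bounded_linear_mult_right])

lemma schwartz_minus: "schwartz f ==> schwartz (%x. - f x)"
 by (rule schwartz_bounded_linear[OF bounded_linear_minus[OF bounded_linear_ident]])

lemma schwartz_diff: "schwartz f ==> schwartz g ==> schwartz (%x. f x - g x)"
 using schwartz_add[of f "%x. - g x"] schwartz_minus[of g] by simp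

lemma schwartz_complex_of_real: "schwartz f ==> schwartz (%x. cor (f x))"
 by (rule schwartz_bounded_linear[OF bounded_linear_of_real])

lemma schwartz_Re: "schwartz f ==> schwartz (%x. Re (f x))"
 by (rule schwartz_bounded_linear[OF bounded_linear_Re])

lemma one_plus_norm_affine:
 fixes x a :: "'a::real_normed_vector"
 assumes "c \<noteq> 0"
 shows "1 + norm x <= (1 + 1 / \<bar>c\<bar>) * (1 + norm a) * (1 + norm (c *R x + a))"
proof -
 have "norm x = norm (c *R x + a - a) / \<bar>c\<bar>" using assms by simp
 also have "... <= (norm (c *R x + a) + norm a) / \<bar>c\<bar>"
  by (intro divide_right_mono norm_triangle_ineq4) simp
 finally have 1: "norm x <= (1 / \<bar>c\<bar>) * (norm (c *R x + a) + norm a)" by simp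
 have 2: "norm (c *R x + a) + norm a <= (1 + norm a) * (1 + norm (c *R x + a))"
  by (simp add: algebra_simps)
 have 3: "1 <= (1 + norm a) * (1 + norm (c *R x + a))"
  by (simp add: algebra_simps)
 have "1 + norm x <= 1 * ((1 + norm a) * (1 + norm (c *R x + a)))
   + (1 / \<bar>c\<bar>) * ((1 + norm a) * (1 + norm (c *R x + a)))"
  using 1 3 mult_left_mono[OF 2, of "1 / \<bar>c\<bar>"] by simp
 then show ?thesis by (simp only: distrib_right mult.assoc)
qed

lemma decays_affine:
 assumes "decays f" and c: "c \<noteq> 0"
 shows "decays (%x. f (c *R x + a))"
proof (rule decaysI)
 fix n
 obtain C where C: "C > 0" "\<And>x. norm (f x) <= C / (1 + norm x) ^ n" using decaysE[OF assms(1), of n] by metis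
 define K where "K = (1 + 1 / \<bar>c\<bar>) * (1 + norm a)"
 have "norm (f (c *R x + a)) <= (C * K ^ n) / (1 + norm x) ^ n" for x
 proof -
  have p: "1 + norm x > 0" "1 + norm (c *R x + a) > 0" by (simp_all add: add_pos_nonneg)
  have "(1 + norm x) ^ n <= (K * (1 + norm (c *R x + a))) ^ n"
   unfolding K_def using one_plus_norm_affine[OF c, of x a] by (intro power_mono) auto
  then have "(1 + norm x) ^ n * C <= K ^ n * (1 + norm (c *R x + a)) ^ n * C"
   using C(1) by (intro mult_right_mono) (auto simp: power_mult_distrib)
  then have "C / (1 + norm (c *R x + a)) ^ n <= (C * K ^ n) / (1 + norm x) ^ n"
   using p by (simp add: divide_simps mult.commute mult.left_commute)
  then show ?thesis using C(2)[of "c *R x + a"] by linarith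
 qed
 then show "\<exists>C. \<forall>x. norm (f (c *R x + a)) <= C / (1 + norm x) ^ n" by blast
qed

lemma schwartz_affine:
 fixes f :: "'a::euclidean_space => 'b::real_normed_vector"
 assumes "schwartz f" and c: "c \<noteq> 0"
 shows "schwartz (%x. f (c *R x + a))"
proof (rule schwartz_coinduct[where P = "%h. \<exists>f k. schwartz f \<and> h = (%x. k *R f (c *R x + a))"])
 show "\<exists>g k. schwartz g \<and> (%x. f (c *R x + a)) = (%x. k *R g (c *R x + a))"
  using assms(1) by (intro exI[of _ f] exI[of _ 1]) simp
 fix h :: "'a => 'b" and b :: 'a and x
 assume "\<exists>f k. schwartz f \<and> h = (%x. k *R f (c *R x + a))"
 then obtain f k where h: "schwartz f" "h = (%x. k *R f (c *R x + a))" by blast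
 have d: "(h has_derivative (%b. k *R c *R dir_deriv b f (c *R x + a))) (at x)" for x
  unfolding h(2) by (intro has_derivative_scaleR_right has_derivative_affine schwartz_differentiable h)
 then show "h differentiable (at x)" unfolding differentiable_def by blast
 show "decays h" unfolding h(2)
  by (intro decays_bounded_linear[OF bounded_linear_scaleR_right] decays_affine schwartz_decays h c)
 assume b: "b \<in> Basis"
 have "dir_deriv b h = (%x. (k * c) *R dir_deriv b f (c *R x + a))"
  using dir_deriv_eq[OF d] by auto
 then show "\<exists>f k. schwartz f \<and> dir_deriv b h = (%x. k *R f (c *R x + a))"
  using h b schwartz_dir_deriv by blast
qed

lemma schwartz_translate: "schwartz f ==> schwartz (%x. f (x + a))"
 using schwartz_affine[of f 1 a] by simp

lemma schwartz_reflect: "schwartz f ==> schwartz (%x. f (- x))"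
 using schwartz_affine[of f "-1" 0] by simp

text \<open>A product is not closed under differentiation, but finite sums of products are, by the
  Leibniz rule. This class is the invariant for the next lemma.\<close>

inductive leibniz_sum :: "('a::euclidean_space => 'b::real_normed_algebra) => bool" where
 prod: "moderate f ==> schwartz g ==> leibniz_sum (%x. f x * g x)"
| add: "leibniz_sum f ==> leibniz_sum g ==> leibniz_sum (%x. f x + g x)"

lemma leibniz_sum_differentiable: "leibniz_sum f ==> f differentiable (at x)"
 by (induction rule: leibniz_sum.induct)
  (auto intro: differentiable_mult differentiable_add moderate_differentiable schwartz_differentiable)

lemma schwartz_moderate_mult:
 fixes f g :: "'a::euclidean_space => 'b::real_normed_algebra"
 assumes "moderate f" "schwartz g"
 shows "schwartz (%x. f x * g x)"
proof (rule schwartz_coinduct[where P = leibniz_sum])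
 show "leibniz_sum (%x. f x * g x)" using assms by (rule leibniz_sum.prod)
 fix f :: "'a => 'b" and x b :: 'a
 assume f: "leibniz_sum f"
 then show "f differentiable (at x)" by (rule leibniz_sum_differentiable)
 show "decays f" using f
  by (induction rule: leibniz_sum.induct)
   (auto intro: decays_add decays_moderate_mult moderate_bound schwartz_decays)
 assume b: "b \<in> Basis"
 show "leibniz_sum (dir_deriv b f)" using f
 proof (induction rule: leibniz_sum.induct)
  case (prod f g)
  have "dir_deriv b (%x. f x * g x) = (%x. f x * dir_deriv b g x + dir_deriv b f x * g x)"
   using prod by (auto simp: dir_deriv_mult moderate_differentiable schwartz_differentiable)
  then show ?case using prod b by (auto intro!: leibniz_sum.intros schwartz_dir_deriv moderate_dir_deriv)
 next
  case (add f g)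
  have "dir_deriv b (%x. f x + g x) = (%x. dir_deriv b f x + dir_deriv b g x)"
   using add by (auto simp: dir_deriv_add leibniz_sum_differentiable)
  then show ?case using add by (auto intro!: leibniz_sum.add)
 qed
qed

lemma schwartz_imp_moderate: "schwartz f ==> moderate f"
proof (rule moderate_coinduct[where P = schwartz])
 fix f :: "'a => 'b" assume "schwartz f"
 then obtain C where "\<And>x. norm (f x) <= C / (1 + norm x) ^ 0" using decaysE[OF schwartz_decays, of f 0] by metis
 then show "\<exists>n C. \<forall>x. norm (f x) <= C * (1 + norm x) ^ n" by (intro exI[of _ 0] exI[of _ C]) auto
qed (auto intro: schwartz_differentiable schwartz_dir_deriv)

lemma schwartz_mult:
 fixes f g :: "'a::euclidean_space => 'b::real_normed_algebra"
 shows "schwartz f ==> schwartz g ==> schwartz (%x. f x * g x)"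
 by (intro schwartz_moderate_mult schwartz_imp_moderate)

lemma moderate_of_real_inner:
 "moderate (%x::'a::euclidean_space. of_real (a \<bullet> x) :: 'b::real_normed_algebra_1)"
\<comment> \<open>Affine functions serve as the invariant, because the derivative of a linear
  function is a constant.\<close>
proof (rule moderate_coinduct[where P = "%f. \<exists>a c. f = (%x. of_real (a \<bullet> x + c))"])
 show "\<exists>a' c. (%x. of_real (a \<bullet> x) :: 'b) = (%x. of_real (a' \<bullet> x + c))"
  by (intro exI[of _ a] exI[of _ 0]) simp
 fix f :: "'a => 'b" and x b :: 'a
 assume "\<exists>a c. f = (%x. of_real (a \<bullet> x + c))"
 then obtain a c where f: "f = (%x. of_real (a \<bullet> x + c))" by blast
 have d: "(f has_derivative (%b. of_real (a \<bullet> b))) (at x)" for x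
  unfolding f by (auto intro!: derivative_eq_intros)
 then show "f differentiable (at x)" unfolding differentiable_def by blast
 have "norm (f x) <= (norm a + \<bar>c\<bar>) * (1 + norm x) ^ 1" for x
 proof -
  have "\<bar>a \<bullet> x + c\<bar> <= norm a * norm x + \<bar>c\<bar>"
   using Cauchy_Schwarz_ineq2[of a x] by linarith
  also have "... <= (norm a + \<bar>c\<bar>) * (1 + norm x) ^ 1"
   by (simp add: algebra_simps)
  finally show ?thesis unfolding f by (simp only: norm_of_real)
 qed
 then show "\<exists>n C. \<forall>x. norm (f x) <= C * (1 + norm x) ^ n" by blast
 have "dir_deriv b f = (%x. of_real (0 \<bullet> x + a \<bullet> b))" using dir_deriv_eq[OF d] by auto
 then show "\<exists>a c. dir_deriv b f = (%x. of_real (a \<bullet> x + c))" by blast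
qed

lemma moderate_trig:
 "moderate (%x::'a::euclidean_space. c * cos (a \<bullet> x) + d * sin (a \<bullet> x))"
proof (rule moderate_coinduct[where P = "%f. \<exists>c d. f = (%x. c * cos (a \<bullet> x) + d * sin (a \<bullet> x))"])
 fix f :: "'a => real" and x b :: 'a
 assume "\<exists>c d. f = (%x. c * cos (a \<bullet> x) + d * sin (a \<bullet> x))"
 then obtain c d where f: "f = (%x. c * cos (a \<bullet> x) + d * sin (a \<bullet> x))" by blast
 have d: "(f has_derivative (%b. (d * (a \<bullet> b)) * cos (a \<bullet> x) + (- c * (a \<bullet> b)) * sin (a \<bullet> x))) (at x)" for x
  unfolding f by (auto intro!: derivative_eq_intros simp: algebra_simps)
 then show "f differentiable (at x)" unfolding differentiable_def by blast
 have "norm (f x) <= (\<bar>c\<bar> + \<bar>d\<bar>) * (1 + norm x) ^ 0" for x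
 proof -
  have "\<bar>c * cos (a \<bullet> x)\<bar> <= \<bar>c\<bar>" "\<bar>d * sin (a \<bullet> x)\<bar> <= \<bar>d\<bar>"
   by (simp_all add: abs_mult mult_left_le)
  then show ?thesis unfolding f by simp
 qed
 then show "\<exists>n C. \<forall>x. norm (f x) <= C * (1 + norm x) ^ n" by blast
 show "\<exists>c d. dir_deriv b f = (%x. c * cos (a \<bullet> x) + d * sin (a \<bullet> x))"
  using dir_deriv_eq[OF d] by blast
qed blast

section \<open>Affine changes of variables in Lebesgue integrals\<close>

lemma lborel_integrable_affine:
 fixes f :: "'a::euclidean_space => 'b::{banach, second_countable_topology}"
 assumes f: "integrable lborel f" and c: "c \<noteq> 0"
 shows "integrable lborel (%x. f (a + c *R x))"
proof -
 have [measurable]: "f \<in> borel_measurable borel" using f by simp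
 have "integrable (density (distr lborel borel (%x. a + c *R x)) (%_. \<bar>c\<bar> ^ DIM('a))) f"
  using f lborel_affine[OF c, of a] by simp
 then have 1: "integrable lborel (%x. (\<bar>c\<bar> ^ DIM('a)) *R f (a + c *R x))"
  by (simp add: integrable_density integrable_distr_eq)
 have "integrable lborel (%x. (1 / \<bar>c\<bar> ^ DIM('a)) *R ((\<bar>c\<bar> ^ DIM('a)) *R f (a + c *R x)))"
  by (rule Bochner_Integration.integrable_scaleR_right) (rule 1)
 moreover have "(1 / \<bar>c\<bar> ^ DIM('a)) *R ((\<bar>c\<bar> ^ DIM('a)) *R f y) = f y" for y
  unfolding scaleR_scaleR using c by simp
 ultimately show ?thesis by simp
qed

lemma lborel_integral_affine:
 fixes f :: "'a::euclidean_space => 'b::{banach, second_countable_topology}"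
 assumes c: "c \<noteq> 0"
 shows "(LBINT x. f (a + c *R x)) = (1 / \<bar>c\<bar> ^ DIM('a)) *R (LBINT x. f x)"
proof (cases "integrable lborel f")
 case True
 have [measurable]: "f \<in> borel_measurable borel" using True by simp
 have "(LBINT x. f x) = (\<integral>x. f x \<partial>density (distr lborel borel (%x. a + c *R x)) (%_. ennreal (\<bar>c\<bar> ^ DIM('a))))"
  by (subst lborel_affine[OF c, of a]) simp
 also have "... = (LBINT x. (\<bar>c\<bar> ^ DIM('a)) *R f (a + c *R x))"
  by (simp add: integral_density integral_distr)
 finally show ?thesis using c by simp
next
 case False
 then have "\<not> integrable lborel (%x. f (a + c *R x))"
  using lborel_integrable_affine[of "%x. f (a + c *R x)" "1 / c" "- (1 / c) *R a"] c
  by (auto simp: algebra_simps)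
 with False show ?thesis by (simp add: not_integrable_integral_eq)
qed

lemma lborel_integrable_translate:
 fixes f :: "'a::euclidean_space => 'b::{banach, second_countable_topology}"
 shows "integrable lborel f ==> integrable lborel (%x. f (x + a))"
 using lborel_integrable_affine[of f 1 a] by (simp add: add.commute)

lemma lborel_integral_translate:
 fixes f :: "'a::euclidean_space => 'b::{banach, second_countable_topology}"
 shows "(LBINT x. f (x + a)) = (LBINT x. f x)"
 using lborel_integral_affine[of 1 f a] by (simp add: add.commute)

lemma lborel_integral_reflect:
 fixes f :: "'a::euclidean_space => 'b::{banach, second_countable_topology}"
 shows "(LBINT x. f (- x)) = (LBINT x. f x)"
 using lborel_integral_affine[of "-1" f 0] by simp

lemma lborel_integrable_reflect:
 fixes f :: "'a::euclidean_space => 'b::{banach, second_countable_topology}"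
 shows "integrable lborel f ==> integrable lborel (%x. f (- x))"
 using lborel_integrable_affine[of f "-1" 0] by simp

subsection \<open>Integrable weights\<close>

text \<open>A product of one-dimensional weights is integrable by Fubini alone. With the exponent
  \<open>1 + 1 / d\<close> in each of the \<open>d\<close> coordinates the total order is
  \<open>d + 1\<close>, so it dominates \<open>1 / (1 + norm x) ^ (d + 1)\<close>.\<close>

definition tensor_weight :: "'a::euclidean_space => real" where
 "tensor_weight x = (\<Prod>b\<in>Basis. (1 + \<bar>x \<bullet> b\<bar>) powr (- (1 + 1 / real DIM('a))))"

lemma tensor_weight_nonneg: "0 <= tensor_weight x"
 unfolding tensor_weight_def by (simp add: prod_nonneg)

lemma tensor_weight_le_1: "tensor_weight x <= 1"
 unfolding tensor_weight_def
proof (rule prod_le_1, safe)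
 fix b :: 'a
 have "(1 + \<bar>x \<bullet> b\<bar>) powr (- (1 + 1 / real DIM('a))) <= (1 + \<bar>x \<bullet> b\<bar>) powr 0"
  by (rule powr_mono) (auto intro: order_trans[of "-1" 0])
 then show "(1 + \<bar>x \<bullet> b\<bar>) powr (- (1 + 1 / real DIM('a))) <= 1" by (simp split: if_splits)
qed simp

lemma tensor_weight_measurable [measurable]: "tensor_weight \<in> borel_measurable borel"
 unfolding tensor_weight_def[abs_def] by measurable

lemma nn_integral_one_plus_abs_powr:
 assumes a: "a > 1"
 shows "(\<integral>\<^sup>+s. ennreal ((1 + \<bar>s\<bar>) powr (- a)) \<partial>lborel) < \<infinity>"
proof -
 let ?I = "(\<integral>\<^sup>+s. ennreal ((1 + s) powr (- a)) * indicator {0..} s \<partial>lborel)"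
 have 1: "?I = 0 - (- ((1 + 0) powr (1 - a)) / (a - 1))"
 proof (rule nn_integral_FTC_atLeast)
  show "(%s. (1 + s) powr - a) \<in> borel_measurable borel" by measurable
  fix x :: real assume x: "0 <= x"
  show "((%x. - ((1 + x) powr (1 - a)) / (a - 1)) has_real_derivative (1 + x) powr (- a)) (at x)"
  proof -
   have 1: "((%x. 1 + x) has_real_derivative 1) (at x)" by (auto intro!: derivative_eq_intros)
   have "((%x. (1 + x) powr (1 - a)) has_real_derivative (1 - a) * (1 + x) powr (1 - a - 1) * 1) (at x)"
    using DERIV_fun_powr[OF 1, of "1 - a"] x by simp
   note DERIV_cdivide[OF DERIV_minus[OF this], of "a - 1"]
   moreover have "- ((1 - a) * (1 + x) powr (1 - a - 1) * 1) / (a - 1) = (1 + x) powr (- a)"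
    using a by (simp add: divide_simps) (simp add: algebra_simps)
   ultimately show ?thesis by (simp only:)
  qed
  show "0 <= (1 + x) powr (- a)" by simp
 next
  have "((%x::real. - ((1 + x) powr (- (a - 1))) / (a - 1)) \<longlongrightarrow> - 0 / (a - 1)) at_top"
   using a by (intro tendsto_intros tendsto_neg_powr filterlim_tendsto_add_at_top[OF tendsto_const] filterlim_ident) auto
  then show "((%x::real. - ((1 + x) powr (1 - a)) / (a - 1)) \<longlongrightarrow> 0) at_top" by simp
 qed
 then have I: "?I < \<infinity>" by (metis ennreal_less_top infinity_ennreal_def)
 have "(\<integral>\<^sup>+s. ennreal ((1 + \<bar>s\<bar>) powr (- a)) \<partial>lborel) \<le>
  (\<integral>\<^sup>+s. ennreal ((1 + s) powr (- a)) * indicator {0..} s + ennreal ((1 + (0 + (-1) * s)) powr (- a)) * indicator {0..} (0 + (-1) * s) \<partial>lborel)"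
  by (intro nn_integral_mono) (auto split: split_indicator)
 also have "... = ?I + (\<integral>\<^sup>+s. ennreal ((1 + (0 + (-1) * s)) powr (- a)) * indicator {0..} (0 + (-1) * s) \<partial>lborel)"
  by (intro nn_integral_add) measurable
 also have "(\<integral>\<^sup>+s. ennreal ((1 + (0 + (-1) * s)) powr (- a)) * indicator {0..} (0 + (-1) * s) \<partial>lborel) = ?I"
  by (subst (2) nn_integral_real_affine[of _ "-1" 0]) (simp_all, measurable)
 also have "?I + ?I < \<infinity>" using I by (simp add: ennreal_add_less_top)
 finally show ?thesis .
qed

lemma tensor_weight_integrable: "integrable lborel (tensor_weight :: 'a::euclidean_space => real)"
proof (rule integrableI_bounded)
 let ?w = "%s::real. ennreal ((1 + \<bar>s\<bar>) powr (- (1 + 1 / real DIM('a))))"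
 have "(\<integral>\<^sup>+x. ennreal (norm (tensor_weight (x::'a))) \<partial>lborel) = (\<integral>\<^sup>+x. (\<Prod>b\<in>(Basis::'a set). ?w (x \<bullet> b)) \<partial>lborel)"
  by (intro nn_integral_cong) (simp add: tensor_weight_def prod_ennreal prod_nonneg abs_prod)
 also have "... = (\<Prod>b\<in>(Basis::'a set). (\<integral>\<^sup>+s. ?w s \<partial>lborel))"
  by (intro nn_integral_lborel_prod) auto
 also have "... < \<infinity>"
  using nn_integral_one_plus_abs_powr[of "1 + 1 / real DIM('a)"]
  by (simp add: power_less_top_ennreal)
 finally show "(\<integral>\<^sup>+x. ennreal (norm (tensor_weight (x::'a))) \<partial>lborel) < \<infinity>" .
qed simp

text \<open>There is one bound for each of the \<open>d\<close> coordinates. Taking the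
  \<open>d\<close>-th root of each and multiplying them gives back \<open>y\<close> on the left and
  the product weight on the right.\<close>

lemma tensor_weight_dominates:
 fixes x :: "'a::euclidean_space"
 assumes "\<And>b. b \<in> Basis ==> (1 + \<bar>x \<bullet> b\<bar>) ^ (DIM('a) + 1) * y <= C" and "0 <= y" and "0 <= C"
 shows "y <= C * tensor_weight x"
proof -
 let ?d = "real DIM('a)"
 have d: "?d > 0" by simp
 have le: "y powr (1 / ?d) <= C powr (1 / ?d) * (1 + \<bar>x \<bullet> b\<bar>) powr (- (1 + 1 / ?d))" if b: "b \<in> Basis" for b
 proof -
  have p: "1 + \<bar>x \<bullet> b\<bar> > 0" by simp
  have "y <= C * (1 + \<bar>x \<bullet> b\<bar>) powr (- (?d + 1))"
  proof -
   have "(1 + \<bar>x \<bullet> b\<bar>) powr (- (?d + 1)) = 1 / (1 + \<bar>x \<bullet> b\<bar>) ^ (DIM('a) + 1)"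
    using powr_realpow[OF p, of "DIM('a) + 1"] unfolding powr_minus_divide by (simp add: add.commute)
   then show ?thesis using assms(1)[OF b] p by (simp add: pos_le_divide_eq mult.commute del: power_Suc)
  qed
  then have "y powr (1 / ?d) <= (C * (1 + \<bar>x \<bullet> b\<bar>) powr (- (?d + 1))) powr (1 / ?d)"
   using assms(2) by (intro powr_mono2) auto
  also have "... = C powr (1 / ?d) * (1 + \<bar>x \<bullet> b\<bar>) powr (- (?d + 1) * (1 / ?d))"
   using assms(3) by (simp add: powr_mult powr_powr)
  also have "- (?d + 1) * (1 / ?d) = - (1 + 1 / ?d)" using d by (simp add: field_simps)
  finally show ?thesis .
 qed
 have pw: "(z powr (1 / ?d)) ^ DIM('a) = z" if "z >= 0" for z :: real
  using that by (cases "z = 0") (auto simp: powr_powr powr_realpow[symmetric])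
 have "y = (\<Prod>b\<in>(Basis::'a set). y powr (1 / ?d))" using pw[OF assms(2)] by simp
 also have "... <= (\<Prod>b\<in>(Basis::'a set). C powr (1 / ?d) * (1 + \<bar>x \<bullet> b\<bar>) powr (- (1 + 1 / ?d)))"
  using le by (intro prod_mono) auto
 also have "... = C * tensor_weight x"
  using pw[OF assms(3)] by (simp add: prod.distrib tensor_weight_def)
 finally show ?thesis .
qed

lemma inverse_norm_power_le_tensor_weight:
 "1 / (1 + norm (x::'a::euclidean_space)) ^ (DIM('a) + 1) <= tensor_weight x"
proof -
 have p: "1 + norm x > 0" by (simp add: add_pos_nonneg)
 have "1 / (1 + norm x) ^ (DIM('a) + 1) <= 1 * tensor_weight x"
 proof (rule tensor_weight_dominates)
  fix b :: 'a assume b: "b \<in> Basis"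
  have "(1 + \<bar>x \<bullet> b\<bar>) ^ (DIM('a) + 1) <= (1 + norm x) ^ (DIM('a) + 1)"
   using Basis_le_norm[OF b, of x] by (intro power_mono) auto
  then show "(1 + \<bar>x \<bullet> b\<bar>) ^ (DIM('a) + 1) * (1 / (1 + norm x) ^ (DIM('a) + 1)) <= 1"
   using p by (simp add: divide_simps)
 qed (use p in auto)
 then show ?thesis by simp
qed

lemma decays_integrable:
 fixes f :: "'a::euclidean_space => 'b::{banach, second_countable_topology}"
 assumes "decays f" and [measurable]: "f \<in> borel_measurable borel"
 shows "integrable lborel f"
proof -
 obtain C where C: "C > 0" "\<And>x. norm (f x) <= C / (1 + norm x) ^ (DIM('a) + 1)"
  using decaysE[OF assms(1)] by metis
 show ?thesis
 proof (rule integrable_dom[of lborel "%x. C * tensor_weight x"])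
  show "AE x in lborel. norm (f x) <= norm (C * tensor_weight x)"
  proof (intro AE_I2)
   fix x :: 'a
   have "C / (1 + norm x) ^ (DIM('a) + 1) <= C * tensor_weight x"
    using mult_left_mono[OF inverse_norm_power_le_tensor_weight[of x], of C] C(1) by simp
   then show "norm (f x) <= norm (C * tensor_weight x)" using C(2)[of x] by simp
  qed
 qed (use tensor_weight_integrable in auto)
qed

lemma schwartz_integrable:
 fixes f :: "'a::euclidean_space => 'b::{banach, second_countable_topology}"
 shows "schwartz f ==> integrable lborel f"
 by (simp add: decays_integrable schwartz_decays schwartz_measurable)

lemma schwartz_bounded: "schwartz f ==> \<exists>C>0. \<forall>x. norm (f x) <= C"
 by (rule decaysE[OF schwartz_decays, of f 0]) auto

lemma decays_mult_norm_power:
 assumes "decays (f :: 'a::real_normed_vector => 'b::real_normed_vector)"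
 shows "decays (%x. (1 + norm x) ^ k *R f x)"
proof (rule decaysI)
 fix n
 obtain C where C: "C > 0" "\<And>x. norm (f x) <= C / (1 + norm x) ^ (k + n)"
  using decaysE[OF assms] by metis
 have "norm ((1 + norm x) ^ k *R f x) <= C / (1 + norm x) ^ n" for x
 proof -
  have p: "1 + norm x > 0" by (simp add: add_pos_nonneg)
  then have "norm ((1 + norm x) ^ k *R f x) <= (1 + norm x) ^ k * (C / (1 + norm x) ^ (k + n))"
   using mult_left_mono[OF C(2)[of x], of "(1 + norm x) ^ k"] by simp
  also have "... = C / (1 + norm x) ^ n" using p by (simp add: power_add)
  finally show ?thesis .
 qed
 then show "\<exists>C. \<forall>x. norm ((1 + norm x) ^ k *R f x) <= C / (1 + norm x) ^ n" by blast
qed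

lemma integrable_mult_norm_power:
 fixes f :: "'a::euclidean_space => 'b::{banach, second_countable_topology}"
 assumes "schwartz f"
 shows "integrable lborel (%x. (1 + norm x) ^ k *R f x)"
 using schwartz_measurable[OF assms]
 by (intro decays_integrable decays_mult_norm_power schwartz_decays assms) measurable

subsection \<open>The integral of a derivative\<close>

text \<open>Difference quotients integrate to 0 by translation invariance, and the bound on short
  segments dominates them. Only the derivative along \<open>b\<close> enters, so the lemma also
  covers products that involve \<open>norm xi\<close>.\<close>

lemma integral_derivative_eq_0:
 fixes f f' :: "'a::euclidean_space => 'b::{banach, second_countable_topology}"
 assumes f: "integrable lborel f"
  and d: "\<And>x. ((%s. f (x + s *R b)) has_vector_derivative f' x) (at 0)"
  and bd: "\<And>x s. 0 <= s ==> s <= 1 ==> norm (f' (x + s *R b)) <= m x"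
  and m: "integrable lborel m"
 shows "integrable lborel f'" "(LBINT x. f' x) = 0"
proof -
 define q where "q n x = real (Suc n) *R (f (x + (1 / real (Suc n)) *R b) - f x)" for n x
 have [measurable]: "f \<in> borel_measurable borel" using f by simp
 have qm: "q n \<in> borel_measurable borel" for n unfolding q_def by measurable
 have lim: "(%n. q n x) \<longlonglongrightarrow> f' x" for x
 proof -
  have "((%h. norm (f (x + h *R b) - f x - h *R f' x) / norm h) \<longlongrightarrow> 0) (at 0)"
   using d[of x] unfolding has_vector_derivative_def has_derivative_at by simp
  then have "((%h. norm ((f (x + h *R b) - f x) /\<^sub>R h - f' x)) \<longlongrightarrow> 0) (at 0)"
  proof (rule Lim_transform_eventually)
   have "norm (f (x + h *R b) - f x - h *R f' x) / norm h = norm ((f (x + h *R b) - f x) /\<^sub>R h - f' x)" if "h \<noteq> 0" for h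
   proof -
    have "(f (x + h *R b) - f x) /\<^sub>R h - f' x = (1 / h) *R (f (x + h *R b) - f x - h *R f' x)"
     using that by (simp add: scaleR_diff_right inverse_eq_divide)
    then show ?thesis by simp
   qed
   then show "\<forall>\<^sub>F h in at 0. norm (f (x + h *R b) - f x - h *R f' x) / norm h = norm ((f (x + h *R b) - f x) /\<^sub>R h - f' x)"
    by (auto simp: eventually_at intro!: exI[of _ 1])
  qed
  then have "((%h. (f (x + h *R b) - f x) /\<^sub>R h) \<longlongrightarrow> f' x) (at 0)"
   by (simp add: tendsto_norm_zero_iff LIM_zero_iff)
  moreover have "filterlim (%n. 1 / real (Suc n)) (at 0) sequentially"
   unfolding filterlim_at using LIMSEQ_inverse_real_of_nat by (auto simp: inverse_eq_divide)
  ultimately have "(%n. (f (x + (1 / real (Suc n)) *R b) - f x) /\<^sub>R (1 / real (Suc n))) \<longlonglongrightarrow> f' x"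
   by (rule filterlim_compose)
  then show ?thesis by (simp add: q_def)
 qed
 \<comment> \<open>Mean value inequality on the segment from \<open>x\<close> to
   \<open>x + b\<close>; this is why \<open>m x\<close> has to control \<open>f'\<close> on that
   whole segment.\<close>
 have qb: "norm (q n x) <= m x" for n x
 proof -
  have dx: "((%s. f (x + s *R b)) has_derivative (%h. h *R f' (x + s *R b))) (at s within {0..1})" for s
  proof -
   have 1: "((%u. u - s) has_derivative (%h. h)) (at s within {0..1})"
    by (auto intro!: derivative_eq_intros)
   have "((%u. f (x + s *R b + u *R b)) has_derivative (%h. h *R f' (x + s *R b))) (at (s - s))"
    using d[of "x + s *R b"] by (simp add: has_vector_derivative_def)
   from has_derivative_compose[OF 1 this]
   show ?thesis by (simp add: algebra_simps)
  qed
  have "norm (f (x + (1 / real (Suc n)) *R b) - f (x + 0 *R b)) <= m x * norm (1 / real (Suc n) - 0)"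
  proof (rule differentiable_bound[where S = "{0..1}" and f = "%s. f (x + s *R b)"])
   show "onorm (%h. h *R f' (x + s *R b)) <= m x" if "s \<in> {0..1}" for s
   proof (rule onorm_le)
    fix h :: real show "norm (h *R f' (x + s *R b)) <= m x * norm h"
     using mult_right_mono[OF bd[of s x], of "\<bar>h\<bar>"] that by (simp add: mult.commute)
   qed
  qed (auto simp: dx)
  then show ?thesis unfolding q_def norm_scaleR by (simp add: field_simps del: norm_scaleR)
 qed
 have f'm: "f' \<in> borel_measurable lborel"
  by (rule borel_measurable_LIMSEQ_metric[of q]) (use qm lim in auto)
 show "integrable lborel f'"
  by (rule integrable_dominated_convergence[of f' lborel q m]) (use qm f'm m lim qb in auto)
 have "(%n. integral\<^sup>L lborel (q n)) \<longlonglongrightarrow> integral\<^sup>L lborel f'"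
  by (rule integral_dominated_convergence[of f' lborel q m]) (use qm f'm m lim qb in auto)
 moreover have "integral\<^sup>L lborel (q n) = 0" for n
  unfolding q_def using f lborel_integrable_translate[OF f]
  by (simp add: lborel_integral_translate Bochner_Integration.integral_diff)
 ultimately show "(LBINT x. f' x) = 0" by (simp add: LIMSEQ_const_iff)
qed

section \<open>The Fourier transform\<close>

definition fkernel :: "'a::euclidean_space => 'a => complex" where
 "fkernel xi x = cis (- (2 * pi * (xi \<bullet> x)))"

lemma fourier_eq: "fourier f xi = (LBINT x. f x * fkernel xi x)"
proof -
 have "exp (- (2 * cor pi * \<i> * cor (xi \<bullet> x))) = fkernel xi x" for x
  by (simp add: fkernel_def cis_conv_exp mult.commute mult.left_commute)
 then show ?thesis unfolding fourier_def by simp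
qed

lemma norm_fkernel [simp]: "norm (fkernel xi x) = 1"
 by (simp add: fkernel_def)

lemma fkernel_commute: "fkernel xi x = fkernel x xi"
 by (simp add: fkernel_def inner_commute)

lemma fkernel_add_left: "fkernel (xi + eta) x = fkernel xi x * fkernel eta x"
 by (simp add: fkernel_def cis_mult inner_add_left algebra_simps)

lemma fkernel_add_right: "fkernel xi (x + y) = fkernel xi x * fkernel xi y"
 by (simp add: fkernel_def cis_mult inner_add_right algebra_simps)

lemma fkernel_minus_left: "fkernel (- xi) x = cnj (fkernel xi x)"
 by (simp add: fkernel_def cis_cnj)

lemma fkernel_minus_right: "fkernel xi (- x) = cnj (fkernel xi x)"
 by (simp add: fkernel_def cis_cnj)

lemma fkernel_0 [simp]: "fkernel 0 x = 1" "fkernel xi 0 = 1"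
 by (simp_all add: fkernel_def)

lemma fkernel_mult_cnj [simp]: "fkernel xi x * cnj (fkernel xi x) = 1" "cnj (fkernel xi x) * fkernel xi x = 1"
 by (simp_all add: fkernel_def cis_cnj cis_mult)

lemma continuous_fkernel [continuous_intros]:
 "continuous_on S (%p. fkernel (f p) (g p))" if "continuous_on S f" "continuous_on S g"
 unfolding fkernel_def by (intro continuous_intros that)

lemma fkernel_measurable [measurable]:
 assumes [measurable]: "f \<in> borel_measurable M" "g \<in> borel_measurable M"
 shows "(%p. fkernel (f p) (g p)) \<in> borel_measurable M"
 unfolding fkernel_def cis_conv_exp by measurable

lemma integrable_mult_fkernel:
 "integrable lborel f ==> integrable lborel (%x. f x * fkernel xi x)"
 by (rule integrable_dom[of lborel f]) (auto simp: norm_mult)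

lemma norm_fourier_le: "integrable lborel f ==> norm (fourier f xi) <= (LBINT x. norm (f x))"
 unfolding fourier_eq using integral_norm_bound[of lborel "%x. f x * fkernel xi x"] by (simp add: norm_mult)

lemma fourier_measurable [measurable (raw)]:
 assumes "integrable lborel f"
 shows "fourier f \<in> borel_measurable borel"
proof -
 have [measurable]: "f \<in> borel_measurable borel" using assms by simp
 have "(%xi. (LBINT x. f x * fkernel xi x)) \<in> borel_measurable borel" by measurable
 then show ?thesis by (simp add: fourier_eq[abs_def])
qed

lemma fourier_isCont:
 assumes "integrable lborel f"
 shows "isCont (fourier f) xi"
proof (rule continuous_at_sequentiallyI)
 fix u assume u: "u \<longlonglongrightarrow> xi"
 have [measurable]: "f \<in> borel_measurable borel" using assms by simp
 show "(%n. fourier f (u n)) \<longlonglongrightarrow> fourier f xi"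
  unfolding fourier_eq
 proof (rule integral_dominated_convergence[where w = "%x. norm (f x)"])
  show "AE x in lborel. (%n. f x * fkernel (u n) x) \<longlonglongrightarrow> f x * fkernel xi x"
  proof (intro AE_I2 tendsto_intros)
   fix x
   have "isCont (%xi. fkernel xi x) xi"
    by (intro continuous_on_interior[of UNIV] continuous_fkernel continuous_intros) auto
   then show "(%n. fkernel (u n) x) \<longlonglongrightarrow> fkernel xi x" using u by (rule isCont_tendsto_compose)
  qed
 qed (use assms in \<open>auto simp: norm_mult\<close>)
qed

lemma fourier_add:
 "integrable lborel f ==> integrable lborel g ==> fourier (%x. f x + g x) xi = fourier f xi + fourier g xi"
 unfolding fourier_eq distrib_right by (intro Bochner_Integration.integral_add integrable_mult_fkernel)

lemma fourier_cmult: "fourier (%x. c * f x) xi = c * fourier f xi"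
 unfolding fourier_eq mult.assoc by simp

lemma fourier_minus: "fourier (%x. - f x) xi = - fourier f xi"
 using fourier_cmult[of "-1" f xi] by simp

lemma fourier_diff:
 "integrable lborel f ==> integrable lborel g ==> fourier (%x. f x - g x) xi = fourier f xi - fourier g xi"
 using fourier_add[of f "%x. - g x" xi] by (simp add: fourier_minus)

lemma fourier_translate: "fourier (%x. f (x + a)) xi = cnj (fkernel xi a) * fourier f xi"
proof -
 have "fourier (%x. f (x + a)) xi = (LBINT x. cnj (fkernel xi a) * (f (x + a) * fkernel xi (x + a)))"
  unfolding fourier_eq fkernel_add_right
  by (intro Bochner_Integration.integral_cong refl) (simp add: mult.left_commute mult.assoc)
 also have "... = cnj (fkernel xi a) * (LBINT x. f (x + a) * fkernel xi (x + a))"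
  by simp
 also have "(LBINT x. f (x + a) * fkernel xi (x + a)) = fourier f xi"
  unfolding fourier_eq by (rule lborel_integral_translate)
 finally show ?thesis .
qed

lemma fourier_modulate: "fourier (%x. f x * fkernel a x) xi = fourier f (xi + a)"
 unfolding fourier_eq fkernel_add_left by (simp add: mult_ac)

lemma fourier_reflect: "fourier (%x. f (- x)) xi = fourier f (- xi)"
proof -
 have "fourier (%x. f (- x)) xi = (LBINT x. f (- x) * fkernel (- xi) (- x))"
  unfolding fourier_eq by (simp add: fkernel_def)
 then show ?thesis unfolding fourier_eq by (simp add: lborel_integral_reflect[of "%x. f x * fkernel (- xi) x"])
qed

lemma fourier_dilate:
 fixes f :: "'a::euclidean_space => complex"
 assumes "c > 0"
 shows "fourier (%x. f (c *R x)) xi = fourier f (xi /\<^sub>R c) / c ^ DIM('a)"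
proof -
 have "fourier (%x. f (c *R x)) xi = (LBINT x. f (0 + c *R x) * fkernel (xi /\<^sub>R c) (0 + c *R x))"
 proof -
  have "fkernel (xi /\<^sub>R c) (0 + c *R x) = fkernel xi x" for x
   using assms by (simp add: fkernel_def field_simps)
  then show ?thesis unfolding fourier_eq by simp
 qed
 also have "... = (1 / \<bar>c\<bar> ^ DIM('a)) *R (LBINT x. f x * fkernel (xi /\<^sub>R c) x)"
  using assms by (intro lborel_integral_affine) auto
 finally show ?thesis unfolding fourier_eq using assms by (simp add: scaleR_conv_of_real)
qed

lemma fourier_cnj: "fourier (%x. cnj (f x)) xi = cnj (fourier f (- xi))"
 unfolding fourier_eq fkernel_minus_left
 using Bochner_Integration.integral_cnj[of lborel "%x. f x * cnj (fkernel xi x)"] by simp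

lemma integrable_pair_mult:
 fixes f :: "'a::euclidean_space => 'c::{real_normed_field, banach, second_countable_topology}" and g :: "'b::euclidean_space => 'c"
 assumes f: "integrable lborel f" and g: "integrable lborel g"
 shows "integrable lborel2 (%(x, y). f x * g y)"
proof -
 have [measurable]: "f \<in> borel_measurable borel" "g \<in> borel_measurable borel" using f g by auto
 show ?thesis
 proof (rule lborel_pair.Fubini_integrable)
  show "(%(x, y). f x * g y) \<in> borel_measurable lborel2" by measurable
  show "integrable lborel (%x. (LBINT y. norm (case (x, y) of (x, y) => f x * g y)))"
   using f by (simp add: norm_mult)
  show "AE x in lborel. integrable lborel (%y. case (x, y) of (x, y) => f x * g y)"
   using g by simp
 qed
qed

text \<open>Fubini, together with the symmetry of the kernel in its two arguments.\<close>

lemma fourier_mult_formula: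
 assumes f: "integrable lborel f" and g: "integrable lborel g"
 shows "(LBINT x. fourier f x * g x) = (LBINT x. f x * fourier g x)"
proof -
 have [measurable]: "f \<in> borel_measurable borel" "g \<in> borel_measurable borel" using f g by auto
 have i: "integrable lborel2 (%(x, y). f x * g y * fkernel x y)"
  by (rule integrable_dom[OF integrable_pair_mult[OF f g]]) (auto simp: norm_mult)
 have "(LBINT y. fourier f y * g y) = (LBINT y. (LBINT x. f x * g y * fkernel x y))"
 proof (intro Bochner_Integration.integral_cong refl)
  fix y
  have "fourier f y * g y = (LBINT x. (f x * fkernel y x) * g y)"
   unfolding fourier_eq by (rule integral_mult_left_zero[symmetric])
  then show "fourier f y * g y = (LBINT x. f x * g y * fkernel x y)"
   by (simp add: mult_ac fkernel_commute)
 qed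
 also have "... = (LBINT x. (LBINT y. f x * g y * fkernel x y))"
  by (rule lborel_pair.Fubini_integral[OF i])
 also have "... = (LBINT x. f x * fourier g x)"
  unfolding fourier_eq by (simp add: mult.assoc)
 finally show ?thesis .
qed

subsection \<open>Gaussians and Fourier inversion\<close>

text \<open>The factor \<open>pi\<close> makes the function its own Fourier transform and gives it
  integral 1.\<close>

definition gaussian :: "'a::euclidean_space => real" where
 "gaussian x = exp (- (pi * (norm x)^2))"

lemma gaussian_pos: "gaussian x > 0" and gaussian_le_1: "gaussian x <= 1" and gaussian_0 [simp]: "gaussian 0 = 1"
 by (simp_all add: gaussian_def)

lemma gaussian_measurable [measurable]: "gaussian \<in> borel_measurable borel"
 unfolding gaussian_def[abs_def] by measurable

lemma lborel_integral_prod: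
 fixes f :: "'a::euclidean_space => real => 'b::{real_normed_field, banach, second_countable_topology}"
 assumes f: "\<And>b. b \<in> Basis ==> integrable lborel (f b)"
 shows "(LBINT x. (\<Prod>b\<in>Basis. f b (x \<bullet> b))) = (\<Prod>b\<in>Basis. (LBINT s. f b s))"
  and "integrable lborel (%x. \<Prod>b\<in>Basis. f b (x \<bullet> b))"
proof -
 interpret product_sigma_finite "%_::'a. lborel :: real measure" ..
 have [measurable]: "f b \<in> borel_measurable borel" if "b \<in> Basis" for b using f[OF that] by simp
 have T: "(%u. \<Sum>b\<in>Basis. u b *R b) \<in> (\<Pi>\<^sub>M b\<in>Basis. lborel) \<rightarrow>\<^sub>M (borel :: 'a measure)"
  by measurable
 have eq: "(\<Sum>c\<in>Basis. u c *R c) \<bullet> b = u b" if "b \<in> Basis" for u :: "'a => real" and b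
  using that by (simp add: inner_sum_left inner_Basis if_distrib sum.delta cong: if_cong)
 have m: "(%x. \<Prod>b\<in>Basis. f b (x \<bullet> b)) \<in> borel_measurable borel"
  by measurable
 have "(LBINT x. (\<Prod>b\<in>Basis. f b (x \<bullet> b))) = (\<integral>u. (\<Prod>b\<in>Basis. f b (u b)) \<partial>(\<Pi>\<^sub>M b\<in>Basis. lborel))"
  by (subst lborel_eq, subst integral_distr[OF T m]) (simp add: eq)
 also have "... = (\<Prod>b\<in>Basis. (LBINT s. f b s))"
  by (rule product_integral_prod) (use f in auto)
 finally show "(LBINT x. (\<Prod>b\<in>Basis. f b (x \<bullet> b))) = (\<Prod>b\<in>Basis. (LBINT s. f b s))" .
 have "integrable (\<Pi>\<^sub>M b\<in>Basis. lborel) (%u. (\<Prod>b\<in>Basis. f b (u b)))"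
  by (rule product_integrable_prod) (use f in auto)
 then show "integrable lborel (%x. \<Prod>b\<in>Basis. f b (x \<bullet> b))"
  by (subst lborel_eq, subst integrable_distr_eq[OF T m]) (simp add: eq)
qed

text \<open>This is the characteristic function of the standard normal distribution, rescaled by
  \<open>sqrt (2 * pi)\<close>.\<close>

lemma gaussian_real_fourier:
 fixes xi :: real
 shows "integrable lborel (%s::real. cor (exp (- (pi * s^2))) * cis (- (2 * pi * (xi * s))))"
  and "(LBINT s. cor (exp (- (pi * s^2))) * cis (- (2 * pi * (xi * s)))) = cor (exp (- (pi * xi^2)))"
proof -
 define c where "c = sqrt (2 * pi)"
 have c: "c > 0" "c * c = 2 * pi" by (simp_all add: c_def flip: power2_eq_square)
 define t where "t = - (c * xi)"
 define h where "h s = cor (std_normal_density s) * iexp (t * s)" for s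
 have hm [measurable]: "h \<in> borel_measurable borel" unfolding h_def[abs_def] by measurable
 have hi: "integrable lborel h"
  by (rule integrable_dom[of lborel "std_normal_density"])
   (auto simp: h_def norm_mult norm_exp_i_times integrable_normal_density)
 have "(LBINT s. h s) = char std_normal_distribution t"
  unfolding char_def h_def by (subst integral_density) (auto simp: scaleR_conv_of_real)
 also have "... = cor (exp (- (t^2) / 2))"
  by (simp only: char_std_normal_distribution)
 also have "- (t^2) / 2 = - (pi * xi^2)"
  unfolding t_def using c(2) by (simp add: power2_eq_square algebra_simps)
 finally have I: "(LBINT s. h s) = cor (exp (- (pi * xi^2)))" .
 have eq: "h (0 + c * s) = cor (1 / c) * (cor (exp (- (pi * s^2))) * cis (- (2 * pi * (xi * s))))" for s
 proof -
  have 1: "(c * s)^2 / 2 = pi * s^2" using c(2) by (simp add: power2_eq_square algebra_simps)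
  have 2: "t * (c * s) = - (2 * pi * (xi * s))" unfolding t_def using c(2) by (simp add: algebra_simps)
  have "h (0 + c * s) = cor ((1 / sqrt (2 * pi)) * exp (- ((c * s)^2 / 2))) * cis (t * (c * s))"
   unfolding h_def std_normal_density_def by (simp add: cis_conv_exp)
  then show ?thesis unfolding 1 2 c_def[symmetric] by simp
 qed
 have "integrable lborel (%s. cor c * h (0 + c * s))"
  using lborel_integrable_real_affine[OF hi, of c 0] c by simp
 then show "integrable lborel (%s::real. cor (exp (- (pi * s^2))) * cis (- (2 * pi * (xi * s))))"
  unfolding eq using c by simp
 have "(LBINT s. h s) = \<bar>c\<bar> *R (LBINT s. h (0 + c * s))"
  using c by (intro lborel_integral_real_affine) simp
 also have "... = (LBINT s. cor (exp (- (pi * s^2))) * cis (- (2 * pi * (xi * s))))"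
  unfolding eq using c by (simp add: scaleR_conv_of_real)
 finally show "(LBINT s. cor (exp (- (pi * s^2))) * cis (- (2 * pi * (xi * s)))) = cor (exp (- (pi * xi^2)))"
  using I by simp
qed

lemma gaussian_fourier:
 fixes xi :: "'a::euclidean_space"
 shows "integrable lborel (%x::'a. cor (gaussian x))" (is ?A)
  and "fourier (%x. cor (gaussian x)) xi = cor (gaussian xi)" (is ?B)
proof -
 have nsq: "(norm x)^2 = (\<Sum>b\<in>Basis. (x \<bullet> b)^2)" for x :: 'a
  unfolding power2_norm_eq_inner by (subst euclidean_inner) (simp add: power2_eq_square)
 have cs: "cis (\<Sum>b\<in>A. u b) = (\<Prod>b\<in>A. cis (u b))" if "finite A" for A :: "'a set" and u
  using that by (induction A rule: finite_induct) (auto simp: cis_mult[symmetric])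
 have eq: "cor (gaussian x) * fkernel xi x =
   (\<Prod>b\<in>Basis. cor (exp (- (pi * (x \<bullet> b)^2))) * cis (- (2 * pi * ((xi \<bullet> b) * (x \<bullet> b)))))" for xi x :: 'a
 proof -
  have "cor (gaussian x) = (\<Prod>b\<in>Basis. cor (exp (- (pi * (x \<bullet> b)^2))))"
   unfolding gaussian_def nsq by (simp add: exp_sum sum_distrib_left flip: sum_negf)
  moreover have "fkernel xi x = (\<Prod>b\<in>Basis. cis (- (2 * pi * ((xi \<bullet> b) * (x \<bullet> b)))))"
   unfolding fkernel_def by (subst euclidean_inner) (simp add: sum_distrib_left cs flip: sum_negf)
  ultimately show ?thesis by (simp add: prod.distrib)
 qed
 note P = lborel_integral_prod[where f = "%b s. cor (exp (- (pi * s^2))) * cis (- (2 * pi * ((zeta \<bullet> b) * s)))" for zeta :: 'a, OF gaussian_real_fourier(1)]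
 have "integrable lborel (%x::'a. cor (gaussian x) * fkernel 0 x)"
  unfolding eq by (rule P(2))
 then show ?A by simp
 have "fourier (%x. cor (gaussian x)) xi = (\<Prod>b\<in>Basis. cor (exp (- (pi * (xi \<bullet> b)^2))))"
  unfolding fourier_eq eq P(1) gaussian_real_fourier(2) ..
 also have "... = cor (gaussian xi)"
  unfolding gaussian_def nsq by (simp add: exp_sum sum_distrib_left flip: sum_negf)
 finally show ?B .
qed

lemma gaussian_integrable: "integrable lborel (gaussian :: 'a::euclidean_space => real)"
 using integrable_Re[OF gaussian_fourier(1)[where 'a = 'a]] by simp

lemma gaussian_integral: "(LBINT x. gaussian (x::'a::euclidean_space)) = 1"
proof -
 have "cor (LBINT x. gaussian (x::'a)) = fourier (%x::'a. cor (gaussian x)) 0"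
  by (simp add: fourier_eq)
 then show ?thesis by (simp add: gaussian_fourier)
qed

lemma inverse_Suc_tendsto_0: "(%n. 1 / real (Suc n)) \<longlonglongrightarrow> 0"
 using LIMSEQ_inverse_real_of_nat by (simp add: inverse_eq_divide)

lemma gaussian_scaled_tendsto: "(%n. gaussian ((1 / real (Suc n)) *R x)) \<longlonglongrightarrow> 1"
proof -
 have "isCont gaussian (0::'a)" unfolding gaussian_def[abs_def] by (intro continuous_intros)
 moreover have "(%n. (1 / real (Suc n)) *R x) \<longlonglongrightarrow> 0 *R x"
  by (intro tendsto_intros inverse_Suc_tendsto_0)
 ultimately show ?thesis using isCont_tendsto_compose[of "0::'a" gaussian "%n. (1 / real (Suc n)) *R x"] by simp
qed

text \<open>A Gaussian damping factor of small width parameter \<open>l n\<close> is inserted. The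
  multiplication formula turns the damped integral into a Gaussian average of \<open>f\<close> at
  scale \<open>l n\<close>; both sides converge by dominated convergence.\<close>

lemma integral_fourier_eq_at_0:
 fixes f :: "'a::euclidean_space => complex"
 assumes f: "integrable lborel f" and cont: "isCont f 0" and bd: "\<And>x. norm (f x) <= C"
  and F: "integrable lborel (fourier f)"
 shows "(LBINT xi. fourier f xi) = f 0"
proof -
 define l where "l n = 1 / real (Suc n)" for n
 have l: "l n > 0" for n by (simp add: l_def)
 have l0: "l \<longlonglongrightarrow> 0" unfolding l_def[abs_def] by (rule inverse_Suc_tendsto_0)
 have [measurable]: "f \<in> borel_measurable borel" "fourier f \<in> borel_measurable borel" using f F by auto
 have gl: "integrable lborel (%x::'a. cor (gaussian (l n *R x)))" for n
  using lborel_integrable_affine[OF gaussian_fourier(1), of "l n" 0] l[of n] by simp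
 have eq: "(LBINT xi. fourier f xi * cor (gaussian (l n *R xi)))
   = (LBINT y. f (l n *R y) * cor (gaussian y))" for n
 proof -
  have "(LBINT xi. fourier f xi * cor (gaussian (l n *R xi)))
    = (LBINT x. f x * fourier (%x. cor (gaussian (l n *R x))) x)"
   by (rule fourier_mult_formula[OF f gl])
  also have "... = (LBINT x. f x * (cor (gaussian (x /\<^sub>R l n)) / (l n) ^ DIM('a)))"
   by (simp add: fourier_dilate[OF l, of "%x. cor (gaussian x)"] gaussian_fourier(2))
  also have "... = (l n) ^ DIM('a) *R ((1 / \<bar>l n\<bar> ^ DIM('a)) *R (LBINT x. f x * (cor (gaussian (x /\<^sub>R l n)) / (l n) ^ DIM('a))))"
   using l[of n] by simp
  also have "... = (l n) ^ DIM('a) *R (LBINT y. f (0 + l n *R y) * (cor (gaussian ((0 + l n *R y) /\<^sub>R l n)) / (l n) ^ DIM('a)))"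
   using l[of n] by (subst lborel_integral_affine) auto
  also have "... = (LBINT y. f (l n *R y) * cor (gaussian y))"
   using l[of n] by (simp add: scaleR_conv_of_real)
  finally show ?thesis .
 qed
 have "(%n. (LBINT xi. fourier f xi * cor (gaussian (l n *R xi)))) \<longlonglongrightarrow> (LBINT xi. fourier f xi)"
 proof (rule integral_dominated_convergence[where w = "%x. norm (fourier f x)"])
  show "AE x in lborel. (%n. fourier f x * cor (gaussian (l n *R x))) \<longlonglongrightarrow> fourier f x"
  proof (intro AE_I2)
   fix x
   have "(%n. fourier f x * cor (gaussian (l n *R x))) \<longlonglongrightarrow> fourier f x * cor 1"
    unfolding l_def by (intro tendsto_intros gaussian_scaled_tendsto)
   then show "(%n. fourier f x * cor (gaussian (l n *R x))) \<longlonglongrightarrow> fourier f x" by simp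
  qed
  show "AE x in lborel. norm (fourier f x * cor (gaussian (l n *R x))) <= norm (fourier f x)" for n
   by (simp add: norm_mult mult_left_le gaussian_le_1 gaussian_pos[THEN less_imp_le])
 qed (use F in auto)
 moreover have "(%n. (LBINT y. f (l n *R y) * cor (gaussian y))) \<longlonglongrightarrow> (LBINT y. f 0 * cor (gaussian (y::'a)))"
 proof (rule integral_dominated_convergence[where w = "%y. C * gaussian y"])
  show "AE x in lborel. (%n. f (l n *R x) * cor (gaussian x)) \<longlonglongrightarrow> f 0 * cor (gaussian x)"
  proof (intro AE_I2 tendsto_intros)
   fix x :: 'a
   have "(%n. l n *R x) \<longlonglongrightarrow> 0 *R x" by (intro tendsto_intros l0)
   then show "(%n. f (l n *R x)) \<longlonglongrightarrow> f 0" using isCont_tendsto_compose[OF cont] by simp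
  qed
  show "AE x in lborel. norm (f (l n *R x) * cor (gaussian x)) <= C * gaussian x" for n
   by (simp add: norm_mult mult_right_mono bd gaussian_pos[THEN less_imp_le])
 qed (use gaussian_integrable in auto)
 ultimately have "(LBINT xi. fourier f xi) = (LBINT y. f 0 * cor (gaussian (y::'a)))"
  unfolding eq by (rule LIMSEQ_unique)
 also have "... = f 0" using gaussian_integral[where 'a = 'a] by simp
 finally show ?thesis .
qed

text \<open>Inversion at a general point is inversion at 0 for a translate of
  \<open>f\<close>.\<close>

lemma fourier_fourier:
 fixes f :: "'a::euclidean_space => complex"
 assumes f: "integrable lborel f" and cont: "isCont f (- x)" and bd: "\<And>x. norm (f x) <= C"
  and F: "integrable lborel (fourier f)"
 shows "fourier (fourier f) x = f (- x)"
proof -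
 define k where "k y = f (y + (- x))" for y
 have Fk: "fourier k xi = fourier f xi * fkernel x xi" for xi
  unfolding k_def fourier_translate by (simp add: fkernel_minus_right fkernel_commute)
 have "(LBINT xi. fourier k xi) = k 0"
 proof (rule integral_fourier_eq_at_0)
  show "integrable lborel k" unfolding k_def by (rule lborel_integrable_translate[OF f])
  show "isCont k 0" unfolding k_def by (rule isCont_o2[where g = f]) (use cont in auto)
  show "norm (k y) <= C" for y by (simp add: k_def bd)
  show "integrable lborel (fourier k)" unfolding Fk[abs_def] by (rule integrable_mult_fkernel[OF F])
 qed
 moreover have "(LBINT xi. fourier k xi) = fourier (fourier f) x"
  unfolding Fk fourier_eq[of "fourier f"] ..
 ultimately show ?thesis by (simp add: k_def)
qed

subsection \<open>The Fourier transform on Schwartz functions\<close>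

lemma norm_cis_minus_linear_le: "norm (cis theta - 1 - \<i> * cor theta) <= theta^2"
proof -
 have "norm (cis theta - 1 - \<i> * cor theta) <= \<bar>theta\<bar> ^ Suc 1 / fact (Suc 1)"
  using iexp_approx1[of theta 1] by (simp add: cis_conv_exp diff_diff_eq)
 also have "... <= theta^2" by (simp add: power2_eq_square flip: abs_mult)
 finally show ?thesis .
qed

lemma schwartz_inner_mult:
 fixes f :: "'a::euclidean_space => complex"
 shows "schwartz f ==> schwartz (%x. cor (a \<bullet> x) * f x)"
 by (intro schwartz_moderate_mult moderate_of_real_inner)

text \<open>The remainder of \<open>cis\<close> after its linear term is at most quadratic, which
  after integration leaves an error quadratic in the increment.\<close>

lemma fourier_has_derivative:
 fixes f :: "'a::euclidean_space => complex"
 assumes f: "schwartz f"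
 shows "(fourier f has_derivative (%h. fourier (%x. - (2 * pi * \<i>) * (cor (h \<bullet> x) * f x)) xi)) (at xi)"
proof (rule has_derivativeI_sandwich[where e = 1])
 let ?D = "%h. fourier (%x. - (2 * pi * \<i>) * (cor (h \<bullet> x) * f x)) xi"
 have [measurable]: "f \<in> borel_measurable borel" using f by (rule schwartz_measurable)
 have ih: "integrable lborel (%x. cor (h \<bullet> x) * f x)" for h
  by (intro schwartz_integrable schwartz_inner_mult f)
 \<comment> \<open>One constant serves both estimates, since \<open>norm x\<close> and its square
   are both at most \<open>(1 + norm x) ^ 2\<close>.\<close>
 define A where "A = (LBINT x. (1 + norm x) ^ 2 * norm (f x))"
 have iA: "integrable lborel (%x. (1 + norm x) ^ 2 * norm (f x))"
  using integrable_norm[OF integrable_mult_norm_power[OF f, of 2]] by (simp add: abs_of_nonneg)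
 have n1: "norm x <= (1 + norm x) ^ 2" "(norm x)^2 <= (1 + norm x) ^ 2" for x :: 'a
  by (simp_all add: power2_eq_square algebra_simps)
 show "bounded_linear ?D"
 proof (rule bounded_linear_intro)
  show "?D (h + k) = ?D h + ?D k" for h k
  proof -
   have "?D (h + k) = fourier (%x. - (2 * pi * \<i>) * (cor (h \<bullet> x) * f x) + - (2 * pi * \<i>) * (cor (k \<bullet> x) * f x)) xi"
    by (simp add: inner_add_left algebra_simps)
   also have "... = ?D h + ?D k"
    by (intro fourier_add integrable_mult_right ih)
   finally show ?thesis .
  qed
  show "?D (r *R h) = r *R ?D h" for r h
  proof -
   have "?D (r *R h) = fourier (%x. cor r * (- (2 * pi * \<i>) * (cor (h \<bullet> x) * f x))) xi"
    by (simp add: algebra_simps)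
   then show ?thesis by (simp only: fourier_cmult scaleR_conv_of_real)
  qed
  show "norm (?D h) <= norm h * (2 * pi * A)" for h
  proof -
   have "norm (?D h) <= (LBINT x. norm (- (2 * pi * \<i>) * (cor (h \<bullet> x) * f x)))"
    by (intro norm_fourier_le integrable_mult_right ih)
   also have "... <= (LBINT x. norm h * (2 * pi) * ((1 + norm x) ^ 2 * norm (f x)))"
   proof (rule integral_mono)
    show "integrable lborel (%x. norm (- (2 * pi * \<i>) * (cor (h \<bullet> x) * f x)))"
     by (intro integrable_norm integrable_mult_right ih)
    fix x :: 'a
    have "\<bar>h \<bullet> x\<bar> <= norm h * (1 + norm x) ^ 2"
     using Cauchy_Schwarz_ineq2[of h x] mult_left_mono[OF n1(1)[of x], of "norm h"] by simp
    then show "norm (- (2 * pi * \<i>) * (cor (h \<bullet> x) * f x)) <= norm h * (2 * pi) * ((1 + norm x) ^ 2 * norm (f x))"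
     using mult_right_mono[of "\<bar>h \<bullet> x\<bar>" "norm h * (1 + norm x) ^ 2" "2 * pi * norm (f x)"]
     by (simp add: norm_mult mult_ac)
   qed (use iA in simp)
   finally show ?thesis by (simp add: A_def mult_ac)
  qed
 qed
 show "norm ((fourier f eta - fourier f xi) - ?D (eta - xi)) / norm (eta - xi) <= ((2 * pi)^2 * A) * norm (eta - xi)"
  if "eta \<noteq> xi" for eta
 proof -
  define h where "h = eta - xi"
  have h: "norm h > 0" "eta = xi + h" using that by (auto simp: h_def)
  have "fourier f eta - fourier f xi - ?D h = (LBINT x. f x * fkernel eta x - f x * fkernel xi x - (- (2 * pi * \<i>) * (cor (h \<bullet> x) * f x)) * fkernel xi x)"
   unfolding fourier_eq
   using integrable_mult_fkernel[OF schwartz_integrable[OF f]] integrable_mult_fkernel[OF integrable_mult_right[OF ih, where c = "- (2 * pi * \<i>)"]]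
   by (simp only: Bochner_Integration.integral_diff Bochner_Integration.integrable_diff)
  also have "... = (LBINT x. f x * fkernel xi x * (cis (- (2 * pi * (h \<bullet> x))) - 1 - \<i> * cor (- (2 * pi * (h \<bullet> x)))))"
   unfolding h(2) fkernel_add_left
   by (intro Bochner_Integration.integral_cong refl) (simp add: fkernel_def algebra_simps)
  also have "norm ... <= (LBINT x. ((2 * pi)^2 * (norm h)^2) * ((1 + norm x) ^ 2 * norm (f x)))"
  proof (rule order_trans[OF integral_norm_bound], rule integral_mono')
   show "integrable lborel (%x. ((2 * pi)^2 * (norm h)^2) * ((1 + norm x) ^ 2 * norm (f x)))"
    using iA by simp
   fix x :: 'a
   let ?c = "cis (- (2 * pi * (h \<bullet> x))) - 1 - \<i> * cor (- (2 * pi * (h \<bullet> x)))"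
   have "norm ?c <= (- (2 * pi * (h \<bullet> x)))^2" by (rule norm_cis_minus_linear_le)
   also have "... = (2 * pi)^2 * (h \<bullet> x)^2" by (simp add: power_mult_distrib)
   also have "... <= (2 * pi)^2 * ((norm h)^2 * (1 + norm x) ^ 2)"
   proof (intro mult_left_mono)
    have "(h \<bullet> x)^2 <= (norm h * norm x)^2"
     using Cauchy_Schwarz_ineq2[of h x] by (metis abs_ge_zero power2_abs power_mono)
    also have "... <= (norm h)^2 * (1 + norm x) ^ 2"
     unfolding power_mult_distrib by (intro mult_left_mono n1) simp
    finally show "(h \<bullet> x)^2 <= (norm h)^2 * (1 + norm x) ^ 2" .
   qed simp
   finally have "norm (f x) * norm ?c <= norm (f x) * ((2 * pi)^2 * ((norm h)^2 * (1 + norm x) ^ 2))"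
    by (rule mult_left_mono) simp
   then show "norm (f x * fkernel xi x * ?c) <= ((2 * pi)^2 * (norm h)^2) * ((1 + norm x) ^ 2 * norm (f x))"
    by (simp add: norm_mult mult_ac)
  qed (auto intro!: mult_nonneg_nonneg)
  also have "... = ((2 * pi)^2 * A * norm h) * norm h" by (simp add: A_def power2_eq_square)
  finally show ?thesis using h(1) unfolding h_def[symmetric] by (simp add: pos_divide_le_eq)
 qed
 show "((%eta. ((2 * pi)^2 * A) * norm (eta - xi)) \<longlongrightarrow> 0) (at xi)"
  by (auto intro!: tendsto_eq_intros)
qed simp

lemma dir_deriv_fourier:
 fixes f :: "'a::euclidean_space => complex"
 assumes "schwartz f"
 shows "dir_deriv b (fourier f) = fourier (%x. - (2 * pi * \<i>) * (cor (b \<bullet> x) * f x))"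
 using dir_deriv_eq[OF fourier_has_derivative[OF assms]] by blast

lemma has_vector_derivative_along:
 assumes "f differentiable (at x)"
 shows "((%s. f (x + s *R b)) has_vector_derivative dir_deriv b f x) (at 0)"
proof -
 have 1: "((%s. x + s *R b) has_derivative (%s. s *R b)) (at 0)"
  by (auto intro!: derivative_eq_intros)
 have 2: "(f has_derivative (%b. dir_deriv b f x)) (at (x + 0 *R b))"
  using has_derivative_dir_deriv[OF assms] by simp
 have "((%s. f (x + s *R b)) has_derivative (%s. dir_deriv (s *R b) f x)) (at 0)"
  by (rule has_derivative_compose[OF 1 2])
 moreover have "dir_deriv (s *R b) f x = s *R dir_deriv b f x" for s
  using linear_cmul[OF bounded_linear.linear[OF has_derivative_bounded_linear[OF has_derivative_dir_deriv[OF assms]]]] .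
 ultimately show ?thesis by (simp add: has_vector_derivative_def)
qed

lemma integral_dir_deriv_schwartz:
 fixes f :: "'a::euclidean_space => 'b::{banach, second_countable_topology}"
 assumes f: "schwartz f" and b: "b \<in> Basis"
 shows "(LBINT x. dir_deriv b f x) = 0"
proof -
 obtain C where C: "C > 0" "\<And>x. norm (dir_deriv b f x) <= C / (1 + norm x) ^ (DIM('a) + 1)"
  using decaysE[OF schwartz_decays[OF schwartz_dir_deriv[OF f b]]] by metis
 show ?thesis
 \<comment> \<open>A shift by at most one unit at most doubles \<open>1 + norm x\<close>; this is
   the source of \<open>2 ^ (d + 1)\<close>.\<close>
 proof (rule integral_derivative_eq_0(2)[where f = f and m = "%x. C * 2 ^ (DIM('a) + 1) * tensor_weight x"])
  show "norm (dir_deriv b f (x + s *R b)) <= C * 2 ^ (DIM('a) + 1) * tensor_weight x" if "0 <= s" "s <= 1" for x s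
  proof -
   have "norm x <= norm (x + s *R b) + norm (s *R b)" using norm_triangle_ineq4[of "x + s *R b" "s *R b"] by simp
   also have "... <= norm (x + s *R b) + 1" using that b by (intro add_left_mono) simp
   finally have "1 + norm x <= 2 * (1 + norm (x + s *R b))" using norm_ge_zero[of "x + s *R b"] by argo
   then have *: "(1 + norm x) ^ (DIM('a) + 1) <= 2 ^ (DIM('a) + 1) * (1 + norm (x + s *R b)) ^ (DIM('a) + 1)"
    unfolding power_mult_distrib[symmetric] by (intro power_mono) auto
   have p: "1 + norm x > 0" "1 + norm (x + s *R b) > 0" by (simp_all add: add_pos_nonneg)
   have "C / (1 + norm (x + s *R b)) ^ (DIM('a) + 1) <= C * 2 ^ (DIM('a) + 1) * (1 / (1 + norm x) ^ (DIM('a) + 1))"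
    using mult_left_mono[OF *, of C] C(1) p by (simp add: divide_simps mult_ac del: power_Suc)
   also have "... <= C * 2 ^ (DIM('a) + 1) * tensor_weight x"
    using C(1) by (intro mult_left_mono inverse_norm_power_le_tensor_weight) auto
   finally show ?thesis using C(2)[of "x + s *R b"] by linarith
  qed
 qed (auto intro: schwartz_integrable f has_vector_derivative_along schwartz_differentiable tensor_weight_integrable)
qed

lemma fkernel_has_derivative:
 "(fkernel xi has_derivative (%b. - (2 * pi * \<i> * cor (xi \<bullet> b)) * fkernel xi x)) (at x)"
proof -
 have 1: "((%x. \<i> * cor (- (2 * pi * (xi \<bullet> x)))) has_derivative (%b. \<i> * cor (- (2 * pi * (xi \<bullet> b))))) (at x)"
  by (auto intro!: derivative_eq_intros)
 have 2: "(exp has_derivative (%h. exp z * h)) (at z)" for z :: complex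
  using DERIV_exp[of z] by (rule has_field_derivative_imp_has_derivative)
 show ?thesis using has_derivative_compose[OF 1 2]
  unfolding fkernel_def[abs_def] cis_conv_exp by (simp add: mult_ac)
qed

lemma moderate_fkernel: "moderate (fkernel xi)"
proof (rule moderate_coinduct[where P = "%f. \<exists>c. f = (%x. c * fkernel xi x)"])
 show "\<exists>c. fkernel xi = (%x. c * fkernel xi x)" by (intro exI[of _ 1]) simp
 fix f :: "'a => complex" and x b :: 'a
 assume "\<exists>c. f = (%x. c * fkernel xi x)"
 then obtain c where f: "f = (%x. c * fkernel xi x)" by blast
 have d: "(f has_derivative (%b. (c * (- (2 * pi * \<i> * (xi \<bullet> b)))) * fkernel xi x)) (at x)" for x
  using has_derivative_mult_right[OF fkernel_has_derivative[of xi x], of c] unfolding f by (simp add: mult_ac)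
 then show "f differentiable (at x)" unfolding differentiable_def by blast
 show "\<exists>n C. \<forall>x. norm (f x) <= C * (1 + norm x) ^ n"
  by (intro exI[of _ 0] exI[of _ "norm c"]) (simp add: f norm_mult)
 show "\<exists>c. dir_deriv b f = (%x. c * fkernel xi x)"
  using dir_deriv_eq[OF d, of b] by blast
qed

text \<open>Integration by parts: the derivative of the product of kernel and function has integral
  0.\<close>

lemma fourier_dir_deriv:
 fixes f :: "'a::euclidean_space => complex"
 assumes f: "schwartz f" and b: "b \<in> Basis"
 shows "fourier (dir_deriv b f) xi = 2 * pi * \<i> * cor (xi \<bullet> b) * fourier f xi"
proof -
 have s: "schwartz (%x. fkernel xi x * f x)" by (intro schwartz_moderate_mult moderate_fkernel f)
 have dk: "dir_deriv b (fkernel xi) x = - (2 * pi * \<i> * cor (xi \<bullet> b)) * fkernel xi x" for x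
  by (rule dir_deriv_eq[OF fkernel_has_derivative])
 have "0 = (LBINT x. dir_deriv b (%x. fkernel xi x * f x) x)"
  by (rule integral_dir_deriv_schwartz[OF s b, symmetric])
 also have "... = (LBINT x. dir_deriv b f x * fkernel xi x - 2 * pi * \<i> * cor (xi \<bullet> b) * (f x * fkernel xi x))"
  by (intro Bochner_Integration.integral_cong refl)
   (simp add: dir_deriv_mult moderate_differentiable[OF moderate_fkernel] schwartz_differentiable[OF f] dk)
 also have "... = fourier (dir_deriv b f) xi - 2 * pi * \<i> * cor (xi \<bullet> b) * fourier f xi"
  unfolding fourier_eq
  using integrable_mult_fkernel[OF schwartz_integrable[OF f], of xi] integrable_mult_fkernel[OF schwartz_integrable[OF schwartz_dir_deriv[OF f b]], of xi]
  by (subst Bochner_Integration.integral_diff) auto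
 finally show ?thesis by simp
qed

text \<open>Each power of \<open>norm xi\<close> is bought by one more derivative of
  \<open>f\<close>, which is again a Schwartz function; hence the induction over all
  \<open>f\<close> at once.\<close>

lemma decays_fourier:
 fixes f :: "'a::euclidean_space => complex"
 assumes "schwartz f"
 shows "decays (fourier f)"
proof -
 have "\<exists>C. \<forall>xi. (1 + norm xi) ^ n * norm (fourier f xi) <= C" for n using assms
 proof (induction n arbitrary: f)
  case 0
  then show ?case using norm_fourier_le[OF schwartz_integrable] by auto
 next
  case (Suc n)
  obtain C where C: "\<And>xi. (1 + norm xi) ^ n * norm (fourier f xi) <= C" using Suc by blast
  have "\<forall>b\<in>Basis. \<exists>C. \<forall>xi. (1 + norm xi) ^ n * norm (fourier (dir_deriv b f) xi) <= C"
   using Suc schwartz_dir_deriv by blast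
  then obtain D where D: "\<And>b xi. b \<in> Basis ==> (1 + norm xi) ^ n * norm (fourier (dir_deriv b f) xi) <= D b"
   by metis
  have "(1 + norm xi) ^ Suc n * norm (fourier f xi) <= C + (\<Sum>b\<in>Basis. D b)" for xi
  proof -
   let ?N = "(1 + norm xi) ^ n"
   have N: "?N >= 0" by simp
   have "norm xi * (?N * norm (fourier f xi)) <= (\<Sum>b\<in>Basis. \<bar>xi \<bullet> b\<bar>) * (?N * norm (fourier f xi))"
    by (intro mult_right_mono norm_le_l1) simp
   also have "... = (\<Sum>b\<in>Basis. ?N * (\<bar>xi \<bullet> b\<bar> * norm (fourier f xi)))"
    by (simp add: sum_distrib_right sum_distrib_left mult_ac)
   also have "... <= (\<Sum>b\<in>Basis. D b)"
   proof (rule sum_mono)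
    fix b :: 'a assume b: "b \<in> Basis"
    have "norm (fourier (dir_deriv b f) xi) = 2 * pi * (\<bar>xi \<bullet> b\<bar> * norm (fourier f xi))"
     unfolding fourier_dir_deriv[OF Suc.prems b] by (simp add: norm_mult)
    moreover have "1 * (\<bar>xi \<bullet> b\<bar> * norm (fourier f xi)) <= 2 * pi * (\<bar>xi \<bullet> b\<bar> * norm (fourier f xi))"
     using pi_ge_two by (intro mult_right_mono) auto
    ultimately have "\<bar>xi \<bullet> b\<bar> * norm (fourier f xi) <= norm (fourier (dir_deriv b f) xi)" by simp
    then show "?N * (\<bar>xi \<bullet> b\<bar> * norm (fourier f xi)) <= D b"
     using D[OF b, of xi] mult_left_mono[OF _ N] by (meson order_trans)
   qed
   finally show ?thesis using C[of xi] by (simp add: algebra_simps)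
  qed
  then show ?case by blast
 qed
 then show ?thesis unfolding decays_def by blast
qed

text \<open>The transforms of Schwartz functions form an invariant class: differentiating a
  transform multiplies the function by a linear factor.\<close>

theorem schwartz_fourier:
 fixes f :: "'a::euclidean_space => complex"
 assumes "schwartz f"
 shows "schwartz (fourier f)"
proof (rule schwartz_coinduct[where P = "%h. \<exists>f. schwartz f \<and> h = fourier f"])
 fix h :: "'a => complex" and x b :: 'a
 assume "\<exists>f. schwartz f \<and> h = fourier f"
 then obtain f where h: "schwartz f" "h = fourier f" by blast
 show "h differentiable (at x)"
  unfolding h(2) differentiable_def using fourier_has_derivative[OF h(1)] by blast
 show "decays h" unfolding h(2) by (rule decays_fourier[OF h(1)])
 have "schwartz (%x. - (2 * pi * \<i>) * (cor (b \<bullet> x) * f x))"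
  by (intro schwartz_cmult schwartz_inner_mult h)
 then show "\<exists>f. schwartz f \<and> dir_deriv b h = fourier f"
  unfolding h(2) dir_deriv_fourier[OF h(1)] by blast
qed (use assms in blast)

theorem fourier_inversion:
 fixes f :: "'a::euclidean_space => complex"
 assumes "schwartz f"
 shows "fourier (fourier f) x = f (- x)"
proof -
 obtain C where C: "\<And>x. norm (f x) <= C" using schwartz_bounded[OF assms] by blast
 show ?thesis
  by (rule fourier_fourier[where C = C])
   (auto intro: schwartz_integrable schwartz_fourier schwartz_isCont assms C)
qed

subsection \<open>Bessel's inequality\<close>

text \<open>The inequality is wanted for symbols \<open>W\<close> that are only integrable and
  square integrable, since \<open>\<sigma>\<close> need not be continuous. Damping by a Gaussian
  turns the left side into a quadratic form whose kernel is a probability density, bounded by the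
  square integral; Fatou's lemma removes the damping.\<close>

lemma bessel_inequality:
 fixes W :: "'a::euclidean_space => real"
 assumes W: "integrable lborel W" and W2: "integrable lborel (%x. (W x)^2)"
 shows "(\<integral>\<^sup>+x. ennreal ((norm (fourier (%xi. cor (W xi)) x))^2) \<partial>lborel) <= ennreal (LBINT x. (W x)^2)"
proof -
 define F where "F = fourier (%xi. cor (W xi))"
 define l where "l n = 1 / real (Suc n)" for n
 have l: "l n > 0" for n by (simp add: l_def)
 have Wc: "integrable lborel (%xi. cor (W xi))" using W by simp
 have [measurable]: "W \<in> borel_measurable borel" using W by simp
 have [measurable]: "F \<in> borel_measurable borel" unfolding F_def using Wc by (rule fourier_measurable)
 have gl: "integrable lborel (%x::'a. gaussian (l n *R x))" for n
  using lborel_integrable_affine[OF gaussian_integrable, of "l n" 0] l[of n] by simp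
 define B where "B = (LBINT x. norm (W x))"
 have FB: "norm (F x) <= B" for x
  unfolding F_def B_def using norm_fourier_le[OF Wc, of x] by simp
 \<comment> \<open>The transform of the damping factor: a Gaussian probability density of width
   \<open>l n\<close>.\<close>
 define k where "k n x = gaussian (x /\<^sub>R l n) / (l n) ^ DIM('a)" for n and x :: 'a
 have k0: "k n x >= 0" for n x unfolding k_def using l[of n] gaussian_pos[of "x /\<^sub>R l n"] by (simp add: less_imp_le)
 have km [measurable]: "k n \<in> borel_measurable borel" for n unfolding k_def[abs_def] by measurable
 have ki: "integrable lborel (k n)" for n
  unfolding k_def[abs_def] using lborel_integrable_affine[OF gaussian_integrable, of "1 / l n" 0] l[of n]
  by (intro integrable_divide_zero) (simp add: inverse_eq_divide)
 have kI: "(LBINT x. k n x) = 1" for n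
 proof -
  have "(LBINT x. k n x) = (LBINT x. gaussian (0 + (1 / l n) *R x :: 'a)) / (l n) ^ DIM('a)"
   unfolding k_def by (simp add: inverse_eq_divide)
  also have "... = 1" using l[of n]
   by (subst lborel_integral_affine) (auto simp: gaussian_integral power_one_over field_simps)
  finally show ?thesis .
 qed
 have fk: "fourier (%x. cor (gaussian (l n *R x))) xi = cor (k n xi)" for n xi
  by (simp add: fourier_dilate[OF l, of "%x. cor (gaussian x)"] gaussian_fourier(2) k_def)
 have pair: "integrable lborel2 (%(xi, eta). (W xi)^2 * k n (xi - eta))" 
  "integrable lborel2 (%(xi, eta). (W eta)^2 * k n (xi - eta))" for n
 proof -
  have s: "integrable lborel (%eta. k n (xi - eta))" "(LBINT eta. k n (xi - eta)) = 1" for xi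
   using lborel_integrable_affine[OF ki, of "-1" n xi] lborel_integral_affine[of "-1" "k n" xi] kI[of n] by simp_all
  show "integrable lborel2 (%(xi, eta). (W xi)^2 * k n (xi - eta))"
   by (rule lborel_pair.Fubini_integrable) (use s W2 k0 in \<open>auto simp: abs_mult\<close>)
  have ksym: "k n (xi - eta) = k n (eta - xi)" for xi eta
   by (simp add: k_def gaussian_def norm_minus_commute)
  have "integrable lborel2 (%(eta, xi). (W eta)^2 * k n (xi - eta))"
   by (subst ksym, rule lborel_pair.Fubini_integrable) (use s W2 k0 in \<open>auto simp: abs_mult\<close>)
  then show "integrable lborel2 (%(xi, eta). (W eta)^2 * k n (xi - eta))"
   by (subst lborel_pair.integrable_product_swap_iff[symmetric]) (simp add: case_prod_beta)
 qed
 have kl: "(LBINT eta. k n (xi - eta)) = 1" for n xi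
  using lborel_integral_affine[of "-1" "k n" xi] kI[of n] by simp
 have kr: "(LBINT xi. k n (xi - eta)) = 1" for n eta
  using lborel_integral_translate[of "k n" "- eta"] kI[of n] by simp
 have main: "(LBINT x. (norm (F x))^2 * gaussian (l n *R x)) <= (LBINT x. (W x)^2)" for n
 proof -
  have gk: "integrable lborel (%x. cor (gaussian (l n *R x)) * fkernel xi x)" for xi :: 'a
   by (intro integrable_mult_fkernel integrable_of_real gl)
  have cF: "cnj (F x) = fourier (%xi. cor (W (- xi))) x" for x
   unfolding F_def using fourier_cnj[of "%xi. cor (W xi)" "- x"] fourier_reflect[of "%xi. cor (W xi)" x]
   by simp
  have [measurable]: "(%x. cnj (F x)) \<in> borel_measurable borel"
   unfolding cF by (rule fourier_measurable[OF lborel_integrable_reflect[OF Wc]])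
  have iF: "integrable lborel (%x. cnj (F x) * cor (gaussian (l n *R x)))"
   by (rule integrable_dom[of lborel "%x. B * gaussian (l n *R x)"])
    (use gl FB gaussian_pos[THEN less_imp_le] order_trans[OF norm_ge_zero FB] in \<open>auto simp: norm_mult abs_mult intro!: mult_right_mono AE_I2\<close>)
  have inner: "fourier (%x. cnj (F x) * cor (gaussian (l n *R x))) xi = cor (LBINT eta. W eta * k n (xi - eta))" for xi
  proof -
   have "fourier (%x. cnj (F x) * cor (gaussian (l n *R x))) xi
     = (LBINT x. fourier (%xi. cor (W (- xi))) x * (cor (gaussian (l n *R x)) * fkernel xi x))"
    unfolding cF fourier_eq[of "%x. fourier (%xi. cor (W (- xi))) x * cor (gaussian (l n *R x))"]
    by (simp only: mult.assoc)
   also have "... = (LBINT eta. cor (W (- eta)) * fourier (%x. cor (gaussian (l n *R x)) * fkernel xi x) eta)"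
    by (rule fourier_mult_formula[OF _ gk]) (rule lborel_integrable_reflect[OF Wc])
   also have "... = (LBINT eta. cor (W (- eta) * k n (xi - (- eta))))"
    by (simp add: fourier_modulate fk add.commute)
   also have "... = cor (LBINT eta. W (- eta) * k n (xi - (- eta)))"
    by (rule integral_complex_of_real)
   also have "(LBINT eta. W (- eta) * k n (xi - (- eta))) = (LBINT eta. W eta * k n (xi - eta))"
    by (rule lborel_integral_reflect[of "%eta. W eta * k n (xi - eta)"])
   finally show ?thesis .
  qed
  have "cor (LBINT x. (norm (F x))^2 * gaussian (l n *R x))
    = (LBINT x. F x * (cnj (F x) * cor (gaussian (l n *R x))))"
   unfolding integral_complex_of_real[symmetric] of_real_mult mult.assoc[symmetric] complex_norm_square ..
  also have "... = (LBINT xi. cor (W xi) * cor (LBINT eta. W eta * k n (xi - eta)))"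
   unfolding F_def by (subst fourier_mult_formula[OF Wc iF[unfolded F_def]]) (simp only: inner[unfolded F_def])
  also have "... = cor (LBINT xi. W xi * (LBINT eta. W eta * k n (xi - eta)))"
   unfolding of_real_mult[symmetric] by (rule integral_complex_of_real)
  finally have "(LBINT x. (norm (F x))^2 * gaussian (l n *R x)) = (LBINT xi. W xi * (LBINT eta. W eta * k n (xi - eta)))"
   by (simp only: of_real_eq_iff)
  also have "... = (LBINT xi. (LBINT eta. W xi * W eta * k n (xi - eta)))"
   by (simp add: mult.assoc)
  also have "... = (\<integral>z. (case z of (xi, eta) => W xi * W eta * k n (xi - eta)) \<partial>lborel2)"
  proof (rule lborel_pair.integral_fst)
   show "integrable lborel2 (%(xi, eta). W xi * W eta * k n (xi - eta))"
   proof (rule integrable_dom[OF Bochner_Integration.integrable_add[OF pair]])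
    show "AE z in lborel2. norm (case z of (xi, eta) => W xi * W eta * k n (xi - eta)) \<le>
     norm ((case z of (xi, eta) => (W xi)^2 * k n (xi - eta)) + (case z of (xi, eta) => (W eta)^2 * k n (xi - eta)))"
    proof (intro AE_I2)
     fix z :: "'a \<times> 'a"
     obtain xi eta where z: "z = (xi, eta)" by (cases z)
     have "2 * \<bar>W xi\<bar> * \<bar>W eta\<bar> <= (W xi)^2 + (W eta)^2"
      using sum_squares_bound[of "\<bar>W xi\<bar>" "\<bar>W eta\<bar>"] by simp
     moreover have "0 <= \<bar>W xi\<bar> * \<bar>W eta\<bar>" by simp
     ultimately have "\<bar>W xi\<bar> * \<bar>W eta\<bar> <= (W xi)^2 + (W eta)^2" by linarith
     from mult_right_mono[OF this k0[of n "xi - eta"]]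
     have "\<bar>W xi\<bar> * \<bar>W eta\<bar> * k n (xi - eta) <= (W xi)^2 * k n (xi - eta) + (W eta)^2 * k n (xi - eta)"
      by (simp only: distrib_right)
     then show "norm (case z of (xi, eta) => W xi * W eta * k n (xi - eta)) \<le>
      norm ((case z of (xi, eta) => (W xi)^2 * k n (xi - eta)) + (case z of (xi, eta) => (W eta)^2 * k n (xi - eta)))"
      unfolding z prod.case real_norm_def abs_mult abs_of_nonneg[OF k0] by linarith
    qed
   qed measurable
  qed
  \<comment> \<open>The elementary bound \<open>2 * a * b <= a^2 + b^2\<close>; the two resulting
    integrals agree because the kernel has mass 1 in either variable.\<close>
  also have "... <= (\<integral>z. ((case z of (xi, eta) => (W xi)^2 * k n (xi - eta)) + (case z of (xi, eta) => (W eta)^2 * k n (xi - eta))) / 2 \<partial>lborel2)"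
  proof (rule integral_mono')
   show "integrable lborel2 (%z. ((case z of (xi, eta) => (W xi)^2 * k n (xi - eta)) + (case z of (xi, eta) => (W eta)^2 * k n (xi - eta))) / 2)"
    using pair by simp
   fix z :: "'a \<times> 'a"
   obtain xi eta where z: "z = (xi, eta)" by (cases z)
   have "W xi * W eta <= ((W xi)^2 + (W eta)^2) / 2"
    using sum_squares_bound[of "W xi" "W eta"] by simp
   from mult_right_mono[OF this k0[of n "xi - eta"]]
   show "(case z of (xi, eta) => W xi * W eta * k n (xi - eta)) <= ((case z of (xi, eta) => (W xi)^2 * k n (xi - eta)) + (case z of (xi, eta) => (W eta)^2 * k n (xi - eta))) / 2"
    unfolding z by (simp add: algebra_simps)
  qed (auto simp: k0 split: prod.splits)
  also have "... = ((\<integral>z. (case z of (xi, eta) => (W xi)^2 * k n (xi - eta)) \<partial>lborel2) + (\<integral>z. (case z of (xi, eta) => (W eta)^2 * k n (xi - eta)) \<partial>lborel2)) / 2"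
   using pair by simp
  also have "(\<integral>z. (case z of (xi, eta) => (W xi)^2 * k n (xi - eta)) \<partial>lborel2) = (LBINT x. (W x)^2)"
   by (subst lborel_pair.integral_fst[OF pair(1), symmetric]) (simp add: kl)
  also have "(\<integral>z. (case z of (xi, eta) => (W eta)^2 * k n (xi - eta)) \<partial>lborel2) = (LBINT x. (W x)^2)"
   by (subst lborel_pair.integral_snd[OF pair(2), symmetric]) (simp add: kr)
  finally show ?thesis by simp
 qed
 \<comment> \<open>The damping factors tend to 1, so the undamped integrand is a pointwise lower
   limit and Fatou applies.\<close>
 have "(\<integral>\<^sup>+x. ennreal ((norm (F x))^2) \<partial>lborel) = (\<integral>\<^sup>+x. liminf (%n. ennreal ((norm (F x))^2 * gaussian (l n *R x))) \<partial>lborel)"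
 proof (intro nn_integral_cong)
  fix x
  have "(%n. (norm (F x))^2 * gaussian (l n *R x)) \<longlonglongrightarrow> (norm (F x))^2 * 1"
   unfolding l_def by (intro tendsto_intros gaussian_scaled_tendsto)
  then have "(%n. ennreal ((norm (F x))^2 * gaussian (l n *R x))) \<longlonglongrightarrow> ennreal ((norm (F x))^2)"
   by (intro tendsto_ennrealI) simp
  then show "ennreal ((norm (F x))^2) = liminf (%n. ennreal ((norm (F x))^2 * gaussian (l n *R x)))"
   by (rule lim_imp_Liminf[OF trivial_limit_sequentially, symmetric])
 qed
 also have "... <= liminf (%n. \<integral>\<^sup>+x. ennreal ((norm (F x))^2 * gaussian (l n *R x)) \<partial>lborel)"
  by (rule nn_integral_liminf) measurable
 also have "... <= ennreal (LBINT x. (W x)^2)"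
 proof (rule Liminf_le)
  have "(\<integral>\<^sup>+x. ennreal ((norm (F x))^2 * gaussian (l n *R x)) \<partial>lborel) = ennreal (LBINT x. (norm (F x))^2 * gaussian (l n *R x))" for n
  proof (rule nn_integral_eq_integral)
   show "integrable lborel (%x. (norm (F x))^2 * gaussian (l n *R x))"
    by (rule integrable_dom[of lborel "%x. B^2 * gaussian (l n *R x)"])
     (use gl FB gaussian_pos[THEN less_imp_le] in \<open>auto simp: abs_mult intro!: mult_right_mono power_mono AE_I2\<close>)
  qed (simp add: gaussian_pos[THEN less_imp_le])
  then show "\<forall>\<^sub>F n in sequentially. (\<integral>\<^sup>+x. ennreal ((norm (F x))^2 * gaussian (l n *R x)) \<partial>lborel) <= ennreal (LBINT x. (W x)^2)"
   using main by (auto intro!: ennreal_leI)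
 qed simp
 finally show ?thesis unfolding F_def .
qed

section \<open>Bump functions\<close>

lemma poly_mult_exp_minus_tendsto_0: "((%x. poly p x * exp (- x)) \<longlongrightarrow> 0) at_top" for p :: "real poly"
proof -
 have "((%x. \<Sum>i\<le>degree p. coeff p i * (x ^ i / exp x)) \<longlongrightarrow> (\<Sum>i\<le>degree p. coeff p i * 0)) at_top"
  by (intro tendsto_intros tendsto_power_div_exp_0)
 then show ?thesis by (simp add: poly_altdef exp_minus sum_distrib_right divide_inverse mult.assoc)
qed

definition flat_exp :: "real poly => real => real" where
 "flat_exp p x = (if x > 0 then poly p (1 / x) * exp (- (1 / x)) else 0)"

text \<open>With \<open>z = 1 / x\<close> the derivative of \<open>p(z) * exp (- z)\<close> is
  \<open>z^2 * (p - p')(z) * exp (- z)\<close>, again of the same form. At 0 the exponential beats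
  every polynomial in \<open>z\<close>.\<close>

lemma flat_exp_has_derivative:
 "(flat_exp p has_real_derivative flat_exp ([:0, 0, 1:] * (p - pderiv p)) x) (at x)"
proof -
 consider "x > 0" | "x < 0" | "x = 0" by linarith
 then show ?thesis
 proof cases
  case 1
  have "((%x. poly p (1 / x) * exp (- (1 / x))) has_real_derivative flat_exp ([:0, 0, 1:] * (p - pderiv p)) x) (at x)"
   using 1 unfolding flat_exp_def
   by (auto intro!: derivative_eq_intros simp: power2_eq_square divide_simps) (simp add: algebra_simps)
  then show ?thesis
   by (rule DERIV_cong_ev[THEN iffD1, rotated -1])
    (use 1 in \<open>auto simp: flat_exp_def eventually_nhds intro!: exI[of _ "{0<..}"]\<close>)
 next
  case 2
  have "((%x. 0) has_real_derivative flat_exp ([:0, 0, 1:] * (p - pderiv p)) x) (at x)"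
   using 2 by (simp add: flat_exp_def)
  then show ?thesis
   by (rule DERIV_cong_ev[THEN iffD1, rotated -1])
    (use 2 in \<open>auto simp: flat_exp_def eventually_nhds intro!: exI[of _ "{..<0}"]\<close>)
 next
  case 3
  have "((%h. flat_exp p h / h) \<longlongrightarrow> 0) (at_right 0)"
  proof (rule Lim_transform_eventually)
   have "((%h. poly ([:0, 1:] * p) (inverse h) * exp (- (inverse h))) \<longlongrightarrow> 0) (at_right 0)"
    by (rule filterlim_compose[OF poly_mult_exp_minus_tendsto_0 filterlim_inverse_at_top_right])
   then show "((%h. poly ([:0, 1:] * p) (inverse h) * exp (- (inverse h))) \<longlongrightarrow> 0) (at_right 0)" .
   show "\<forall>\<^sub>F h in at_right 0. poly ([:0, 1:] * p) (inverse h) * exp (- (inverse h)) = flat_exp p h / h"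
    by (auto simp: eventually_at_right_field flat_exp_def inverse_eq_divide intro!: exI[of _ 1])
  qed
  moreover have "((%h. flat_exp p h / h) \<longlongrightarrow> 0) (at_left 0)"
   by (rule Lim_transform_eventually[OF tendsto_const])
    (auto simp: eventually_at_left_field flat_exp_def intro!: exI[of _ "-1"])
  ultimately have "((%h. flat_exp p h / h) \<longlongrightarrow> 0) (at 0)" by (simp add: filterlim_split_at)
  then show ?thesis using 3 by (simp add: has_field_derivative_iff flat_exp_def)
 qed
qed

text \<open>The functions \<open>flat_exp p (delta^2 - x \<bullet> x)\<close> are closed under
  differentiation only up to linear factors and sums. This closure keeps the support in the ball of
  radius \<open>delta\<close> and is the invariant that makes \<open>bump\<close> a Schwartz
  function.\<close>

inductive radial_sum :: "real => ('a::euclidean_space => real) => bool" for delta where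
 base: "radial_sum delta (%x. flat_exp p (delta^2 - x \<bullet> x))"
| mult: "radial_sum delta f ==> radial_sum delta (%x. (a \<bullet> x) * f x)"
| scale: "radial_sum delta f ==> radial_sum delta (%x. c * f x)"
| add: "radial_sum delta f ==> radial_sum delta g ==> radial_sum delta (%x. f x + g x)"

lemma radial_sum_derivative:
 fixes f :: "'a::euclidean_space => real"
 assumes "radial_sum delta f"
 shows "\<exists>f'. (\<forall>x. (f has_derivative (%b. f' b x)) (at x)) \<and> (\<forall>b. radial_sum delta (f' b))"
 using assms
proof (induction rule: radial_sum.induct)
 case (base p)
 let ?q = "[:0, 0, 1:] * (p - pderiv p)"
 have "((%x. flat_exp p (delta^2 - x \<bullet> x)) has_derivative (%b. (- 2) * ((b \<bullet> x) * flat_exp ?q (delta^2 - x \<bullet> x)))) (at x)" for x :: 'a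
 proof -
  have 1: "((%x. delta^2 - x \<bullet> x) has_derivative (%b. - 2 * (b \<bullet> x))) (at x)"
   by (auto intro!: derivative_eq_intros simp: inner_commute)
  have 2: "(flat_exp p has_derivative (%h. flat_exp ?q z * h)) (at z)" for z
   using flat_exp_has_derivative[of p z] by (rule has_field_derivative_imp_has_derivative)
  show ?thesis using has_derivative_compose[OF 1 2] by (simp add: mult_ac)
 qed
 moreover have "radial_sum delta (%x. (- 2) * ((b \<bullet> x) * flat_exp ?q (delta^2 - x \<bullet> x)))" for b :: 'a
  by (intro radial_sum.intros)
 ultimately show ?case
  by (intro exI[of _ "%b x. (- 2) * ((b \<bullet> x) * flat_exp ?q (delta^2 - x \<bullet> x))"] conjI allI)
next
 case (mult f a)
 then obtain f' where f': "\<And>x. (f has_derivative (%b. f' b x)) (at x)" "\<And>b. radial_sum delta (f' b)" by blast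
 have "((%x. (a \<bullet> x) * f x) has_derivative (%b. (a \<bullet> x) * f' b x + (a \<bullet> b) * f x)) (at x)" for x
  by (rule has_derivative_mult[OF _ f'(1)]) (auto intro!: derivative_eq_intros)
 moreover have "radial_sum delta (%x. (a \<bullet> x) * f' b x + (a \<bullet> b) * f x)" for b
  by (intro radial_sum.add radial_sum.mult[OF f'(2)] radial_sum.scale[OF mult(1)])
 ultimately show ?case
  by (intro exI[of _ "%b x. (a \<bullet> x) * f' b x + (a \<bullet> b) * f x"] conjI allI)
next
 case (scale f c)
 then obtain f' where f': "\<And>x. (f has_derivative (%b. f' b x)) (at x)" "\<And>b. radial_sum delta (f' b)" by blast
 then show ?case
  by (intro exI[of _ "%b x. c * f' b x"]) (auto intro: radial_sum.intros has_derivative_mult_right)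
next
 case (add f g)
 then obtain f' g' where f': "\<And>x. (f has_derivative (%b. f' b x)) (at x)" "\<And>b. radial_sum delta (f' b)"
  and g': "\<And>x. (g has_derivative (%b. g' b x)) (at x)" "\<And>b. radial_sum delta (g' b)" by blast
 then show ?case
  by (intro exI[of _ "%b x. f' b x + g' b x"]) (auto intro: radial_sum.intros has_derivative_add)
qed

lemma radial_sum_support: "radial_sum delta f ==> 0 < delta ==> delta <= norm x ==> f x = 0"
proof (induction arbitrary: x rule: radial_sum.induct)
 case (base p)
 have "delta^2 <= x \<bullet> x" using base by (simp add: dot_square_norm power_mono)
 then show ?case by (simp add: flat_exp_def)
qed auto

lemma decays_compact_support:
 fixes f :: "'a::euclidean_space => 'b::real_normed_vector"
 assumes "continuous_on UNIV f" and "\<And>x. delta <= norm x ==> f x = 0" and "0 < delta"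
 shows "decays f"
 unfolding decays_def
proof
 fix n
 have "compact (f ` cball 0 delta)"
  by (intro compact_continuous_image continuous_on_subset[OF assms(1)]) auto
 then obtain C where C: "\<And>x. norm x <= delta ==> norm (f x) <= C"
  by (meson bounded_iff compact_imp_bounded imageI mem_cball_0)
 have "(1 + norm x) ^ n * norm (f x) <= (1 + delta) ^ n * C" for x
 proof (cases "norm x <= delta")
  case True
  then show ?thesis using C[OF True] assms(3) by (intro mult_mono power_mono) auto
 next
  case False
  then show ?thesis using assms C[of 0] order_trans[OF norm_ge_zero, of "f 0" C] by simp
 qed
 then show "\<exists>C. \<forall>x. (1 + norm x) ^ n * norm (f x) <= C" by blast
qed

definition bump :: "real => 'a::euclidean_space => real" where
 "bump delta x = flat_exp 1 (delta^2 - x \<bullet> x)"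

lemma schwartz_bump:
 assumes "0 < delta"
 shows "schwartz (bump delta :: 'a::euclidean_space => real)"
proof (rule schwartz_coinduct[where P = "radial_sum delta"])
 show "radial_sum delta (bump delta :: 'a => real)" unfolding bump_def[abs_def] by (rule radial_sum.base)
 fix f :: "'a => real" and x b :: 'a
 assume f: "radial_sum delta f"
 obtain f' where f': "\<And>x. (f has_derivative (%b. f' b x)) (at x)" "\<And>b. radial_sum delta (f' b)"
  using radial_sum_derivative[OF f] by blast
 show diff: "f differentiable (at x)" for x unfolding differentiable_def using f' by blast
 show "decays f"
  by (rule decays_compact_support[where delta = delta])
   (use diff radial_sum_support[OF f assms] assms in \<open>auto intro!: continuous_at_imp_continuous_on differentiable_imp_continuous_within\<close>)
 have "dir_deriv b f = f' b" using dir_deriv_eq[OF f'(1)] by blast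
 then show "radial_sum delta (dir_deriv b f)" using f'(2) by simp
qed

lemma bump_nonneg: "0 <= bump delta x"
 by (simp add: bump_def flat_exp_def)

lemma bump_pos: "norm x < delta ==> 0 < bump delta x"
 using power_strict_mono[of "norm x" delta 2] by (simp add: bump_def flat_exp_def dot_square_norm)

lemma bump_eq_0: "0 < delta ==> delta <= norm x ==> bump delta x = 0"
 using power_mono[of delta "norm x" 2] by (simp add: bump_def flat_exp_def dot_square_norm not_less)

lemma bump_minus [simp]: "bump delta (- x) = bump delta x"
 by (simp add: bump_def)

text \<open>If the integral were 0, \<open>f\<close> would vanish almost everywhere, and
  \<open>S\<close> would be a null set, which a nonempty open set is not.\<close>

lemma integral_pos_open:
 fixes f :: "'a::euclidean_space => real"
 assumes f: "integrable lborel f" and nonneg: "\<And>x. 0 <= f x"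
  and S: "open S" "S \<noteq> {}" "\<And>x. x \<in> S ==> 0 < f x"
 shows "0 < (LBINT x. f x)"
proof (rule ccontr)
 assume "\<not> ?thesis"
 then have "(LBINT x. f x) = 0"
  using Bochner_Integration.integral_nonneg[of lborel f] nonneg by (simp add: not_less antisym)
 then have "AE x in lborel. f x = 0"
  using integral_nonneg_eq_0_iff_AE[OF f] nonneg by simp
 then have "AE x in lborel. x \<notin> S" by eventually_elim (use S(3) in force)
 then have "S \<in> null_sets lborel"
  using S(1) by (subst (asm) AE_iff_null_sets[symmetric]) auto
 then have "negligible S"
  by (simp add: negligible_iff_null_sets null_sets_completionI)
 then show False using open_not_negligible[OF S(1,2)] by simp
qed

lemma bump_integral_pos: "0 < delta ==> 0 < (LBINT x. bump delta (x::'a::euclidean_space))"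
 by (rule integral_pos_open[where S = "ball 0 delta"])
  (auto intro: schwartz_integrable schwartz_bump bump_nonneg bump_pos)

definition mollifier :: "real => 'a::euclidean_space => real" where
 "mollifier delta x = bump delta x / (LBINT y. bump delta (y::'a))"

lemma schwartz_mollifier: "0 < delta ==> schwartz (mollifier delta :: 'a::euclidean_space => real)"
 using schwartz_cmult[OF schwartz_bump, of delta "inverse (LBINT y. bump delta (y::'a))"]
 by (simp add: mollifier_def[abs_def] divide_inverse mult.commute)

lemma mollifier_nonneg: "0 < delta ==> 0 <= mollifier delta x"
 unfolding mollifier_def by (intro divide_nonneg_nonneg bump_nonneg less_imp_le bump_integral_pos)

lemma mollifier_eq_0: "0 < delta ==> delta <= norm x ==> mollifier delta x = 0"
 by (simp add: mollifier_def bump_eq_0)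

lemma mollifier_integral: "0 < delta ==> (LBINT x. mollifier delta (x::'a::euclidean_space)) = 1"
 using bump_integral_pos[of delta, where 'a = 'a] by (simp add: mollifier_def)

section \<open>Tempered functions and potentials\<close>

lemma tempered_measurable: "tempered f ==> f \<in> borel_measurable borel"
 by (simp add: tempered_def)

lemma tempered_decays_integrable:
 fixes u :: "'a::euclidean_space => real" and f :: "'a => 'b::{real_normed_field, banach, second_countable_topology}"
 assumes u: "tempered u" and f: "decays f" and [measurable]: "f \<in> borel_measurable borel"
 shows "integrable lborel (%x. of_real (u x) * f x)"
proof -
 have [measurable]: "u \<in> borel_measurable borel" using u by (rule tempered_measurable)
 obtain N where N: "integrable lborel (%x. (1 / (1 + norm x) ^ N) *R u x)"
  using u unfolding tempered_def by blast
 obtain C where C: "C > 0" "\<And>x. norm (f x) <= C / (1 + norm x) ^ N" using decaysE[OF f] by metis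
 show ?thesis
 proof (rule integrable_dom[OF integrable_mult_right[OF N, of C]])
  show "AE x in lborel. norm (of_real (u x) * f x) <= norm (C * (1 / (1 + norm x) ^ N) *R u x)"
  proof (intro AE_I2)
   fix x :: 'a
   have "1 + norm x > 0" by (simp add: add_pos_nonneg)
   then show "norm (of_real (u x) * f x) <= norm (C * (1 / (1 + norm x) ^ N) *R u x)"
    using C(1) mult_left_mono[OF C(2)[of x], of "\<bar>u x\<bar>"] by (simp add: norm_mult abs_mult mult_ac)
  qed
 qed simp
qed

lemma tempered_schwartz_integrable:
 fixes u :: "'a::euclidean_space => real" and f :: "'a => 'b::{real_normed_field, banach, second_countable_topology}"
 shows "tempered u ==> schwartz f ==> integrable lborel (%x. of_real (u x) * f x)"
 by (intro tempered_decays_integrable schwartz_decays schwartz_measurable)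

lemma dir_deriv_affine:
 assumes "f differentiable (at (c *R x + a))"
 shows "dir_deriv b (%x. f (c *R x + a)) x = c *R dir_deriv b f (c *R x + a)"
 by (rule dir_deriv_eq[OF has_derivative_affine[OF assms]])

text \<open>Vanishing moments of orders 0 and 1 say that the transform of \<open>psi\<close>
  vanishes to second order at 0, which is what \<open>potential_fourier\<close> asks of its test
  functions. The reflection undoes the double transform.\<close>

lemma potential_fourier_pairing:
 fixes g :: "'a::euclidean_space => real" and psi :: "'a => complex"
 assumes pf: "potential_fourier g G" and psi: "schwartz psi" and m0: "(LBINT x. psi x) = 0"
  and m1: "\<And>b. b \<in> Basis ==> (LBINT x. cor (b \<bullet> x) * psi x) = 0"
 shows "integrable lborel (%xi. cor (G xi) * fourier psi (- xi))"
  and "(LBINT x. cor (g x) * psi x) = (LBINT xi. cor (G xi) * fourier psi (- xi))"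
proof -
 define phi where "phi xi = fourier psi (- xi)" for xi
 have s: "schwartz phi" unfolding phi_def by (intro schwartz_reflect schwartz_fourier psi)
 have 0: "phi 0 = 0" by (simp add: phi_def fourier_eq m0)
 have 1: "iter_partial [b] phi 0 = 0" if b: "b \<in> Basis" for b
 proof -
  have "dir_deriv b phi 0 = - dir_deriv b (fourier psi) 0"
   unfolding phi_def using dir_deriv_affine[of "fourier psi" "-1" "0::'a" 0 b] schwartz_differentiable[OF schwartz_fourier[OF psi]]
   by simp
  also have "dir_deriv b (fourier psi) 0 = 0"
   unfolding dir_deriv_fourier[OF psi] by (simp only: fourier_cmult) (simp add: fourier_eq m1[OF b])
  finally show ?thesis by (simp add: iter_partial_Cons del: iter_partial.simps(2))
 qed
 have "fourier phi x = psi x" for x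
  unfolding phi_def[abs_def] fourier_reflect fourier_inversion[OF psi] by simp
 then show "integrable lborel (%xi. cor (G xi) * fourier psi (- xi))"
  and "(LBINT x. cor (g x) * psi x) = (LBINT xi. cor (G xi) * fourier psi (- xi))"
  using pf s 0 1 unfolding potential_fourier_def phi_def[symmetric] by auto
qed

lemma mollifier_tendsto:
 fixes u :: "'a::euclidean_space => real"
 assumes u: "tempered u" and cont: "isCont u p"
 shows "(%n. (LBINT x. u x * mollifier (1 / real (Suc n)) (x - p))) \<longlonglongrightarrow> u p"
proof (rule LIMSEQ_I)
 fix e :: real assume e: "0 < e"
 obtain d where d: "d > 0" "\<And>x. norm (x - p) < d ==> \<bar>u x - u p\<bar> < e / 2"
  using cont e unfolding isCont_def LIM_eq by (metis diff_self half_gt_zero norm_zero real_norm_def)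
 obtain N where N: "1 / real (Suc N) < d" using d(1) nat_approx_posE by blast
 show "\<exists>no. \<forall>n\<ge>no. norm ((LBINT x. u x * mollifier (1 / real (Suc n)) (x - p)) - u p) < e"
 proof (intro exI allI impI)
  fix n assume n: "n >= N"
  let ?r = "1 / real (Suc n)"
  have r: "?r > 0" "?r < d" using N n le_less_trans[OF _ N] by (auto simp: frac_le)
  have s: "schwartz (%x. mollifier ?r (x - p))" using schwartz_translate[OF schwartz_mollifier[OF r(1)], of "- p"] by simp
  have i1: "integrable lborel (%x. u x * mollifier ?r (x - p))"
   using tempered_schwartz_integrable[OF u s] by simp
  have i2: "integrable lborel (%x. mollifier ?r (x - p))" by (rule schwartz_integrable[OF s])
  have I2: "(LBINT x. mollifier ?r (x - p)) = 1"
   using lborel_integral_translate[of "mollifier ?r" "- p"] mollifier_integral[OF r(1)] by simp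
  have "(LBINT x. u x * mollifier ?r (x - p)) - u p = (LBINT x. (u x - u p) * mollifier ?r (x - p))"
   using i1 i2 I2 by (simp add: left_diff_distrib)
  also have "norm ... <= (LBINT x. (e / 2) * mollifier ?r (x - p))"
  proof (rule order_trans[OF integral_norm_bound], rule integral_mono')
   fix x
   show "norm ((u x - u p) * mollifier ?r (x - p)) <= (e / 2) * mollifier ?r (x - p)"
   proof (cases "norm (x - p) < ?r")
    case True
    then have "\<bar>u x - u p\<bar> <= e / 2" using d(2)[of x] r by simp
    from mult_right_mono[OF this mollifier_nonneg[OF r(1), of "x - p"]]
    show ?thesis using mollifier_nonneg[OF r(1), of "x - p"] by (simp only: real_norm_def abs_mult abs_of_nonneg)
   next
    case False
    then have "mollifier ?r (x - p) = 0" by (intro mollifier_eq_0 r) simp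
    then show ?thesis by simp
   qed
   show "0 <= (e / 2) * mollifier ?r (x - p)" using e mollifier_nonneg[OF r(1), of "x - p"] by simp
  qed (use i2 in simp)
  also have "... < e" using I2 e by simp
  finally show "norm ((LBINT x. u x * mollifier ?r (x - p)) - u p) < e" .
 qed
qed

text \<open>\<open>potential_fourier\<close> sees a potential only through tests with vanishing
  moments, that is, up to affine functions. Four approximate point masses at the vertices of a
  parallelogram, with signs, form such a test and yield the affine identity for \<open>u\<close>;
  evenness removes the linear part.\<close>

theorem affine_annihilator:
 fixes u :: "'a::euclidean_space => real"
 assumes u: "tempered u" and cont: "\<And>x. x \<noteq> 0 ==> isCont u x" and even: "\<And>x. x \<noteq> 0 ==> u (- x) = u x"
  and ann: "\<And>psi. schwartz psi ==> (LBINT x. psi x) = 0 ==>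
   (\<And>b. b \<in> Basis ==> (LBINT x. cor (b \<bullet> x) * psi x) = 0) ==>
   (LBINT x. cor (u x) * psi x) = 0"
  and nz: "x \<noteq> 0" "y \<noteq> 0"
 shows "u x = u y"
proof -
 have four: "u p1 + u p4 = u p2 + u p3"
  if p: "p1 \<noteq> 0" "p2 \<noteq> 0" "p3 \<noteq> 0" "p4 \<noteq> 0" "p1 + p4 = p2 + p3" for p1 p2 p3 p4
 proof -
  define k where "k n = (mollifier (1 / real (Suc n)) :: 'a => real)" for n
  have k: "schwartz (%x. k n (x - q))" for n q
   using schwartz_translate[OF schwartz_mollifier, of "1 / real (Suc n)" "- q"] by (simp add: k_def)
  have kI: "(LBINT x. k n (x - q)) = 1" for n q
   using lborel_integral_translate[of "k n" "- q"] mollifier_integral[of "1 / real (Suc n)", where 'a = 'a] by (simp add: k_def)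
  have km: "(LBINT x. (b \<bullet> x) * k n (x - q)) = (LBINT x. (b \<bullet> x) * k n x) + b \<bullet> q" for b n q
  proof -
   have i: "integrable lborel (%x. (b \<bullet> x) * k n (x - 0))"
    by (intro schwartz_integrable schwartz_moderate_mult k) (use moderate_of_real_inner[of b, where 'b = real] in simp)
   have "(LBINT x. (b \<bullet> x) * k n (x - q)) = (LBINT x. (b \<bullet> (x + q)) * k n (x + q - q))"
    by (rule lborel_integral_translate[symmetric])
   also have "... = (LBINT x. (b \<bullet> x) * k n (x - 0) + (b \<bullet> q) * k n (x - 0))"
    by (simp add: inner_add_right distrib_right)
   also have "... = (LBINT x. (b \<bullet> x) * k n x) + b \<bullet> q"
    using i schwartz_integrable[OF k[of n 0]] kI[of n 0] by simp
   finally show ?thesis .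
  qed
  have zero: "(LBINT x. u x * k n (x - p1)) + (LBINT x. u x * k n (x - p4))
    - (LBINT x. u x * k n (x - p2)) - (LBINT x. u x * k n (x - p3)) = 0" for n
  proof -
   define psi where "psi x = k n (x - p1) + k n (x - p4) - k n (x - p2) - k n (x - p3)" for x
   have s: "schwartz psi" unfolding psi_def by (intro schwartz_diff schwartz_add k)
   have i: "integrable lborel (%x. k n (x - q))" for q by (rule schwartz_integrable[OF k])
   have ib: "integrable lborel (%x. (b \<bullet> x) * k n (x - q))" for b q
    by (intro schwartz_integrable schwartz_moderate_mult k) (use moderate_of_real_inner[of b, where 'b = real] in simp)
   have iu: "integrable lborel (%x. u x * k n (x - q))" for q
    using tempered_schwartz_integrable[OF u k, of n q] by simp
   \<comment> \<open>The masses cancel and so do the first moments, because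
     \<open>p1 + p4 = p2 + p3\<close>.\<close>
   have "(LBINT x. cor (u x) * cor (psi x)) = 0"
   proof (rule ann)
    show "schwartz (%x. cor (psi x))" by (rule schwartz_complex_of_real[OF s])
    have "(LBINT x. psi x) = 0" unfolding psi_def using i kI by simp
    then show "(LBINT x. cor (psi x)) = 0" by simp
    fix b :: 'a assume "b \<in> Basis"
    have "(LBINT x. (b \<bullet> x) * psi x) = b \<bullet> p1 + b \<bullet> p4 - b \<bullet> p2 - b \<bullet> p3"
     unfolding psi_def right_diff_distrib distrib_left using ib km by simp
    also have "... = b \<bullet> (p1 + p4) - b \<bullet> (p2 + p3)" by (simp add: inner_add_right)
    finally have "(LBINT x. (b \<bullet> x) * psi x) = 0" using p(5) by simp
    then show "(LBINT x. cor (b \<bullet> x) * cor (psi x)) = 0"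
     by (simp only: of_real_mult[symmetric] integral_complex_of_real of_real_0)
   qed
   then have "(LBINT x. u x * psi x) = 0"
    by (simp only: of_real_mult[symmetric] integral_complex_of_real of_real_eq_0_iff)
   then show ?thesis unfolding psi_def right_diff_distrib distrib_left using iu by simp
  qed
  have "(%n. (LBINT x. u x * k n (x - p1)) + (LBINT x. u x * k n (x - p4))
    - (LBINT x. u x * k n (x - p2)) - (LBINT x. u x * k n (x - p3))) \<longlonglongrightarrow> u p1 + u p4 - u p2 - u p3"
   unfolding k_def using p by (intro tendsto_intros mollifier_tendsto u cont) auto
  then have "u p1 + u p4 - u p2 - u p3 = 0" unfolding zero by (simp add: LIMSEQ_const_iff)
  then show ?thesis by simp
 qed
 show ?thesis
 proof (cases "x + y = 0 \<or> x - y = 0")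
  case True
  then show ?thesis using even[OF nz(1)] by (auto simp: add_eq_0_iff)
 next
  case False
  \<comment> \<open>The parallelogram is degenerate: its second and third vertices coincide at
    \<open>x\<close>. Exchanging \<open>x\<close> and \<open>y\<close> gives the same left side by
    evenness.\<close>
  have "u (x + y) + u (x - y) = u x + u x" by (rule four) (use False nz in auto)
  moreover have "u (y + x) + u (y - x) = u y + u y" by (rule four) (use False nz in \<open>auto simp: add.commute\<close>)
  moreover have "u (y - x) = u (x - y)" using even[of "x - y"] False by simp
  ultimately show ?thesis by (simp add: add.commute)
 qed
qed

subsection \<open>The energy\<close>

lemma integrable_pair_conv:
 fixes a m :: "'a::euclidean_space => real"
 assumes a: "integrable lborel a" and m: "integrable lborel m"
 shows "integrable lborel2 (%(x, y). a x * m (x - y))"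
proof -
 have [measurable]: "a \<in> borel_measurable borel" "m \<in> borel_measurable borel" using a m by auto
 have s: "integrable lborel (%y. m (x - y))" "(LBINT y. \<bar>m (x - y)\<bar>) = (LBINT y. \<bar>m y\<bar>)" for x
  using lborel_integrable_affine[OF m, of "-1" x] lborel_integral_affine[of "-1" "%y. \<bar>m y\<bar>" x] by simp_all
 show ?thesis
  by (rule lborel_pair.Fubini_integrable) (use a s in \<open>auto simp: abs_mult\<close>)
qed

lemma one_plus_norm_diff_le: "1 + norm (x - y) <= (1 + norm x) * (1 + norm y)"
proof -
 have "0 <= norm x * norm y" by simp
 then have "1 + (norm x + norm y) <= (1 + norm x) * (1 + norm y)" by (simp add: algebra_simps)
 then show ?thesis using norm_triangle_ineq4[of x y] by linarith
qed

text \<open>The weight \<open>(1 + norm (x - y)) ^ N\<close> that makes \<open>g\<close> integrable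
  is split between the two variables and paid for by the decay of \<open>u\<close> and of
  \<open>v\<close>.\<close>

lemma tempered_pair_integrable:
 fixes g u v :: "'a::euclidean_space => real"
 assumes g: "tempered g" and u: "decays u" and v: "decays v"
  and [measurable]: "u \<in> borel_measurable borel" "v \<in> borel_measurable borel"
 shows "integrable lborel2 (%(x, y). g (x - y) * u x * v y)"
proof -
 have [measurable]: "g \<in> borel_measurable borel" using g by (rule tempered_measurable)
 obtain N where N: "integrable lborel (%x. (1 / (1 + norm x) ^ N) *R g x)"
  using g unfolding tempered_def by blast
 obtain C where C: "C > 0" "\<And>x. norm (v x) <= C / (1 + norm x) ^ N" using decaysE[OF v] by metis
 have a: "integrable lborel (%x. (1 + norm x) ^ N *R u x)"
  by (intro decays_integrable decays_mult_norm_power u) measurable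
 show ?thesis
 proof (rule integrable_dom[OF integrable_mult_right[OF integrable_pair_conv[OF a N], of C]])
  show "AE z in lborel2. norm (case z of (x, y) => g (x - y) * u x * v y) \<le>
   norm (C * (case z of (x, y) => ((1 + norm x) ^ N *R u x) * ((1 / (1 + norm (x - y)) ^ N) *R g (x - y))))"
  proof (intro AE_I2)
   fix z :: "'a \<times> 'a"
   obtain x y where z: "z = (x, y)" by (cases z)
   have p: "1 + norm x > 0" "1 + norm y > 0" "1 + norm (x - y) > 0" by (simp_all add: add_pos_nonneg)
   have "(1 + norm (x - y)) ^ N <= (1 + norm x) ^ N * (1 + norm y) ^ N"
    unfolding power_mult_distrib[symmetric] by (intro power_mono one_plus_norm_diff_le) simp
   then have "C / (1 + norm y) ^ N <= C * (1 + norm x) ^ N / (1 + norm (x - y)) ^ N"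
    using p C(1) by (simp add: divide_simps mult_ac)
   then have "\<bar>v y\<bar> <= C * (1 + norm x) ^ N / (1 + norm (x - y)) ^ N" using C(2)[of y] by simp
   from mult_left_mono[OF this, of "\<bar>g (x - y)\<bar> * \<bar>u x\<bar>"]
   have "\<bar>g (x - y)\<bar> * \<bar>u x\<bar> * \<bar>v y\<bar> <= C * ((1 + norm x) ^ N * \<bar>u x\<bar> * (1 / (1 + norm (x - y)) ^ N * \<bar>g (x - y)\<bar>))"
    by (simp add: mult_ac)
   then show "norm (case z of (x, y) => g (x - y) * u x * v y) \<le>
    norm (C * (case z of (x, y) => ((1 + norm x) ^ N *R u x) * ((1 / (1 + norm (x - y)) ^ N) *R g (x - y))))"
    unfolding z using C(1) p by (simp add: abs_mult)
  qed
 qed measurable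
qed

lemma fourier_real_minus: "fourier (%x. cor (u x)) (- xi) = cnj (fourier (%x. cor (u x)) xi)"
 using fourier_cnj[of "%x. cor (u x)" "- xi"] by simp

abbreviation fourier_real :: "('a::euclidean_space => real) => 'a => complex" where
 "fourier_real u \<equiv> fourier (%x. cor (u x))"

text \<open>The squared modulus of the transform of \<open>u\<close> is an admissible test, because
  zero mean makes it vanish to second order at 0. Its transform is the autocorrelation of
  \<open>u\<close>, and pairing that with \<open>g\<close> gives the double integral.\<close>

theorem energy_eq_fourier:
 fixes g u :: "'a::euclidean_space => real"
 assumes pf: "potential_fourier g G" and u: "schwartz u" and u0: "(LBINT x. u x) = 0"
 shows "integrable lborel (%xi. G xi * (norm (fourier_real u xi))^2)"
  and "(\<integral>(x, y). g (x - y) * u x * u y \<partial>lborel2) = (LBINT xi. G xi * (norm (fourier_real u xi))^2)"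
proof -
 have g: "tempered g" using pf by (simp add: potential_fourier_def)
 have uc: "schwartz (%x. cor (u x))" by (rule schwartz_complex_of_real[OF u])
 let ?F = "fourier_real u"
 have F: "schwartz ?F" by (rule schwartz_fourier[OF uc])
 have F': "schwartz (%xi. ?F (- xi))" by (rule schwartz_reflect[OF F])
 \<comment> \<open>For real \<open>u\<close> this product is the squared modulus; as a product it is
   visibly Schwartz, and the Leibniz rule gives its derivative at 0.\<close>
 define phi where "phi xi = ?F xi * ?F (- xi)" for xi
 have phi: "phi xi = cor ((norm (?F xi))^2)" for xi
  unfolding phi_def fourier_real_minus by (rule complex_norm_square[symmetric])
 have s: "schwartz phi" unfolding phi_def by (rule schwartz_mult[OF F F'])
 have F0: "?F 0 = 0" by (simp add: fourier_eq u0)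
 have phi0: "phi 0 = 0" by (simp add: phi_def F0)
 have phi1: "iter_partial [b] phi 0 = 0" for b
 proof -
  have "dir_deriv b phi 0 = 0"
   unfolding phi_def[abs_def]
   by (subst dir_deriv_mult) (simp_all add: F0 schwartz_differentiable F F')
  then show ?thesis by (simp add: iter_partial_Cons del: iter_partial.simps(2))
 qed
 have *: "integrable lborel (%xi. cor (G xi) * phi xi)"
  "(LBINT x. cor (g x) * fourier phi x) = (LBINT xi. cor (G xi) * phi xi)"
  using pf s phi0 phi1 unfolding potential_fourier_def by auto
 show "integrable lborel (%xi. G xi * (norm (?F xi))^2)"
  using integrable_Re[OF *(1)] by (simp add: phi)
 have autocorr: "fourier phi z = cor (LBINT y. u y * u (y + z))" for z
 proof -
  have i: "integrable lborel (%xi. ?F (- xi) * fkernel z xi)"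
   by (intro integrable_mult_fkernel schwartz_integrable F')
  have "fourier phi z = (LBINT xi. ?F xi * (?F (- xi) * fkernel z xi))"
   by (simp add: fourier_eq[of phi] phi_def mult.assoc)
  also have "... = (LBINT y. cor (u y) * fourier (%xi. ?F (- xi) * fkernel z xi) y)"
   by (rule fourier_mult_formula[OF schwartz_integrable[OF uc] i])
  also have "... = (LBINT y. cor (u y * u (y + z)))"
   unfolding fourier_modulate fourier_reflect fourier_inversion[OF uc] by (simp add: add.commute)
  finally show ?thesis by (simp only: integral_complex_of_real)
 qed
 have pair: "integrable lborel2 (%(x, y). g (x - y) * u x * u y)"
  by (rule tempered_pair_integrable[OF g]) (use schwartz_decays[OF u] schwartz_measurable[OF u] in auto)
 \<comment> \<open>The substitution \<open>x = y + z\<close> in the inner integral separates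
   \<open>g\<close> from the autocorrelation; integrability is carried along by Fubini.\<close>
 have pair': "integrable lborel2 (%(y, z). g z * u y * u (y + z))"
 proof -
  have [measurable]: "g \<in> borel_measurable borel" "u \<in> borel_measurable borel"
   using tempered_measurable[OF g] schwartz_measurable[OF u] by auto
  have swap: "integrable lborel2 (%(y, x). g (x - y) * u x * u y)"
   using pair by (subst lborel_pair.integrable_product_swap_iff[symmetric]) (simp add: case_prod_beta)
  have 1: "integrable lborel (%y. (LBINT x. norm (g (x - y) * u x * u y)))"
   using lborel_pair.integrable_fst'[OF integrable_norm[OF swap]] by simp
  have 2: "AE y in lborel. integrable lborel (%x. g (x - y) * u x * u y)"
   using lborel_pair.AE_integrable_fst'[OF swap] by simp
  have tr: "(LBINT x. norm (g (x - y) * u x * u y)) = (LBINT z. norm (g z * u y * u (y + z)))" for y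
   using lborel_integral_translate[of "%x. norm (g (x - y) * u x * u y)" y] by (simp add: mult_ac add.commute)
  show ?thesis
  proof (rule lborel_pair.Fubini_integrable)
   show "integrable lborel (%y. (LBINT z. norm (case (y, z) of (y, z) => g z * u y * u (y + z))))"
    using 1 unfolding tr by simp
   show "AE y in lborel. integrable lborel (%z. case (y, z) of (y, z) => g z * u y * u (y + z))"
    using 2
   proof eventually_elim
    case (elim y)
    show ?case using lborel_integrable_translate[OF elim, of y] by (simp add: mult_ac add.commute)
   qed
  qed measurable
 qed
 have "(\<integral>(x, y). g (x - y) * u x * u y \<partial>lborel2) = (LBINT y. (LBINT x. g (x - y) * u x * u y))"
  by (rule lborel_pair.integral_snd[OF pair, symmetric])
 also have "... = (LBINT y. (LBINT z. g z * u y * u (y + z)))"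
 proof (rule Bochner_Integration.integral_cong[OF refl])
  fix y
  show "(LBINT x. g (x - y) * u x * u y) = (LBINT z. g z * u y * u (y + z))"
   using lborel_integral_translate[of "%x. g (x - y) * u x * u y" y] by (simp add: mult_ac add.commute)
 qed
 also have "... = (LBINT z. (LBINT y. g z * u y * u (y + z)))"
  by (rule lborel_pair.Fubini_integral[OF pair', symmetric])
 also have "... = (LBINT z. g z * (LBINT y. u y * u (y + z)))"
  by (simp add: mult.assoc)
 finally have A: "(\<integral>(x, y). g (x - y) * u x * u y \<partial>lborel2) = (LBINT z. g z * (LBINT y. u y * u (y + z)))" .
 have "cor (LBINT z. g z * (LBINT y. u y * u (y + z))) = (LBINT x. cor (g x) * fourier phi x)"
  unfolding autocorr by (simp only: of_real_mult[symmetric] integral_complex_of_real)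
 also have "... = cor (LBINT xi. G xi * (norm (?F xi))^2)"
  unfolding *(2) phi by (simp only: of_real_mult[symmetric] integral_complex_of_real)
 finally show "(\<integral>(x, y). g (x - y) * u x * u y \<partial>lborel2) = (LBINT xi. G xi * (norm (?F xi))^2)"
  unfolding A by (simp only: of_real_eq_iff)
qed

lemma potential_fourier_dilate:
 fixes g :: "'a::euclidean_space => real"
 assumes pf: "potential_fourier g G" and t: "t > 0"
 shows "potential_fourier (dilate t g) (%xi. t ^ DIM('a) * G (t *R xi))"
 unfolding potential_fourier_def
proof (intro conjI allI impI)
 have g: "tempered g" using pf by (simp add: potential_fourier_def)
 have [measurable]: "g \<in> borel_measurable borel" using g by (rule tempered_measurable)
 have [measurable]: "dilate t g \<in> borel_measurable borel" unfolding dilate_def[abs_def] by measurable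
 obtain N where N: "integrable lborel (%x. (1 / (1 + norm x) ^ N) *R g x)"
  using g unfolding tempered_def by blast
 define K where "K = max 1 (1 / t)"
 have "integrable lborel (%x. (1 / (1 + norm x) ^ N) *R dilate t g x)"
 proof (rule integrable_dom[OF integrable_mult_right[OF lborel_integrable_affine[OF N, of "1 / t" 0], of "K ^ N"]])
  show "AE x in lborel. norm ((1 / (1 + norm x) ^ N) *R dilate t g x)
   <= norm (K ^ N * (1 / (1 + norm (0 + (1 / t) *R x)) ^ N) *R g (0 + (1 / t) *R x))"
  proof (intro AE_I2)
   fix x :: 'a
   have "norm x / t <= K * norm x" using t mult_right_mono[of "1 / t" K "norm x"] by (simp add: K_def)
   then have "1 + norm x / t <= K * (1 + norm x)" by (simp add: distrib_left K_def)
   then have "(1 + norm x / t) ^ N <= K ^ N * (1 + norm x) ^ N"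
    unfolding power_mult_distrib[symmetric] using t by (intro power_mono) auto
   moreover have "1 + norm x > 0" "1 + norm x / t > 0" using t by (auto intro!: add_pos_nonneg)
   ultimately have "1 / (1 + norm x) ^ N <= K ^ N / (1 + norm x / t) ^ N"
    by (simp add: divide_simps mult_ac)
   from mult_right_mono[OF this, of "\<bar>g (x /\<^sub>R t)\<bar>"]
   show "norm ((1 / (1 + norm x) ^ N) *R dilate t g x)
    <= norm (K ^ N * (1 / (1 + norm (0 + (1 / t) *R x)) ^ N) *R g (0 + (1 / t) *R x))"
    using t by (simp add: dilate_def abs_mult K_def inverse_eq_divide add_nonneg_nonneg)
  qed
 qed (use t in auto)
 then show "tempered (dilate t g)" unfolding tempered_def by auto
 fix phi :: "'a => complex"
 assume "schwartz phi \<and> phi 0 = 0 \<and> (\<forall>b\<in>Basis. iter_partial [b] phi 0 = 0)"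
 then have phi: "schwartz phi" "phi 0 = 0" "\<And>b. b \<in> Basis ==> dir_deriv b phi 0 = 0"
  by (auto simp: iter_partial_Cons simp del: iter_partial.simps(2))
 \<comment> \<open>A test for the dilated potential is rescaled into a test for \<open>g\<close>;
   vanishing to second order at 0 is invariant under this.\<close>
 define theta where "theta xi = phi ((1 / t) *R xi + 0)" for xi
 have s: "schwartz theta" unfolding theta_def using t by (intro schwartz_affine phi) simp
 have "dir_deriv b theta 0 = 0" if "b \<in> Basis" for b
  unfolding theta_def using dir_deriv_affine[of phi "1 / t" 0 0 b] phi(3)[OF that] schwartz_differentiable[OF phi(1)] by simp
 then have *: "integrable lborel (%xi. cor (G xi) * theta xi)"
  "(LBINT x. cor (g x) * fourier theta x) = (LBINT xi. cor (G xi) * theta xi)"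
  using pf s phi(2) unfolding potential_fourier_def by (auto simp: theta_def iter_partial_Cons simp del: iter_partial.simps(2))
 have "integrable lborel (%xi. cor (t ^ DIM('a)) * (cor (G (0 + t *R xi)) * theta (0 + t *R xi)))"
  using lborel_integrable_affine[OF *(1), of t 0] t by (intro integrable_mult_right) auto
 then show "integrable lborel (%xi. cor (t ^ DIM('a) * G (t *R xi)) * phi xi)"
  using t by (simp add: theta_def mult.assoc)
 have F: "fourier theta x = cor (t ^ DIM('a)) * fourier phi (t *R x)" for x
  using fourier_dilate[of "1 / t" phi x] t by (simp add: theta_def[abs_def] power_one_over mult.commute)
 have "(LBINT xi. cor (t ^ DIM('a) * G (t *R xi)) * phi xi)
   = cor (t ^ DIM('a)) * (LBINT xi. cor (G (0 + t *R xi)) * theta (0 + t *R xi))"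
  using t by (simp add: theta_def mult.assoc)
 also have "... = (LBINT xi. cor (G xi) * theta xi)"
  using t by (subst lborel_integral_affine) (auto simp: scaleR_conv_of_real)
 also have "... = cor (t ^ DIM('a)) * (LBINT x. cor (g x) * fourier phi (t *R x))"
 proof -
  have "cor (g x) * (cor (t ^ DIM('a)) * z) = cor (t ^ DIM('a)) * (cor (g x) * z)" for x z
   by (rule mult.left_commute)
  then show ?thesis unfolding *(2)[symmetric] F by (simp only: integral_mult_right_zero)
 qed
 also have "(LBINT x. cor (g x) * fourier phi (t *R x))
   = (LBINT x. cor (dilate t g (0 + t *R x)) * fourier phi (0 + t *R x))"
  using t by (simp add: dilate_def)
 also have "... = (1 / \<bar>t\<bar> ^ DIM('a)) *R (LBINT x. cor (dilate t g x) * fourier phi x)"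
  using t by (subst lborel_integral_affine) auto
 finally show "(LBINT x. cor (dilate t g x) * fourier phi x)
   = (LBINT xi. cor (t ^ DIM('a) * G (t *R xi)) * phi xi)"
  using t by (simp add: scaleR_conv_of_real)
qed

section \<open>Radial multipliers\<close>

lemma AE_lborel_scale:
 fixes P :: "'a::euclidean_space => bool"
 assumes [measurable]: "Measurable.pred borel P" and c: "c \<noteq> 0" and P: "AE x in lborel. P x"
 shows "AE x in lborel. P (c *R x)"
proof -
 have "AE x in density (distr lborel borel (%x::'a. 0 + c *R x)) (%_. ennreal (\<bar>c\<bar> ^ DIM('a))). P x"
  using P by (simp only: lborel_affine[OF c, of "0::'a", symmetric])
 then have "AE x in distr lborel borel (%x::'a. 0 + c *R x). 0 < ennreal (\<bar>c\<bar> ^ DIM('a)) --> P x"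
  by (subst (asm) AE_density) auto
 then have "AE x in distr lborel borel (%x::'a. 0 + c *R x). P x"
  using c by simp
 then show ?thesis by (subst (asm) AE_distr_iff) auto
qed

text \<open>A null set \<open>N\<close> of radii gives a null set of points by Fubini in an
  auxiliary dilation factor \<open>l\<close>: for every \<open>x\<close> other than 0, almost every
  \<open>l\<close> has \<open>l * norm x\<close> outside \<open>N\<close>. Exchanging the
  quantifiers fixes one good \<open>l > 0\<close>, and a dilation removes it.\<close>

lemma AE_norm:
 assumes Q: "AE r in lborel. 0 < r --> Q (r::real)"
 shows "AE x in lborel. Q (norm (x::'a::euclidean_space))"
proof -
 obtain N where N: "N \<in> null_sets lborel" "{r. \<not> (0 < r --> Q r)} \<subseteq> N"
  using Q unfolding eventually_ae_filter by auto
 have [measurable]: "N \<in> sets borel" using N(1) by auto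
 have nN: "AE r in lborel. r \<notin> N" using N(1) by (rule AE_not_in)
 have nz: "AE x in lborel. x \<noteq> (0::'a)" by (rule AE_lborel_singleton)
 have "AE x in lborel. AE l in lborel. l * norm (x::'a) \<notin> N"
  using nz
 proof eventually_elim
  case (elim x)
  then show ?case using AE_borel_affine[of "norm x" "%r. r \<notin> N" 0] nN by (simp add: mult.commute)
 qed
 then have "AE l in lborel. AE x in lborel. l * norm (x::'a) \<notin> N"
  by (subst (asm) lborel_pair.AE_commute) measurable
 \<comment> \<open>The good factors have full measure, so they cannot all be nonpositive.\<close>
 moreover have "\<not> (AE l in lborel. l <= (0::real))"
 proof
  assume "AE l in lborel. l <= (0::real)"
  then have "{0<..1::real} \<in> null_sets lborel"
   by (subst AE_iff_null_sets) (auto elim!: eventually_mono)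
  then show False by auto
 qed
 ultimately obtain l where l: "l > 0" "AE x in lborel. l * norm (x::'a) \<notin> N"
  by (metis (mono_tags, lifting) eventually_mono not_le)
 have "AE x in lborel. l * norm ((1 / l) *R x :: 'a) \<notin> N"
  by (rule AE_lborel_scale[OF _ _ l(2)]) (use l(1) in auto)
 then show ?thesis using nz
 proof eventually_elim
  case (elim x)
  then have "norm x \<notin> N" "0 < norm x" using l(1) by simp_all
  then show "Q (norm x)" using N(2) by blast
 qed
qed

lemma AE_le_Linf_on:
 assumes "S \<in> sets borel"
 shows "AE s in lborel. s \<in> S --> u s <= Linf_on S u"
 using esssup_AE[of u "restrict_space lborel S"] assms unfolding Linf_on_def
 by (subst (asm) AE_restrict_space_iff) auto

lemma tempered_integrable: "integrable lborel V ==> tempered V"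
 unfolding tempered_def by (auto intro!: exI[of _ 0])

lemma tempered_bounded:
 fixes u :: "'a::euclidean_space => 'b::{banach, second_countable_topology}"
 assumes [measurable]: "u \<in> borel_measurable borel" and bd: "\<And>x. norm (u x) <= C"
 shows "tempered u"
 unfolding tempered_def
proof (intro conjI exI)
 show "integrable lborel (%x. (1 / (1 + norm x) ^ (DIM('a) + 1)) *R u x)"
 proof (rule integrable_dom[OF integrable_mult_right[OF tensor_weight_integrable, of C]])
  show "AE x in lborel. norm ((1 / (1 + norm x) ^ (DIM('a) + 1)) *R u x) <= norm (C * tensor_weight x)"
  proof (intro AE_I2)
   fix x :: 'a
   have "1 / (1 + norm x) ^ (DIM('a) + 1) * norm (u x) <= tensor_weight x * C"
    by (intro mult_mono inverse_norm_power_le_tensor_weight bd tensor_weight_nonneg norm_ge_zero)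
   moreover have "0 <= 1 / (1 + norm x) ^ (DIM('a) + 1)" by (simp add: add_nonneg_nonneg)
   moreover have "0 <= C" using order_trans[OF norm_ge_zero bd] .
   ultimately show "norm ((1 / (1 + norm x) ^ (DIM('a) + 1)) *R u x) <= norm (C * tensor_weight x)"
    using tensor_weight_nonneg[of x] by (simp only: norm_scaleR real_norm_def abs_mult abs_of_nonneg mult.commute)
  qed
 qed measurable
qed fact

text \<open>As a distribution, the transform of \<open>fourier V\<close> is the reflection of
  \<open>V\<close>; evenness absorbs the reflection. \<open>V\<close> is merely integrable, since it
  will carry the factor \<open>\<sigma>\<close>.\<close>

lemma tempered_fourier_fourier:
 fixes V :: "'a::euclidean_space => complex"
 assumes V: "integrable lborel V" and even: "\<And>xi. V (- xi) = V xi"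
 shows "tempered_fourier (fourier V) V"
 unfolding tempered_fourier_def
proof (intro conjI allI impI)
 show "tempered (fourier V)"
  by (rule tempered_bounded[OF fourier_measurable[OF V] norm_fourier_le[OF V]])
 show "tempered V" by (rule tempered_integrable[OF V])
 fix phi :: "'a => complex" assume phi: "schwartz phi"
 have "(LBINT x. fourier V x * fourier phi x) = (LBINT x. V x * fourier (fourier phi) x)"
  by (rule fourier_mult_formula[OF V schwartz_integrable[OF schwartz_fourier[OF phi]]])
 also have "... = (LBINT x. V (- x) * phi (- x))"
  by (simp add: fourier_inversion[OF phi] even)
 also have "... = (LBINT x. V x * phi x)"
  by (rule lborel_integral_reflect[of "%x. V x * phi x"])
 finally show "(LBINT x. fourier V x * fourier phi x) = (LBINT x. V x * phi x)" .
qed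

lemma fourier_real_even:
 fixes V :: "'a::euclidean_space => real"
 assumes "\<And>xi. V (- xi) = V xi"
 shows "cor (Re (fourier_real V x)) = fourier_real V x"
proof -
 have "cnj (fourier_real V x) = fourier_real V (- x)" by (simp add: fourier_real_minus)
 also have "... = fourier_real V x" using fourier_reflect[of "%xi. cor (V xi)" x] assms by simp
 finally have "Im (cnj (fourier_real V x)) = Im (fourier_real V x)" by simp
 then show ?thesis by (simp add: complex_eq_iff)
qed

lemma fourier_multiplierI:
 fixes V :: "'a::euclidean_space => real" and e :: 'a and \<sigma> :: "real => ennreal"
 defines "W \<equiv> %xi. enn2real (\<sigma> (norm xi)) * V xi"
 assumes V: "integrable lborel V" and W: "integrable lborel W"
  and even: "\<And>xi. V (- xi) = V xi" and top: "AE xi in lborel. \<sigma> (norm xi) = top --> V xi = 0" and e: "e \<in> Basis"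
 shows "fourier_multiplier \<sigma> (%x. Re (fourier_real V x) *R e) (%x. Re (fourier_real W x) *R e)"
 unfolding fourier_multiplier_def
proof
 fix b :: 'a assume b: "b \<in> Basis"
 have tf: "tempered_fourier (%x. cor (Re (fourier_real U x))) (%xi. cor (U xi))"
  if "integrable lborel U" "\<And>xi. U (- xi) = U xi" for U :: "'a => real"
 proof -
  have "(%x. cor (Re (fourier_real U x))) = fourier_real U"
   by (intro ext fourier_real_even that)
  then show ?thesis by (simp only:) (rule tempered_fourier_fourier, use that in auto)
 qed
 have z: "tempered_fourier (%x::'a. 0) (%xi. 0)"
  unfolding tempered_fourier_def by (auto intro!: tempered_integrable)
 have We: "W (- xi) = W xi" for xi by (simp add: W_def even)
 show "\<exists>U. tempered_fourier (%x. cor (Re (fourier_real V x) *R e \<bullet> b)) U \<and>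
  (AE xi in lborel. \<sigma> (norm xi) = top --> U xi = 0) \<and>
  tempered_fourier (%x. cor (Re (fourier_real W x) *R e \<bullet> b)) (%xi. cor (enn2real (\<sigma> (norm xi))) * U xi)"
 proof (cases "b = e")
  case True
  then show ?thesis using tf[OF V even] tf[OF W We] top e
   by (intro exI[of _ "%xi. cor (V xi)"]) (simp add: inner_Basis W_def)
 next
  \<comment> \<open>The field points along \<open>e\<close>, so in every other coordinate both
    transforms are 0.\<close>
  case False
  then show ?thesis using b e z by (intro exI[of _ "%_. 0"]) (simp add: inner_Basis)
 qed
qed

subsection \<open>Lebesgue norms\<close>

text \<open>Since \<open>1 <= p\<close>, the root \<open>A powr (1 / p)\<close> is at most
  \<open>1 + A\<close>; the resulting constant does not depend on \<open>p\<close>.\<close>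

lemma Lp_norm_leI:
 fixes f :: "'a::euclidean_space => 'b::real_normed_vector"
 assumes p: "p \<noteq> top" "1 <= p" and K: "0 < K" and A: "0 <= A"
  and le: "(\<integral>\<^sup>+x. ennreal (norm (f x) powr enn2real p) \<partial>lborel) <= ennreal (K powr enn2real p * A)"
 shows "Lp_norm p f <= ennreal (K * (1 + A))"
proof -
 let ?p = "enn2real p"
 have p1: "?p >= 1" using p by (cases p) auto
 define I where "I = (\<integral>\<^sup>+x. ennreal (norm (f x) powr ?p) \<partial>lborel)"
 have It: "I \<noteq> top" using le unfolding I_def by (auto simp: top_unique)
 have "enn2real I <= K powr ?p * A" using le K A unfolding I_def[symmetric] by (intro enn2real_leI) auto
 then have "enn2real I powr (1 / ?p) <= (K powr ?p * A) powr (1 / ?p)"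
  using p1 by (intro powr_mono2) auto
 also have "... = K * A powr (1 / ?p)" using K A p1 by (simp add: powr_mult powr_powr)
 also have "... <= K * (1 + A)"
 proof (intro mult_left_mono)
  have "A powr (1 / ?p) <= (1 + A) powr (1 / ?p)" using A p1 by (intro powr_mono2) auto
  also have "... <= (1 + A) powr 1" using A p1 by (intro powr_mono) auto
  finally show "A powr (1 / ?p) <= 1 + A" using A by simp
 qed (use K in simp)
 finally show ?thesis using p It unfolding Lp_norm_def I_def[symmetric] by (simp add: Let_def ennreal_leI)
qed

text \<open>Interpolation between the supremum and the square integral: the power \<open>p\<close>
  is split as \<open>(p - 2) + 2\<close>.\<close>

lemma Lp_norm_le_ge_2:
 fixes f :: "'a::euclidean_space => 'b::euclidean_space"
 assumes p: "2 <= p" and K: "0 < K" and A: "0 <= A" and [measurable]: "f \<in> borel_measurable borel"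
  and sup: "\<And>x. norm (f x) <= K"
  and L2: "(\<integral>\<^sup>+x. ennreal ((norm (f x))^2) \<partial>lborel) <= ennreal (K^2 * A)"
 shows "Lp_norm p f <= ennreal (K * (1 + A))"
proof (cases "p = top")
 case True
 have "esssup lborel (%x. ennreal (norm (f x))) <= ennreal K"
  using sup by (intro esssup_I) (auto intro: ennreal_leI)
 also have "... <= ennreal (K * (1 + A))" using K A by (intro ennreal_leI) (simp add: distrib_left)
 finally show ?thesis using True by (simp add: Lp_norm_def)
next
 case False
 let ?p = "enn2real p"
 have p2: "?p >= 2" using p False by (cases p) (auto simp: ennreal_le_iff2 simp flip: ennreal_numeral)
 have pp: "1 <= p" using p by (rule order_trans[rotated]) simp
 show ?thesis
 proof (rule Lp_norm_leI[OF False pp K A])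
  have "(\<integral>\<^sup>+x. ennreal (norm (f x) powr ?p) \<partial>lborel) <= (\<integral>\<^sup>+x. ennreal (K powr (?p - 2)) * ennreal ((norm (f x))^2) \<partial>lborel)"
  proof (intro nn_integral_mono)
   fix x
   have "norm (f x) powr ?p = norm (f x) powr (?p - 2) * (norm (f x))^2"
    using p2 by (cases "norm (f x) = 0") (auto simp: powr_diff powr_numeral)
   also have "... <= K powr (?p - 2) * (norm (f x))^2"
    using p2 sup by (intro mult_right_mono powr_mono2) auto
   finally show "ennreal (norm (f x) powr ?p) <= ennreal (K powr (?p - 2)) * ennreal ((norm (f x))^2)"
    by (simp add: ennreal_leI flip: ennreal_mult)
  qed
  also have "... = ennreal (K powr (?p - 2)) * (\<integral>\<^sup>+x. ennreal ((norm (f x))^2) \<partial>lborel)"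
   by (rule nn_integral_cmult) measurable
  also have "... <= ennreal (K powr (?p - 2)) * ennreal (K^2 * A)"
   by (rule mult_left_mono[OF L2]) simp
  also have "... = ennreal (K powr ?p * A)"
   using K A by (simp add: powr_diff powr_numeral flip: ennreal_mult)
  finally show "(\<integral>\<^sup>+x. ennreal (norm (f x) powr ?p) \<partial>lborel) <= ennreal (K powr ?p * A)" .
 qed
qed

text \<open>A weight with values in \<open>[0, 1]\<close> only decreases when raised to a power
  \<open>p >= 1\<close>, so its integral controls every finite exponent.\<close>

lemma Lp_norm_le_tensor_weight:
 fixes f :: "'a::euclidean_space => 'b::euclidean_space"
 assumes p: "p \<noteq> top" "1 <= p" and K: "0 < K" and bd: "\<And>x. norm (f x) <= K * tensor_weight x"
 shows "Lp_norm p f <= ennreal (K * (1 + (LBINT x. tensor_weight (x::'a))))"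
proof (rule Lp_norm_leI[OF p K])
 let ?p = "enn2real p"
 have p1: "?p >= 1" using p by (cases p) auto
 show "0 <= (LBINT x. tensor_weight (x::'a))" by (simp add: tensor_weight_nonneg)
 have "(\<integral>\<^sup>+x. ennreal (norm (f x) powr ?p) \<partial>lborel) <= (\<integral>\<^sup>+x. ennreal (K powr ?p * tensor_weight (x::'a)) \<partial>lborel)"
 proof (intro nn_integral_mono ennreal_leI)
  fix x
  have "norm (f x) powr ?p <= (K * tensor_weight x) powr ?p" using p1 bd by (intro powr_mono2) auto
  also have "... = K powr ?p * tensor_weight x powr ?p" using K tensor_weight_nonneg[of x] by (simp add: powr_mult)
  also have "... <= K powr ?p * tensor_weight x"
  proof (intro mult_left_mono)
   show "tensor_weight x powr ?p <= tensor_weight x"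
    using p1 tensor_weight_nonneg[of x] tensor_weight_le_1[of x] powr_mono'[of 1 ?p "tensor_weight x"] by simp
  qed simp
  finally show "norm (f x) powr ?p <= K powr ?p * tensor_weight x" .
 qed
 also have "... = ennreal (LBINT x. K powr ?p * tensor_weight (x::'a))"
  by (intro nn_integral_eq_integral integrable_mult_right tensor_weight_integrable) (simp add: tensor_weight_nonneg)
 finally show "(\<integral>\<^sup>+x. ennreal (norm (f x) powr ?p) \<partial>lborel) <= ennreal (K powr ?p * (LBINT x. tensor_weight (x::'a)))"
  by simp
qed

subsection \<open>A pair of bumps at high frequency\<close>

text \<open>The Fourier transform of the scalar factor of the test field. Two symmetric bumps make
  it even, so that the field is real; the normalisation \<open>1 / (2 * rho)\<close> keeps the
  gradient of the field bounded.\<close>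

definition twin_bump :: "real => real => 'a::euclidean_space => 'a => real" where
 "twin_bump delta rho e xi = (bump delta (xi - rho *R e) + bump delta (xi + rho *R e)) / (2 * rho)"

lemma twin_bump_minus: "twin_bump delta rho e (- xi) = twin_bump delta rho e xi"
proof -
 have "- xi - rho *R e = - (xi + rho *R e)" "- xi + rho *R e = - (xi - rho *R e)" by simp_all
 then show ?thesis unfolding twin_bump_def by (simp only: bump_minus add.commute)
qed

lemma schwartz_bump_shift: "0 < delta ==> schwartz (%xi. bump delta (xi - a))" "0 < delta ==> schwartz (%xi. bump delta (xi + a))"
 using schwartz_translate[OF schwartz_bump, of delta "- a"] schwartz_translate[OF schwartz_bump, of delta a] by simp_all

lemma schwartz_twin_bump:
 assumes "0 < delta"
 shows "schwartz (twin_bump delta rho e)"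
proof -
 have "schwartz (%xi. (1 / (2 * rho)) * (bump delta (xi - rho *R e) + bump delta (xi + rho *R e)))"
  by (intro schwartz_cmult schwartz_add schwartz_bump_shift assms)
 then show ?thesis by (simp add: twin_bump_def[abs_def])
qed

lemma twin_bump_nonneg: "0 < rho ==> 0 <= twin_bump delta rho e xi"
 by (simp add: twin_bump_def bump_nonneg)

lemma twin_bump_support:
 assumes delta: "0 < delta" and e: "e \<in> Basis" and nz: "twin_bump delta rho e xi \<noteq> 0" and rho: "0 < rho"
 shows "rho - delta < norm xi" "norm xi < rho + delta"
proof -
 have n: "norm (rho *R e) = rho" using e rho by simp
 have "norm (xi - rho *R e) < delta \<or> norm (xi + rho *R e) < delta"
  using nz bump_eq_0[OF delta, of "xi - rho *R e"] bump_eq_0[OF delta, of "xi + rho *R e"]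
  unfolding twin_bump_def by fastforce
 then have "\<bar>norm xi - norm (rho *R e)\<bar> < delta"
  using norm_triangle_ineq3[of xi "rho *R e"] norm_triangle_ineq3[of xi "- rho *R e"] by force
 then show "rho - delta < norm xi" "norm xi < rho + delta" unfolding n by linarith+
qed

lemma twin_bump_integral:
 fixes e :: "'a::euclidean_space"
 assumes delta: "0 < delta" and rho: "0 < rho"
 shows "(LBINT xi. twin_bump delta rho e xi) = (LBINT xi. bump delta (xi::'a)) / rho"
  and "(LBINT xi. (twin_bump delta rho e xi)^2) <= (LBINT xi. (bump delta (xi::'a))^2) / rho^2"
  and "integrable lborel (%xi. (twin_bump delta rho e xi)^2)"
proof -
 have tr: "(LBINT xi. f (xi - rho *R e)) = (LBINT xi. f xi)" "(LBINT xi. f (xi + rho *R e)) = (LBINT xi. f xi)" for f :: "'a => real"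
  using lborel_integral_translate[of f "- rho *R e"] lborel_integral_translate[of f "rho *R e"] by simp_all
 have i: "integrable lborel (%xi. bump delta (xi - rho *R e))" "integrable lborel (%xi. bump delta (xi + rho *R e))"
  by (intro schwartz_integrable schwartz_bump_shift delta)+
 have i2: "integrable lborel (%xi. (bump delta (xi - rho *R e))^2)" "integrable lborel (%xi. (bump delta (xi + rho *R e))^2)"
  unfolding power2_eq_square by (intro schwartz_integrable schwartz_mult schwartz_bump_shift delta)+
 show "(LBINT xi. twin_bump delta rho e xi) = (LBINT xi. bump delta (xi::'a)) / rho"
  unfolding twin_bump_def using i rho by (simp add: tr[of "bump delta"])
 show it: "integrable lborel (%xi. (twin_bump delta rho e xi)^2)"
  unfolding power2_eq_square by (intro schwartz_integrable schwartz_mult schwartz_twin_bump delta)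
 have "(LBINT xi. (twin_bump delta rho e xi)^2) <= (LBINT xi. (2 * (bump delta (xi - rho *R e))^2 + 2 * (bump delta (xi + rho *R e))^2) / (2 * rho)^2)"
 proof (rule integral_mono[OF it])
  show "integrable lborel (%xi. (2 * (bump delta (xi - rho *R e))^2 + 2 * (bump delta (xi + rho *R e))^2) / (2 * rho)^2)"
   using i2 by (intro integrable_divide_zero Bochner_Integration.integrable_add integrable_mult_right) auto
  fix xi :: 'a
  have "(bump delta (xi - rho *R e) + bump delta (xi + rho *R e))^2 <= 2 * (bump delta (xi - rho *R e))^2 + 2 * (bump delta (xi + rho *R e))^2"
   using sum_squares_bound[of "bump delta (xi - rho *R e)" "bump delta (xi + rho *R e)"] by (simp add: power2_sum)
  then show "(twin_bump delta rho e xi)^2 <= (2 * (bump delta (xi - rho *R e))^2 + 2 * (bump delta (xi + rho *R e))^2) / (2 * rho)^2"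
   unfolding twin_bump_def power_divide by (rule divide_right_mono) simp
 qed
 also have "... = (LBINT xi. (bump delta (xi::'a))^2) / rho^2"
  using i2 rho by (simp add: tr[of "%x. (bump delta x)^2"] power_mult_distrib)
 finally show "(LBINT xi. (twin_bump delta rho e xi)^2) <= (LBINT xi. (bump delta (xi::'a))^2) / rho^2" .
qed

lemma fourier_twin_bump:
 fixes e :: "'a::euclidean_space"
 assumes delta: "0 < delta" and rho: "0 < rho"
 shows "fourier_real (twin_bump delta rho e) x = cor (cos (2 * pi * rho * (x \<bullet> e)) / rho) * fourier_real (bump delta) x"
proof -
 define B where "B xi = cor (bump delta (xi::'a))" for xi
 have sB: "schwartz (%xi. B (xi + a))" for a
  unfolding B_def by (intro schwartz_complex_of_real schwartz_bump_shift delta)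
 have i: "integrable lborel (%xi. B (xi + a))" for a by (rule schwartz_integrable[OF sB])
 have "(%xi. cor (twin_bump delta rho e xi)) = (%xi. cor (1 / (2 * rho)) * (B (xi + - rho *R e) + B (xi + rho *R e)))"
  by (simp add: twin_bump_def B_def)
 then have "fourier_real (twin_bump delta rho e) x = cor (1 / (2 * rho)) * ((cnj (fkernel x (- rho *R e)) + cnj (fkernel x (rho *R e))) * fourier B x)"
  by (simp only: fourier_cmult fourier_add[OF i i] fourier_translate distrib_right)
 also have "cnj (fkernel x (- rho *R e)) + cnj (fkernel x (rho *R e)) = cor (2 * cos (2 * pi * rho * (x \<bullet> e)))"
  by (simp add: fkernel_def complex_eq_iff mult_ac)
 also have "cor (1 / (2 * rho)) * (cor (2 * cos (2 * pi * rho * (x \<bullet> e))) * fourier B x)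
   = cor (cos (2 * pi * rho * (x \<bullet> e)) / rho) * fourier B x"
  using rho by (simp add: field_simps)
 finally show ?thesis unfolding B_def .
qed

lemma radial_measurable:
 assumes "\<sigma> \<in> borel_measurable (restrict_space borel {0..})"
 shows "(%xi::'a::euclidean_space. \<sigma> (norm xi)) \<in> borel_measurable borel"
proof -
 have "(norm :: 'a => real) \<in> borel \<rightarrow>\<^sub>M restrict_space borel {0..}"
  by (rule measurable_restrict_space2) auto
 from measurable_compose[OF this assms] show ?thesis .
qed

lemma multiplier_twin_bump:
 fixes e :: "'a::euclidean_space" and \<sigma> :: "real => ennreal"
 assumes \<sigma>m: "\<sigma> \<in> borel_measurable (restrict_space borel {0..})"
  and delta: "0 < delta" "delta <= 1 / 2" and e: "e \<in> Basis" and r: "r >= 0" and rho: "rho = r + 1 / 2"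
  and s: "AE x in lborel. x \<in> {r - 1..r + 1} --> \<sigma> x <= ennreal s" and s0: "0 <= s"
 defines "V \<equiv> twin_bump delta rho e" and "W \<equiv> %xi. enn2real (\<sigma> (norm xi)) * twin_bump delta rho e xi"
 shows "integrable lborel W"
  and "AE xi in lborel. \<bar>W xi\<bar> <= s * V xi"
  and "fourier_multiplier \<sigma> (%x. Re (fourier_real V x) *R e) (%x. Re (fourier_real W x) *R e)"
proof -
 have rho0: "rho > 0" using r rho by simp
 have m: "(%xi::'a. \<sigma> (norm xi)) \<in> borel_measurable borel" by (rule radial_measurable[OF \<sigma>m])
 have V: "schwartz V" unfolding V_def by (rule schwartz_twin_bump[OF delta(1)])
 have [measurable]: "V \<in> borel_measurable borel" by (rule schwartz_measurable[OF V])
 have [measurable]: "W \<in> borel_measurable borel" using m unfolding W_def V_def[symmetric] by measurable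
 have "AE x in lborel. 0 < x --> x \<in> {r - 1..r + 1} --> \<sigma> x <= ennreal s" using s by auto
 then have ae: "AE xi in lborel. norm (xi::'a) \<in> {r - 1..r + 1} --> \<sigma> (norm xi) <= ennreal s"
  by (rule AE_norm)
 \<comment> \<open>The support lies between \<open>rho - delta\<close> and
   \<open>rho + delta\<close>, hence in \<open>[r, r + 1]\<close> because
   \<open>delta <= 1 / 2\<close>.\<close>
 have supp: "norm xi \<in> {r - 1..r + 1}" if "V xi \<noteq> 0" for xi
  using twin_bump_support[OF delta(1) e that[unfolded V_def] rho0] delta rho by auto
 show bound: "AE xi in lborel. \<bar>W xi\<bar> <= s * V xi"
  using ae
 proof eventually_elim
  case (elim xi)
  show ?case
  proof (cases "V xi = 0")
   case True
   then show ?thesis by (simp add: W_def V_def)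
  next
   case False
   then have "enn2real (\<sigma> (norm xi)) <= s" using elim supp s0 by (intro enn2real_leI) auto
   from mult_right_mono[OF this twin_bump_nonneg[OF rho0, of delta e xi]]
   show ?thesis using twin_bump_nonneg[OF rho0, of delta e xi] by (simp add: W_def V_def abs_mult)
  qed
 qed
 show iW: "integrable lborel W"
  by (rule integrable_dom[OF integrable_mult_right[OF schwartz_integrable[OF V], of s]])
   (use bound in auto)
 \<comment> \<open>\<open>\<sigma>\<close> is essentially bounded on the window that contains the
   support, so it can be infinite only where \<open>V\<close> vanishes, up to a null set.\<close>
 have top: "AE xi in lborel. \<sigma> (norm xi) = top --> V xi = 0"
  using ae by eventually_elim (use supp in \<open>auto simp: top_unique\<close>)
 show "fourier_multiplier \<sigma> (%x. Re (fourier_real V x) *R e) (%x. Re (fourier_real W x) *R e)"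
  using fourier_multiplierI[OF schwartz_integrable[OF V] _ _ top e] iW
  unfolding W_def V_def by (simp add: twin_bump_minus)
qed

text \<open>The symbol is at most \<open>s\<close> times the bumps. The trivial bound and Bessel's
  inequality then give a supremum and a square norm of the same size \<open>s / rho\<close>, and
  interpolation covers every \<open>p >= 2\<close>.\<close>

theorem multiplier_Lp_ge_2:
 fixes e :: "'a::euclidean_space" and \<sigma> :: "real => ennreal"
 assumes \<sigma>m: "\<sigma> \<in> borel_measurable (restrict_space borel {0..})"
  and delta: "0 < delta" "delta <= 1 / 2" and e: "e \<in> Basis" and p: "2 <= p"
 shows "\<exists>C>0. \<forall>r s. 0 <= r --> 0 < s --> (AE x in lborel. x \<in> {r - 1..r + 1} --> \<sigma> x <= ennreal s) -->
  Lp_norm p (%x. Re (fourier_real (%xi. enn2real (\<sigma> (norm xi)) * twin_bump delta (r + 1 / 2) e xi) x) *R e) <= ennreal (C * s / (r + 1 / 2))"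
proof -
 define b1 where "b1 = (LBINT xi. bump delta (xi::'a))"
 define b2 where "b2 = (LBINT xi. (bump delta (xi::'a))^2)"
 have b1: "b1 > 0" unfolding b1_def by (rule bump_integral_pos[OF delta(1)])
 have b2: "b2 >= 0" unfolding b2_def by simp
 define C where "C = (1 + b1) * (1 + b2)"
 show ?thesis
 proof (intro exI[of _ C] conjI allI impI)
  show "C > 0" unfolding C_def using b1 b2 by (intro mult_pos_pos) auto
  fix r s :: real assume r: "0 <= r" and s: "0 < s" and ae: "AE x in lborel. x \<in> {r - 1..r + 1} --> \<sigma> x <= ennreal s"
  define rho where "rho = r + 1 / 2"
  have rho: "rho > 0" using r by (simp add: rho_def)
  define V where "V = twin_bump delta rho e"
  define W where "W = (%xi. enn2real (\<sigma> (norm xi)) * twin_bump delta rho e xi)"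
  have mt: "integrable lborel W" "AE xi in lborel. \<bar>W xi\<bar> <= s * V xi"
   unfolding W_def V_def by (rule multiplier_twin_bump[OF \<sigma>m delta e r rho_def ae less_imp_le[OF s]])+
  have V: "schwartz V" unfolding V_def by (rule schwartz_twin_bump[OF delta(1)])
  have iW: "integrable lborel W" by (rule mt(1))
  have [measurable]: "W \<in> borel_measurable borel" using iW by simp
  \<comment> \<open>The summand 1 lets the same \<open>K\<close> dominate \<open>s / rho\<close>,
    which the square norm needs, besides the supremum bound \<open>s / rho * b1\<close>.\<close>
  define K where "K = s / rho * (1 + b1)"
  have K: "K > 0" unfolding K_def using s rho b1 by (intro mult_pos_pos divide_pos_pos) auto
  have sup: "norm (Re (fourier_real W x) *R e) <= K" for x
  proof -
   have "norm (Re (fourier_real W x) *R e) <= norm (fourier_real W x)" using e abs_Re_le_cmod by simp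
   also have "... <= (LBINT xi. norm (cor (W xi)))"
    by (rule norm_fourier_le) (use iW in simp)
   also have "... <= (LBINT xi. s * V xi)"
    by (rule integral_mono_AE) (use iW mt(2) schwartz_integrable[OF V] in auto)
   also have "... = s / rho * b1" unfolding V_def b1_def using twin_bump_integral(1)[OF delta(1) rho, of e] by simp
   also have "... <= K" unfolding K_def using s rho by (intro mult_left_mono) auto
   finally show ?thesis .
  qed
  have W2: "AE xi in lborel. (W xi)^2 <= s^2 * (V xi)^2"
   using mt(2)
  proof eventually_elim
   case (elim xi)
   then have "\<bar>W xi\<bar>^2 <= (s * V xi)^2" by (intro power_mono) auto
   then show ?case by (simp add: power_mult_distrib)
  qed
  have iV2: "integrable lborel (%xi. (V xi)^2)" unfolding V_def by (rule twin_bump_integral(3)[OF delta(1) rho])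
  have iW2: "integrable lborel (%xi. (W xi)^2)"
   by (rule integrable_dom[OF integrable_mult_right[OF iV2, of "s^2"]]) (use W2 in auto)
  have "(\<integral>\<^sup>+x. ennreal ((norm (Re (fourier_real W x) *R e))^2) \<partial>lborel) <= (\<integral>\<^sup>+x. ennreal ((norm (fourier_real W x))^2) \<partial>lborel)"
   using e by (intro nn_integral_mono ennreal_leI power_mono) (auto simp: abs_Re_le_cmod)
  also have "... <= ennreal (LBINT x. (W x)^2)" by (rule bessel_inequality[OF iW iW2])
  also have "... <= ennreal (K^2 * b2)"
  proof (rule ennreal_leI)
   have "(LBINT x. (W x)^2) <= (LBINT xi. s^2 * (V xi)^2)"
    by (rule integral_mono_AE) (use iW2 W2 iV2 in auto)
   also have "... <= s^2 * (b2 / rho^2)"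
    unfolding b2_def V_def using mult_left_mono[OF twin_bump_integral(2)[OF delta(1) rho, of e], of "s^2"] by simp
   also have "... = (s / rho)^2 * b2" by (simp add: power_divide)
   also have "... <= K^2 * b2"
   proof (intro mult_right_mono power_mono b2)
    show "s / rho <= K" unfolding K_def using s rho b1 mult_left_mono[of 1 "1 + b1" "s / rho"] by simp
   qed (use s rho in simp)
   finally show "(LBINT x. (W x)^2) <= K^2 * b2" .
  qed
  finally have L2: "(\<integral>\<^sup>+x. ennreal ((norm (Re (fourier_real W x) *R e))^2) \<partial>lborel) <= ennreal (K^2 * b2)" .
  have [measurable]: "fourier_real W \<in> borel_measurable borel"
   by (rule fourier_measurable) (use iW in simp)
  have mW: "(%x. Re (fourier_real W x) *R e) \<in> borel_measurable borel"
   by measurable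
  have "Lp_norm p (%x. Re (fourier_real W x) *R e) <= ennreal (K * (1 + b2))"
   by (rule Lp_norm_le_ge_2[OF p K b2 mW sup L2])
  also have "K * (1 + b2) = C * s / rho" by (simp add: K_def C_def)
  finally show "Lp_norm p (%x. Re (fourier_real (%xi. enn2real (\<sigma> (norm xi)) * twin_bump delta (r + 1 / 2) e xi) x) *R e) <= ennreal (C * s / (r + 1 / 2))"
   unfolding W_def rho_def .
 qed
qed

section \<open>Weak derivatives on a half-line\<close>

lemma smooth_onI_dir_deriv:
 fixes f :: "'a::euclidean_space => 'b::real_normed_vector"
 assumes "\<And>x. f differentiable (at x)" and "\<And>b. b \<in> Basis ==> smooth_on UNIV (dir_deriv b f)"
 shows "smooth_on UNIV f"
 unfolding smooth_on_def
proof (intro ballI)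
 fix bs x assume bs: "bs \<in> lists (Basis::'a set)"
 show "iter_partial bs f differentiable (at x)"
 proof (cases bs rule: rev_cases)
  case Nil
  then show ?thesis using assms(1) by simp
 next
  case (snoc cs b)
  then have "b \<in> Basis" "cs \<in> lists Basis" using bs by auto
  then have "iter_partial cs (dir_deriv b f) differentiable (at x)"
   using assms(2)[of b] unfolding smooth_on_def by blast
  then show ?thesis using snoc by (simp add: iter_partial_append dir_deriv_def[abs_def])
 qed
qed

lemma dir_deriv_real: "(f has_real_derivative D) (at x) ==> dir_deriv b f x = D * b"
 by (rule dir_deriv_eq) (simp add: has_field_derivative_def)

lemma smooth_real_derivI:
 fixes f :: "real => real"
 assumes "\<And>x. (f has_real_derivative f' x) (at x)" and "smooth_on UNIV f'"
 shows "smooth_on UNIV f"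
proof (rule smooth_onI_dir_deriv)
 show "f differentiable (at x)" for x
  using assms(1) real_differentiable_def by blast
 show "smooth_on UNIV (dir_deriv b f)" if "b \<in> Basis" for b
 proof -
  have "dir_deriv b f = f'" using that dir_deriv_real[OF assms(1)] by auto
  then show ?thesis using assms(2) by simp
 qed
qed

lemma smooth_real_deriv:
 fixes f :: "real => real"
 assumes "smooth_on UNIV f"
 shows "smooth_on UNIV (deriv f)" and "(f has_real_derivative deriv f x) (at x)"
proof -
 have d: "f field_differentiable (at x)" for x
  using smooth_differentiable[OF assms] by (simp add: field_differentiable_def real_differentiable_def)
 then show *: "(f has_real_derivative deriv f x) (at x)" for x
  by (simp add: field_differentiable_derivI)
 have "dir_deriv 1 f = deriv f" using dir_deriv_real[OF *] by auto
 then show "smooth_on UNIV (deriv f)" using smooth_dir_deriv[OF assms, of 1] by simp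
qed

text \<open>On each compact interval the positive and the negative part of \<open>f\<close> are
  densities of finite measures that agree on all half-lines, so the measures and then the densities
  coincide. Countably many such intervals exhaust the half-line.\<close>

lemma AE_eq_0_of_interval_integrals:
 fixes f :: "real => real"
 assumes f: "\<And>c d. a < c ==> set_integrable lborel {c..d} f"
  and zero: "\<And>c d. a < c ==> c < d ==> (LBINT x. f x * indicator {c..d} x) = 0"
 shows "AE x in lborel. a < x --> f x = 0"
proof -
 have *: "AE x in lborel. x \<in> {c..d} --> f x = 0" if c: "a < c" and cd: "c < d" for c d
 proof -
  define h where "h x = f x * indicator {c..d} x" for x
  have h: "integrable lborel h" using f[OF c, of d] unfolding set_integrable_def h_def by (simp add: mult.commute)
  have [measurable]: "h \<in> borel_measurable borel" using h by simp
  have hz: "(LBINT x. h x * indicator {s<..} x) = 0" for s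
  proof -
   have "(LBINT x. h x * indicator {s<..} x) = (LBINT x. f x * indicator {max c s..d} x)"
   proof (rule integral_cong_AE)
    show "(%x. f x * indicator {max c s..d} x) \<in> borel_measurable lborel"
    proof -
     have "(%x. f x * indicator {max c s..d} x) = (%x. h x * indicator {s..} x)"
      by (auto simp: h_def fun_eq_iff split: split_indicator)
     then show ?thesis by simp
    qed
    have "AE x in lborel. x \<noteq> s" by (rule AE_lborel_singleton)
    then show "AE x in lborel. h x * indicator {s<..} x = f x * indicator {max c s..d} x"
     by eventually_elim (auto simp: h_def split: split_indicator)
   qed measurable
   also have "... = 0"
   proof (cases "max c s < d")
    case True
    then show ?thesis using zero[of "max c s" d] c by simp
   next
    case False
    have "(LBINT x. f x * indicator {max c s..d} x) = (\<integral>x. 0 \<partial>(lborel :: real measure))"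
    proof (rule integral_cong_AE)
     show "(%x. f x * indicator {max c s..d} x) \<in> borel_measurable lborel"
     proof -
      have "(%x. f x * indicator {max c s..d} x) = (%x. h x * indicator {s..} x)"
       by (auto simp: h_def fun_eq_iff split: split_indicator)
      then show ?thesis by simp
     qed
     have "AE x in lborel. x \<noteq> d" by (rule AE_lborel_singleton)
     then show "AE x in lborel. f x * indicator {max c s..d} x = 0"
      by eventually_elim (use False in \<open>auto split: split_indicator\<close>)
    qed simp
    then show ?thesis by simp
   qed
   finally show ?thesis .
  qed
  have ip: "integrable lborel (%x. max 0 (h x))" "integrable lborel (%x. max 0 (- h x))"
   using h by auto
  have fin: "(\<integral>\<^sup>+x. ennreal (h x) \<partial>lborel) < \<infinity>" "(\<integral>\<^sup>+x. ennreal (- h x) \<partial>lborel) < \<infinity>"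
   using ip[THEN integrableD(2)] by (auto simp: ennreal_max_0 less_top)
  have eq: "density lborel (%x. ennreal (h x)) = density lborel (%x. ennreal (- h x))"
  proof (rule measure_eqI_lessThan)
   fix s :: real
   have i: "integrable lborel (%x. max 0 (h x) * indicator {s<..} x)" "integrable lborel (%x. max 0 (- h x) * indicator {s<..} x)"
    using ip by (auto intro: integrable_real_mult_indicator)
   have e: "emeasure (density lborel (%x. ennreal (u x))) {s<..} = ennreal (LBINT x. max 0 (u x) * indicator {s<..} x)"
    if "integrable lborel (%x. max 0 (u x) * indicator {s<..} x)" "u \<in> borel_measurable borel" for u :: "real => real"
   proof -
    have "emeasure (density lborel (%x. ennreal (u x))) {s<..} = (\<integral>\<^sup>+x. ennreal (max 0 (u x) * indicator {s<..} x) \<partial>lborel)"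
     using that(2) by (subst emeasure_density) (auto intro!: nn_integral_cong simp: ennreal_max_0 split: split_indicator)
    then show ?thesis using that(1) by (simp add: nn_integral_eq_integral)
   qed
   show "emeasure (density lborel (%x. ennreal (h x))) {s<..} < \<infinity>" using i(1) by (simp add: e)
   have "(LBINT x. max 0 (h x) * indicator {s<..} x) - (LBINT x. max 0 (- h x) * indicator {s<..} x)
     = (LBINT x. h x * indicator {s<..} x)"
    by (subst Bochner_Integration.integral_diff[OF i, symmetric], rule Bochner_Integration.integral_cong[OF refl]) (auto split: split_indicator)
   then show "emeasure (density lborel (%x. ennreal (h x))) {s<..} = emeasure (density lborel (%x. ennreal (- h x))) {s<..}"
    using hz[of s] by (simp add: e[OF i(1)] e[OF i(2)])
  qed simp_all
  have "AE x in lborel. ennreal (h x) = ennreal (- h x)"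
   by (subst finite_density_unique[symmetric]) (use fin eq in auto)
  then show ?thesis
  proof eventually_elim
   case (elim x)
   have "h x = 0"
   proof (cases "0 <= h x")
    case True
    then have "ennreal (h x) = 0" using elim by (simp add: ennreal_neg)
    then show ?thesis using True by simp
   next
    case False
    then have "ennreal (- h x) = 0" using elim by (simp add: ennreal_neg)
    then show ?thesis using False by simp
   qed
   then show ?case by (auto simp: h_def)
  qed
 qed
 \<comment> \<open>Both ends move with \<open>n\<close>, so a single countable family of intervals
   covers everything to the right of \<open>a\<close>.\<close>
 have "AE x in lborel. \<forall>n. x \<in> {a + 1 / real (Suc n)..a + 1 / real (Suc n) + real (Suc n)} --> f x = 0"
  unfolding AE_all_countable
 proof
  fix n
  have "0 < 1 / real (Suc n)" by simp
  then show "AE x in lborel. x \<in> {a + 1 / real (Suc n)..a + 1 / real (Suc n) + real (Suc n)} --> f x = 0"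
   by (intro *) auto
 qed
 then show ?thesis
 proof eventually_elim
  case (elim x)
  show ?case
  proof
   assume x: "a < x"
   obtain n where n: "1 / real (Suc n) < x - a" using x nat_approx_posE[of "x - a"] by auto
   obtain k where k: "x - a < real k" using reals_Archimedean2 by blast
   define j where "j = max n k"
   have "1 / real (Suc j) <= 1 / real (Suc n)" by (rule frac_le) (auto simp: j_def)
   moreover have "real k <= real (Suc j)" by (simp add: j_def)
   moreover have "0 <= 1 / real (Suc j)" by simp
   ultimately have "x \<in> {a + 1 / real (Suc j)..a + 1 / real (Suc j) + real (Suc j)}"
    using n k unfolding atLeastAtMost_iff by linarith
   then show "f x = 0" using elim by blast
  qed
 qed
qed

section \<open>Smooth steps and plateaus on the line\<close>

abbreviation unit_mollifier :: "real => real" where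
 "unit_mollifier \<equiv> mollifier 1"

text \<open>The lower limit -2 lies strictly left of \<open>[-1, 1]\<close>, outside which the
  mollifier vanishes. So the step is locally 0 at every point up to -2, and to the right of it the
  fundamental theorem of calculus applies.\<close>

definition smooth_step :: "real => real" where
 "smooth_step x = integral {-2..x} unit_mollifier"

lemma smooth_step_has_derivative: "(smooth_step has_real_derivative unit_mollifier x) (at x)"
proof -
 have c: "continuous_on S unit_mollifier" for S
  by (rule schwartz_continuous_on[OF schwartz_mollifier]) simp
 show ?thesis
 proof (cases "x > -2")
  case True
  have "((%x. integral {-2..x} unit_mollifier) has_real_derivative unit_mollifier x) (at x within {-2..x + 1})"
   by (rule integral_has_real_derivative[OF c]) (use True in auto)
  then show ?thesis unfolding smooth_step_def[abs_def] using True by (subst (asm) at_within_Icc_at) auto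
 next
  case False
  have "smooth_step y = 0" if "y < -1" for y
  proof -
   have "smooth_step y = integral {-2..y} (%_. 0 :: real)"
    unfolding smooth_step_def by (rule integral_cong) (use that in \<open>auto intro!: mollifier_eq_0\<close>)
   then show ?thesis by simp
  qed
  then have "\<forall>\<^sub>F y in nhds x. smooth_step y = 0"
   using False unfolding eventually_nhds by (intro exI[of _ "{..<-1}"]) auto
  moreover have "((%_. 0) has_real_derivative unit_mollifier x) (at x)"
   using False mollifier_eq_0[of 1 x] by simp
  ultimately show ?thesis by (subst DERIV_cong_ev[OF refl _ refl, where g = "%_. 0"])
 qed
qed

lemma smooth_step_eq_integral: "-2 <= x ==> smooth_step x = (LBINT y. unit_mollifier y * indicator {-2..x} y)"
 using integral_FTC_Icc_real[of "-2" x smooth_step unit_mollifier] smooth_step_has_derivative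
  schwartz_isCont[OF schwartz_mollifier, of 1, where 'a = real]
 by (simp add: smooth_step_def)

lemma smooth_step_bounds: "0 <= smooth_step x" "smooth_step x <= 1"
proof -
 have i: "integrable lborel unit_mollifier" by (rule schwartz_integrable[OF schwartz_mollifier]) simp
 have "0 <= smooth_step x \<and> smooth_step x <= 1"
 proof (cases "-2 <= x")
  case True
  have "(LBINT y. unit_mollifier y * indicator {-2..x} y) <= (LBINT y. unit_mollifier y)"
   by (rule integral_mono') (use i mollifier_nonneg[of 1] in \<open>auto split: split_indicator\<close>)
  moreover have "0 <= (LBINT y. unit_mollifier y * indicator {-2..x} y)"
   by (rule Bochner_Integration.integral_nonneg) (simp add: mollifier_nonneg)
  ultimately show ?thesis using smooth_step_eq_integral[OF True] mollifier_integral[of 1, where 'a = real] by simp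
 next
  case False
  then show ?thesis by (simp add: smooth_step_def)
 qed
 then show "0 <= smooth_step x" "smooth_step x <= 1" by auto
qed

lemma smooth_step_left: "x <= -1 ==> smooth_step x = 0"
proof (cases "-2 <= x")
 case True
 assume x: "x <= -1"
 have "(LBINT y. unit_mollifier y * indicator {-2..x} y) = (\<integral>y. 0 \<partial>(lborel::real measure))"
  by (rule Bochner_Integration.integral_cong[OF refl]) (use x in \<open>auto split: split_indicator intro!: mollifier_eq_0\<close>)
 then show ?thesis using smooth_step_eq_integral[OF True] by simp
qed (simp add: smooth_step_def)

lemma smooth_step_right: "1 <= x ==> smooth_step x = 1"
proof -
 assume x: "1 <= x"
 have "(LBINT y. unit_mollifier y * indicator {-2..x} y) = (LBINT y. unit_mollifier y)"
  by (rule Bochner_Integration.integral_cong[OF refl]) (use x in \<open>auto split: split_indicator intro!: mollifier_eq_0\<close>)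
 then show ?thesis using smooth_step_eq_integral[of x] x mollifier_integral[of 1, where 'a = real] by simp
qed

lemma smooth_step_measurable [measurable]: "smooth_step \<in> borel_measurable borel"
 using smooth_step_has_derivative
 by (intro borel_measurable_continuous_onI continuous_at_imp_continuous_on ballI) (blast intro: DERIV_isCont)

text \<open>A smoothed indicator of \<open>[a, b]\<close> with transitions of half-width
  \<open>1 / N\<close>; its derivative is a mollifier at \<open>a\<close> minus a mollifier at
  \<open>b\<close>.\<close>

definition plateau :: "real => real => real => real => real" where
 "plateau N a b x = smooth_step (N * (x - a)) - smooth_step (N * (x - b))"

lemma plateau_has_derivative:
 "(plateau N a b has_real_derivative N * unit_mollifier (N * (x - a)) - N * unit_mollifier (N * (x - b))) (at x)"
proof -
 have "((%x. smooth_step (N * (x - a))) has_real_derivative unit_mollifier (N * (x - a)) * N) (at x)" for a x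
  by (rule DERIV_chain2[OF smooth_step_has_derivative]) (auto intro!: derivative_eq_intros)
 then show ?thesis unfolding plateau_def[abs_def] by (auto intro!: DERIV_diff simp: mult.commute)
qed

lemma smooth_plateau:
 assumes N: "N \<noteq> 0"
 shows "smooth_on UNIV (plateau N a b)"
proof (rule smooth_real_derivI[OF plateau_has_derivative])
 have "schwartz (%x. N * unit_mollifier (N *R x + (- N * a)) - N * unit_mollifier (N *R x + (- N * b)))"
  by (intro schwartz_diff schwartz_cmult schwartz_affine schwartz_mollifier N) auto
 then show "smooth_on UNIV (%x. N * unit_mollifier (N * (x - a)) - N * unit_mollifier (N * (x - b)))"
  by (simp add: schwartz_smooth right_diff_distrib)
qed

lemma plateau_support:
 assumes "N > 0" "a <= b" "x \<notin> {a - 1 / N..b + 1 / N}"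
 shows "plateau N a b x = 0"
proof -
 have "N * (x - a) <= -1 \<and> N * (x - b) <= -1 \<or> 1 <= N * (x - a) \<and> 1 <= N * (x - b)"
 proof (cases "x < a - 1 / N")
  case True
  then have "N * (x - a) <= N * (- (1 / N))" "N * (x - b) <= N * (- (1 / N))"
   using assms by (intro mult_left_mono; simp)+
  then show ?thesis using assms by simp
 next
  case False
  then have "N * (1 / N) <= N * (x - a)" "N * (1 / N) <= N * (x - b)"
   using assms by (intro mult_left_mono; simp)+
  then show ?thesis using assms by simp
 qed
 then show ?thesis by (auto simp: plateau_def smooth_step_left smooth_step_right)
qed

lemma plateau_abs_le_1: "\<bar>plateau N a b x\<bar> <= 1"
 using smooth_step_bounds[of "N * (x - a)"] smooth_step_bounds[of "N * (x - b)"] by (simp add: plateau_def abs_le_iff)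

lemma plateau_measurable [measurable]: "plateau N a b \<in> borel_measurable borel"
 unfolding plateau_def[abs_def] by measurable

lemma plateau_tendsto:
 assumes N: "filterlim N at_top sequentially" and ab: "a <= b" and x: "x \<noteq> a" "x \<noteq> b"
 shows "(%n. plateau (N n) a b x) \<longlonglongrightarrow> indicator {a..b} x"
proof -
 have st: "(%n. smooth_step (N n * y)) \<longlonglongrightarrow> (if 0 < y then 1 else 0)" if "y \<noteq> 0" for y
 proof (cases "0 < y")
  case True
  have "\<forall>\<^sub>F n in sequentially. 1 / y <= N n" using N by (simp add: filterlim_at_top)
  then have "\<forall>\<^sub>F n in sequentially. 1 = smooth_step (N n * y)"
   by eventually_elim (use True in \<open>simp add: smooth_step_right field_simps\<close>)
  then show ?thesis using True by (auto intro: Lim_transform_eventually[OF tendsto_const])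
 next
  case False
  then have y: "y < 0" using that by simp
  have "\<forall>\<^sub>F n in sequentially. - 1 / y <= N n" using N by (simp add: filterlim_at_top)
  then have "\<forall>\<^sub>F n in sequentially. 0 = smooth_step (N n * y)"
   by eventually_elim (use y in \<open>simp add: smooth_step_left field_simps\<close>)
  then show ?thesis using False by (auto intro: Lim_transform_eventually[OF tendsto_const])
 qed
 have "(%n. plateau (N n) a b x) \<longlonglongrightarrow> (if 0 < x - a then 1 else 0) - (if 0 < x - b then 1 else 0)"
  unfolding plateau_def by (intro tendsto_diff st) (use x in auto)
 moreover have "(if 0 < x - a then 1 else 0) - (if 0 < x - b then 1 else 0) = (indicator {a..b} x :: real)"
  using x ab by (auto simp: indicator_def)
 ultimately show ?thesis by simp
qed

lemma plateau_integral_tendsto: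
 fixes u :: "real => real"
 assumes N: "filterlim N at_top sequentially" "\<And>n. N0 <= N n" and N0: "0 < N0" and ab: "a <= b"
  and u: "set_integrable lborel {a - 1 / N0..b + 1 / N0} u"
 shows "(%n. (LBINT x. u x * plateau (N n) a b x)) \<longlonglongrightarrow> (LBINT x. u x * indicator {a..b} x)"
  and "\<bar>(LBINT x. u x * plateau (N n) a b x)\<bar> <= (LBINT x. \<bar>u x * indicator {a - 1 / N0..b + 1 / N0} x\<bar>)"
  and "integrable lborel (%x. u x * plateau (N n) a b x)"
proof -
 define v where "v x = u x * indicator {a - 1 / N0..b + 1 / N0} x" for x
 have v: "integrable lborel v" using u unfolding v_def set_integrable_def by (simp add: mult.commute)
 have [measurable]: "v \<in> borel_measurable borel" using v by simp
 have eq: "u x * plateau (N n) a b x = v x * plateau (N n) a b x" for n x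
 proof (cases "x \<in> {a - 1 / N0..b + 1 / N0}")
  case False
  have "1 / N n <= 1 / N0" using N(2)[of n] N0 by (intro frac_le) auto
  then have "plateau (N n) a b x = 0" using False N(2)[of n] N0 ab by (intro plateau_support) auto
  then show ?thesis by simp
 qed (simp add: v_def)
 have bd: "norm (v x * plateau (N n) a b x) <= \<bar>v x\<bar>" for n x
  using mult_left_mono[OF plateau_abs_le_1[of "N n" a b x], of "\<bar>v x\<bar>"] by (simp add: abs_mult)
 have ind: "v x * indicator {a..b} x = u x * indicator {a..b} x" for x
 proof (cases "x \<in> {a..b}")
  case True
  have "0 < 1 / N0" using N0 by simp
  then have "x \<in> {a - 1 / N0..b + 1 / N0}" using True unfolding atLeastAtMost_iff by linarith
  then show ?thesis by (simp add: v_def)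
 qed simp
 have "(%n. (LBINT x. v x * plateau (N n) a b x)) \<longlonglongrightarrow> (LBINT x. v x * indicator {a..b} x)"
 proof (rule integral_dominated_convergence[where w = "%x. \<bar>v x\<bar>"])
  have "AE x in lborel. x \<noteq> a" "AE x in lborel. x \<noteq> b" by (rule AE_lborel_singleton)+
  then show "AE x in lborel. (%n. v x * plateau (N n) a b x) \<longlonglongrightarrow> v x * indicator {a..b} x"
   by eventually_elim (intro tendsto_mult tendsto_const plateau_tendsto N ab)
 qed (use v bd in auto)
 then show "(%n. (LBINT x. u x * plateau (N n) a b x)) \<longlonglongrightarrow> (LBINT x. u x * indicator {a..b} x)"
  unfolding eq ind .
 show i: "integrable lborel (%x. u x * plateau (N n) a b x)" unfolding eq
  by (rule integrable_dom[OF integrable_norm[OF v]]) (use bd in auto)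
 have "norm (LBINT x. v x * plateau (N n) a b x) <= (LBINT x. \<bar>v x\<bar>)"
  by (rule order_trans[OF integral_norm_bound], rule integral_mono) (use i[unfolded eq] v bd in \<open>auto intro: integrable_norm\<close>)
 then show "\<bar>(LBINT x. u x * plateau (N n) a b x)\<bar> <= (LBINT x. \<bar>u x * indicator {a - 1 / N0..b + 1 / N0} x\<bar>)"
  unfolding eq v_def by simp
qed

text \<open>Testing with a plateau between \<open>a\<close> and \<open>b\<close> compares mollified
  values of \<open>u\<close> at both ends with the integral of \<open>w\<close>. Averaging over
  \<open>b\<close> replaces pointwise convergence of the mollified values by convergence of
  integrals. This yields the constant \<open>kappa\<close> and then the identity on every
  interval.\<close>

theorem du_bois_reymond:
 fixes u w :: "real => real"
 assumes u: "\<And>c d. R < c ==> set_integrable lborel {c..d} u"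
  and w: "\<And>c d. R < c ==> set_integrable lborel {c..d} w"
  and test: "\<And>phi K. smooth_on UNIV phi ==> compact K ==> K \<subseteq> {R<..} ==> (\<And>x. x \<notin> K ==> phi x = 0) ==>
   (LBINT x. u x * deriv phi x) = - (LBINT x. w x * phi x)"
  and a: "R < a"
 shows "\<exists>kappa. AE s in lborel. a < s --> u s = kappa + (LBINT y. w y * indicator {a..s} y)"
proof -
 \<comment> \<open>Large enough for \<open>1 / N0 < a - R\<close>, so that all test functions stay
   supported in \<open>{R<..}\<close>.\<close>
 define N0 where "N0 = 1 / (a - R) + 1"
 have N0: "N0 > 1" using a by (simp add: N0_def)
 have "(a - R) * N0 = 1 + (a - R)" using a by (simp add: N0_def distrib_left)
 then have "1 / N0 < a - R" using a N0 by (simp add: pos_divide_less_eq)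
 then have aR: "R < a - 1 / N0" by simp
 define N where "N n = real n + N0" for n :: nat
 have N: "filterlim N at_top sequentially" "\<And>n. N0 <= N n"
  unfolding N_def using N0 by (auto intro!: filterlim_at_top_mono[OF filterlim_real_sequentially] always_eventually)
 have N0': "0 < N0" using N0 by simp
 have Np: "N n > 0" for n using N(2)[of n] N0' by linarith
 have inv: "1 / N n <= 1 / N0" for n using N(2)[of n] N0' by (intro frac_le) auto
 define k where "k n b x = N n * unit_mollifier (N n * (x - b))" for n b x
 have k_supp: "k n b x = 0" if "x \<notin> {b - 1 / N0..b + 1 / N0}" for n b x
 proof -
  have "1 / N n < \<bar>x - b\<bar>" using that inv[of n] by (auto simp: abs_if)
  then have "1 <= N n * \<bar>x - b\<bar>" using Np[of n] by (simp add: pos_divide_less_eq mult.commute)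
  then have "1 <= norm (N n * (x - b))" using Np[of n] unfolding real_norm_def abs_mult by simp
  then show ?thesis by (simp add: k_def mollifier_eq_0)
 qed
 have iI [simp]: "integrable lborel (indicator {c..d} :: real => real)" for c d :: real
  by (intro integrable_real_indicator) (auto simp: emeasure_lborel_Icc_eq)
 obtain B where B: "B > 0" "\<And>x. \<bar>unit_mollifier x\<bar> <= B"
  using schwartz_bounded[OF schwartz_mollifier[of 1, where 'a = real]] by auto
 have k_bd: "\<bar>k n b x\<bar> <= N n * B" for n b x
  using B(2)[of "N n * (x - b)"] Np[of n] by (simp add: k_def abs_mult)
 have um [measurable]: "unit_mollifier \<in> borel_measurable borel"
  by (rule schwartz_measurable[OF schwartz_mollifier]) simp
 have loc: "integrable lborel (%x. f x * indicator {c..d} x)" if "\<And>c d. R < c ==> set_integrable lborel {c..d} f" "R < c" for f :: "real => real" and c d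
  using that(1)[OF that(2), of d] unfolding set_integrable_def by (simp add: mult.commute)
 define un where "un n b = (LBINT x. u x * k n b x)" for n b
 have iuk: "integrable lborel (%x. u x * k n b x)" if "a <= b" for n b
 proof -
  define v where "v x = u x * indicator {a - 1 / N0..b + 1 / N0} x" for x
  have v: "integrable lborel v" unfolding v_def by (rule loc[OF u aR])
  have "u x * k n b x = v x * k n b x" for x
  proof (cases "x \<in> {b - 1 / N0..b + 1 / N0}")
   case True
   then have "x \<in> {a - 1 / N0..b + 1 / N0}" using that by simp
   then show ?thesis by (simp add: v_def)
  qed (simp add: k_supp)
  moreover have "integrable lborel (%x. v x * k n b x)"
  proof (rule integrable_dom[OF integrable_mult_left[OF v, of "N n * B"]])
   show "AE x in lborel. norm (v x * k n b x) <= norm (v x * (N n * B))"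
    using k_bd[of n b] B(1) Np[of n] by (auto simp: abs_mult intro!: mult_left_mono AE_I2)
  qed (use v in \<open>simp add: k_def\<close>)
  ultimately show ?thesis by (simp only:)
 qed
 define Delta where "Delta n b = (LBINT x. w x * plateau (N n) a b x)" for n b
 have step1: "un n b = un n a + Delta n b" if b: "a <= b" for n b
 proof -
  have d: "deriv (plateau (N n) a b) x = k n a x - k n b x" for x
   using DERIV_imp_deriv[OF plateau_has_derivative] by (simp add: k_def)
  have "(LBINT x. u x * deriv (plateau (N n) a b) x) = - (LBINT x. w x * plateau (N n) a b x)"
  proof (rule test[where K = "{a - 1 / N n..b + 1 / N n}"])
   show "smooth_on UNIV (plateau (N n) a b)" using Np[of n] by (intro smooth_plateau) simp
   show "{a - 1 / N n..b + 1 / N n} \<subseteq> {R<..}" using aR inv[of n] by auto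
  qed (use plateau_support[OF Np b] in auto)
  then show ?thesis unfolding d right_diff_distrib un_def Delta_def
   using iuk[of a n] iuk[OF b, of n] by simp
 qed
 define U where "U b = (LBINT y. w y * indicator {a..b} y)" for b
 have wN: "set_integrable lborel {a - 1 / N0..b + 1 / N0} w" for b by (rule w[OF aR])
 have limDelta: "(%n. Delta n b) \<longlonglongrightarrow> U b" if "a <= b" for b
  unfolding Delta_def U_def by (rule plateau_integral_tendsto(1)[OF N N0' that wN])
 have bdDelta: "\<bar>Delta n b\<bar> <= (LBINT x. \<bar>w x * indicator {a - 1 / N0..d + 1 / N0} x\<bar>)" if "a <= b" "b <= d" for n b d
 proof -
  have "\<bar>Delta n b\<bar> <= (LBINT x. \<bar>w x * indicator {a - 1 / N0..b + 1 / N0} x\<bar>)"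
   unfolding Delta_def by (rule plateau_integral_tendsto(2)[OF N N0' that(1) wN])
  also have "... <= (LBINT x. \<bar>w x * indicator {a - 1 / N0..d + 1 / N0} x\<bar>)"
   by (rule integral_mono) (use loc[OF w aR] that in \<open>auto intro: integrable_abs split: split_indicator\<close>)
  finally show ?thesis .
 qed
 \<comment> \<open>The value \<open>un n a\<close> is independent of \<open>b\<close>, so
   integrating \<open>step1\<close> over \<open>b\<close> in \<open>[c, d]\<close> isolates it; the
   other two terms have known limits.\<close>
 have key: "(%n. (d - c) * un n a) \<longlonglongrightarrow> (LBINT x. u x * indicator {c..d} x) - (LBINT b. U b * indicator {c..d} b)"
  and Ui: "integrable lborel (%b. U b * indicator {c..d} b)"
  if c: "a <= c" and cd: "c < d" for c d
 proof -
  define v where "v x = u x * indicator {a - 1 / N0..d + 1 / N0} x" for x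
  have v: "integrable lborel v" unfolding v_def by (rule loc[OF u aR])
  have [measurable]: "v \<in> borel_measurable borel" using v by simp
  have uv: "u x * k n b x = v x * k n b x" if "b \<in> {c..d}" for n b x
  proof (cases "x \<in> {b - 1 / N0..b + 1 / N0}")
   case True
   then have "x \<in> {a - 1 / N0..d + 1 / N0}" using that c by simp
   then show ?thesis by (simp add: v_def)
  qed (simp add: k_supp)
  have un_eq: "un n b * indicator {c..d} b = (LBINT x. v x * (k n b x * indicator {c..d} b))" for n b
  proof (cases "b \<in> {c..d}")
   case True
   then show ?thesis unfolding un_def uv[OF True] by simp
  qed simp
  have pair: "integrable lborel2 (%(x, b). v x * (k n b x * indicator {c..d} b))" for n
  proof (rule integrable_dom[OF integrable_pair_mult[OF v, of "%b. N n * B * indicator {c..d} b"]])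
   show "AE z in lborel2. norm (case z of (x, b) => v x * (k n b x * indicator {c..d} b))
     <= norm (case z of (x, b) => v x * (N n * B * indicator {c..d} b))"
    using k_bd[of n] B(1) Np[of n] by (auto simp: abs_mult intro!: mult_left_mono mult_right_mono AE_I2)
  qed (auto simp: k_def)
  \<comment> \<open>Integrating a mollifier over its centre produces a plateau, so the averaged
    values of \<open>u\<close> are again integrals against plateaus.\<close>
  have inner: "(LBINT b. k n b x * indicator {c..d} b) = plateau (N n) c d x" for n x
  proof -
   have "((%b. - smooth_step (N n * (x - b))) has_real_derivative k n b x) (at b)" for b
   proof -
    have "((%b. smooth_step (N n * (x - b))) has_real_derivative unit_mollifier (N n * (x - b)) * (- N n)) (at b)"
     by (rule DERIV_chain2[OF smooth_step_has_derivative]) (auto intro!: derivative_eq_intros)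
    from DERIV_minus[OF this] show ?thesis by (simp add: k_def mult.commute)
   qed
   moreover have "isCont (%b. k n b x) b" for b
   proof -
    have 1: "isCont (%b. N n * (x - b)) b" by (intro continuous_intros)
    have 2: "isCont unit_mollifier (N n * (x - b))" by (rule schwartz_isCont[OF schwartz_mollifier]) simp
    show ?thesis unfolding k_def by (intro continuous_mult continuous_const isCont_o2[OF 1 2])
   qed
   ultimately have "(LBINT b. k n b x * indicator {c..d} b) = - smooth_step (N n * (x - d)) - - smooth_step (N n * (x - c))"
    using cd by (intro integral_FTC_Icc_real) auto
   then show ?thesis by (simp add: plateau_def)
  qed
  have "(LBINT b. un n b * indicator {c..d} b) = (LBINT x. (LBINT b. v x * (k n b x * indicator {c..d} b)))" for n
   unfolding un_eq by (rule lborel_pair.Fubini_integral[OF pair])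
  then have Iun: "(LBINT b. un n b * indicator {c..d} b) = (LBINT x. v x * plateau (N n) c d x)" for n
   by (simp add: inner)
  have iun: "integrable lborel (%b. un n b * indicator {c..d} b)" for n
   unfolding un_eq using lborel_pair.integrable_snd[OF pair[of n]] by simp
  have vset: "set_integrable lborel {c - 1 / N0..d + 1 / N0} v"
   unfolding set_integrable_def using v by (intro integrable_mult_indicator) auto
  have vi: "v x * indicator {c..d} x = u x * indicator {c..d} x" for x
  proof (cases "x \<in> {c..d}")
   case True
   have "0 < 1 / N0" using N0' by simp
   then have "x \<in> {a - 1 / N0..d + 1 / N0}" using True c unfolding atLeastAtMost_iff by linarith
   then show ?thesis by (simp add: v_def)
  qed simp
  have L1: "(%n. (LBINT b. un n b * indicator {c..d} b)) \<longlonglongrightarrow> (LBINT x. u x * indicator {c..d} x)"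
   unfolding Iun vi[symmetric] using cd by (intro plateau_integral_tendsto(1)[OF N N0' _ vset]) simp
  have Deltaeq: "Delta n b * indicator {c..d} b = un n b * indicator {c..d} b - un n a * indicator {c..d} b" for n b
   using step1[of b n] c by (auto simp: indicator_def)
  have iDelta: "integrable lborel (%b. Delta n b * indicator {c..d} b)" for n
   unfolding Deltaeq using iun by (intro Bochner_Integration.integrable_diff integrable_mult_right) auto
  define Bd where "Bd = (LBINT x. \<bar>w x * indicator {a - 1 / N0..d + 1 / N0} x\<bar>)"
  have lim: "(%n. Delta n b * indicator {c..d} b) \<longlonglongrightarrow> U b * indicator {c..d} b" for b
  proof (cases "b \<in> {c..d}")
   case True
   then show ?thesis using limDelta[of b] c by simp
  qed simp
  have bd: "norm (Delta n b * indicator {c..d} b) <= Bd * indicator {c..d} b" for n b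
   using bdDelta[of b d n] c by (auto simp: Bd_def indicator_def)
  have Um: "(%b. U b * indicator {c..d} b) \<in> borel_measurable lborel"
   by (rule borel_measurable_LIMSEQ_metric[OF _ lim]) (use iDelta in auto)
  have L2: "(%n. (LBINT b. Delta n b * indicator {c..d} b)) \<longlonglongrightarrow> (LBINT b. U b * indicator {c..d} b)"
   by (rule integral_dominated_convergence[where w = "%b. Bd * indicator {c..d} b"])
    (use Um iDelta lim bd in auto)
  show "integrable lborel (%b. U b * indicator {c..d} b)"
   by (rule integrable_dominated_convergence[where w = "%b. Bd * indicator {c..d} b" and s = "%n b. Delta n b * indicator {c..d} b"])
    (use Um iDelta lim bd in auto)
  have "(d - c) * un n a = (LBINT b. un n b * indicator {c..d} b) - (LBINT b. Delta n b * indicator {c..d} b)" for n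
  proof -
   have "(LBINT b. Delta n b * indicator {c..d} b) = (LBINT b. un n b * indicator {c..d} b) - (LBINT b. un n a * indicator {c..d} b)"
    unfolding Deltaeq using iun by (intro Bochner_Integration.integral_diff integrable_mult_right) auto
   also have "(LBINT b. un n a * indicator {c..d} b) = (d - c) * un n a" using cd by simp
   finally show ?thesis by simp
  qed
  then show "(%n. (d - c) * un n a) \<longlonglongrightarrow> (LBINT x. u x * indicator {c..d} x) - (LBINT b. U b * indicator {c..d} b)"
   using tendsto_diff[OF L1 L2] by simp
 qed
 define kappa where "kappa = (LBINT x. u x * indicator {a..a + 1} x) - (LBINT b. U b * indicator {a..a + 1} b)"
 have limkappa: "(%n. un n a) \<longlonglongrightarrow> kappa" using key(1)[of a "a + 1"] by (simp add: kappa_def)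
 have "AE s in lborel. a < s --> u s - kappa - U s = 0"
 proof (rule AE_eq_0_of_interval_integrals)
  fix c d assume c: "a < c"
  have iu: "integrable lborel (%x. u x * indicator {c..d} x)" by (rule loc[OF u]) (use a c in auto)
  have iU: "integrable lborel (%x. U x * indicator {c..d} x)" 
  proof (cases "c < d")
   case True
   then show ?thesis using Ui[of c d] c by simp
  next
   case False
   have "integrable lborel (%x. (U x * indicator {c..c + 1} x) * indicator {c..d} x)"
    by (rule integrable_real_mult_indicator) (use Ui[of c "c + 1"] c in auto)
   moreover have "(U x * indicator {c..c + 1} x) * indicator {c..d} x = U x * indicator {c..d} x" for x
    using False by (auto split: split_indicator)
   ultimately show ?thesis by simp
  qed
  have i: "integrable lborel (%x. u x * indicator {c..d} x - kappa * indicator {c..d} x - U x * indicator {c..d} x)"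
   using iu iU by (intro Bochner_Integration.integrable_diff integrable_mult_right) auto
  then show "set_integrable lborel {c..d} (%s. u s - kappa - U s)"
   unfolding set_integrable_def by (simp add: algebra_simps)
  assume cd: "c < d"
  have "(%n. (d - c) * un n a) \<longlonglongrightarrow> (d - c) * kappa" by (intro tendsto_intros limkappa)
  from LIMSEQ_unique[OF this key(1)[of c d]]
  have "(d - c) * kappa = (LBINT x. u x * indicator {c..d} x) - (LBINT b. U b * indicator {c..d} b)" using c cd by simp
  moreover have "(LBINT x. (u x - kappa - U x) * indicator {c..d} x)
    = (LBINT x. u x * indicator {c..d} x - kappa * indicator {c..d} x - U x * indicator {c..d} x)"
   by (rule Bochner_Integration.integral_cong[OF refl]) (simp add: algebra_simps)
  moreover have "... = (LBINT x. u x * indicator {c..d} x) - (d - c) * kappa - (LBINT b. U b * indicator {c..d} b)"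
   using iu iU cd by simp
  ultimately show "(LBINT x. (u x - kappa - U x) * indicator {c..d} x) = 0" by simp
 qed
 then show ?thesis unfolding U_def by (intro exI[of _ kappa]) (auto elim!: eventually_mono)
qed

lemma indefinite_integral_isCont:
 fixes w :: "real => real"
 assumes w: "\<And>d. integrable lborel (%y. w y * indicator {a..d} y)"
 shows "isCont (%s. (LBINT y. w y * indicator {a..s} y)) s"
proof (rule continuous_at_sequentiallyI)
 fix u assume u: "u \<longlonglongrightarrow> s"
 then obtain B where B: "\<And>n. u n <= B"
 proof -
  obtain K where K: "\<And>n. norm (u n) <= K"
   using convergent_imp_Bseq[OF convergentI[OF u]] unfolding Bseq_def by blast
  have "u n <= K" for n using K[of n] by simp
  then show ?thesis using that by blast
 qed
 define d where "d = max B s"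
 show "(%n. (LBINT y. w y * indicator {a..u n} y)) \<longlonglongrightarrow> (LBINT y. w y * indicator {a..s} y)"
 proof (rule integral_dominated_convergence[where w = "%y. \<bar>w y * indicator {a..d} y\<bar>"])
  have "AE y in lborel. y \<noteq> s" by (rule AE_lborel_singleton)
  then show "AE y in lborel. (%n. w y * indicator {a..u n} y) \<longlonglongrightarrow> w y * indicator {a..s} y"
  proof eventually_elim
   case (elim y)
   have "\<forall>\<^sub>F n in sequentially. (indicator {a..s} y :: real) = indicator {a..u n} y"
   proof (cases "y < s")
    case True
    then have "\<forall>\<^sub>F n in sequentially. y < u n" using u by (rule order_tendstoD(1)[rotated])
    then show ?thesis by eventually_elim (use True in \<open>auto simp: indicator_def\<close>)
   next
    case False
    then have "s < y" using elim by simp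
    then have "\<forall>\<^sub>F n in sequentially. u n < y" using u by (rule order_tendstoD(2)[rotated])
    then show ?thesis by eventually_elim (use \<open>s < y\<close> in \<open>auto simp: indicator_def\<close>)
   qed
   then have "(%n. indicator {a..u n} y) \<longlonglongrightarrow> (indicator {a..s} y :: real)"
    by (rule Lim_transform_eventually[OF tendsto_const])
   then show ?case by (intro tendsto_intros)
  qed
  show "AE y in lborel. norm (w y * indicator {a..u n} y) <= \<bar>w y * indicator {a..d} y\<bar>" for n
   using B[of n] by (intro AE_I2) (auto simp: d_def split: split_indicator)
  show "integrable lborel (%y. \<bar>w y * indicator {a..d} y\<bar>)" using w by (rule integrable_abs)
  show "(%y. w y * indicator {a..u n} y) \<in> borel_measurable lborel" for n using w[of "u n"] by simp
  show "(%y. w y * indicator {a..s} y) \<in> borel_measurable lborel" using w[of s] by simp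
 qed
qed

text \<open>Each weak derivative is a primitive of the next one, so it has a continuous
  representative \<open>U n\<close>, and these are classical derivatives of each other. The
  derivative of order \<open>m + 1\<close> is only essentially bounded and survives as a Lipschitz
  bound for \<open>U m\<close>.\<close>

theorem weak_deriv_chain:
 fixes u :: "real => real" and D :: "nat => real => real"
 assumes wd: "\<And>n. n <= m + 1 ==> weak_deriv_on {R<..} n u (D n)" and a: "R < a"
 obtains U where "AE s in lborel. a < s --> u s = U 0 s"
  and "\<And>n. n <= m ==> AE s in lborel. a < s --> D n s = U n s"
  and "\<And>n s. n < m ==> a < s ==> (U n has_real_derivative U (Suc n) s) (at s)"
  and "\<And>n. n <= m ==> continuous_on UNIV (U n)"
  and "\<And>c d B s s'. a < c ==> (AE s in lborel. s \<in> {c..d} --> \<bar>D (m + 1) s\<bar> <= B) ==>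
   s \<in> {c..d} ==> s' \<in> {c..d} ==> \<bar>U m s - U m s'\<bar> <= B * \<bar>s - s'\<bar>"
proof -
 have loc: "set_integrable lborel {c..d} (D n)" if "n <= m + 1" "R < c" for n c d
  using wd[OF that(1)] that(2) unfolding weak_deriv_on_def by (auto simp: subset_eq)
 have locu: "set_integrable lborel {c..d} u" if "R < c" for c d
  using wd[of 0] that unfolding weak_deriv_on_def by (auto simp: subset_eq)
 have test: "(LBINT x. u x * (deriv ^^ n) phi x) = (-1) ^ n * (LBINT x. D n x * phi x)"
  if "n <= m + 1" "smooth_on UNIV phi" "compact K" "K \<subseteq> {R<..}" "\<And>x. x \<notin> K ==> phi x = 0" for n phi K
  using wd[OF that(1)] that(2-) unfolding weak_deriv_on_def by blast
 have "\<exists>kappa. AE s in lborel. a < s --> D n s = kappa + (LBINT y. D (Suc n) y * indicator {a..s} y)" if n: "n <= m" for n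
 \<comment> \<open>The derivative of a test function is again a test function. Inserting it at order
   \<open>n\<close> and comparing with order \<open>n + 1\<close> shows that
   \<open>D (Suc n)\<close> is the weak derivative of \<open>D n\<close>.\<close>
 proof (rule du_bois_reymond[OF _ _ _ a])
  fix phi :: "real => real" and K
  assume phi: "smooth_on UNIV phi" and K: "compact K" "K \<subseteq> {R<..}" "\<And>x. x \<notin> K ==> phi x = 0"
  have d0: "deriv phi x = 0" if "x \<notin> K" for x
  proof -
   have "\<forall>\<^sub>F y in nhds x. phi y = 0"
    using K that compact_imp_closed[OF K(1)] unfolding eventually_nhds by (intro exI[of _ "- K"]) auto
   then have "deriv phi x = deriv (%_. 0) x" by (intro deriv_cong_ev) auto
   then show ?thesis by simp
  qed
  have "(LBINT x. u x * (deriv ^^ n) (deriv phi) x) = (-1) ^ n * (LBINT x. D n x * deriv phi x)"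
   by (rule test[OF _ smooth_real_deriv(1)[OF phi] K(1,2) d0]) (use n in auto)
  moreover have "(LBINT x. u x * (deriv ^^ Suc n) phi x) = (-1) ^ Suc n * (LBINT x. D (Suc n) x * phi x)"
   by (rule test[OF _ phi K]) (use n in auto)
  moreover have "(deriv ^^ Suc n) phi = (deriv ^^ n) (deriv phi)" by (simp only: funpow_Suc_right o_apply)
  ultimately have "(-1) ^ n * (LBINT x. D n x * deriv phi x) = (-1) ^ n * (- (LBINT x. D (Suc n) x * phi x))"
   by simp
  then show "(LBINT x. D n x * deriv phi x) = - (LBINT x. D (Suc n) x * phi x)"
   by (subst (asm) mult_left_cancel) auto
 qed (use loc n in auto)
 then obtain kappa where kappa: "\<And>n. n <= m ==> AE s in lborel. a < s --> D n s = kappa n + (LBINT y. D (Suc n) y * indicator {a..s} y)"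
  by metis
 define U where "U n s = kappa n + (LBINT y. D (Suc n) y * indicator {a..s} y)" for n s
 have Di: "integrable lborel (%y. D n y * indicator {a..d} y)" if "n <= m + 1" for n d
  using loc[OF that a, of d] unfolding set_integrable_def by (simp add: mult.commute)
 have cont: "isCont (U n) s" if "n <= m" for n s
  unfolding U_def by (intro continuous_intros indefinite_integral_isCont Di) (use that in simp)
 show thesis
 proof (rule that[of U])
  show DU: "AE s in lborel. a < s --> D n s = U n s" if "n <= m" for n
   using kappa[OF that] unfolding U_def .
  show "AE s in lborel. a < s --> u s = U 0 s"
  proof -
   \<comment> \<open>Order 0 of the hypothesis identifies \<open>u\<close> with \<open>D 0\<close>
     only through smooth tests; plateaus approximating indicators make this an identity almost
     everywhere.\<close>
   have "AE s in lborel. R < s --> u s - D 0 s = 0"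
   proof (rule AE_eq_0_of_interval_integrals)
    fix c d assume c: "R < c"
    have i: "set_integrable lborel {c..d} (%s. u s - D 0 s)" if "R < c" for c d
     using locu[OF that] loc[OF _ that, of 0] by (intro set_integral_diff(1)) auto
    then show "set_integrable lborel {c..d} (%s. u s - D 0 s)" using c by blast
    assume cd: "c < d"
    define N0 where "N0 = 1 / (c - R) + 1"
    have N0: "N0 > 1" using c by (simp add: N0_def)
    have "(c - R) * N0 = 1 + (c - R)" using c by (simp add: N0_def distrib_left)
    then have "1 / N0 < c - R" using c N0 by (simp add: pos_divide_less_eq)
    then have cR: "R < c - 1 / N0" by simp
    define N where "N n = real n + N0" for n :: nat
    have N: "filterlim N at_top sequentially" "\<And>n. N0 <= N n"
     unfolding N_def using N0 by (auto intro!: filterlim_at_top_mono[OF filterlim_real_sequentially] always_eventually)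
    have N0': "0 < N0" using N0 by simp
    note pt = plateau_integral_tendsto[OF N N0' less_imp_le[OF cd]]
    have "(LBINT x. (u x - D 0 x) * plateau (N n) c d x) = 0" for n
    proof -
     have Np: "N n > 0" using N(2)[of n] N0 by simp
     have inv: "1 / N n <= 1 / N0" using N(2)[of n] N0 by (intro frac_le) auto
     have "(LBINT x. u x * (deriv ^^ 0) (plateau (N n) c d) x) = (-1) ^ 0 * (LBINT x. D 0 x * plateau (N n) c d x)"
     proof (rule test[where K = "{c - 1 / N n..d + 1 / N n}"])
      show "smooth_on UNIV (plateau (N n) c d)" using Np by (intro smooth_plateau) simp
      show "{c - 1 / N n..d + 1 / N n} \<subseteq> {R<..}" using cR inv by auto
     qed (use plateau_support[OF Np less_imp_le[OF cd]] in auto)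
     moreover have "integrable lborel (%x. u x * plateau (N n) c d x)" "integrable lborel (%x. D 0 x * plateau (N n) c d x)"
      by (intro pt(3) locu loc cR; simp)+
     ultimately show ?thesis by (simp add: left_diff_distrib)
    qed
    moreover have "(%n. (LBINT x. (u x - D 0 x) * plateau (N n) c d x)) \<longlonglongrightarrow> (LBINT x. (u x - D 0 x) * indicator {c..d} x)"
     by (rule pt(1)[OF i[OF cR]])
    ultimately show "(LBINT x. (u x - D 0 x) * indicator {c..d} x) = 0"
     by (simp add: LIMSEQ_const_iff)
   qed
   moreover have "AE s in lborel. a < s --> D 0 s = U 0 s" by (rule DU) simp
   ultimately show ?thesis by eventually_elim (use a in auto)
  qed
  show "continuous_on UNIV (U n)" if "n <= m" for n
   using cont[OF that] by (simp add: continuous_at_imp_continuous_on)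
  show "(U n has_real_derivative U (Suc n) s) (at s)" if n: "n < m" and s: "a < s" for n s
  proof -
   have c: "continuous_on S (U (Suc n))" for S
    using cont[of "Suc n"] n by (simp add: continuous_at_imp_continuous_on)
   have eq: "U n x = kappa n + integral {a..x} (U (Suc n))" if "a <= x" for x
   proof -
    have ae: "AE s in lborel. a < s --> D (Suc n) s = U (Suc n) s" by (rule DU) (use n in simp)
    have [measurable]: "U (Suc n) \<in> borel_measurable borel" by (rule borel_measurable_continuous_onI[OF c])
    have "AE y in lborel. y \<noteq> a" by (rule AE_lborel_singleton)
    with ae have "AE y in lborel. D (Suc n) y * indicator {a..x} y = indicator {a..x} y *R U (Suc n) y"
     by eventually_elim (auto split: split_indicator)
    then have "(LBINT y. D (Suc n) y * indicator {a..x} y) = (LBINT y. indicator {a..x} y *R U (Suc n) y)"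
     by (rule integral_cong_AE[rotated 2]) (use Di[of "Suc n" x] n in auto)
    also have "... = integral {a..x} (U (Suc n)) - integral {a..a} (U (Suc n))"
     by (rule integral_FTC_atLeastAtMost[OF that integral_has_vector_derivative[OF c] c]) auto
    finally show ?thesis by (simp add: U_def)
   qed
   have "((%x. integral {a..x} (U (Suc n))) has_real_derivative U (Suc n) s) (at s within {a..s + 1})"
    by (rule integral_has_real_derivative[OF c]) (use s in auto)
   then have 1: "((%x. kappa n + integral {a..x} (U (Suc n))) has_real_derivative U (Suc n) s) (at s)"
    using s by (subst (asm) at_within_Icc_at) (auto intro!: derivative_eq_intros)
   have "\<forall>\<^sub>F x in nhds s. U n x = kappa n + integral {a..x} (U (Suc n))"
    using s eq unfolding eventually_nhds by (intro exI[of _ "{a<..}"]) auto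
   then show ?thesis using 1 by (subst DERIV_cong_ev[OF refl _ refl])
  qed
  fix c d B s s'
  assume c: "a < c" and ae: "AE s in lborel. s \<in> {c..d} --> \<bar>D (m + 1) s\<bar> <= B"
  have le: "\<bar>U m s - U m s'\<bar> <= B * (s - s')" if s: "s \<in> {c..d}" "s' \<in> {c..d}" "s' <= s" for s s'
  proof -
   have i: "integrable lborel (%y. D (Suc m) y * indicator {a..s} y)" "integrable lborel (%y. D (Suc m) y * indicator {a..s'} y)"
    by (rule Di; simp)+
   have eq: "D (Suc m) y * indicator {a..s} y - D (Suc m) y * indicator {a..s'} y = D (Suc m) y * indicator {s'<..s} y" for y
    using c s by (auto split: split_indicator)
   have "U m s - U m s' = (LBINT y. D (Suc m) y * indicator {s'<..s} y)"
    unfolding U_def using Bochner_Integration.integral_diff[OF i] by (simp add: eq)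
   also have "norm ... <= (LBINT y. B * indicator {s'<..s} y)"
   proof (rule order_trans[OF integral_norm_bound], rule integral_mono_AE)
    show "integrable lborel (%y. norm (D (Suc m) y * indicator {s'<..s} y))"
     using Bochner_Integration.integrable_diff[OF i] unfolding eq by (rule integrable_norm)
    show "integrable lborel (%y. B * indicator {s'<..s} y)"
     by (intro integrable_mult_right integrable_real_indicator) (auto simp: s)
    show "AE y in lborel. norm (D (Suc m) y * indicator {s'<..s} y) <= B * indicator {s'<..s} y"
     using ae by eventually_elim (use s in \<open>auto split: split_indicator\<close>)
   qed
   also have "... = B * (s - s')" using s by simp
   finally show ?thesis by simp
  qed
  assume "s \<in> {c..d}" "s' \<in> {c..d}"
  then show "\<bar>U m s - U m s'\<bar> <= B * \<bar>s - s'\<bar>"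
   using le[of s s'] le[of s' s] by (cases "s' <= s") (auto simp: abs_minus_commute)
 qed
qed

section \<open>Decay of the kernel of a differentiable multiplier\<close>

text \<open>Amplitudes that arise when \<open>U (norm xi) * a rho xi\<close> is differentiated along
  \<open>b\<close>: the chain rule brings the factor \<open>(xi \<bullet> b) / norm xi\<close>,
  whose own derivative involves \<open>inverse (norm xi)\<close>. The shift \<open>rho\<close>
  remains a parameter, so that all bounds are uniform in it.\<close>

inductive symb :: "'a::euclidean_space => 'a => real => (real => 'a => real) => bool" for b e delta where
 base: "radial_sum delta f ==> symb b e delta (%rho xi. f (xi - rho *R e))"
| dir: "symb b e delta a ==> symb b e delta (%rho xi. (xi \<bullet> b) / norm xi * a rho xi)"
| inv: "symb b e delta a ==> symb b e delta (%rho xi. inverse (norm xi) * a rho xi)"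
| scale: "symb b e delta a ==> symb b e delta (%rho xi. c * a rho xi)"
| add: "symb b e delta a ==> symb b e delta a' ==> symb b e delta (%rho xi. a rho xi + a' rho xi)"

lemma norm_has_derivative_along:
 fixes xi b :: "'a::euclidean_space"
 assumes "xi \<noteq> 0"
 shows "((%s. norm (xi + s *R b)) has_real_derivative (xi \<bullet> b) / norm xi) (at 0)"
proof -
 have n: "norm (xi + s *R b) = sqrt ((norm xi)^2 + 2 * s * (xi \<bullet> b) + s^2 * (b \<bullet> b))" for s
  unfolding norm_eq_sqrt_inner by (simp add: inner_add inner_commute power2_eq_square algebra_simps)
 have "((%s. sqrt ((norm xi)^2 + 2 * s * (xi \<bullet> b) + s^2 * (b \<bullet> b))) has_real_derivative (xi \<bullet> b) / norm xi) (at 0)"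
  using assms by (auto intro!: derivative_eq_intros simp: field_simps)
 then show ?thesis unfolding n .
qed

lemma symb_derivative:
 fixes b e :: "'a::euclidean_space"
 assumes "symb b e delta a" and b: "b \<in> Basis"
 shows "\<exists>a'. symb b e delta a' \<and> (\<forall>rho xi. xi \<noteq> 0 --> ((%s. a rho (xi + s *R b)) has_real_derivative a' rho xi) (at 0))"
 using assms(1)
proof (induction rule: symb.induct)
 case (base f)
 obtain f' where f': "\<And>x. (f has_derivative (%b. f' b x)) (at x)" "\<And>b. radial_sum delta (f' b)"
  using radial_sum_derivative[OF base] by blast
 have "((%s. f (xi + s *R b - rho *R e)) has_real_derivative f' b (xi - rho *R e)) (at 0)" for rho xi
 proof -
  have "f differentiable (at (xi - rho *R e))" using f'(1) unfolding differentiable_def by blast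
  from has_vector_derivative_along[OF this, of b]
  show ?thesis unfolding has_real_derivative_iff_has_vector_derivative dir_deriv_eq[OF f'(1)]
   by (simp add: algebra_simps)
 qed
 then show ?case using symb.base[OF f'(2)[of b], of b e] by blast
next
 case (dir a)
 then obtain a' where a': "symb b e delta a'" "\<And>rho xi. xi \<noteq> 0 ==> ((%s. a rho (xi + s *R b)) has_real_derivative a' rho xi) (at 0)"
  by blast
 let ?n = "%rho xi. inverse (norm xi) * a rho xi + ((- 1) * ((xi \<bullet> b) / norm xi * ((xi \<bullet> b) / norm xi * (inverse (norm xi) * a rho xi))) + (xi \<bullet> b) / norm xi * a' rho xi)"
 have "symb b e delta ?n" by (intro symb.add symb.scale symb.dir symb.inv dir a')
 moreover have "((%s. ((xi + s *R b) \<bullet> b) / norm (xi + s *R b) * a rho (xi + s *R b)) has_real_derivative ?n rho xi) (at 0)" if "xi \<noteq> 0" for rho xi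
 proof -
  have 1: "((%s. (xi + s *R b) \<bullet> b) has_real_derivative 1) (at 0)"
   using b by (auto intro!: derivative_eq_intros simp: inner_add_left)
  have "((%s. ((xi + s *R b) \<bullet> b) / norm (xi + s *R b) * a rho (xi + s *R b)) has_real_derivative
   (1 * norm (xi + 0 *R b) - ((xi + 0 *R b) \<bullet> b) * ((xi \<bullet> b) / norm xi)) / (norm (xi + 0 *R b) * norm (xi + 0 *R b)) * a rho (xi + 0 *R b)
    + a' rho xi * (((xi + 0 *R b) \<bullet> b) / norm (xi + 0 *R b))) (at 0)"
   by (rule DERIV_mult[OF DERIV_divide[OF 1 norm_has_derivative_along[OF that]] a'(2)[OF that]]) (use that in simp)
  then show ?thesis using that by (simp add: field_simps)
 qed
 ultimately show ?case by (intro exI[of _ ?n]) auto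
next
 case (inv a)
 then obtain a' where a': "symb b e delta a'" "\<And>rho xi. xi \<noteq> 0 ==> ((%s. a rho (xi + s *R b)) has_real_derivative a' rho xi) (at 0)"
  by blast
 let ?n = "%rho xi. (- 1) * ((xi \<bullet> b) / norm xi * (inverse (norm xi) * (inverse (norm xi) * a rho xi))) + inverse (norm xi) * a' rho xi"
 have "symb b e delta ?n" by (intro symb.add symb.scale symb.dir symb.inv inv a')
 moreover have "((%s. inverse (norm (xi + s *R b)) * a rho (xi + s *R b)) has_real_derivative ?n rho xi) (at 0)" if "xi \<noteq> 0" for rho xi
 proof -
  have "((%s. inverse (norm (xi + s *R b)) * a rho (xi + s *R b)) has_real_derivative
   - (inverse (norm (xi + 0 *R b)) * ((xi \<bullet> b) / norm xi) * inverse (norm (xi + 0 *R b))) * a rho (xi + 0 *R b)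
    + a' rho xi * inverse (norm (xi + 0 *R b))) (at 0)"
   by (rule DERIV_mult[OF DERIV_inverse'[OF norm_has_derivative_along[OF that]] a'(2)[OF that]]) (use that in simp)
  then show ?thesis using that by (simp add: field_simps)
 qed
 ultimately show ?case by (intro exI[of _ ?n]) auto
next
 case (scale a c)
 then obtain a' where a': "symb b e delta a'" "\<And>rho xi. xi \<noteq> 0 ==> ((%s. a rho (xi + s *R b)) has_real_derivative a' rho xi) (at 0)"
  by blast
 then show ?case by (intro exI[of _ "%rho xi. c * a' rho xi"]) (auto intro: symb.scale DERIV_cmult)
next
 case (add a1 a2)
 then obtain a1' a2' where "symb b e delta a1'" "\<And>rho xi. xi \<noteq> 0 ==> ((%s. a1 rho (xi + s *R b)) has_real_derivative a1' rho xi) (at 0)"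
  and "symb b e delta a2'" "\<And>rho xi. xi \<noteq> 0 ==> ((%s. a2 rho (xi + s *R b)) has_real_derivative a2' rho xi) (at 0)"
  by blast
 then show ?case by (intro exI[of _ "%rho xi. a1' rho xi + a2' rho xi"]) (auto intro: symb.add DERIV_add)
qed

lemma symb_support:
 assumes "symb b e delta a" "0 < delta" "delta <= norm (xi - rho *R e)"
 shows "a rho xi = 0"
 using assms(1) by (induction rule: symb.induct) (use assms(2,3) in \<open>auto intro: radial_sum_support\<close>)

lemma radial_sum_measurable: "radial_sum delta f ==> f \<in> borel_measurable borel"
 using radial_sum_derivative[of delta f]
 by (intro borel_measurable_continuous_onI continuous_at_imp_continuous_on ballI) (blast intro: has_derivative_continuous)

lemma symb_measurable:
 assumes "symb b e delta a"
 shows "a rho \<in> borel_measurable borel"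
 using assms
proof (induction rule: symb.induct)
 case (base f)
 have [measurable]: "f \<in> borel_measurable borel" by (rule radial_sum_measurable[OF base])
 show ?case by measurable
next
 case (dir a)
 note [measurable] = dir(2)
 show ?case by measurable
next
 case (inv a)
 note [measurable] = inv(2)
 show ?case by measurable
next
 case (scale a c)
 note [measurable] = scale(2)
 show ?case by measurable
next
 case (add a a')
 note [measurable] = add(3,4)
 show ?case by measurable
qed

text \<open>Uniformity in \<open>rho\<close> holds because the base functions are only translated,
  and the remaining factors are at most 1 once \<open>norm xi >= 1\<close>.\<close>

lemma symb_bounded:
 fixes b e :: "'a::euclidean_space"
 assumes "symb b e delta a" and b: "b \<in> Basis" and delta: "0 < delta"
 shows "\<exists>C\<ge>0. \<forall>rho xi. 1 <= norm xi --> \<bar>a rho xi\<bar> <= C"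
 using assms(1)
proof (induction rule: symb.induct)
 case (base f)
 obtain f' where f': "\<And>x. (f has_derivative (%b. f' b x)) (at x)" using radial_sum_derivative[OF base] by blast
 have "continuous_on UNIV f" using f' by (intro continuous_at_imp_continuous_on ballI) (blast intro: has_derivative_continuous)
 then have "decays f" by (rule decays_compact_support[where delta = delta]) (use radial_sum_support[OF base delta] delta in auto)
 then obtain C where "C > 0" "\<And>x. norm (f x) <= C / (1 + norm x) ^ 0" using decaysE[of f 0] by metis
 then show ?case by (intro exI[of _ C]) auto
next
 case (dir a)
 then obtain C where C: "C >= 0" "\<And>rho xi. 1 <= norm xi ==> \<bar>a rho xi\<bar> <= C" by blast
 have "\<bar>(xi \<bullet> b) / norm xi * a rho xi\<bar> <= C" if "1 <= norm xi" for rho xi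
 proof -
  have "\<bar>(xi \<bullet> b) / norm xi\<bar> <= 1" using Basis_le_norm[OF b, of xi] that by (simp add: divide_le_eq_1)
  then have "\<bar>(xi \<bullet> b) / norm xi\<bar> * \<bar>a rho xi\<bar> <= 1 * C" using C(2)[OF that] by (intro mult_mono) auto
  then show ?thesis by (simp add: abs_mult)
 qed
 then show ?case using C(1) by blast
next
 case (inv a)
 then obtain C where C: "C >= 0" "\<And>rho xi. 1 <= norm xi ==> \<bar>a rho xi\<bar> <= C" by blast
 have "\<bar>inverse (norm xi) * a rho xi\<bar> <= C" if "1 <= norm xi" for rho xi
 proof -
  have "inverse (norm xi) * \<bar>a rho xi\<bar> <= 1 * C" using C(2)[OF that] that by (intro mult_mono) (auto simp: inverse_le_1_iff)
  then show ?thesis using that by (simp add: abs_mult)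
 qed
 then show ?case using C(1) by blast
next
 case (scale a c)
 then obtain C where C: "C >= 0" "\<And>rho xi. 1 <= norm xi ==> \<bar>a rho xi\<bar> <= C" by blast
 then show ?case by (intro exI[of _ "\<bar>c\<bar> * C"]) (auto simp: abs_mult intro: mult_left_mono)
next
 case (add a a')
 then obtain C C' where C: "C >= 0" "\<And>rho xi. 1 <= norm xi ==> \<bar>a rho xi\<bar> <= C"
  and C': "C' >= 0" "\<And>rho xi. 1 <= norm xi ==> \<bar>a' rho xi\<bar> <= C'" by blast
 have "\<bar>a rho xi + a' rho xi\<bar> <= C + C'" if "1 <= norm xi" for rho xi
  using C(2)[OF that, of rho] C'(2)[OF that, of rho] by linarith
 then show ?case using C(1) C'(1) by (intro exI[of _ "C + C'"]) auto
qed

lemma near_annulus: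
 fixes e :: "'a::real_normed_vector"
 assumes "norm e = 1" "0 <= rho" "norm (xi - rho *R e) <= d"
 shows "rho - d <= norm xi" "norm xi <= rho + d"
proof -
 have "\<bar>norm xi - norm (rho *R e)\<bar> <= d" using norm_triangle_ineq3[of xi "rho *R e"] assms(3) by linarith
 then show "rho - d <= norm xi" "norm xi <= rho + d" using assms(1,2) by auto
qed

text \<open>The radius 2 leaves room for the support radius 1/2 and for a displacement by at most
  one unit along a basis vector.\<close>

definition ball_ind :: "'a::euclidean_space => 'a => real" where
 "ball_ind c xi = indicator (cball 0 2) (xi - c)"

lemma
 fixes c :: "'a::euclidean_space"
 shows ball_ind_integrable: "integrable lborel (ball_ind c)"
  and ball_ind_integral: "(LBINT xi. ball_ind c xi) = measure lborel (cball (0::'a) 2)"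
proof -
 have i: "integrable lborel (indicator (cball (0::'a) 2) :: 'a => real)"
  by (intro integrable_real_indicator) (use emeasure_bounded_finite[OF bounded_cball, of "0::'a" 2] in auto)
 show "integrable lborel (ball_ind c)"
  using lborel_integrable_translate[OF i, of "- c"] by (simp add: ball_ind_def[abs_def])
 show "(LBINT xi. ball_ind c xi) = measure lborel (cball (0::'a) 2)"
  using lborel_integral_translate[of "indicator (cball (0::'a) 2) :: 'a => real" "- c"] by (simp add: ball_ind_def)
qed

lemma ball_ind_nonneg: "0 <= ball_ind c xi"
 by (simp add: ball_ind_def)

lemma ball_ind_eq_1: "norm (xi - c) <= 2 ==> ball_ind c xi = 1"
 by (simp add: ball_ind_def)

lemma fourier_norm_le_ball:
 fixes T :: "'a::euclidean_space => real"
 assumes [measurable]: "T \<in> borel_measurable borel" and T: "\<And>xi. \<bar>T xi\<bar> <= M * ball_ind c xi"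
 shows "integrable lborel T" and "norm (fourier_real T x) <= M * measure lborel (cball (0::'a) 2)"
proof -
 show i: "integrable lborel T"
  by (rule integrable_dom[OF integrable_mult_right[OF ball_ind_integrable[of c], of M]])
   (use T in \<open>auto intro!: AE_I2 intro: order_trans[OF _ abs_ge_self]\<close>)
 have "norm (fourier_real T x) <= (LBINT xi. norm (cor (T xi)))"
  by (rule norm_fourier_le) (use i in simp)
 also have "... <= (LBINT xi. M * ball_ind c xi)"
  by (rule integral_mono) (use i T in \<open>auto intro: integrable_mult_right ball_ind_integrable\<close>)
 also have "... = M * measure lborel (cball (0::'a) 2)" by (simp only: integral_mult_right_zero ball_ind_integral)
 finally show "norm (fourier_real T x) <= M * measure lborel (cball (0::'a) 2)" .
qed

lemma symb_product_bound:
 fixes b e :: "'a::euclidean_space"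
 assumes a: "symb b e delta a" and delta: "0 < delta" "delta <= 1 / 2" and e: "norm e = 1"
  and C: "\<And>rho xi. 1 <= norm xi ==> \<bar>a rho xi\<bar> <= C" and rho: "3 <= rho" and m: "0 <= m"
  and u: "\<And>s. s \<in> {rho - 1 / 2..rho + 1 / 2} ==> \<bar>u s\<bar> <= m"
 shows "\<bar>u (norm xi) * a rho xi\<bar> <= m * C * ball_ind (rho *R e) xi"
  and "norm (xi - rho *R e) > 1 / 2 ==> u (norm xi) * a rho xi = 0"
proof -
 show 0: "norm (xi - rho *R e) > 1 / 2 ==> u (norm xi) * a rho xi = 0"
  using symb_support[OF a delta(1), of xi rho] delta(2) by simp
 show "\<bar>u (norm xi) * a rho xi\<bar> <= m * C * ball_ind (rho *R e) xi"
 proof (cases "norm (xi - rho *R e) <= 1 / 2")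
  case True
  have n: "rho - 1 / 2 <= norm xi" "norm xi <= rho + 1 / 2" using near_annulus[OF e _ True] rho by auto
  have "\<bar>u (norm xi)\<bar> * \<bar>a rho xi\<bar> <= m * C"
   using n rho m by (intro mult_mono u C) auto
  then show ?thesis using True by (simp add: abs_mult ball_ind_eq_1)
 next
  case False
  have "1 <= norm (rho *R e)" using rho e by simp
  then have "0 <= C" using C[of "rho *R e" 0] by linarith
  moreover have "u (norm xi) * a rho xi = 0" using 0 False by simp
  ultimately show ?thesis using m ball_ind_nonneg[of "rho *R e" xi] by (simp only: abs_zero mult_nonneg_nonneg)
 qed
qed

text \<open>Each of \<open>n\<close> integrations by parts along \<open>b\<close> gains a factor
  \<open>1 / (x \<bullet> b)\<close>; the Lipschitz bound on the last derivative gains one more by a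
  half-period translation. The constant is chosen before \<open>U\<close>, since the induction step
  applies the hypothesis to the shifted sequence \<open>%k. U (Suc k)\<close>.\<close>

lemma symb_decay:
 fixes b e :: "'a::euclidean_space"
 assumes b: "b \<in> Basis" and e: "norm e = 1" and delta: "0 < delta" "delta <= 1 / 2" and a: "symb b e delta a"
 shows "\<exists>C\<ge>0. \<forall>U rho m alpha x. 3 <= rho --> 0 < alpha --> alpha < rho - 1 / 2 --> 0 <= m -->
  (\<forall>k\<le>n. continuous_on UNIV (U k)) -->
  (\<forall>k<n. \<forall>s>alpha. (U k has_real_derivative U (Suc k) s) (at s)) -->
  (\<forall>k\<le>n. \<forall>s\<in>{rho - 1 / 2..rho + 1 / 2}. \<bar>U k s\<bar> <= m) -->
  (\<forall>s\<in>{rho - 1 / 2..rho + 1 / 2}. \<forall>s'\<in>{rho - 1 / 2..rho + 1 / 2}. \<bar>U n s - U n s'\<bar> <= m * \<bar>s - s'\<bar>) -->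
  1 <= \<bar>x \<bullet> b\<bar> --> \<bar>x \<bullet> b\<bar> ^ (n + 1) * norm (fourier_real (%xi. U 0 (norm xi) * a rho xi) x) <= C * m"
 using a
proof (induction n arbitrary: a)
 case 0
 define V where "V = measure lborel (cball (0::'a) 2)"
 obtain C where C: "C >= 0" "\<And>rho xi. 1 <= norm xi ==> \<bar>a rho xi\<bar> <= C" using symb_bounded[OF 0 b delta(1)] by blast
 obtain a' where a': "symb b e delta a'" "\<And>rho xi. xi \<noteq> 0 ==> ((%s. a rho (xi + s *R b)) has_real_derivative a' rho xi) (at 0)"
  using symb_derivative[OF 0 b] by blast
 obtain C' where C': "C' >= 0" "\<And>rho xi. 1 <= norm xi ==> \<bar>a' rho xi\<bar> <= C'" using symb_bounded[OF a'(1) b delta(1)] by blast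
 show ?case
 proof (intro exI[of _ "(C + C') * V"] conjI allI impI)
  show "0 <= (C + C') * V" using C C' by (simp add: V_def)
  fix U :: "nat => real => real" and rho m alpha :: real and x :: 'a
  assume rho: "3 <= rho" and m: "0 <= m" and cont: "\<forall>k\<le>0. continuous_on UNIV (U k)"
   and bdU: "\<forall>k\<le>0. \<forall>s\<in>{rho - 1 / 2..rho + 1 / 2}. \<bar>U k s\<bar> <= m"
   and lipU: "\<forall>s\<in>{rho - 1 / 2..rho + 1 / 2}. \<forall>s'\<in>{rho - 1 / 2..rho + 1 / 2}. \<bar>U 0 s - U 0 s'\<bar> <= m * \<bar>s - s'\<bar>"
   and x: "1 <= \<bar>x \<bullet> b\<bar>"
  define T where "T xi = U 0 (norm xi) * a rho xi" for xi
  have [measurable]: "U 0 \<in> borel_measurable borel" using cont by (simp add: borel_measurable_continuous_onI)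
  have [measurable]: "a rho \<in> borel_measurable borel" by (rule symb_measurable[OF 0])
  have Tm [measurable]: "T \<in> borel_measurable borel" unfolding T_def by measurable
  have Tb: "\<bar>T xi\<bar> <= m * C * ball_ind (rho *R e) xi" for xi
   unfolding T_def by (rule symb_product_bound(1)[OF 0 delta e C(2) rho m]) (use bdU in auto)
  have T0: "a rho xi = 0" if "norm (xi - rho *R e) > 1 / 2" for xi
   using symb_support[OF 0 delta(1), of xi rho] delta(2) that by simp
  \<comment> \<open>Half a period: the translation by \<open>h *R b\<close> multiplies the transform
    at \<open>x\<close> by -1, so twice the transform is that of a difference of size
    \<open>h\<close>.\<close>
  define h where "h = 1 / (2 * (x \<bullet> b))"
  have h: "\<bar>h\<bar> <= 1 / 2" "h \<noteq> 0" "h * (x \<bullet> b) = 1 / 2" using x by (auto simp: h_def abs_mult field_simps)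
  have lip: "\<bar>a rho (xi + h *R b) - a rho xi\<bar> <= C' * \<bar>h\<bar>" if "norm (xi - rho *R e) <= 1" for xi
  proof -
   have far: "1 <= norm (xi + s *R b)" if "\<bar>s\<bar> <= 1 / 2" for s
   proof -
    have "norm (xi + s *R b - rho *R e) <= norm (xi - rho *R e) + norm (s *R b)"
     using norm_triangle_ineq[of "xi - rho *R e" "s *R b"] by (simp add: algebra_simps)
    also have "... <= 2" using \<open>norm (xi - rho *R e) <= 1\<close> that b by simp
    finally show ?thesis using near_annulus(1)[OF e, of rho "xi + s *R b" 2] rho by simp
   qed
   have "norm (a rho (xi + h *R b) - a rho (xi + 0 *R b)) <= C' * norm (h - 0)"
   proof (rule field_differentiable_bound[where S = "{- 1 / 2..1 / 2}" and f = "%s. a rho (xi + s *R b)" and f' = "%s. a' rho (xi + s *R b)"])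
    fix s :: real assume s: "s \<in> {- 1 / 2..1 / 2}"
    then have s': "\<bar>s\<bar> <= 1 / 2" by auto
    have "xi + s *R b \<noteq> 0" using far[OF s'] by auto
    from a'(2)[OF this, of rho]
    have 1: "((%u. a rho (xi + s *R b + u *R b)) has_real_derivative a' rho (xi + s *R b)) (at (s - s))" by simp
    have 2: "((%u. u - s) has_real_derivative 1) (at s)" by (auto intro!: derivative_eq_intros)
    have "((%u. a rho (xi + u *R b)) has_real_derivative a' rho (xi + s *R b)) (at s)"
     using DERIV_chain2[OF 1 2] by (simp add: algebra_simps)
    then show "((%s. a rho (xi + s *R b)) has_real_derivative a' rho (xi + s *R b)) (at s within {- 1 / 2..1 / 2})"
     by (rule DERIV_subset) simp
    show "norm (a' rho (xi + s *R b)) <= C'" using C'(2) far[OF s'] by simp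
   qed (use h in \<open>auto simp: abs_le_iff\<close>)
   then show ?thesis by simp
  qed
  have diff: "\<bar>T xi - T (xi + h *R b)\<bar> <= (m * (C + C') * \<bar>h\<bar>) * ball_ind (rho *R e) xi" for xi
  proof (cases "norm (xi - rho *R e) <= 1")
   case far: False
   have "norm (xi - rho *R e) <= norm (xi + h *R b - rho *R e) + norm (h *R b)"
    using norm_triangle_ineq4[of "xi + h *R b - rho *R e" "h *R b"] by (simp add: algebra_simps)
   then have "norm (xi + h *R b - rho *R e) > 1 / 2" using far h b by simp
   then have "T xi = 0" "T (xi + h *R b) = 0" using T0 far by (auto simp: T_def)
   then show ?thesis using m C C' by (simp add: ball_ind_nonneg)
  next
   case near: True
   have one: "ball_ind (rho *R e) xi = 1" using near by (intro ball_ind_eq_1) simp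
   note l = lip[OF near]
   have win: "norm eta \<in> {rho - 1 / 2..rho + 1 / 2}" if "a rho eta \<noteq> 0" for eta
   proof -
    have "norm (eta - rho *R e) <= 1 / 2" using T0[of eta] that by force
    then show ?thesis using near_annulus[OF e, of rho eta "1 / 2"] rho by simp
   qed
   have ub: "\<bar>U 0 (norm eta)\<bar> <= m" if "a rho eta \<noteq> 0" for eta using bdU win[OF that] by blast
   have Cb: "\<bar>a rho eta\<bar> <= C" if "a rho eta \<noteq> 0" for eta using C(2)[of eta rho] win[OF that] rho by auto
   \<comment> \<open>\<open>U 0\<close> is controlled only where the amplitude is nonzero. If one of
     the two amplitudes vanishes, the difference of amplitudes alone suffices; otherwise the
     difference of the product is split.\<close>
   have "\<bar>T xi - T (xi + h *R b)\<bar> <= m * (C + C') * \<bar>h\<bar>"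
   proof (cases "a rho xi = 0")
    case True
    show ?thesis
    proof (cases "a rho (xi + h *R b) = 0")
     case nz: False
     have "\<bar>T xi - T (xi + h *R b)\<bar> = \<bar>U 0 (norm (xi + h *R b))\<bar> * \<bar>a rho (xi + h *R b) - a rho xi\<bar>"
      using True by (simp add: T_def abs_mult)
     also have "... <= m * (C' * \<bar>h\<bar>)" using ub[OF nz] l m by (intro mult_mono) auto
     also have "... <= m * (C + C') * \<bar>h\<bar>" using m C by (simp add: algebra_simps)
     finally show ?thesis .
    qed (use True m C C' in \<open>simp add: T_def\<close>)
   next
    case nz: False
    show ?thesis
    proof (cases "a rho (xi + h *R b) = 0")
     case True
     have "\<bar>T xi - T (xi + h *R b)\<bar> = \<bar>U 0 (norm xi)\<bar> * \<bar>a rho (xi + h *R b) - a rho xi\<bar>"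
      using True by (simp add: T_def abs_mult)
     also have "... <= m * (C' * \<bar>h\<bar>)" using ub[OF nz] l m by (intro mult_mono) auto
     also have "... <= m * (C + C') * \<bar>h\<bar>" using m C by (simp add: algebra_simps)
     finally show ?thesis .
    next
     case nz': False
     have "T xi - T (xi + h *R b) = (U 0 (norm xi) - U 0 (norm (xi + h *R b))) * a rho xi
       - U 0 (norm (xi + h *R b)) * (a rho (xi + h *R b) - a rho xi)"
      by (simp add: T_def algebra_simps)
     then have "\<bar>T xi - T (xi + h *R b)\<bar> <= \<bar>U 0 (norm xi) - U 0 (norm (xi + h *R b))\<bar> * \<bar>a rho xi\<bar>
       + \<bar>U 0 (norm (xi + h *R b))\<bar> * \<bar>a rho (xi + h *R b) - a rho xi\<bar>"
      by (simp only: abs_triangle_ineq4 flip: abs_mult)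
     also have "... <= (m * \<bar>h\<bar>) * C + m * (C' * \<bar>h\<bar>)"
     proof (intro add_mono mult_mono l ub[OF nz'] Cb[OF nz])
      have "\<bar>norm xi - norm (xi + h *R b)\<bar> <= norm (h *R b)"
       using norm_triangle_ineq3[of xi "xi + h *R b"] by simp
      also have "... = \<bar>h\<bar>" using b by simp
      finally have "m * \<bar>norm xi - norm (xi + h *R b)\<bar> <= m * \<bar>h\<bar>" using m by (rule mult_left_mono)
      moreover have "\<bar>U 0 (norm xi) - U 0 (norm (xi + h *R b))\<bar> <= m * \<bar>norm xi - norm (xi + h *R b)\<bar>"
       using lipU win[OF nz] win[OF nz'] by blast
      ultimately show "\<bar>U 0 (norm xi) - U 0 (norm (xi + h *R b))\<bar> <= m * \<bar>h\<bar>" by linarith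
     qed (use m C in auto)
     also have "... = m * (C + C') * \<bar>h\<bar>" by (simp add: algebra_simps)
     finally show ?thesis .
    qed
   qed
   then show ?thesis by (simp add: one)
  qed
  have Ti: "integrable lborel T" by (rule fourier_norm_le_ball(1)[OF Tm Tb])
  have Ti': "integrable lborel (%xi. T (xi + h *R b))" by (rule lborel_integrable_translate[OF Ti])
  have "fourier_real (%xi. T (xi + h *R b)) x = cnj (fkernel x (h *R b)) * fourier_real T x"
   by (rule fourier_translate[of "%xi. cor (T xi)"])
  also have "fkernel x (h *R b) = -1"
  proof -
   have "2 * pi * (x \<bullet> h *R b) = 2 * pi * (h * (x \<bullet> b))" by simp
   also have "... = pi" unfolding h(3) by simp
   finally have "fkernel x (h *R b) = cis (- pi)" by (simp only: fkernel_def)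
   then show ?thesis by (simp add: complex_eq_iff)
  qed
  finally have "fourier_real (%xi. T xi - T (xi + h *R b)) x = 2 * fourier_real T x"
   using fourier_diff[of "%xi. cor (T xi)" "%xi. cor (T (xi + h *R b))" x] Ti Ti' by simp
  then have "2 * norm (fourier_real T x) <= (m * (C + C') * \<bar>h\<bar>) * V"
   using fourier_norm_le_ball(2)[OF _ diff, of x] by (simp add: V_def norm_mult)
  then have "\<bar>x \<bullet> b\<bar> * (2 * norm (fourier_real T x)) <= \<bar>x \<bullet> b\<bar> * ((m * (C + C') * \<bar>h\<bar>) * V)"
   by (intro mult_left_mono) auto
  also have "... = m * (C + C') * V * \<bar>h * (x \<bullet> b)\<bar>" by (simp add: abs_mult)
  also have "... <= 2 * ((C + C') * V * m)" unfolding h(3) using m C C' by (simp add: V_def)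
  finally show "\<bar>x \<bullet> b\<bar> ^ (0 + 1) * norm (fourier_real (%xi. U 0 (norm xi) * a rho xi) x) <= (C + C') * V * m"
   unfolding T_def[symmetric] by simp
 qed
next
 case (Suc n)
 obtain a' where a': "symb b e delta a'" "\<And>rho xi. xi \<noteq> 0 ==> ((%s. a rho (xi + s *R b)) has_real_derivative a' rho xi) (at 0)"
  using symb_derivative[OF Suc.prems b] by blast
 define d where "d rho xi = (xi \<bullet> b) / norm xi * a rho xi" for rho xi
 have d: "symb b e delta d" unfolding d_def by (rule symb.dir[OF Suc.prems])
 obtain C where C: "C >= 0" "\<And>rho xi. 1 <= norm xi ==> \<bar>a rho xi\<bar> <= C" using symb_bounded[OF Suc.prems b delta(1)] by blast
 obtain C' where C': "C' >= 0" "\<And>rho xi. 1 <= norm xi ==> \<bar>a' rho xi\<bar> <= C'" using symb_bounded[OF a'(1) b delta(1)] by blast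
 obtain Cd where Cd: "Cd >= 0" "\<And>rho xi. 1 <= norm xi ==> \<bar>d rho xi\<bar> <= Cd" using symb_bounded[OF d b delta(1)] by blast
 from Suc.IH[OF d] obtain C1 where C1: "C1 >= 0" "\<And>U rho m alpha x. 3 <= rho ==> 0 < alpha ==> alpha < rho - 1 / 2 ==> 0 <= m ==>
  (\<forall>k\<le>n. continuous_on UNIV (U k)) ==>
  (\<forall>k<n. \<forall>s>alpha. (U k has_real_derivative U (Suc k) s) (at s)) ==>
  (\<forall>k\<le>n. \<forall>s\<in>{rho - 1 / 2..rho + 1 / 2}. \<bar>U k s\<bar> <= m) ==>
  (\<forall>s\<in>{rho - 1 / 2..rho + 1 / 2}. \<forall>s'\<in>{rho - 1 / 2..rho + 1 / 2}. \<bar>U n s - U n s'\<bar> <= m * \<bar>s - s'\<bar>) ==>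
  1 <= \<bar>x \<bullet> b\<bar> ==> \<bar>x \<bullet> b\<bar> ^ (n + 1) * norm (fourier_real (%xi. U 0 (norm xi) * d rho xi) x) <= C1 * m"
  by blast
 from Suc.IH[OF a'(1)] obtain C2 where C2: "C2 >= 0" "\<And>U rho m alpha x. 3 <= rho ==> 0 < alpha ==> alpha < rho - 1 / 2 ==> 0 <= m ==>
  (\<forall>k\<le>n. continuous_on UNIV (U k)) ==>
  (\<forall>k<n. \<forall>s>alpha. (U k has_real_derivative U (Suc k) s) (at s)) ==>
  (\<forall>k\<le>n. \<forall>s\<in>{rho - 1 / 2..rho + 1 / 2}. \<bar>U k s\<bar> <= m) ==>
  (\<forall>s\<in>{rho - 1 / 2..rho + 1 / 2}. \<forall>s'\<in>{rho - 1 / 2..rho + 1 / 2}. \<bar>U n s - U n s'\<bar> <= m * \<bar>s - s'\<bar>) ==>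
  1 <= \<bar>x \<bullet> b\<bar> ==> \<bar>x \<bullet> b\<bar> ^ (n + 1) * norm (fourier_real (%xi. U 0 (norm xi) * a' rho xi) x) <= C2 * m"
  by blast
 show ?case
 proof (intro exI[of _ "C1 + C2"] conjI allI impI)
  show "0 <= C1 + C2" using C1(1) C2(1) by simp
  fix U :: "nat => real => real" and rho m alpha :: real and x :: 'a
  assume rho: "3 <= rho" and alpha: "0 < alpha" "alpha < rho - 1 / 2" and m: "0 <= m" and cont: "\<forall>k\<le>Suc n. continuous_on UNIV (U k)"
   and der: "\<forall>k<Suc n. \<forall>s>alpha. (U k has_real_derivative U (Suc k) s) (at s)"
   and bdU: "\<forall>k\<le>Suc n. \<forall>s\<in>{rho - 1 / 2..rho + 1 / 2}. \<bar>U k s\<bar> <= m"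
   and lipU: "\<forall>s\<in>{rho - 1 / 2..rho + 1 / 2}. \<forall>s'\<in>{rho - 1 / 2..rho + 1 / 2}. \<bar>U (Suc n) s - U (Suc n) s'\<bar> <= m * \<bar>s - s'\<bar>"
   and x: "1 <= \<bar>x \<bullet> b\<bar>"
  define T where "T xi = U 0 (norm xi) * a rho xi" for xi
  define T1 where "T1 xi = U (Suc 0) (norm xi) * d rho xi" for xi
  define T2 where "T2 xi = U 0 (norm xi) * a' rho xi" for xi
  have [measurable]: "U 0 \<in> borel_measurable borel" "U (Suc 0) \<in> borel_measurable borel"
   using cont by (auto intro: borel_measurable_continuous_onI)
  have [measurable]: "a rho \<in> borel_measurable borel" "a' rho \<in> borel_measurable borel" "d rho \<in> borel_measurable borel"
   by (rule symb_measurable[OF Suc.prems] symb_measurable[OF a'(1)] symb_measurable[OF d])+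
  have m1 [measurable]: "T \<in> borel_measurable borel" "T1 \<in> borel_measurable borel" "T2 \<in> borel_measurable borel"
   unfolding T_def T1_def T2_def by measurable
  have Tb: "\<bar>T xi\<bar> <= m * C * ball_ind (rho *R e) xi" for xi
   unfolding T_def by (rule symb_product_bound(1)[OF Suc.prems delta e C(2) rho m]) (use bdU in auto)
  have T1b: "\<bar>T1 xi\<bar> <= m * Cd * ball_ind (rho *R e) xi" for xi
   unfolding T1_def by (rule symb_product_bound(1)[OF d delta e Cd(2) rho m]) (use bdU in auto)
  have T2b: "\<bar>T2 xi\<bar> <= m * C' * ball_ind (rho *R e) xi" for xi
   unfolding T2_def by (rule symb_product_bound(1)[OF a'(1) delta e C'(2) rho m]) (use bdU in auto)
  have sup: "T xi = 0" "T1 xi = 0" "T2 xi = 0" if "norm (xi - rho *R e) > 1 / 2" for xi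
   using symb_support[OF Suc.prems delta(1), of xi rho] symb_support[OF d delta(1), of xi rho] symb_support[OF a'(1) delta(1), of xi rho] delta(2) that
   by (auto simp: T_def T1_def T2_def)
  have Ti: "integrable lborel T" "integrable lborel T1" "integrable lborel T2"
   by (rule fourier_norm_le_ball(1)[OF m1(1) Tb] fourier_norm_le_ball(1)[OF m1(2) T1b] fourier_norm_le_ball(1)[OF m1(3) T2b])+
  \<comment> \<open>Two regions: beyond radius \<open>alpha\<close> the chain rule applies, and
    within it \<open>T\<close> vanishes near the point, because the support of the amplitude starts
    at radius \<open>rho - 1 / 2 > alpha\<close>. This also avoids the singularity of
    \<open>norm\<close> at 0.\<close>
  have dT: "((%s. T (xi + s *R b)) has_real_derivative T1 xi + T2 xi) (at 0)" for xi
  proof (cases "alpha < norm xi")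
   case True
   then have nz: "xi \<noteq> 0" using alpha(1) by auto
   have 1: "(U 0 has_real_derivative U (Suc 0) (norm (xi + 0 *R b))) (at (norm (xi + 0 *R b)))"
    using der True by simp
   have "((%s. U 0 (norm (xi + s *R b)) * a rho (xi + s *R b)) has_real_derivative
    U (Suc 0) (norm (xi + 0 *R b)) * ((xi \<bullet> b) / norm xi) * a rho (xi + 0 *R b) + a' rho xi * U 0 (norm (xi + 0 *R b))) (at 0)"
    by (rule DERIV_mult[OF DERIV_chain2[OF 1 norm_has_derivative_along[OF nz]] a'(2)[OF nz]])
   then show ?thesis by (simp add: T_def T1_def T2_def d_def mult_ac)
  next
   case False
   have far: "norm (xi - rho *R e) > 1 / 2" if "norm xi < rho - 1 / 2" for xi
   proof (rule ccontr)
    assume "\<not> ?thesis"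
    then show False using near_annulus(1)[OF e, of rho xi "1 / 2"] that rho by simp
   qed
   have "isCont (%s. norm (xi + s *R b)) 0" by (intro continuous_intros)
   then have "((%s. norm (xi + s *R b)) \<longlongrightarrow> norm (xi + 0 *R b)) (nhds 0)"
    unfolding isCont_def by (rule tendsto_at_iff_tendsto_nhds[THEN iffD1])
   then have "\<forall>\<^sub>F s in nhds 0. norm (xi + s *R b) < rho - 1 / 2"
    by (rule order_tendstoD(2)) (use False alpha in simp)
   then have ev: "\<forall>\<^sub>F s in nhds 0. T (xi + s *R b) = 0"
    by eventually_elim (rule sup(1)[OF far])
   have "T1 xi + T2 xi = 0" using sup[OF far[of xi]] False alpha by simp
   then show ?thesis by (subst DERIV_cong_ev[OF refl ev refl]) simp
  qed
  define f where "f xi = cor (T xi) * fkernel x xi" for xi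
  define f' where "f' xi = cor (T1 xi + T2 xi) * fkernel x xi - (2 * pi * \<i> * cor (x \<bullet> b)) * (cor (T xi) * fkernel x xi)" for xi
  have "(LBINT xi. f' xi) = 0"
  proof (rule integral_derivative_eq_0(2)[where f = f and b = b and m = "%xi. (m * Cd + m * C' + 2 * pi * \<bar>x \<bullet> b\<bar> * (m * C)) * ball_ind (rho *R e) xi"])
   show "integrable lborel f" unfolding f_def using Ti by (intro integrable_mult_fkernel) simp
   show "((%s. f (xi + s *R b)) has_vector_derivative f' xi) (at 0)" for xi
   proof -
    have 1: "((%s. cor (T (xi + s *R b))) has_vector_derivative cor (T1 xi + T2 xi)) (at 0)"
     using dT[of xi] by (intro has_vector_derivative_of_real) (simp add: has_real_derivative_iff_has_vector_derivative)
    have 2: "((%s. fkernel x (xi + s *R b)) has_vector_derivative dir_deriv b (fkernel x) xi) (at 0)"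
     by (rule has_vector_derivative_along[OF moderate_differentiable[OF moderate_fkernel]])
    have 3: "dir_deriv b (fkernel x) xi = - (2 * pi * \<i> * cor (x \<bullet> b)) * fkernel x xi"
     by (rule dir_deriv_eq[OF fkernel_has_derivative])
    show ?thesis
     using has_vector_derivative_mult[OF 1 2] unfolding f_def f'_def 3 by (simp add: algebra_simps)
   qed
   show "integrable lborel (%xi. (m * Cd + m * C' + 2 * pi * \<bar>x \<bullet> b\<bar> * (m * C)) * ball_ind (rho *R e) xi)"
    by (intro integrable_mult_right ball_ind_integrable)
   show "norm (f' (xi + s *R b)) <= (m * Cd + m * C' + 2 * pi * \<bar>x \<bullet> b\<bar> * (m * C)) * ball_ind (rho *R e) xi"
    if s: "0 <= s" "s <= 1" for xi s
   proof (cases "norm (xi + s *R b - rho *R e) <= 1 / 2")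
    case True
    have "norm (xi - rho *R e) <= norm (xi + s *R b - rho *R e) + norm (s *R b)"
     using norm_triangle_ineq4[of "xi + s *R b - rho *R e" "s *R b"] by (simp add: algebra_simps)
    also have "... <= 2" using True s b by simp
    finally have one: "ball_ind (rho *R e) xi = 1" by (rule ball_ind_eq_1)
    have one': "ball_ind (rho *R e) (xi + s *R b) = 1" using True by (intro ball_ind_eq_1) simp
    have "norm (f' (xi + s *R b)) <= norm (cor (T1 (xi + s *R b) + T2 (xi + s *R b)) * fkernel x (xi + s *R b))
      + norm ((2 * pi * \<i> * cor (x \<bullet> b)) * (cor (T (xi + s *R b)) * fkernel x (xi + s *R b)))"
     unfolding f'_def by (rule norm_triangle_ineq4)
    also have "... = \<bar>T1 (xi + s *R b) + T2 (xi + s *R b)\<bar> + 2 * pi * \<bar>x \<bullet> b\<bar> * \<bar>T (xi + s *R b)\<bar>"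
     unfolding norm_mult norm_of_real norm_fkernel by simp
    also have "... <= (m * Cd + m * C') + 2 * pi * \<bar>x \<bullet> b\<bar> * (m * C)"
     using Tb[of "xi + s *R b"] T1b[of "xi + s *R b"] T2b[of "xi + s *R b"] unfolding one'
     by (intro add_mono mult_left_mono) auto
    finally show ?thesis by (simp add: one)
   next
    case False
    then have "f' (xi + s *R b) = 0" using sup[of "xi + s *R b"] by (simp add: f'_def)
    then show ?thesis using m C C' Cd by (simp add: ball_ind_nonneg)
   qed
  qed
  moreover have "(LBINT xi. f' xi) = fourier_real (%xi. T1 xi + T2 xi) x - (2 * pi * \<i> * cor (x \<bullet> b)) * fourier_real T x"
  proof -
   have i1: "integrable lborel (%xi. cor (T1 xi + T2 xi) * fkernel x xi)"
    by (rule integrable_mult_fkernel) (use Ti in simp)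
   have i2: "integrable lborel (%xi. cor (T xi) * fkernel x xi)"
    by (rule integrable_mult_fkernel) (use Ti in simp)
   show ?thesis unfolding f'_def fourier_eq
    by (subst Bochner_Integration.integral_diff[OF i1 integrable_mult_right[OF i2]]) (simp only: integral_mult_right_zero)
  qed
  moreover have "fourier_real (%xi. T1 xi + T2 xi) x = fourier_real T1 x + fourier_real T2 x"
   using fourier_add[of "%xi. cor (T1 xi)" "%xi. cor (T2 xi)" x] Ti by simp
  ultimately have eq: "(2 * pi * \<i> * cor (x \<bullet> b)) * fourier_real T x = fourier_real T1 x + fourier_real T2 x"
   by simp
  have "2 * pi * \<bar>x \<bullet> b\<bar> * norm (fourier_real T x) = norm ((2 * pi * \<i> * cor (x \<bullet> b)) * fourier_real T x)"
   by (simp add: norm_mult)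
  also have "... <= norm (fourier_real T1 x) + norm (fourier_real T2 x)" unfolding eq by (rule norm_triangle_ineq)
  finally have "2 * pi * (\<bar>x \<bullet> b\<bar> * norm (fourier_real T x)) <= norm (fourier_real T1 x) + norm (fourier_real T2 x)" by simp
  moreover have "1 * (\<bar>x \<bullet> b\<bar> * norm (fourier_real T x)) <= 2 * pi * (\<bar>x \<bullet> b\<bar> * norm (fourier_real T x))"
   using pi_ge_two by (intro mult_right_mono) auto
  ultimately have "\<bar>x \<bullet> b\<bar> * norm (fourier_real T x) <= norm (fourier_real T1 x) + norm (fourier_real T2 x)" by linarith
  then have "\<bar>x \<bullet> b\<bar> ^ (n + 1) * (\<bar>x \<bullet> b\<bar> * norm (fourier_real T x)) <= \<bar>x \<bullet> b\<bar> ^ (n + 1) * (norm (fourier_real T1 x) + norm (fourier_real T2 x))"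
   by (intro mult_left_mono) auto
  also have "... = \<bar>x \<bullet> b\<bar> ^ (n + 1) * norm (fourier_real T1 x) + \<bar>x \<bullet> b\<bar> ^ (n + 1) * norm (fourier_real T2 x)"
   by (rule distrib_left)
  also have "... <= C1 * m + C2 * m"
  proof (rule add_mono)
   show "\<bar>x \<bullet> b\<bar> ^ (n + 1) * norm (fourier_real T1 x) <= C1 * m"
    unfolding T1_def
    by (rule C1(2)[where U = "%k. U (Suc k)" and alpha = alpha]) (use rho alpha m cont der bdU lipU x in auto)
   \<comment> \<open>In the term where the amplitude is differentiated the sequence \<open>U\<close>
     is not shifted; the bound on \<open>U (Suc n)\<close> supplies the Lipschitz bound required at
     order \<open>n\<close>.\<close>
   have lipn: "\<bar>U n s - U n s'\<bar> <= m * \<bar>s - s'\<bar>" if "s \<in> {rho - 1 / 2..rho + 1 / 2}" "s' \<in> {rho - 1 / 2..rho + 1 / 2}" for s s'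
   proof -
    have "norm (U n s - U n s') <= m * norm (s - s')"
    proof (rule field_differentiable_bound[where S = "{rho - 1 / 2..rho + 1 / 2}" and f' = "U (Suc n)"])
     fix z assume z: "z \<in> {rho - 1 / 2..rho + 1 / 2}"
     show "(U n has_real_derivative U (Suc n) z) (at z within {rho - 1 / 2..rho + 1 / 2})"
      by (rule has_field_derivative_at_within) (use der z alpha in auto)
     show "norm (U (Suc n) z) <= m" using bdU z by auto
    qed (use that in auto)
    then show ?thesis by simp
   qed
   show "\<bar>x \<bullet> b\<bar> ^ (n + 1) * norm (fourier_real T2 x) <= C2 * m"
    unfolding T2_def
    by (rule C2(2)[where U = U and alpha = alpha]) (use rho alpha m cont der bdU lipn x in auto)
  qed
  finally show "\<bar>x \<bullet> b\<bar> ^ (Suc n + 1) * norm (fourier_real (%xi. U 0 (norm xi) * a rho xi) x) <= (C1 + C2) * m"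
   unfolding T_def[symmetric] by (simp add: algebra_simps)
 qed
qed

section \<open>The multiplier estimate for \<open>p < 2\<close> and its combination with the other
  range\<close>

lemma AE_not_in_open:
 fixes S :: "'a::euclidean_space set"
 assumes "AE x in lborel. x \<notin> S" and S: "open S"
 shows "S = {}"
proof (rule ccontr)
 assume "S \<noteq> {}"
 have "S \<in> null_sets lborel"
  using assms by (subst (asm) AE_iff_null_sets[symmetric]) auto
 then have "negligible S" by (simp add: negligible_iff_null_sets null_sets_completionI)
 then show False using open_not_negligible[OF S \<open>S \<noteq> {}\<close>] by simp
qed

lemma AE_continuous_le:
 fixes f :: "'a::euclidean_space => real"
 assumes cont: "continuous_on UNIV f" and S: "open S" and ae: "AE x in lborel. x \<in> S --> f x <= c" and x: "x \<in> S"
 shows "f x <= c"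
proof (rule ccontr)
 assume "\<not> ?thesis"
 then have "x \<in> S \<inter> f -` {c<..}" using x by simp
 moreover have "S \<inter> f -` {c<..} = {}"
 proof (rule AE_not_in_open)
  show "AE x in lborel. x \<notin> S \<inter> f -` {c<..}" using ae by eventually_elim auto
  show "open (S \<inter> f -` {c<..})" 
   by (intro open_Int S open_vimage[OF _ cont]) simp
 qed
 ultimately show False by simp
qed

text \<open>The weak derivatives up to order \<open>d + 1\<close> give decay of order
  \<open>d + 1\<close> in every coordinate direction, hence domination by
  \<open>tensor_weight\<close>, whose powers are integrable for all finite \<open>p >= 1\<close>.
  The condition \<open>R + 3 <= r\<close> keeps the window beyond \<open>R + 1\<close>, where the
  smooth representatives live, and makes \<open>rho >= 3\<close>.\<close>

theorem multiplier_Lp_lt_2: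
 fixes e :: "'a::euclidean_space" and \<sigma> :: "real => ennreal"
 assumes \<sigma>m: "\<sigma> \<in> borel_measurable (restrict_space borel {0..})"
  and delta: "0 < delta" "delta <= 1 / 2" and e: "e \<in> Basis" and p: "1 <= p" "p \<noteq> top"
  and R: "0 <= R" and fin: "AE r in lborel. R < r --> \<sigma> r < top"
  and wd: "\<And>n. n <= DIM('a) + 1 ==> weak_deriv_on {R<..} n (%r. enn2real (\<sigma> r)) (D n)"
 shows "\<exists>C>0. \<forall>r s. R + 3 <= r --> 0 < s -->
  (\<forall>n\<le>DIM('a) + 1. AE x in lborel. x \<in> {r - 1..r + 1} --> \<bar>D n x\<bar> <= s) -->
  (AE x in lborel. x \<in> {r - 1..r + 1} --> \<sigma> x <= ennreal s) \<and>
  Lp_norm p (%x. Re (fourier_real (%xi. enn2real (\<sigma> (norm xi)) * twin_bump delta (r + 1 / 2) e xi) x) *R e) <= ennreal (C * s / (r + 1 / 2))"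
proof -
 let ?d = "DIM('a)"
 have Ra: "R < R + 1" by simp
 obtain U where U0: "AE s in lborel. R + 1 < s --> enn2real (\<sigma> s) = U 0 s"
  and DU: "\<And>n. n <= ?d ==> AE s in lborel. R + 1 < s --> D n s = U n s"
  and der: "\<And>n s. n < ?d ==> R + 1 < s ==> (U n has_real_derivative U (Suc n) s) (at s)"
  and cont: "\<And>n. n <= ?d ==> continuous_on UNIV (U n)"
  and lip: "\<And>c d B s s'. R + 1 < c ==> (AE s in lborel. s \<in> {c..d} --> \<bar>D (?d + 1) s\<bar> <= B) ==>
   s \<in> {c..d} ==> s' \<in> {c..d} ==> \<bar>U ?d s - U ?d s'\<bar> <= B * \<bar>s - s'\<bar>"
  by (rule weak_deriv_chain[OF wd Ra]) (assumption, rule that)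
 define F where "F rho e' = fourier_real (%xi. U 0 (norm xi) * bump delta (xi - rho *R e'))" for rho and e' :: 'a
 have sb: "symb b e' delta (%rho xi. bump delta (xi - rho *R e'))" for b e' :: 'a
  unfolding bump_def by (rule symb.base[OF radial_sum.base])
 \<comment> \<open>Named as a predicate so that constants for both signs of \<open>e\<close> and all
   basis vectors can be chosen at once.\<close>
 define Q where "Q e' b C \<longleftrightarrow> 0 <= C \<and> (\<forall>rho m x. 3 <= rho --> R + 1 < rho - 1 / 2 --> 0 <= m -->
  (\<forall>k\<le>?d. \<forall>s\<in>{rho - 1 / 2..rho + 1 / 2}. \<bar>U k s\<bar> <= m) -->
  (\<forall>s\<in>{rho - 1 / 2..rho + 1 / 2}. \<forall>s'\<in>{rho - 1 / 2..rho + 1 / 2}. \<bar>U ?d s - U ?d s'\<bar> <= m * \<bar>s - s'\<bar>) -->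
  1 <= \<bar>x \<bullet> b\<bar> --> \<bar>x \<bullet> b\<bar> ^ (?d + 1) * norm (F rho e' x) <= C * m)" for e' b C
 have "\<exists>C. Q e' b C" if e': "e' \<in> {e, - e}" and b: "b \<in> Basis" for e' b
 proof -
  have "norm e' = 1" using e e' by auto
  from symb_decay[OF b this delta sb, of ?d]
  obtain C where C: "C >= 0" and C': "\<forall>U rho m alpha x. 3 <= rho --> 0 < alpha --> alpha < rho - 1 / 2 --> 0 <= m -->
   (\<forall>k\<le>?d. continuous_on UNIV (U k)) -->
   (\<forall>k<?d. \<forall>s>alpha. (U k has_real_derivative U (Suc k) s) (at s)) -->
   (\<forall>k\<le>?d. \<forall>s\<in>{rho - 1 / 2..rho + 1 / 2}. \<bar>U k s\<bar> <= m) -->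
   (\<forall>s\<in>{rho - 1 / 2..rho + 1 / 2}. \<forall>s'\<in>{rho - 1 / 2..rho + 1 / 2}. \<bar>U ?d s - U ?d s'\<bar> <= m * \<bar>s - s'\<bar>) -->
   1 <= \<bar>x \<bullet> b\<bar> --> \<bar>x \<bullet> b\<bar> ^ (?d + 1) * norm (fourier_real (%xi. U 0 (norm xi) * bump delta (xi - rho *R e')) x) <= C * m"
   by (elim exE conjE) (rule that)
  have "Q e' b C" unfolding Q_def
  proof (intro conjI allI impI C)
   fix rho m :: real and x :: 'a
   assume "3 <= rho" "R + 1 < rho - 1 / 2" "0 <= m"
    "\<forall>k\<le>?d. \<forall>s\<in>{rho - 1 / 2..rho + 1 / 2}. \<bar>U k s\<bar> <= m"
    "\<forall>s\<in>{rho - 1 / 2..rho + 1 / 2}. \<forall>s'\<in>{rho - 1 / 2..rho + 1 / 2}. \<bar>U ?d s - U ?d s'\<bar> <= m * \<bar>s - s'\<bar>" "1 <= \<bar>x \<bullet> b\<bar>"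
   moreover have "0 < R + 1" using R by simp
   moreover have "\<forall>k\<le>?d. continuous_on UNIV (U k)" "\<forall>k<?d. \<forall>s>R + 1. (U k has_real_derivative U (Suc k) s) (at s)"
    using cont der by auto
   ultimately show "\<bar>x \<bullet> b\<bar> ^ (?d + 1) * norm (F rho e' x) <= C * m"
    unfolding F_def using C'[THEN spec, of U, THEN spec, of rho, THEN spec, of m, THEN spec, of "R + 1", THEN spec, of x] by (simp only:)
  qed
  then show ?thesis by blast
 qed
 then obtain C where QC: "\<And>e' b. e' \<in> {e, - e} ==> b \<in> Basis ==> Q e' b (C e' b)"
  by metis
 have C: "C e' b >= 0" if "e' \<in> {e, - e}" "b \<in> Basis" for e' b
  using QC[OF that] unfolding Q_def by (rule conjunct1)
 have Cb: "\<bar>x \<bullet> b\<bar> ^ (?d + 1) * norm (F rho e' x) <= C e' b * m"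
  if "e' \<in> {e, - e}" "b \<in> Basis" "3 <= rho" "R + 1 < rho - 1 / 2" "0 <= m"
  "\<forall>k\<le>?d. \<forall>s\<in>{rho - 1 / 2..rho + 1 / 2}. \<bar>U k s\<bar> <= m"
  "\<forall>s\<in>{rho - 1 / 2..rho + 1 / 2}. \<forall>s'\<in>{rho - 1 / 2..rho + 1 / 2}. \<bar>U ?d s - U ?d s'\<bar> <= m * \<bar>s - s'\<bar>"
  "1 <= \<bar>x \<bullet> b\<bar>" for e' b rho m x
  using QC[OF that(1,2), unfolded Q_def, THEN conjunct2, THEN spec, of rho, THEN spec, of m, THEN spec, of x] that(3-) by (simp only:)
 define CS where "CS = (\<Sum>e'\<in>{e, - e}. \<Sum>b\<in>Basis. C e' b)"
 have CS: "C e' b <= CS" if "e' \<in> {e, - e}" "b \<in> Basis" for e' b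
 proof -
  have "C e' b <= (\<Sum>b\<in>Basis. C e' b)" using C that by (intro member_le_sum) auto
  also have "... <= CS" unfolding CS_def using C that by (intro member_le_sum[where f = "%e'. \<Sum>b\<in>Basis. C e' b"]) (auto intro: sum_nonneg)
  finally show ?thesis .
 qed
 obtain B where B: "B > 0" "\<And>x :: 'a. norm (bump delta x) <= B" using schwartz_bounded[OF schwartz_bump[OF delta(1)]] by blast
 define V2 where "V2 = measure lborel (cball (0::'a) 2)"
 \<comment> \<open>Covers both regimes below: \<open>CS\<close> for
   \<open>\<bar>x \<bullet> b\<bar> >= 1\<close>, the trivial bound \<open>B * V2\<close> otherwise,
   and \<open>2 ^ (d + 1)\<close> for replacing \<open>1 + \<bar>x \<bullet> b\<bar>\<close>. The
   summand 1 ensures positivity.\<close>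
 define K1 where "K1 = 2 ^ (?d + 1) * (\<bar>CS\<bar> + B * V2 + 1)"
 have K1: "K1 > 0" unfolding K1_def using B by (intro mult_pos_pos add_nonneg_pos) (auto simp: V2_def)
 define Ct where "Ct = K1 * (1 + (LBINT x. tensor_weight (x::'a)))"
 have twI: "0 <= (LBINT x. tensor_weight (x::'a))" by (simp add: tensor_weight_nonneg)
 show ?thesis
 proof (intro exI[of _ Ct] conjI allI impI)
  show "0 < Ct" unfolding Ct_def using K1 twI by (intro mult_pos_pos) auto
  fix r s :: real
  assume r: "R + 3 <= r" and s: "0 < s" and Ds: "\<forall>n\<le>?d + 1. AE x in lborel. x \<in> {r - 1..r + 1} --> \<bar>D n x\<bar> <= s"
  define rho where "rho = r + 1 / 2"
  have rho: "3 <= rho" "R + 1 < rho - 1 / 2" "0 < rho" and win: "{rho - 1 / 2..rho + 1 / 2} = {r..r + 1}" using r R by (auto simp: rho_def)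
  have r0: "0 <= r" using r R by simp
  have D0: "AE x in lborel. x \<in> {r - 1..r + 1} --> \<bar>D 0 x\<bar> <= s" using Ds by simp
  have D0U: "AE x in lborel. R + 1 < x --> D 0 x = U 0 x" by (rule DU) simp
  show \<sigma>s: "AE x in lborel. x \<in> {r - 1..r + 1} --> \<sigma> x <= ennreal s"
   using fin U0 D0U D0
  proof eventually_elim
   case (elim x)
   show ?case
   proof
    assume x: "x \<in> {r - 1..r + 1}"
    then have "\<sigma> x < top" "enn2real (\<sigma> x) <= s" using elim r R by auto
    then show "\<sigma> x <= ennreal s" by (metis ennreal_enn2real ennreal_leI)
   qed
  qed
  have Ub: "\<bar>U n x\<bar> <= s" if n: "n <= ?d" and x: "x \<in> {r..r + 1}" for n x
  proof -
   have Dn: "AE x in lborel. x \<in> {r - 1..r + 1} --> \<bar>D n x\<bar> <= s" using Ds n by simp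
   have "AE x in lborel. x \<in> {r - 1<..<r + 1 + 1 / 2} \<inter> {r - 1<..<r + 1} --> \<bar>U n x\<bar> <= s"
    using DU[OF n] Dn
   proof eventually_elim
    case (elim x)
    then show ?case using n r R by auto
   qed
   then have ae: "AE x in lborel. x \<in> {r - 1<..<r + 1} --> \<bar>U n x\<bar> <= s" by eventually_elim auto
   have c: "continuous_on UNIV (%x. \<bar>U n x\<bar>)" by (intro continuous_intros cont n)
   have le: "\<bar>U n x\<bar> <= s" if "x \<in> {r - 1<..<r + 1}" for x
    by (rule AE_continuous_le[OF c _ ae that]) simp
   show ?thesis
   \<comment> \<open>Almost-everywhere bounds pass to every point of the open window by continuity;
     the right end \<open>r + 1\<close> lies on its boundary and is reached by a limit from the
     left.\<close>
   proof (cases "x = r + 1")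
    case True
    have "(%k. \<bar>U n (x - 1 / real (Suc (Suc k)))\<bar>) \<longlonglongrightarrow> \<bar>U n (x - 0)\<bar>"
    proof (rule isCont_tendsto_compose[where g = "%x. \<bar>U n x\<bar>"])
     show "isCont (%x. \<bar>U n x\<bar>) (x - 0)" using c by (simp add: continuous_on_eq_continuous_at)
     show "(%k. x - 1 / real (Suc (Suc k))) \<longlonglongrightarrow> x - 0"
      by (intro tendsto_diff tendsto_const LIMSEQ_Suc[OF inverse_Suc_tendsto_0])
    qed
    moreover have "\<bar>U n (x - 1 / real (Suc (Suc k)))\<bar> <= s" for k
     by (rule le) (use True in \<open>auto simp: field_simps\<close>)
    ultimately show ?thesis by (intro LIMSEQ_le_const2[where X = "%k. \<bar>U n (x - 1 / real (Suc (Suc k)))\<bar>"]) auto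
   qed (use x le in auto)
  qed
  have Ulip: "\<bar>U ?d x - U ?d y\<bar> <= s * \<bar>x - y\<bar>" if "x \<in> {r..r + 1}" "y \<in> {r..r + 1}" for x y
  proof (rule lip[of r "r + 1"])
   have "AE x in lborel. x \<in> {r - 1..r + 1} --> \<bar>D (?d + 1) x\<bar> <= s" using Ds by blast
   then show "AE x in lborel. x \<in> {r..r + 1} --> \<bar>D (?d + 1) x\<bar> <= s" by eventually_elim auto
  qed (use that r R in auto)
  have [measurable]: "U 0 \<in> borel_measurable borel" using cont[of 0] by (auto intro: borel_measurable_continuous_onI)
  have bm [measurable]: "bump delta \<in> borel_measurable (borel :: 'a measure)" by (rule schwartz_measurable[OF schwartz_bump[OF delta(1)]])
  define T where "T e' xi = U 0 (norm xi) * bump delta (xi - rho *R e')" for e' xi :: 'a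
  have Tm: "T e' \<in> borel_measurable borel" for e' unfolding T_def by measurable
  have Tb: "\<bar>T e' xi\<bar> <= s * B * ball_ind (rho *R e') xi" if "e' \<in> {e, - e}" for e' xi
  proof -
   have n: "norm e' = 1" using e that by auto
   show ?thesis unfolding T_def
    by (rule symb_product_bound(1)[OF sb[of e e'] delta n _ rho(1) less_imp_le[OF s], where C = B])
     (use B(2) Ub[of 0] win in auto)
  qed
  have Ti: "integrable lborel (T e')" if "e' \<in> {e, - e}" for e'
   by (rule fourier_norm_le_ball(1)[OF Tm Tb[OF that]])
  have Fb: "(1 + \<bar>x \<bullet> b\<bar>) ^ (?d + 1) * norm (F rho e' x) <= K1 * s" if e': "e' \<in> {e, - e}" and b: "b \<in> Basis" for e' b x
  proof (cases "1 <= \<bar>x \<bullet> b\<bar>")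
   case True
   have "(1 + \<bar>x \<bullet> b\<bar>) ^ (?d + 1) <= (2 * \<bar>x \<bullet> b\<bar>) ^ (?d + 1)" using True by (intro power_mono) auto
   then have "(1 + \<bar>x \<bullet> b\<bar>) ^ (?d + 1) * norm (F rho e' x) <= (2 * \<bar>x \<bullet> b\<bar>) ^ (?d + 1) * norm (F rho e' x)"
    by (intro mult_right_mono) auto
   also have "... = 2 ^ (?d + 1) * (\<bar>x \<bullet> b\<bar> ^ (?d + 1) * norm (F rho e' x))"
    by (simp only: power_mult_distrib mult.assoc)
   also have "... <= 2 ^ (?d + 1) * (C e' b * s)"
   proof (intro mult_left_mono Cb[OF e' b rho(1,2) less_imp_le[OF s]])
    show "\<forall>k\<le>?d. \<forall>x\<in>{rho - 1 / 2..rho + 1 / 2}. \<bar>U k x\<bar> <= s" using Ub win by auto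
    show "\<forall>x\<in>{rho - 1 / 2..rho + 1 / 2}. \<forall>y\<in>{rho - 1 / 2..rho + 1 / 2}. \<bar>U ?d x - U ?d y\<bar> <= s * \<bar>x - y\<bar>" using Ulip win by auto
   qed (use True in auto)
   also have "... <= 2 ^ (?d + 1) * ((\<bar>CS\<bar> + B * V2 + 1) * s)"
   proof -
    have "0 <= B * V2" using B(1) by (simp add: V2_def)
    then have "C e' b <= \<bar>CS\<bar> + B * V2 + 1" using CS[OF e' b] by linarith
    then show ?thesis using s by (intro mult_left_mono mult_right_mono) auto
   qed
   finally show ?thesis by (simp only: K1_def mult.assoc)
  next
   case False
   have "norm (F rho e' x) <= s * B * V2"
    unfolding F_def V2_def T_def[symmetric] by (rule fourier_norm_le_ball(2)[OF Tm Tb[OF e']])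
   moreover have "(1 + \<bar>x \<bullet> b\<bar>) ^ (?d + 1) <= 2 ^ (?d + 1)" using False by (intro power_mono) auto
   ultimately have "(1 + \<bar>x \<bullet> b\<bar>) ^ (?d + 1) * norm (F rho e' x) <= 2 ^ (?d + 1) * (s * B * V2)"
    by (intro mult_mono) auto
   also have "... <= 2 ^ (?d + 1) * ((\<bar>CS\<bar> + B * V2 + 1) * s)"
    using s by (intro mult_left_mono) (auto simp: algebra_simps)
   finally show ?thesis by (simp only: K1_def mult.assoc)
  qed
  define W where "W = (%xi. enn2real (\<sigma> (norm xi)) * twin_bump delta rho e xi)"
  have Wm [measurable]: "W \<in> borel_measurable borel"
   using radial_measurable[OF \<sigma>m, where 'a = 'a] schwartz_measurable[OF schwartz_twin_bump[OF delta(1), of rho e]]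
   unfolding W_def by measurable
  \<comment> \<open>On the support of the bumps \<open>\<sigma>\<close> agrees almost everywhere
    with the smooth representative \<open>U 0\<close>, so the transform can be computed with the
    latter, one bump at a time.\<close>
  have W_eq: "fourier_real W x = cor (1 / (2 * rho)) * (F rho e x + F rho (- e) x)" for x
  proof -
   have ae: "AE xi in lborel. R + 1 < norm (xi::'a) --> enn2real (\<sigma> (norm xi)) = U 0 (norm xi)"
    by (rule AE_norm) (use U0 in \<open>auto elim: eventually_mono\<close>)
   have "fourier_real W x = fourier (%xi. cor (1 / (2 * rho)) * (cor (T e xi) + cor (T (- e) xi))) x"
    unfolding fourier_eq
   proof (rule integral_cong_AE)
    show "AE xi in lborel. cor (W xi) * fkernel x xi = cor (1 / (2 * rho)) * (cor (T e xi) + cor (T (- e) xi)) * fkernel x xi"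
     using ae
    proof eventually_elim
     case (elim xi)
     have "W xi = (1 / (2 * rho)) * (T e xi + T (- e) xi)"
     proof (cases "twin_bump delta rho e xi = 0")
      case True
      then have "bump delta (xi - rho *R e) + bump delta (xi + rho *R e) = 0" using rho(3) by (simp add: twin_bump_def)
      then have "bump delta (xi - rho *R e) = 0" "bump delta (xi + rho *R e) = 0"
       using bump_nonneg[of delta "xi - rho *R e"] bump_nonneg[of delta "xi + rho *R e"] by linarith+
      then show ?thesis using True by (simp add: W_def T_def)
     next
      case False
      then have "R + 1 < norm xi" using twin_bump_support(1)[OF delta(1) e False rho(3)] rho(2) delta(2) by linarith
      then show ?thesis using elim by (simp add: W_def T_def twin_bump_def algebra_simps add_divide_distrib)
     qed
     then show ?case by simp
    qed
   qed (use Tm[of e] Tm[of "- e"] in measurable)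
   also have "... = cor (1 / (2 * rho)) * (fourier_real (T e) x + fourier_real (T (- e)) x)"
    using Ti[of e] Ti[of "- e"] by (simp only: fourier_cmult) (simp add: fourier_add)
   finally show ?thesis by (simp add: F_def T_def)
  qed
  have bound: "norm (Re (fourier_real W x) *R e) <= (K1 * s / rho) * tensor_weight x" for x
  proof (rule tensor_weight_dominates)
   fix b :: 'a assume b: "b \<in> Basis"
   have "norm (Re (fourier_real W x) *R e) <= norm (fourier_real W x)" using e abs_Re_le_cmod by simp
   also have "... <= (1 / (2 * rho)) * (norm (F rho e x) + norm (F rho (- e) x))"
    unfolding W_eq norm_mult using rho(3) norm_triangle_ineq[of "F rho e x" "F rho (- e) x"]
    by (intro mult_mono) (auto simp: norm_divide norm_mult)
   finally have "(1 + \<bar>x \<bullet> b\<bar>) ^ (?d + 1) * norm (Re (fourier_real W x) *R e)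
     <= (1 + \<bar>x \<bullet> b\<bar>) ^ (?d + 1) * ((1 / (2 * rho)) * (norm (F rho e x) + norm (F rho (- e) x)))"
    by (intro mult_left_mono) auto
   also have "... = (1 / (2 * rho)) * ((1 + \<bar>x \<bullet> b\<bar>) ^ (?d + 1) * norm (F rho e x) + (1 + \<bar>x \<bullet> b\<bar>) ^ (?d + 1) * norm (F rho (- e) x))"
    by (simp only: distrib_left mult.left_commute)
   also have "... <= (1 / (2 * rho)) * (K1 * s + K1 * s)"
    using rho(3) by (intro mult_left_mono add_mono Fb b) auto
   also have "... = K1 * s / rho" using rho(3) by (simp add: field_simps)
   finally show "(1 + \<bar>x \<bullet> b\<bar>) ^ (?d + 1) * norm (Re (fourier_real W x) *R e) <= K1 * s / rho" .
  qed (use K1 s rho(3) in auto)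
  have "Lp_norm p (%x. Re (fourier_real W x) *R e) <= ennreal ((K1 * s / rho) * (1 + (LBINT x. tensor_weight (x::'a))))"
   by (rule Lp_norm_le_tensor_weight[OF p(2,1) _ bound]) (use K1 s rho(3) in auto)
  also have "(K1 * s / rho) * (1 + (LBINT x. tensor_weight (x::'a))) = Ct * s / rho"
   by (simp add: Ct_def)
  finally show "Lp_norm p (%x. Re (fourier_real (%xi. enn2real (\<sigma> (norm xi)) * twin_bump delta (r + 1 / 2) e xi) x) *R e) <= ennreal (Ct * s / (r + 1 / 2))"
   unfolding W_def rho_def .
 qed
qed

text \<open>The multiplier bounds ask for a strictly positive real \<open>s\<close>, so
  \<open>s = enn2real (N r) + 1\<close> is used; the added 1 is harmless because
  \<open>sqrt (G (t * r))\<close> itself tends to 0.\<close>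

lemma weighted_decay_real:
 assumes wd: "weighted_decay G t N" and G: "((%r. sqrt (G (t * r))) \<longlongrightarrow> 0) at_top"
  and nonneg: "\<forall>\<^sub>F r in at_top. 0 <= G (t * r)"
 shows "((%r. sqrt (G (t * r)) * (C * (enn2real (N r) + 1))) \<longlongrightarrow> 0) at_top"
proof -
 have fin: "\<forall>\<^sub>F r in at_top. N r < top" and lim: "((%r. ennreal (sqrt (G (t * r))) * N r) \<longlongrightarrow> 0) at_top"
  using wd by (auto simp: weighted_decay_def)
 have "((%r. ennreal (sqrt (G (t * r)) * enn2real (N r))) \<longlongrightarrow> ennreal 0) at_top"
 proof (rule Lim_transform_eventually)
  show "((%r. ennreal (sqrt (G (t * r))) * N r) \<longlongrightarrow> ennreal 0) at_top" using lim by simp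
  show "\<forall>\<^sub>F r in at_top. ennreal (sqrt (G (t * r))) * N r = ennreal (sqrt (G (t * r)) * enn2real (N r))"
   using fin nonneg
  proof eventually_elim
   case (elim r)
   then show ?case by (simp add: ennreal_mult)
  qed
 qed
 moreover have "\<forall>\<^sub>F r in at_top. 0 <= sqrt (G (t * r)) * enn2real (N r)"
  using nonneg by eventually_elim auto
 ultimately have 1: "((%r. sqrt (G (t * r)) * enn2real (N r)) \<longlongrightarrow> 0) at_top"
  by (rule tendsto_ennrealD) simp
 have "((%r. C * (sqrt (G (t * r)) * enn2real (N r) + sqrt (G (t * r)))) \<longlongrightarrow> C * (0 + 0)) at_top"
  by (intro tendsto_intros 1 G)
 then show ?thesis by (simp add: algebra_simps)
qed

text \<open>Both ranges of \<open>p\<close> are brought to one form, in which \<open>K r\<close>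
  bounds \<open>rho\<close> times the norm; this is the form in which the final estimate compares it
  with \<open>rho\<close> times the gradient.\<close>

theorem multiplier_Lp:
 fixes e :: "'a::euclidean_space" and \<sigma> :: "real => ennreal"
 assumes \<sigma>m: "\<sigma> \<in> borel_measurable (restrict_space borel {0..})"
  and delta: "0 < delta" "delta <= 1 / 2" and e: "e \<in> Basis" and p: "1 <= p"
  and G: "((%r. sqrt (G (t * r))) \<longlongrightarrow> 0) at_top" and nonneg: "\<forall>\<^sub>F r in at_top. 0 <= G (t * r)"
  and ge_2: "2 <= p ==> weighted_decay G t (%r. Linf_on {r - 1..r + 1} \<sigma>)"
  and less_2: "p < 2 ==>
   \<exists>R\<ge>0. \<exists>D :: nat => real => real.
    (AE r in lborel. R < r --> \<sigma> r < top) \<and>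
    (\<forall>n\<le>DIM('a) + 1. weak_deriv_on {R<..} n (%r. enn2real (\<sigma> r)) (D n)) \<and>
    weighted_decay G t
     (%r. Max ((%n. Linf_on {r - 1..r + 1} (%s. ennreal \<bar>D n s\<bar>)) ` {..DIM('a) + 1}))"
 shows "\<exists>K. ((%r. sqrt (G (t * r)) * K r) \<longlongrightarrow> 0) at_top \<and> (\<forall>r. 0 <= K r) \<and>
  (\<forall>\<^sub>F r in at_top. \<exists>w. fourier_multiplier \<sigma> (%x. Re (fourier_real (twin_bump delta (r + 1 / 2) e) x) *R e) w \<and>
   Lp_norm p w <= ennreal (K r / (r + 1 / 2)))"
proof (cases "2 <= p")
 case True
 define N where "N r = Linf_on {r - 1..r + 1} \<sigma>" for r
 have wd: "weighted_decay G t N" unfolding N_def using ge_2[OF True] .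
 obtain C where C: "C > 0" "\<And>r s. 0 <= r ==> 0 < s ==> (AE x in lborel. x \<in> {r - 1..r + 1} --> \<sigma> x <= ennreal s) ==>
  Lp_norm p (%x. Re (fourier_real (%xi. enn2real (\<sigma> (norm xi)) * twin_bump delta (r + 1 / 2) e xi) x) *R e) <= ennreal (C * s / (r + 1 / 2))"
  using multiplier_Lp_ge_2[OF \<sigma>m delta e True] by blast
 show ?thesis
 proof (intro exI[of _ "%r. C * (enn2real (N r) + 1)"] conjI allI)
  show "((%r. sqrt (G (t * r)) * (C * (enn2real (N r) + 1))) \<longlongrightarrow> 0) at_top"
   by (rule weighted_decay_real[OF wd G nonneg])
  show "0 <= C * (enn2real (N r) + 1)" for r using C(1) by simp
  have "\<forall>\<^sub>F r in at_top. N r < top" using wd by (simp add: weighted_decay_def)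
  then show "\<forall>\<^sub>F r in at_top. \<exists>w. fourier_multiplier \<sigma> (%x. Re (fourier_real (twin_bump delta (r + 1 / 2) e) x) *R e) w \<and>
   Lp_norm p w <= ennreal (C * (enn2real (N r) + 1) / (r + 1 / 2))"
   using eventually_ge_at_top[of 0]
  proof eventually_elim
   case (elim r)
   define s where "s = enn2real (N r) + 1"
   have s: "0 < s" unfolding s_def by (simp add: add_nonneg_pos)
   have "N r <= ennreal s" using elim(1) unfolding s_def
    by (metis ennreal_enn2real ennreal_leI le_add_same_cancel1 zero_le_one)
   then have ae: "AE x in lborel. x \<in> {r - 1..r + 1} --> \<sigma> x <= ennreal s"
    using AE_le_Linf_on[of "{r - 1..r + 1}" \<sigma>] unfolding N_def[symmetric] by (auto elim!: eventually_mono)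
   show ?case
    using multiplier_twin_bump(3)[OF \<sigma>m delta e elim(2) refl ae less_imp_le[OF s]] C(2)[OF elim(2) s ae]
    unfolding s_def by blast
  qed
 qed
next
 case False
 then have p2: "p < 2" by simp
 then have pt: "p \<noteq> top" by auto
 obtain R D where R: "0 <= R" and fin: "AE r in lborel. R < r --> \<sigma> r < top"
  and wdn: "\<And>n. n <= DIM('a) + 1 ==> weak_deriv_on {R<..} n (%r. enn2real (\<sigma> r)) (D n)"
  and wd': "weighted_decay G t (%r. Max ((%n. Linf_on {r - 1..r + 1} (%s. ennreal \<bar>D n s\<bar>)) ` {..DIM('a) + 1}))"
  using less_2[OF p2] by blast
 define N where "N r = Max ((%n. Linf_on {r - 1..r + 1} (%s. ennreal \<bar>D n s\<bar>)) ` {..DIM('a) + 1})" for r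
 have wd: "weighted_decay G t N" unfolding N_def using wd' .
 have "\<exists>C>0. \<forall>r s. R + 3 <= r --> 0 < s -->
  (\<forall>n\<le>DIM('a) + 1. AE x in lborel. x \<in> {r - 1..r + 1} --> \<bar>D n x\<bar> <= s) -->
  (AE x in lborel. x \<in> {r - 1..r + 1} --> \<sigma> x <= ennreal s) \<and>
  Lp_norm p (%x. Re (fourier_real (%xi. enn2real (\<sigma> (norm xi)) * twin_bump delta (r + 1 / 2) e xi) x) *R e) <= ennreal (C * s / (r + 1 / 2))"
  by (rule multiplier_Lp_lt_2[OF \<sigma>m delta e p pt R fin]) (rule wdn)
 then obtain C where C: "C > 0" and C': "\<forall>r s. R + 3 <= r --> 0 < s -->
  (\<forall>n\<le>DIM('a) + 1. AE x in lborel. x \<in> {r - 1..r + 1} --> \<bar>D n x\<bar> <= s) -->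
  (AE x in lborel. x \<in> {r - 1..r + 1} --> \<sigma> x <= ennreal s) \<and>
  Lp_norm p (%x. Re (fourier_real (%xi. enn2real (\<sigma> (norm xi)) * twin_bump delta (r + 1 / 2) e xi) x) *R e) <= ennreal (C * s / (r + 1 / 2))"
  by (elim exE conjE) (rule that)
 show ?thesis
 proof (intro exI[of _ "%r. C * (enn2real (N r) + 1)"] conjI allI)
  show "((%r. sqrt (G (t * r)) * (C * (enn2real (N r) + 1))) \<longlongrightarrow> 0) at_top"
   by (rule weighted_decay_real[OF wd G nonneg])
  show "0 <= C * (enn2real (N r) + 1)" for r using C(1) by simp
  have "\<forall>\<^sub>F r in at_top. N r < top" using wd by (simp add: weighted_decay_def)
  then show "\<forall>\<^sub>F r in at_top. \<exists>w. fourier_multiplier \<sigma> (%x. Re (fourier_real (twin_bump delta (r + 1 / 2) e) x) *R e) w \<and>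
   Lp_norm p w <= ennreal (C * (enn2real (N r) + 1) / (r + 1 / 2))"
   using eventually_ge_at_top[of "R + 3"]
  proof eventually_elim
   case (elim r)
   define s where "s = enn2real (N r) + 1"
   have s: "0 < s" unfolding s_def by (simp add: add_nonneg_pos)
   have r0: "0 <= r" using elim(2) R by simp
   have Ns: "N r <= ennreal s" using elim(1) unfolding s_def
    by (metis ennreal_enn2real ennreal_leI le_add_same_cancel1 zero_le_one)
   have "AE x in lborel. x \<in> {r - 1..r + 1} --> \<bar>D n x\<bar> <= s" if n: "n <= DIM('a) + 1" for n
   proof -
    have "Linf_on {r - 1..r + 1} (%s. ennreal \<bar>D n s\<bar>) <= N r"
     unfolding N_def using n by (intro Max_ge) auto
    then have le: "Linf_on {r - 1..r + 1} (%s. ennreal \<bar>D n s\<bar>) <= ennreal s" using Ns by (rule order_trans)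
    have "AE x in lborel. x \<in> {r - 1..r + 1} --> ennreal \<bar>D n x\<bar> <= Linf_on {r - 1..r + 1} (%s. ennreal \<bar>D n s\<bar>)"
     by (rule AE_le_Linf_on) simp
    then show ?thesis
    proof eventually_elim
     case (elim x)
     show ?case
     proof
      assume "x \<in> {r - 1..r + 1}"
      then have "ennreal \<bar>D n x\<bar> <= ennreal s" using elim le order_trans by blast
      then show "\<bar>D n x\<bar> <= s" using s by (simp add: ennreal_le_iff)
     qed
    qed
   qed
   then have Ds: "\<forall>n\<le>DIM('a) + 1. AE x in lborel. x \<in> {r - 1..r + 1} --> \<bar>D n x\<bar> <= s" by blast
   note L = C'[THEN spec, of r, THEN spec, of s, THEN mp, OF elim(2), THEN mp, OF s, THEN mp, OF Ds]
   show ?case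
    using multiplier_twin_bump(3)[OF \<sigma>m delta e r0 refl L[THEN conjunct1] less_imp_le[OF s]] L[THEN conjunct2]
    unfolding s_def by blast
  qed
 qed
qed

text \<open>Translating by half a period reverses the sign of the cosine, so twice the integral is
 bounded by the \<open>L\<^sup>1\<close> distance of \<open>F\<close> to a small translate.\<close>

lemma riemann_lebesgue_cos:
 fixes F :: "'b::euclidean_space => real" and a :: 'b
 assumes F [measurable]: "F \<in> borel_measurable borel"
  and cont: "AE z in lborel. isCont F z" and bd: "\<And>z. \<bar>F z\<bar> <= C / (1 + norm z) ^ (DIM('b) + 1)"
  and a: "a \<noteq> 0" and r: "filterlim r at_top sequentially"
 shows "(%n. (LBINT z. F z * cos (r n * (a \<bullet> z)))) \<longlonglongrightarrow> 0"
  and "integrable lborel F"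
proof -
 let ?N = "DIM('b) + 1"
 have C: "0 <= C" using bd[of 0] abs_ge_zero[of "F 0"] by simp
 have "norm (1 / (1 + norm z) ^ ?N) <= norm (tensor_weight z)" for z :: 'b
  using inverse_norm_power_le_tensor_weight[of z] tensor_weight_nonneg[of z] by simp
 then have Wi: "integrable lborel (%z::'b. 1 / (1 + norm z) ^ ?N)"
  by (intro integrable_dom[OF tensor_weight_integrable] AE_I2) measurable
 have WiC: "integrable lborel (%z::'b. c / (1 + norm z) ^ ?N)" for c
  using integrable_mult_right[OF Wi, of c] by simp
 show Fi: "integrable lborel F"
  by (rule integrable_dom[OF WiC[of C]]) (use bd C in auto)
 \<comment> \<open>Half a period of the cosine: \<open>r n * (a \<bullet> c n) = pi\<close>.\<close>
 define c where "c n = (pi / (r n * (a \<bullet> a))) *R a" for n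
 \<comment> \<open>Truncated so that the shift has norm at most 1 for every \<open>n\<close>, as
   domination requires; eventually it equals \<open>c n\<close>.\<close>
 define d where "d n = (if 0 < r n \<and> norm (c n) <= 1 then c n else 0)" for n
 have d1: "norm (d n) <= 1" for n by (simp add: d_def)
 have c0: "c \<longlonglongrightarrow> 0"
 proof -
  have "(%n. pi / (r n * (a \<bullet> a))) \<longlonglongrightarrow> 0"
   using a by (intro tendsto_divide_0[OF tendsto_const] filterlim_at_top_imp_at_infinity
     filterlim_at_top_mult_tendsto_pos[OF tendsto_const _ r] | simp)+
  from tendsto_scaleR[OF this tendsto_const[of a]] show ?thesis by (simp add: c_def[abs_def])
 qed
 have ev: "\<forall>\<^sub>F n in sequentially. 0 < r n \<and> norm (c n) <= 1"
 proof (intro eventually_conj)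
  show "\<forall>\<^sub>F n in sequentially. 0 < r n" using r by (simp add: filterlim_at_top_dense)
  have "\<forall>\<^sub>F n in sequentially. norm (c n) < 1"
   by (rule order_tendstoD(2)[OF tendsto_norm_zero[OF c0]]) simp
  then show "\<forall>\<^sub>F n in sequentially. norm (c n) <= 1" by eventually_elim simp
 qed
 have d0: "d \<longlonglongrightarrow> 0"
  by (rule Lim_transform_eventually[OF c0]) (use ev in \<open>eventually_elim, simp add: d_def\<close>)
 have lim: "(%n. (LBINT z. \<bar>F z - F (z + d n)\<bar>)) \<longlonglongrightarrow> (\<integral>z. 0 \<partial>(lborel :: 'b measure))"
 proof (rule integral_dominated_convergence[OF _ _ WiC[of "C + C * 2 ^ ?N"]])
  show "AE z in lborel. (%n. \<bar>F z - F (z + d n)\<bar>) \<longlonglongrightarrow> 0"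
   using cont
  proof eventually_elim
   case (elim z)
   have "(%n. z + d n) \<longlonglongrightarrow> z" using tendsto_add[OF tendsto_const d0, of z] by simp
   then have "(%n. F (z + d n)) \<longlonglongrightarrow> F z" by (rule isCont_tendsto_compose[OF elim])
   then have "(%n. F z - F (z + d n)) \<longlonglongrightarrow> F z - F z" by (intro tendsto_diff tendsto_const)
   then show ?case using tendsto_rabs_zero by auto
  qed
  show "AE z in lborel. norm \<bar>F z - F (z + d n)\<bar> <= (C + C * 2 ^ ?N) / (1 + norm z) ^ ?N" for n
  proof (rule AE_I2)
   fix z :: 'b
   have "1 + norm z <= 2 * (1 + norm (z + d n))"
    using d1[of n] norm_triangle_ineq4[of "z + d n" "d n"] norm_ge_zero[of "z + d n"]
    by (simp add: algebra_simps del: norm_ge_zero)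
   then have "(1 + norm z) ^ ?N <= (2 * (1 + norm (z + d n))) ^ ?N" by (intro power_mono) auto
   moreover have "1 / y <= u / x" if "0 < x" "0 < y" "x <= u * y" for x y u :: real
    using that by (simp add: field_simps)
   moreover have "0 < (1 + norm y) ^ ?N" for y :: 'b by (intro zero_less_power add_pos_nonneg) auto
   ultimately have le: "1 / (1 + norm (z + d n)) ^ ?N <= 2 ^ ?N / (1 + norm z) ^ ?N"
    unfolding power_mult_distrib by blast
   have "C * (1 / (1 + norm (z + d n)) ^ ?N) <= C * (2 ^ ?N / (1 + norm z) ^ ?N)"
    by (rule mult_left_mono[OF le C])
   then have "\<bar>F (z + d n)\<bar> <= C * 2 ^ ?N / (1 + norm z) ^ ?N" using bd[of "z + d n"] by simp
   then show "norm \<bar>F z - F (z + d n)\<bar> <= (C + C * 2 ^ ?N) / (1 + norm z) ^ ?N"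
    using bd[of z] abs_triangle_ineq4[of "F z" "F (z + d n)"] unfolding add_divide_distrib by simp
  qed
 qed auto
 have ib: "integrable lborel (%z. u z * cos (r n * (a \<bullet> z)))" if "integrable lborel u" for n and u :: "'b => real"
  by (rule integrable_dom[OF that])
    (use that in \<open>auto simp: abs_mult intro!: mult_left_le AE_I2\<close>)
 have eq: "2 * (LBINT z. F z * cos (r n * (a \<bullet> z))) = (LBINT z. (F z - F (z + d n)) * cos (r n * (a \<bullet> z)))"
  if n: "0 < r n \<and> norm (c n) <= 1" for n
 proof -
  have "(LBINT z. F z * cos (r n * (a \<bullet> z))) = (LBINT z. F (z + d n) * cos (r n * (a \<bullet> (z + d n))))"
   by (rule lborel_integral_translate[symmetric, of "%z. F z * cos (r n * (a \<bullet> z))"])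
  also have "... = (LBINT z. - (F (z + d n) * cos (r n * (a \<bullet> z))))"
  proof (rule Bochner_Integration.integral_cong[OF refl])
   fix z
   have "d n = c n" using n by (simp add: d_def)
   then have "r n * (a \<bullet> (z + d n)) = r n * (a \<bullet> z) + pi" using n a by (simp add: c_def inner_add_right distrib_left)
   then show "F (z + d n) * cos (r n * (a \<bullet> (z + d n))) = - (F (z + d n) * cos (r n * (a \<bullet> z)))" by simp
  qed
  finally have "(LBINT z. F z * cos (r n * (a \<bullet> z))) = - (LBINT z. F (z + d n) * cos (r n * (a \<bullet> z)))" by simp
  moreover have "(LBINT z. (F z - F (z + d n)) * cos (r n * (a \<bullet> z)))
    = (LBINT z. F z * cos (r n * (a \<bullet> z))) - (LBINT z. F (z + d n) * cos (r n * (a \<bullet> z)))"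
   unfolding left_diff_distrib
   by (rule Bochner_Integration.integral_diff[OF ib[OF Fi] ib[OF lborel_integrable_translate[OF Fi]]])
  ultimately show ?thesis by simp
 qed
 show "(%n. (LBINT z. F z * cos (r n * (a \<bullet> z)))) \<longlonglongrightarrow> 0"
 proof (rule Lim_null_comparison[OF _ lim[unfolded integral_zero]])
  show "\<forall>\<^sub>F n in sequentially. norm (LBINT z. F z * cos (r n * (a \<bullet> z))) <= (LBINT z. \<bar>F z - F (z + d n)\<bar>)"
   using ev
  proof eventually_elim
   case (elim n)
   have "\<bar>(LBINT z. (F z - F (z + d n)) * cos (r n * (a \<bullet> z)))\<bar> <= (LBINT z. \<bar>F z - F (z + d n)\<bar>)"
    using Fi lborel_integrable_translate[OF Fi, of "d n"] ib
    by (intro integral_abs_bound_integral ib) (auto simp: abs_mult intro!: mult_left_le)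
   then show ?case using eq[OF elim] by (simp add: abs_mult)
  qed
 qed
qed

text \<open>Defined as a derivative so that its mean is exactly 0. It differs from the modulated
  function \<open>k x * cos (2 * pi * rho * (x \<bullet> e))\<close> by a term of order
  \<open>1 / rho\<close>.\<close>

definition packet :: "real => 'a::euclidean_space => ('a => real) => 'a => real" where
 "packet rho e k x = dir_deriv e (%x. k x * sin (2 * pi * rho * (x \<bullet> e))) x / (2 * pi * rho)"

lemma
 fixes e :: "'a::euclidean_space"
 assumes k: "schwartz k" and e: "e \<in> Basis" and rho: "0 < rho"
 shows packet_eq: "packet rho e k x = k x * cos (2 * pi * rho * (x \<bullet> e)) + dir_deriv e k x * sin (2 * pi * rho * (x \<bullet> e)) / (2 * pi * rho)"
  and schwartz_packet: "schwartz (packet rho e k)"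
  and packet_integral: "(LBINT x. packet rho e k x) = 0"
  and fourier_packet: "fourier_real (packet rho e k) xi = cor ((xi \<bullet> e) / (2 * rho)) *
   (fourier_real k (xi - rho *R e) - fourier_real k (xi + rho *R e))"
proof -
 define u where "u x = k x * sin (2 * pi * rho * (x \<bullet> e))" for x
 have p: "packet rho e k = (%x. 1 / (2 * pi * rho) * dir_deriv e u x)" by (simp add: packet_def u_def[abs_def] fun_eq_iff)
 have D: "((%x. sin (2 * pi * rho * (x \<bullet> e))) has_derivative (%h. cos (2 * pi * rho * (x \<bullet> e)) * (2 * pi * rho * (h \<bullet> e)))) (at x)" for x
  by (auto intro!: derivative_eq_intros simp: algebra_simps)
 have "dir_deriv e u x = k x * (cos (2 * pi * rho * (x \<bullet> e)) * (2 * pi * rho)) + dir_deriv e k x * sin (2 * pi * rho * (x \<bullet> e))" for x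
  unfolding u_def using dir_deriv_mult[OF schwartz_differentiable[OF k] differentiableI[OF D], of e x] e
  by (simp add: dir_deriv_eq[OF D])
 then show "packet rho e k x = k x * cos (2 * pi * rho * (x \<bullet> e)) + dir_deriv e k x * sin (2 * pi * rho * (x \<bullet> e)) / (2 * pi * rho)"
  using rho by (simp add: p field_simps)
 have "schwartz (%x. (0 * cos ((2 * pi * rho) *R e \<bullet> x) + 1 * sin ((2 * pi * rho) *R e \<bullet> x)) * k x)"
  by (rule schwartz_moderate_mult[OF moderate_trig k])
 then have u: "schwartz u" by (simp add: u_def[abs_def] inner_commute mult.commute)
 show "schwartz (packet rho e k)" unfolding p by (intro schwartz_cmult schwartz_dir_deriv u e)
 show "(LBINT x. packet rho e k x) = 0" unfolding p using integral_dir_deriv_schwartz[OF u e] by simp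
 have ki: "integrable lborel (%x. cor (k x))" by (intro schwartz_integrable schwartz_complex_of_real k)
 have ki2: "integrable lborel (%x. cor (k x) * fkernel b x)" for b
  by (rule integrable_mult_fkernel[OF ki])
 have cc: "dir_deriv e (%x. cor (u x)) = (%x. cor (dir_deriv e u x))"
  by (rule ext) (rule dir_deriv_bounded_linear[OF bounded_linear_of_real schwartz_differentiable[OF u]])
 \<comment> \<open>The sine is a combination of two characters, and modulation by a character
   translates the transform.\<close>
 have "fourier_real u xi = fourier (%x. (- \<i> / 2) * (cor (k x) * fkernel (- (rho *R e)) x - cor (k x) * fkernel (rho *R e) x)) xi"
 proof (rule arg_cong[where f = "%f. fourier f xi"], rule ext)
  fix x
  have "2 * pi * rho * (x \<bullet> e) = 2 * pi * (rho * (x \<bullet> e))" by simp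
  then show "cor (u x) = (- \<i> / 2) * (cor (k x) * fkernel (- (rho *R e)) x - cor (k x) * fkernel (rho *R e) x)"
   by (simp add: u_def fkernel_def complex_eq_iff inner_commute algebra_simps)
 qed
 also have "... = (- \<i> / 2) * (fourier_real k (xi - rho *R e) - fourier_real k (xi + rho *R e))"
  by (simp only: fourier_cmult fourier_diff[OF ki2 ki2] fourier_modulate) simp
 finally have Fu: "fourier_real u xi = (- \<i> / 2) * (fourier_real k (xi - rho *R e) - fourier_real k (xi + rho *R e))" .
 have "fourier_real (packet rho e k) xi = cor (1 / (2 * pi * rho)) * fourier_real (dir_deriv e u) xi"
  unfolding p of_real_mult by (rule fourier_cmult)
 also have "fourier_real (dir_deriv e u) xi = 2 * pi * \<i> * cor (xi \<bullet> e) * fourier_real u xi"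
  using fourier_dir_deriv[OF schwartz_complex_of_real[OF u] e, of xi] unfolding cc .
 also note Fu
 also have "cor (1 / (2 * pi * rho)) * (2 * pi * \<i> * cor (xi \<bullet> e) * ((- \<i> / 2) * z))
   = cor ((xi \<bullet> e) / (2 * rho)) * z" for z
  using rho by (simp add: field_simps)
 finally show "fourier_real (packet rho e k) xi = cor ((xi \<bullet> e) / (2 * rho)) *
   (fourier_real k (xi - rho *R e) - fourier_real k (xi + rho *R e))"
  .
qed

text \<open>Up to the factor \<open>t ^ d\<close> this is the squared energy norm for the dilated
  potential, as seen on the Fourier side.\<close>

abbreviation spectral_energy :: "(real => real) => real => ('a::euclidean_space => real) => real" where
 "spectral_energy ghat t u == (LBINT xi. ghat (t * norm xi) * (norm (fourier_real u xi))^2)"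

lemma fourier_energy:
 fixes g u :: "'a::euclidean_space => real"
 assumes pf: "potential_fourier g (%xi. ghat (norm xi))" and t: "0 < t"
  and u: "schwartz u" and u0: "(LBINT x. u x) = 0"
 shows "integrable lborel (%xi. ghat (t * norm xi) * (norm (fourier_real u xi))^2)"
  and "energy_norm (dilate t g) u = sqrt (t ^ DIM('a) * spectral_energy ghat t u)"
proof -
 have pf': "potential_fourier (dilate t g) (%xi. t ^ DIM('a) * ghat (t * norm xi))"
  using potential_fourier_dilate[OF pf t] t by simp
 note en = energy_eq_fourier[OF pf' u u0]
 show "integrable lborel (%xi. ghat (t * norm xi) * (norm (fourier_real u xi))^2)"
  using en(1) t by (simp add: mult.assoc)
 show "energy_norm (dilate t g) u = sqrt (t ^ DIM('a) * spectral_energy ghat t u)"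
  unfolding energy_norm_def en(2) by (simp add: mult.assoc)
qed

text \<open>The derivative of \<open>s *R e\<close> is the rank-one map
  \<open>h \<mapsto> (h \<bullet> G x) *R e\<close>, whose operator norm is
  \<open>norm (G x)\<close>. In the second claim continuity upgrades an almost-everywhere zero to an
  identity; this excludes a vanishing denominator later.\<close>

lemma
 fixes s :: "'a::euclidean_space => real"
 assumes s: "schwartz s" and e: "e \<in> Basis"
 shows Linf_gradient_le: "(\<And>x b. b \<in> Basis ==> \<bar>dir_deriv b s x\<bar> <= c) ==> 0 <= c ==>
   Lp_norm top (%x. onorm (frechet_derivative (%x. s x *R e) (at x))) <= ennreal (real DIM('a) * c)"
  and Linf_gradient_eq_0: "Lp_norm top (%x. onorm (frechet_derivative (%x. s x *R e) (at x))) = 0 ==> s x = s y"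
proof -
 define G where "G x = (\<Sum>b\<in>Basis. dir_deriv b s x *R b)" for x
 have n1: "norm e = 1" using e by simp
 have D: "(s has_derivative (%h. dir_deriv h s x)) (at x)" for x
  by (rule has_derivative_dir_deriv[OF schwartz_differentiable[OF s]])
 have inner: "h \<bullet> G x = dir_deriv h s x" for h x
  unfolding G_def inner_sum_right
  using dir_deriv_sum_Basis[OF schwartz_differentiable[OF s], of h x] by (simp add: mult.commute)
 have fr: "frechet_derivative (%x. s x *R e) (at x) = (%h. (h \<bullet> G x) *R e)" for x
  unfolding inner by (rule frechet_derivative_at[symmetric]) (rule bounded_linear.has_derivative[OF bounded_linear_scaleR_left D])
 have on: "onorm (%h. (h \<bullet> a) *R e) = norm a" for a :: 'a
 proof (rule antisym)
  show "onorm (%h. (h \<bullet> a) *R e) <= norm a"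
   by (rule onorm_le) (use n1 Cauchy_Schwarz_ineq2 in \<open>auto simp: mult.commute\<close>)
  have "bounded_linear (%h. (h \<bullet> a) *R e)"
   by (intro bounded_linear_scaleR_const bounded_linear_inner_left)
  from onorm[OF this, of a] have "norm a * norm a <= onorm (%h. (h \<bullet> a) *R e) * norm a"
   using n1 by (simp add: dot_square_norm power2_eq_square)
  then show "norm a <= onorm (%h. (h \<bullet> a) *R e)"
   using onorm_pos_le[OF \<open>bounded_linear (%h. (h \<bullet> a) *R e)\<close>] by (cases "a = 0") auto
 qed
 have Gc: "continuous_on UNIV G" unfolding G_def
  by (intro continuous_intros schwartz_continuous_on schwartz_dir_deriv s)
 have [measurable]: "G \<in> borel_measurable borel" by (rule borel_measurable_continuous_onI[OF Gc])
 have L: "Lp_norm top (%x. onorm (frechet_derivative (%x. s x *R e) (at x))) = esssup lborel (%x. ennreal (norm (G x)))"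
  unfolding Lp_norm_def fr on by simp
 show "Lp_norm top (%x. onorm (frechet_derivative (%x. s x *R e) (at x))) <= ennreal (real DIM('a) * c)"
  if c: "\<And>x b. b \<in> Basis ==> \<bar>dir_deriv b s x\<bar> <= c" "0 <= c" 
  unfolding L
 proof (rule esssup_I)
  have "norm (G x) <= real DIM('a) * c" for x
   unfolding G_def by (rule order_trans[OF norm_sum]) (use c in \<open>auto intro!: sum_bounded_above\<close>)
  then show "AE x in lborel. ennreal (norm (G x)) <= ennreal (real DIM('a) * c)" by (intro AE_I2 ennreal_leI)
 qed measurable
 show "s x = s y" if z: "Lp_norm top (%x. onorm (frechet_derivative (%x. s x *R e) (at x))) = 0"
 proof -
  have "AE x in lborel. ennreal (norm (G x)) <= 0" using esssup_AE[of "%x. ennreal (norm (G x))" lborel] z unfolding L by simp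
  then have "AE x in lborel. x \<in> UNIV --> norm (G x) <= 0" by eventually_elim simp
  then have "norm (G x) <= 0" for x
   by (intro AE_continuous_le[where S = UNIV and f = "%x. norm (G x)"]) (auto intro: continuous_on_norm Gc)
  then have "dir_deriv h s x = 0" for h x using inner[of h x] by simp
  then have "(s has_derivative (%h. 0)) (at x within UNIV)" for x using D[of x] by simp
  then obtain c where "\<And>x. s x = c" using has_derivative_zero_constant[OF convex_UNIV, of s] by blast
  then show ?thesis by simp
 qed
qed

section \<open>Asymptotics of the commutator integral\<close>

lemma AE_pair_neq: "AE z in (lborel :: ('a::euclidean_space \<times> 'a) measure). fst z \<noteq> snd z"
proof -
 have "{z \<in> space lborel2. fst z \<noteq> snd (z :: 'a \<times> 'a)} \<in> sets lborel2"
  by measurable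
 moreover have "AE x in lborel. AE y in lborel. fst (x, y) \<noteq> snd (x::'a, y)"
 proof (rule AE_I2)
  fix x :: 'a
  have "AE y in lborel. y \<noteq> x" by (rule AE_lborel_singleton)
  then show "AE y in lborel. fst (x, y) \<noteq> snd (x, y)" by eventually_elim auto
 qed
 ultimately have "AE z in lborel2. fst z \<noteq> snd (z :: 'a \<times> 'a)" by (rule lborel_pair.AE_pair_measure)
 then show ?thesis unfolding lborel_prod .
qed

lemma dir_deriv_off_0:
 assumes g: "smooth_on (- {0}) g" and e: "e \<in> Basis" and z: "z \<noteq> 0"
 shows "g differentiable (at z)" "isCont (dir_deriv e g) z"
proof -
 have "\<forall>bs\<in>lists Basis. iter_partial bs g differentiable (at z)" using g z by (simp add: smooth_on_def)
 from bspec[OF this, of "[]"] bspec[OF this, of "[e]"] e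
 have "g differentiable (at z)" "dir_deriv e g differentiable (at z)" by (auto simp: dir_deriv_def[abs_def])
 then show "g differentiable (at z)" "isCont (dir_deriv e g) z" by (auto intro: differentiable_imp_continuous_within)
qed

lemma measurable_off_0:
 fixes u :: "'a::euclidean_space => real"
 assumes "\<And>z. z \<noteq> 0 ==> isCont u z"
 shows "u \<in> borel_measurable borel"
proof -
 have "(%z. if z \<in> - {0} then u z else u 0) \<in> borel_measurable borel"
  by (rule borel_measurable_continuous_on_if) (use assms in \<open>auto intro!: continuous_at_imp_continuous_on\<close>)
 also have "(%z. if z \<in> - {0} then u z else u 0) = u" by auto
 finally show ?thesis .
qed

text \<open>After multiplication by \<open>rho\<close> the integrand is a product of two cosines in
  \<open>x\<close>, or one in \<open>x\<close> and one in \<open>y\<close>. Only the square of the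
  cosine in \<open>x\<close> has a non-oscillating part, namely its mean 1/2; that is where the
  limit comes from. The other terms oscillate, or are of order \<open>1 / rho\<close> or
  \<open>c\<close>.\<close>

theorem
 fixes g k h :: "'a::euclidean_space => real"
 assumes g: "smooth_on (- {0}) g" and delta: "0 < delta" and e: "e \<in> Basis"
  and k: "schwartz k" and h: "schwartz h"
  and bd: "\<And>u x y. u \<in> {k, dir_deriv e k} ==>
   \<bar>u x * dir_deriv e g (x - y) * h y\<bar> <= C / (1 + norm (x, y)) ^ (DIM('a \<times> 'a) + 1)"
 shows commutator_tendsto: "filterlim rho at_top sequentially ==> c \<longlonglongrightarrow> 0 ==>
   (%n. rho n * (\<integral>z. commutator_integrand g (%x. Re (fourier_real (twin_bump delta (rho n) e) x) *R e)
     (%x. packet (rho n) e k x + c n * dir_deriv e k x) h z \<partial>lborel2))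
   \<longlonglongrightarrow> (\<integral>(x, y). Re (fourier_real (bump delta) x) * (k x * dir_deriv e g (x - y) * h y) \<partial>lborel2) / 2"
  and commutator_integrable: "0 < rho' ==>
   integrable lborel2 (commutator_integrand g (%x. Re (fourier_real (twin_bump delta rho' e) x) *R e)
     (%x. packet rho' e k x + c' * dir_deriv e k x) h)"
proof -
 define Dg where "Dg = dir_deriv e g"
 define q where "q = dir_deriv e k"
 have q: "schwartz q" unfolding q_def by (rule schwartz_dir_deriv[OF k e])
 define beta where "beta x = Re (fourier_real (bump delta) x)" for x :: 'a
 have betas: "schwartz beta" unfolding beta_def by (intro schwartz_Re schwartz_fourier schwartz_complex_of_real schwartz_bump delta)
 obtain B where B: "B > 0" "\<And>x. \<bar>beta x\<bar> <= B" using schwartz_bounded[OF betas] by auto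
 have Dgm [measurable]: "Dg \<in> borel_measurable borel"
  unfolding Dg_def by (rule measurable_off_0) (rule dir_deriv_off_0(2)[OF g e])
 have [measurable]: "k \<in> borel_measurable borel" "q \<in> borel_measurable borel" "h \<in> borel_measurable borel" "beta \<in> borel_measurable borel"
  by (intro schwartz_measurable k q h betas)+
 have [measurable]: "(fst :: 'a \<times> 'a => 'a) \<in> borel_measurable borel" "(snd :: 'a \<times> 'a => 'a) \<in> borel_measurable borel"
  by (auto intro!: borel_measurable_continuous_onI continuous_intros)
 define P where "P u z = u (fst z) * Dg (fst z - snd z) * h (snd z)" for u and z :: "'a \<times> 'a"
 have Pm [measurable]: "P u \<in> borel_measurable borel" if [measurable]: "u \<in> borel_measurable borel" for u
  unfolding P_def by measurable
 have Pb: "\<bar>P u z\<bar> <= C / (1 + norm z) ^ (DIM('a \<times> 'a) + 1)" if "u \<in> {k, q}" for u z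
  using bd[of u "fst z" "snd z"] that by (simp add: P_def Dg_def q_def)
 have C: "0 <= C" using Pb[of k 0] abs_ge_zero[of "P k 0"] by simp
 have Pc: "AE z in lborel. isCont (P u) z" if "u \<in> {k, q}" for u
  using AE_pair_neq
 proof eventually_elim
  case (elim z)
  have u: "isCont u x" "isCont h x" for x using that schwartz_isCont[OF k] schwartz_isCont[OF q] schwartz_isCont[OF h] by auto
  have "isCont Dg (fst z - snd z)" unfolding Dg_def by (rule dir_deriv_off_0(2)[OF g e]) (use elim in simp)
  then have "isCont (%z. Dg (fst z - snd z)) z"
   by (intro isCont_o2[where g = Dg and f = "%z. fst z - snd z"] continuous_intros) auto
  moreover have "isCont (%z. u (fst z)) z" by (rule isCont_o2[where g = u and f = fst]) (auto intro!: continuous_intros u)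
  moreover have "isCont (%z. h (snd z)) z" by (rule isCont_o2[where g = h and f = snd]) (auto intro!: continuous_intros u)
  ultimately show ?case unfolding P_def by (intro continuous_mult)
 qed
 have Pi: "integrable lborel (P u)" if u: "u \<in> {k, q}" for u
  by (rule riemann_lebesgue_cos(2)[OF Pm Pc[OF u] Pb[OF u], of "(e, 0)" "%n. real n"])
   (use u e in \<open>auto simp: zero_prod_def filterlim_real_sequentially\<close>)
 define th where "th rho x = cos (2 * pi * rho * (x \<bullet> e))" for rho and x :: 'a
 have [measurable]: "th rho \<in> borel_measurable borel" for rho unfolding th_def by measurable
 \<comment> \<open>This is \<open>rho\<close> times the integrand. The off-diagonal region suffices
   for its continuity, as the diagonal is a null set.\<close>
 define D where "D rho c z = (th rho (fst z) * beta (fst z) - th rho (snd z) * beta (snd z)) * (th rho (fst z) * P k z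
   + (sin (2 * pi * rho * (fst z \<bullet> e)) / (2 * pi * rho) + c) * P q z)" for rho c z
 define CI where "CI rho c = commutator_integrand g (%x. Re (fourier_real (twin_bump delta rho e) x) *R e)
     (%x. packet rho e k x + c * q x) h" for rho c
 have CI: "CI rho c z = D rho c z / rho" if rho: "0 < rho" for rho c z
 proof -
  have gr: "e \<bullet> gradient g z = Dg z" for z
   unfolding gradient_def Dg_def dir_deriv_def inner_sum_right using e by (simp add: inner_Basis if_distrib cong: if_cong)
  have s: "Re (fourier_real (twin_bump delta rho e) x) = th rho x * beta x / rho" for x
   unfolding fourier_twin_bump[OF delta rho] by (simp add: th_def beta_def)
  show ?thesis
   unfolding CI_def commutator_integrand_def s packet_eq[OF k e rho] q_def[symmetric] case_prod_beta
    scaleR_diff_left[symmetric] inner_scaleR_left gr D_def P_def th_def[symmetric]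
   using rho by (simp add: field_simps)
 qed
 define m where "m rho z = th rho (fst z) * beta (fst z) - th rho (snd z) * beta (snd z)" for rho and z :: "'a \<times> 'a"
 have [measurable]: "m rho \<in> borel_measurable borel" for rho unfolding m_def by measurable
 have mb: "\<bar>m rho z\<bar> <= 2 * B" for rho z
 proof -
  have "\<bar>th rho x * beta x\<bar> <= 1 * B" for x unfolding abs_mult by (intro mult_mono B(2)) (auto simp: th_def)
  from this[of "fst z"] this[of "snd z"] show ?thesis unfolding m_def by linarith
 qed
 define F1 where "F1 z = beta (fst z) * P k z" for z
 define F2 where "F2 z = beta (snd z) * P k z" for z
 define R where "R rho c z = m rho z * (sin (2 * pi * rho * (fst z \<bullet> e)) / (2 * pi * rho) + c) * P q z" for rho c z
 \<comment> \<open>Product-to-sum formulas leave single cosines of linear functions of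
   \<open>z = (x, y)\<close>, with frequency directions \<open>(e, 0)\<close>, \<open>(e, e)\<close>
   and \<open>(e, - e)\<close>. All three are nonzero, so the Riemann-Lebesgue lemma applies on the
   product space.\<close>
 have D_eq: "D rho c z = F1 z / 2 + F1 z * cos (4 * pi * rho * ((e, 0) \<bullet> z)) / 2
   - F2 z * cos (2 * pi * rho * ((e, e) \<bullet> z)) / 2 - F2 z * cos (2 * pi * rho * ((e, - e) \<bullet> z)) / 2 + R rho c z" for rho c z
 proof -
  let ?x = "2 * pi * rho * (fst z \<bullet> e)" and ?y = "2 * pi * rho * (snd z \<bullet> e)"
  have c4: "cos (4 * pi * rho * ((e, 0) \<bullet> z)) = 2 * (cos ?x)^2 - 1"
   using cos_double_cos[of ?x] by (simp add: inner_prod_def inner_commute mult.assoc)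
  have cp: "cos (2 * pi * rho * ((e, e) \<bullet> z)) = cos (?x + ?y)" "cos (2 * pi * rho * ((e, - e) \<bullet> z)) = cos (?x - ?y)"
   by (simp_all add: inner_prod_def inner_commute algebra_simps)
  have "(cx * bx - cy * b) * (cx * p + w * u) = bx * p / 2 + bx * p * (2 * cx^2 - 1) / 2
    - b * p * (cx * cy - sx * sy) / 2 - b * p * (cx * cy + sx * sy) / 2 + (cx * bx - cy * b) * w * u"
   for cx bx cy b p w u sx sy :: real
   by (simp add: field_simps power2_eq_square)
  then show ?thesis unfolding D_def R_def F1_def F2_def m_def th_def c4 cp cos_add cos_diff .
 qed
 have Fm [measurable]: "F1 \<in> borel_measurable borel" "F2 \<in> borel_measurable borel"
  unfolding F1_def F2_def by measurable
 have Fc: "AE z in lborel. isCont F1 z" "AE z in lborel. isCont F2 z"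
 proof -
  have c: "isCont (%z. beta (fst z)) z" "isCont (%z. beta (snd z)) z" for z :: "'a \<times> 'a"
   using isCont_o2[OF _ schwartz_isCont[OF betas], of z fst] isCont_o2[OF _ schwartz_isCont[OF betas], of z snd]
   by (simp_all add: isCont_fst isCont_snd)
  show "AE z in lborel. isCont F1 z" "AE z in lborel. isCont F2 z"
   unfolding F1_def F2_def using Pc[of k] by (auto elim!: eventually_mono intro!: continuous_mult c)
 qed
 have Fb: "\<bar>F1 z\<bar> <= B * C / (1 + norm z) ^ (DIM('a \<times> 'a) + 1)" "\<bar>F2 z\<bar> <= B * C / (1 + norm z) ^ (DIM('a \<times> 'a) + 1)" for z
  unfolding F1_def F2_def abs_mult times_divide_eq_right[symmetric] using B by (intro mult_mono Pb; simp)+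
 have enz: "(e, 0) \<noteq> (0 :: 'a \<times> 'a)" "(e, e) \<noteq> (0 :: 'a \<times> 'a)" "(e, - e) \<noteq> (0 :: 'a \<times> 'a)" using e by (auto simp: zero_prod_def)
 have Fi: "integrable lborel F1" "integrable lborel F2"
  by (rule riemann_lebesgue_cos(2)[OF Fm(1) Fc(1) Fb(1) enz(1) filterlim_real_sequentially],
    rule riemann_lebesgue_cos(2)[OF Fm(2) Fc(2) Fb(2) enz(1) filterlim_real_sequentially])
 have ic: "integrable lborel (%z. F z * cos (r * (a \<bullet> z)) / 2)" if "integrable lborel F" for F :: "'a \<times> 'a => real" and r a
  by (rule integrable_dom[OF that])
   (use that in \<open>auto simp: abs_mult intro!: AE_I2 mult_left_mono order_trans[OF abs_cos_le_one]\<close>)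
 have Rb: "integrable lborel (R rho c)" "\<bar>(LBINT z. R rho c z)\<bar> <= 2 * B * (1 / (2 * pi * rho) + \<bar>c\<bar>) * (LBINT z. \<bar>P q z\<bar>)" if rho: "0 < rho" for rho c
 proof -
  have b: "\<bar>R rho c z\<bar> <= 2 * B * (1 / (2 * pi * rho) + \<bar>c\<bar>) * \<bar>P q z\<bar>" for z
  proof -
   have "\<bar>sin (2 * pi * rho * (fst z \<bullet> e)) / (2 * pi * rho)\<bar> <= 1 / (2 * pi * rho)"
    using rho by (simp add: abs_mult divide_right_mono)
   then show ?thesis unfolding R_def abs_mult using B(1) rho
    by (intro mult_right_mono mult_mono mb order_trans[OF abs_triangle_ineq] add_mono) auto
  qed
  have [measurable]: "R rho c \<in> borel_measurable borel"
   unfolding R_def by measurable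
  have i: "integrable lborel (%z. 2 * B * (1 / (2 * pi * rho) + \<bar>c\<bar>) * \<bar>P q z\<bar>)" using Pi[of q] by auto
  show Ri: "integrable lborel (R rho c)"
   by (rule integrable_dom[OF i]) (use b in \<open>auto intro!: AE_I2 order_trans[OF _ abs_ge_self]\<close>)
  have "\<bar>(LBINT z. R rho c z)\<bar> <= (LBINT z. 2 * B * (1 / (2 * pi * rho) + \<bar>c\<bar>) * \<bar>P q z\<bar>)"
   by (intro integral_abs_bound_integral Ri i b)
  then show "\<bar>(LBINT z. R rho c z)\<bar> <= 2 * B * (1 / (2 * pi * rho) + \<bar>c\<bar>) * (LBINT z. \<bar>P q z\<bar>)" by simp
 qed
 have Di: "integrable lborel (D rho c)" if rho: "0 < rho" for rho c
  unfolding D_eq[abs_def] by (intro Bochner_Integration.integrable_add Bochner_Integration.integrable_diff ic Fi Rb(1)[OF rho] integrable_divide)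
 show "integrable lborel2 (commutator_integrand g (%x. Re (fourier_real (twin_bump delta rho' e) x) *R e)
     (%x. packet rho' e k x + c' * dir_deriv e k x) h)" if rho': "0 < rho'"
 proof -
  have "CI rho' c' = (%z. D rho' c' z / rho')" using CI[OF rho'] by auto
  then have "integrable lborel (CI rho' c')" using Di[OF rho'] by simp
  then show ?thesis unfolding lborel_prod CI_def q_def .
 qed
 show "(%n. rho n * (\<integral>z. commutator_integrand g (%x. Re (fourier_real (twin_bump delta (rho n) e) x) *R e)
     (%x. packet (rho n) e k x + c n * dir_deriv e k x) h z \<partial>lborel2))
   \<longlonglongrightarrow> (\<integral>(x, y). Re (fourier_real (bump delta) x) * (k x * dir_deriv e g (x - y) * h y) \<partial>lborel2) / 2"
  if rho: "filterlim rho at_top sequentially" and c: "c \<longlonglongrightarrow> 0"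
 proof -
  have lim: "filterlim (%n. b * rho n) at_top sequentially" if "0 < b" for b
   by (rule filterlim_tendsto_pos_mult_at_top[OF tendsto_const that rho])
  have p: "0 < 4 * pi" "0 < 2 * pi" by simp_all
  note RL = tendsto_divide[OF riemann_lebesgue_cos(1) tendsto_const[of 2], unfolded div_0]
  have t1: "(%n. (LBINT z. F1 z * cos (4 * pi * rho n * ((e, 0) \<bullet> z))) / 2) \<longlonglongrightarrow> 0"
   by (rule RL[OF Fm(1) Fc(1) Fb(1) enz(1) lim[OF p(1)]]) simp
  have t2: "(%n. (LBINT z. F2 z * cos (2 * pi * rho n * ((e, e) \<bullet> z))) / 2) \<longlonglongrightarrow> 0"
   by (rule RL[OF Fm(2) Fc(2) Fb(2) enz(2) lim[OF p(2)]]) simp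
  have t3: "(%n. (LBINT z. F2 z * cos (2 * pi * rho n * ((e, - e) \<bullet> z))) / 2) \<longlonglongrightarrow> 0"
   by (rule RL[OF Fm(2) Fc(2) Fb(2) enz(3) lim[OF p(2)]]) simp
  have ev: "\<forall>\<^sub>F n in sequentially. 0 < rho n" using rho by (simp add: filterlim_at_top_dense)
  have tR: "(%n. (LBINT z. R (rho n) (c n) z)) \<longlonglongrightarrow> 0"
  proof (rule Lim_null_comparison)
   show "\<forall>\<^sub>F n in sequentially. norm (LBINT z. R (rho n) (c n) z) <= 2 * B * (1 / (2 * pi * rho n) + \<bar>c n\<bar>) * (LBINT z. \<bar>P q z\<bar>)"
    using ev by eventually_elim (use Rb(2) in simp)
   have "(%n. 1 / (2 * pi * rho n)) \<longlonglongrightarrow> 0"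
    by (rule tendsto_divide_0[OF tendsto_const filterlim_at_top_imp_at_infinity[OF lim[OF p(2)]]])
   then have "(%n. 2 * B * (1 / (2 * pi * rho n) + \<bar>c n\<bar>) * (LBINT z. \<bar>P q z\<bar>)) \<longlonglongrightarrow> 2 * B * (0 + 0) * (LBINT z. \<bar>P q z\<bar>)"
    by (intro tendsto_intros tendsto_rabs_zero c)
   then show "(%n. 2 * B * (1 / (2 * pi * rho n) + \<bar>c n\<bar>) * (LBINT z. \<bar>P q z\<bar>)) \<longlonglongrightarrow> 0" by simp
  qed
  have ID: "(LBINT z. D rho c z) = (LBINT z. F1 z) / 2 + (LBINT z. F1 z * cos (4 * pi * rho * ((e, 0) \<bullet> z))) / 2
    - (LBINT z. F2 z * cos (2 * pi * rho * ((e, e) \<bullet> z))) / 2 - (LBINT z. F2 z * cos (2 * pi * rho * ((e, - e) \<bullet> z))) / 2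
    + (LBINT z. R rho c z)" if "0 < rho" for rho c
   unfolding D_eq by (simp only: Bochner_Integration.integral_add Bochner_Integration.integral_diff
     Bochner_Integration.integrable_add Bochner_Integration.integrable_diff ic[OF Fi(1)] ic[OF Fi(2)] Rb(1)[OF that] integrable_divide Fi integral_divide_zero)
  have "(%n. (LBINT z. F1 z) / 2 + (LBINT z. F1 z * cos (4 * pi * rho n * ((e, 0) \<bullet> z))) / 2
    - (LBINT z. F2 z * cos (2 * pi * rho n * ((e, e) \<bullet> z))) / 2 - (LBINT z. F2 z * cos (2 * pi * rho n * ((e, - e) \<bullet> z))) / 2
    + (LBINT z. R (rho n) (c n) z)) \<longlonglongrightarrow> (LBINT z. F1 z) / 2 + 0 - 0 - 0 + 0"
   by (intro tendsto_add tendsto_diff tendsto_const t1 t2 t3 tR)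
  then have "(%n. rho n * (LBINT z. CI (rho n) (c n) z)) \<longlonglongrightarrow> (LBINT z. F1 z) / 2 + 0 - 0 - 0 + 0"
  proof (rule Lim_transform_eventually)
   show "\<forall>\<^sub>F n in sequentially. (LBINT z. F1 z) / 2 + (LBINT z. F1 z * cos (4 * pi * rho n * ((e, 0) \<bullet> z))) / 2
     - (LBINT z. F2 z * cos (2 * pi * rho n * ((e, e) \<bullet> z))) / 2 - (LBINT z. F2 z * cos (2 * pi * rho n * ((e, - e) \<bullet> z))) / 2
     + (LBINT z. R (rho n) (c n) z) = rho n * (LBINT z. CI (rho n) (c n) z)"
    using ev
   proof eventually_elim
    case (elim n)
    have "CI (rho n) (c n) = (%z. D (rho n) (c n) z / rho n)" using CI[OF elim] by auto
    then show ?case using elim by (simp add: ID)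
   qed
  qed
  then show ?thesis unfolding lborel_prod CI_def F1_def P_def beta_def Dg_def q_def by (simp add: case_prod_beta')
 qed
qed

lemma
 fixes g u w :: "'a::euclidean_space => real"
 assumes pf: "potential_fourier g (%xi. ghat (norm xi))" and t: "0 < t" and nonneg: "\<And>r. 0 < r ==> 0 <= ghat r"
  and u: "schwartz u" "(LBINT x. u x) = 0"
 shows fourier_energy_nonneg: "0 <= spectral_energy ghat t u"
  and fourier_energy_parallelogram: "schwartz w ==> (LBINT x. w x) = 0 ==>
   spectral_energy ghat t (%x. u x + c * w x)
   + spectral_energy ghat t (%x. u x + (- c) * w x)
   = 2 * spectral_energy ghat t u
   + 2 * c^2 * spectral_energy ghat t w"
proof -
 have "AE xi in lborel. xi \<noteq> (0::'a)" by (rule AE_lborel_singleton)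
 then show "0 <= spectral_energy ghat t u"
  by (intro integral_nonneg_AE) (auto elim!: eventually_mono simp: nonneg t)
 assume w: "schwartz w" "(LBINT x. w x) = 0"
 have ui: "integrable lborel u" "integrable lborel w" by (intro schwartz_integrable u w)+
 have i: "integrable lborel (%xi. ghat (t * norm xi) * (norm (fourier_real (%x. u x + c * w x) xi))^2)" for c
  using ui u w by (intro fourier_energy(1)[OF pf t] schwartz_add schwartz_cmult) simp_all
 have F: "fourier_real (%x. u x + c * w x) xi = fourier_real u xi + c * fourier_real w xi" for c xi
  unfolding of_real_add of_real_mult
  using fourier_add[of "%x. cor (u x)" "%x. cor c * cor (w x)"] ui
  by (simp add: fourier_cmult)
 have par: "(norm (a + b))^2 + (norm (a - b))^2 = 2 * (norm a)^2 + 2 * (norm b)^2" for a b :: complex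
  by (simp add: power2_norm_eq_inner inner_add_left inner_add_right inner_diff_left inner_diff_right inner_commute)
 have p: "ghat (t * norm xi) * (norm (fourier_real (%x. u x + c * w x) xi))^2
   + ghat (t * norm xi) * (norm (fourier_real (%x. u x + (- c) * w x) xi))^2
   = 2 * (ghat (t * norm xi) * (norm (fourier_real u xi))^2) + 2 * c^2 * (ghat (t * norm xi) * (norm (fourier_real w xi))^2)" for xi
  using arg_cong[OF par[of "fourier_real u xi" "c * fourier_real w xi"], of "%x. ghat (t * norm xi) * x"]
  unfolding F by (simp add: norm_mult power_mult_distrib algebra_simps)
 show "spectral_energy ghat t (%x. u x + c * w x)
   + spectral_energy ghat t (%x. u x + (- c) * w x)
   = 2 * spectral_energy ghat t u
   + 2 * c^2 * spectral_energy ghat t w"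
  using fourier_energy(1)[OF pf t u] fourier_energy(1)[OF pf t w]
  by (simp only: Bochner_Integration.integral_add[OF i i, symmetric] p) simp
qed

text \<open>Differentiating the cosine produces \<open>2 * pi * rho\<close>, which the factor
  \<open>1 / rho\<close> cancels; the other term is smaller. Hence the bound is uniform in
  \<open>rho >= 1\<close>.\<close>

lemma twin_bump_gradient_bound:
 fixes e :: "'a::euclidean_space"
 assumes delta: "0 < delta" and e: "e \<in> Basis"
 shows "\<exists>C>0. \<forall>rho\<ge>1. \<forall>b\<in>Basis. \<forall>x. \<bar>dir_deriv b (%x. Re (fourier_real (twin_bump delta rho e) x)) x\<bar> <= C"
proof -
 define beta where "beta x = Re (fourier_real (bump delta) x)" for x :: 'a
 have betas: "schwartz beta" unfolding beta_def by (intro schwartz_Re schwartz_fourier schwartz_complex_of_real schwartz_bump delta)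
 obtain B where B: "B > 0" "\<And>x. \<bar>beta x\<bar> <= B" using schwartz_bounded[OF betas] by auto
 have "\<exists>C>0. \<forall>x. \<bar>dir_deriv b beta x\<bar> <= C" if "b \<in> Basis" for b
  using schwartz_bounded[OF schwartz_dir_deriv[OF betas that]] by simp
 then obtain C where C: "\<And>b. b \<in> Basis ==> C b > 0" "\<And>b x. b \<in> Basis ==> \<bar>dir_deriv b beta x\<bar> <= C b" by metis
 have bound: "\<bar>dir_deriv b (%x. Re (fourier_real (twin_bump delta rho e) x)) x\<bar> <= 2 * pi * B + sum C Basis"
  if rho: "1 <= rho" and b: "b \<in> Basis" for rho b x
 proof -
  have rho0: "0 < rho" using rho by simp
  have eq: "(%x. Re (fourier_real (twin_bump delta rho e) x)) = (%x. (cos (2 * pi * rho * (x \<bullet> e)) / rho) * beta x)"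
   unfolding fourier_twin_bump[OF delta rho0] by (auto simp: beta_def)
  have D: "((%x. cos (2 * pi * rho * (x \<bullet> e)) / rho) has_derivative (%h. - sin (2 * pi * rho * (x \<bullet> e)) * (2 * pi * (h \<bullet> e)))) (at x)"
   using rho0 by (auto intro!: derivative_eq_intros simp: field_simps)
  have s: "\<bar>b \<bullet> e\<bar> <= 1" using b e by (simp add: inner_Basis)
  have "dir_deriv b (%x. Re (fourier_real (twin_bump delta rho e) x)) x
    = cos (2 * pi * rho * (x \<bullet> e)) / rho * dir_deriv b beta x - sin (2 * pi * rho * (x \<bullet> e)) * (2 * pi * (b \<bullet> e)) * beta x"
   unfolding eq using dir_deriv_mult[OF differentiableI[OF D] schwartz_differentiable[OF betas], of b] by (simp add: dir_deriv_eq[OF D])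
  also have "\<bar>...\<bar> <= 1 * C b + 1 * (2 * pi * 1) * B"
  proof (intro order_trans[OF abs_triangle_ineq4] add_mono)
   have "\<bar>cos (2 * pi * rho * (x \<bullet> e)) / rho\<bar> <= 1" using order_trans[OF abs_cos_le_one rho] rho0 by (simp add: divide_le_eq)
   then show "\<bar>cos (2 * pi * rho * (x \<bullet> e)) / rho * dir_deriv b beta x\<bar> <= 1 * C b"
    unfolding abs_mult[of "cos (2 * pi * rho * (x \<bullet> e)) / rho"] by (intro mult_mono C b) auto
   show "\<bar>sin (2 * pi * rho * (x \<bullet> e)) * (2 * pi * (b \<bullet> e)) * beta x\<bar> <= 1 * (2 * pi * 1) * B"
    unfolding abs_mult using s B by (intro mult_mono) auto
  qed
  also have "C b <= sum C Basis" by (rule member_le_sum) (use b C in \<open>auto intro: less_imp_le\<close>)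
  finally show ?thesis by simp
 qed
 have "0 < 2 * pi * B + sum C Basis" using B by (intro add_pos_nonneg sum_nonneg) (auto intro: less_imp_le C)
 then show ?thesis using bound by blast
qed

text \<open>The numerator times \<open>rho\<close> tends to \<open>J / 2\<close>, which is nonzero.
  The norm of the field times \<open>rho\<close> is at most \<open>L n\<close>, and the energy norm
  of \<open>f\<close> is \<open>O(sqrt (ghat (t * r n)))\<close> up to the perturbation, so their
  product tends to 0 and the quotient exceeds any \<open>M\<close>.\<close>

theorem commutator_unbounded:
 fixes g k h :: "'a::euclidean_space => real"
 assumes g: "smooth_on (- {0}) g" and pf: "potential_fourier g (%xi. ghat (norm xi))" and t: "0 < t"
  and nonneg: "\<And>r. 0 < r ==> 0 <= ghat r" and decay: "((%r. r^2 * ghat r) \<longlongrightarrow> 0) at_top"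
  and delta: "0 < delta" and e: "e \<in> Basis"
  and K: "((%r. sqrt (ghat (t * r)) * K r) \<longlongrightarrow> 0) at_top" "\<And>r. 0 <= K r"
  and w: "\<forall>\<^sub>F r in at_top. \<exists>w. fourier_multiplier \<sigma> (%x. Re (fourier_real (twin_bump delta (r + 1 / 2) e) x) *R e) w \<and>
   Lp_norm p w <= ennreal (K r / (r + 1 / 2))"
  and k: "schwartz k" and h: "schwartz h" "(LBINT x. h x) = 0"
  and bd: "\<And>u x y. u \<in> {k, dir_deriv e k} ==>
   \<bar>u x * dir_deriv e g (x - y) * h y\<bar> <= C / (1 + norm (x, y)) ^ (DIM('a \<times> 'a) + 1)"
  and J: "(\<integral>(x, y). Re (fourier_real (bump delta) x) * (k x * dir_deriv e g (x - y) * h y) \<partial>lborel2) \<noteq> 0"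
  and r: "filterlim r at_top sequentially"
  and E: "\<And>n. spectral_energy ghat t (packet (r n + 1 / 2) e k) <= c * ghat (t * r n)"
  and pos: "0 < spectral_energy ghat t h"
   "0 < spectral_energy ghat t (dir_deriv e k)"
 shows "\<exists>(v :: 'a => 'a) (w :: 'a => 'a) (f :: 'a => real) (h :: 'a => real).
  smooth_on UNIV v \<and>
  schwartz f \<and> (LBINT x. f x) = 0 \<and>
  schwartz h \<and> (LBINT x. h x) = 0 \<and>
  fourier_multiplier \<sigma> v w \<and>
  integrable lborel2 (commutator_integrand g v f h) \<and>
  (let N = \<bar>\<integral>z. commutator_integrand g v f h z \<partial>lborel2\<bar>;
    A = Lp_norm top (%x. onorm (frechet_derivative v (at x))) + Lp_norm p w;
    B = enn2real A * energy_norm (dilate t g) f * energy_norm (dilate t g) h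
  in A < top \<and> 0 < B \<and> N / B >= M)"
proof -
 define rho where "rho n = r n + 1 / 2" for n
 define q where "q = dir_deriv e k"
 define En where "En u = spectral_energy ghat t u" for u :: "'a => real"
 define s where "s n = (%x. Re (fourier_real (twin_bump delta (rho n) e) x))" for n
 define J where "J = (\<integral>(x, y). Re (fourier_real (bump delta) x) * (k x * dir_deriv e g (x - y) * h y) \<partial>lborel2)"
 have q: "schwartz q" "(LBINT x. q x) = 0"
  unfolding q_def by (intro schwartz_dir_deriv k e integral_dir_deriv_schwartz)+
 have Eq: "0 < En q" "0 < En h" using pos by (simp_all add: En_def q_def)
 obtain C1 where C1: "C1 > 0" "\<And>rho b x. 1 <= rho ==> b \<in> Basis ==> \<bar>dir_deriv b (%x. Re (fourier_real (twin_bump delta rho e) x)) x\<bar> <= C1"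
  using twin_bump_gradient_bound[OF delta e] by blast
 \<comment> \<open>A bound for \<open>rho\<close> times the sum of the two norms of the
   field.\<close>
 define L where "L n = real DIM('a) * C1 * rho n + K (r n)" for n
 \<comment> \<open>Size of the perturbation of \<open>f\<close> that secures positive energy. It is
   so small that both \<open>epsilon n\<close> and \<open>L n * epsilon n\<close> vanish in the
   limit.\<close>
 define epsilon where "epsilon n = 1 / ((1 + \<bar>r n\<bar>) * (\<bar>L n\<bar> + 1))" for n
 have epsilon0: "0 < epsilon n" for n unfolding epsilon_def by (intro divide_pos_pos mult_pos_pos) auto
 have r1: "\<forall>\<^sub>F n in sequentially. 1 <= r n" using r by (simp add: filterlim_at_top)
 have rinv: "(%n. 1 / (1 + \<bar>r n\<bar>)) \<longlonglongrightarrow> 0"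
  by (intro tendsto_divide_0[OF tendsto_const] filterlim_at_top_imp_at_infinity
    filterlim_tendsto_add_at_top[OF tendsto_const] filterlim_compose[OF filterlim_abs_real r])
 have le1: "epsilon n <= 1 / (1 + \<bar>r n\<bar>)" "\<bar>L n\<bar> * epsilon n <= 1 / (1 + \<bar>r n\<bar>)" for n
  unfolding epsilon_def by (simp_all add: divide_simps) (auto simp: field_simps)
 have epsilonlim: "epsilon \<longlonglongrightarrow> 0"
  by (rule Lim_null_comparison[OF _ rinv]) (use le1(1) epsilon0 in \<open>auto intro!: always_eventually simp: less_imp_le\<close>)
 have Lepsilon: "(%n. L n * epsilon n) \<longlonglongrightarrow> 0"
  by (rule Lim_null_comparison[OF _ rinv]) (use le1(2) epsilon0 in \<open>auto intro!: always_eventually simp: abs_mult less_imp_le\<close>)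
 have rholim: "filterlim rho at_top sequentially"
  unfolding rho_def using filterlim_tendsto_add_at_top[OF tendsto_const r, of "1 / 2"] by (simp add: add.commute)
 define fr where "fr n = packet (rho n) e k" for n
 have frs: "schwartz (fr n)" "(LBINT x. fr n x) = 0" if "1 <= r n" for n
  using that unfolding fr_def rho_def by (intro schwartz_packet packet_integral k e; simp)+
 txt \<open>By the parallelogram law one of the two signs of the perturbation makes the energy positive.\<close>
 have sg: "\<exists>c\<in>{epsilon n, - epsilon n}. 0 < En (%x. fr n x + c * q x) \<and> En (%x. fr n x + c * q x) <= 2 * (c' * ghat (t * r n)) + 2 * (epsilon n)^2 * En q"
  if n: "1 <= r n" and c': "c' = \<bar>c\<bar>" for n c'
 proof -
  note fe = fourier_energy_nonneg[OF pf t nonneg]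
  have "schwartz (%x. fr n x + c * q x)" for c by (intro schwartz_add schwartz_cmult frs n q)
  moreover have "(LBINT x. fr n x + c * q x) = 0" for c
   using schwartz_integrable[OF frs(1)[OF n]] schwartz_integrable[OF q(1)] frs(2)[OF n] q(2) by simp
  ultimately have nn: "0 <= En (%x. fr n x + c * q x)" for c
   unfolding En_def by (intro fe) auto
  have sum: "En (%x. fr n x + epsilon n * q x) + En (%x. fr n x + (- epsilon n) * q x) = 2 * En (fr n) + 2 * (epsilon n)^2 * En q"
   unfolding En_def by (rule fourier_energy_parallelogram[OF pf t nonneg frs[OF n] q])
  have "0 <= En (fr n)" unfolding En_def by (intro fe frs[OF n]) auto
  moreover have "0 < (epsilon n)^2 * En q" using epsilon0[of n] Eq(1) by simp
  moreover have "En (fr n) <= c' * ghat (t * r n)"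
   using E[of n] n t nonneg[of "t * r n"] unfolding En_def fr_def rho_def c'
   by (elim order_trans) (auto intro!: mult_right_mono)
  ultimately show ?thesis using sum nn[of "epsilon n"] nn[of "- epsilon n"]
   by (cases "0 < En (%x. fr n x + epsilon n * q x)") auto
 qed
 have "\<exists>c0. \<forall>n. \<bar>c0 n\<bar> <= epsilon n \<and> (1 <= r n --> 0 < En (%x. fr n x + c0 n * q x) \<and> En (%x. fr n x + c0 n * q x) <= 2 * (\<bar>c\<bar> * ghat (t * r n)) + 2 * (epsilon n)^2 * En q)"
 proof (rule choice, rule allI)
  fix n
  show "\<exists>c0. \<bar>c0\<bar> <= epsilon n \<and> (1 <= r n --> 0 < En (%x. fr n x + c0 * q x) \<and> En (%x. fr n x + c0 * q x) <= 2 * (\<bar>c\<bar> * ghat (t * r n)) + 2 * (epsilon n)^2 * En q)"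
  proof (cases "1 <= r n")
   case True
   from sg[OF True refl] obtain c0 where "c0 \<in> {epsilon n, - epsilon n}" "0 < En (%x. fr n x + c0 * q x)"
    "En (%x. fr n x + c0 * q x) <= 2 * (\<bar>c\<bar> * ghat (t * r n)) + 2 * (epsilon n)^2 * En q" by (elim bexE conjE) (rule that)
   then show ?thesis using epsilon0[of n] by (intro exI[of _ c0]) auto
  next
   case False
   then show ?thesis using epsilon0[of n] by (intro exI[of _ 0]) auto
  qed
 qed
 then obtain c0 where c0: "\<And>n. \<bar>c0 n\<bar> <= epsilon n" "\<And>n. 1 <= r n ==> 0 < En (%x. fr n x + c0 n * q x)"
  "\<And>n. 1 <= r n ==> En (%x. fr n x + c0 n * q x) <= 2 * (\<bar>c\<bar> * ghat (t * r n)) + 2 * (epsilon n)^2 * En q" by (elim exE) (rule that, auto)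
 have c0lim: "c0 \<longlonglongrightarrow> 0"
  by (rule Lim_null_comparison[OF _ epsilonlim]) (use c0(1) in \<open>auto intro!: always_eventually\<close>)
 define f where "f n = (%x. fr n x + c0 n * q x)" for n
 define I where "I n = (\<integral>z. commutator_integrand g (%x. s n x *R e) (f n) h z \<partial>lborel2)" for n
 have Ilim: "(%n. rho n * I n) \<longlonglongrightarrow> J / 2"
  unfolding I_def J_def s_def f_def fr_def q_def
  by (rule commutator_tendsto[OF g delta e k h(1) _ rholim c0lim]) (erule bd)
 \<comment> \<open>The gradient part uses \<open>rho <= 2 * r\<close> and the decay of
   \<open>r^2 * ghat r\<close> at \<open>t * r\<close>, which explains \<open>2 / t\<close>; the
   multiplier part is the hypothesis on \<open>K\<close>.\<close>
 have gamma: "(%n. L n * sqrt (ghat (t * r n))) \<longlonglongrightarrow> 0"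
 proof -
  have "((%x. sqrt (x^2 * ghat x)) \<longlongrightarrow> sqrt 0) at_top" by (intro tendsto_intros decay)
  moreover have "filterlim (%n. t * r n) at_top sequentially" by (rule filterlim_tendsto_pos_mult_at_top[OF tendsto_const t r])
  ultimately have "(%n. sqrt ((t * r n)^2 * ghat (t * r n))) \<longlonglongrightarrow> sqrt 0" by (rule filterlim_compose)
  then have "(%n. (real DIM('a) * C1 * 2 / t) * sqrt ((t * r n)^2 * ghat (t * r n)) + sqrt (ghat (t * r n)) * K (r n)) \<longlonglongrightarrow> (real DIM('a) * C1 * 2 / t) * sqrt 0 + 0"
   by (intro tendsto_add tendsto_mult tendsto_const filterlim_compose[OF K(1) r])
  then have lim: "(%n. (real DIM('a) * C1 * 2 / t) * sqrt ((t * r n)^2 * ghat (t * r n)) + sqrt (ghat (t * r n)) * K (r n)) \<longlonglongrightarrow> 0" by simp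
  show ?thesis
  proof (rule Lim_null_comparison[OF _ lim])
   show "\<forall>\<^sub>F n in sequentially. norm (L n * sqrt (ghat (t * r n))) <= (real DIM('a) * C1 * 2 / t) * sqrt ((t * r n)^2 * ghat (t * r n)) + sqrt (ghat (t * r n)) * K (r n)"
    using r1
   proof eventually_elim
    case (elim n)
    have g0: "0 <= sqrt (ghat (t * r n))" using nonneg[of "t * r n"] t elim by simp
    have "0 <= L n" unfolding L_def rho_def using C1(1) K(2)[of "r n"] elim by (intro add_nonneg_nonneg mult_nonneg_nonneg) auto
    then have "norm (L n * sqrt (ghat (t * r n))) = L n * sqrt (ghat (t * r n))" using g0 by simp
    also have "L n <= real DIM('a) * C1 * (2 * r n) + K (r n)"
     unfolding L_def rho_def using C1(1) elim by (intro add_mono mult_left_mono) auto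
    finally show ?case using g0 t elim by (simp add: real_sqrt_mult mult_right_mono algebra_simps)
   qed
  qed
 qed
 \<comment> \<open>Apart from constant factors, a bound for \<open>rho\<close> times the
   denominator.\<close>
 define eta where "eta n = L n * sqrt (En (f n))" for n
 have etalim: "eta \<longlonglongrightarrow> 0"
 proof (rule Lim_null_comparison)
  have "(%n. sqrt (2 * \<bar>c\<bar>) * (L n * sqrt (ghat (t * r n))) + sqrt (2 * En q) * (L n * epsilon n)) \<longlonglongrightarrow> sqrt (2 * \<bar>c\<bar>) * 0 + sqrt (2 * En q) * 0"
   by (intro tendsto_intros gamma Lepsilon)
  then show "(%n. sqrt (2 * \<bar>c\<bar>) * (L n * sqrt (ghat (t * r n))) + sqrt (2 * En q) * (L n * epsilon n)) \<longlonglongrightarrow> 0" by simp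
  show "\<forall>\<^sub>F n in sequentially. norm (eta n) <= sqrt (2 * \<bar>c\<bar>) * (L n * sqrt (ghat (t * r n))) + sqrt (2 * En q) * (L n * epsilon n)"
   using r1
  proof eventually_elim
   case (elim n)
   have g0: "0 <= ghat (t * r n)" using nonneg[of "t * r n"] t elim by simp
   have L0: "0 <= L n" unfolding L_def rho_def using C1(1) K(2)[of "r n"] elim by (intro add_nonneg_nonneg mult_nonneg_nonneg) auto
   have "sqrt (En (f n)) <= sqrt (2 * (\<bar>c\<bar> * ghat (t * r n)) + 2 * (epsilon n)^2 * En q)"
    unfolding f_def using c0(3)[OF elim] by simp
   also have "... <= sqrt (2 * (\<bar>c\<bar> * ghat (t * r n))) + sqrt (2 * (epsilon n)^2 * En q)"
    by (rule sqrt_add_le_add_sqrt) (use g0 Eq in auto)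
   also have "... = sqrt (2 * \<bar>c\<bar>) * sqrt (ghat (t * r n)) + sqrt (2 * En q) * epsilon n"
    using epsilon0[of n] by (simp add: real_sqrt_mult)
   finally have "L n * sqrt (En (f n)) <= L n * (sqrt (2 * \<bar>c\<bar>) * sqrt (ghat (t * r n)) + sqrt (2 * En q) * epsilon n)"
    by (rule mult_left_mono[OF _ L0])
   moreover have "0 <= En (f n)" using c0(2)[OF elim] by (simp add: f_def)
   ultimately show ?case using L0 by (simp add: eta_def algebra_simps)
  qed
 qed
 define T where "T = sqrt (t ^ DIM('a))"
 have T: "0 < T" using t by (simp add: T_def)
 have J0: "0 < \<bar>J\<bar>" using J by (simp add: J_def)
 have "(%n. M * (T * T * sqrt (En h) * eta n)) \<longlonglongrightarrow> M * (T * T * sqrt (En h) * 0)" by (intro tendsto_intros etalim)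
 then have ev1: "\<forall>\<^sub>F n in sequentially. M * (T * T * sqrt (En h) * eta n) < \<bar>J\<bar> / 4"
  by (rule order_tendstoD(2)) (use J0 in simp)
 \<comment> \<open>Any threshold strictly below \<open>J / 2\<close> in modulus is eventually
   exceeded; the same \<open>J / 4\<close> bounds the denominator side from above.\<close>
 have ev2: "\<forall>\<^sub>F n in sequentially. \<bar>J\<bar> / 4 < \<bar>rho n * I n\<bar>"
  by (rule order_tendstoD(1)[OF tendsto_rabs[OF Ilim]]) (use J0 in simp)
 have ev3: "\<forall>\<^sub>F n in sequentially. \<exists>w. fourier_multiplier \<sigma> (%x. s n x *R e) w \<and> Lp_norm p w <= ennreal (K (r n) / rho n)"
  using eventually_compose_filterlim[OF w r] by (simp add: s_def rho_def)
 have "\<exists>n. 1 <= r n \<and> M * (T * T * sqrt (En h) * eta n) < \<bar>J\<bar> / 4 \<and> \<bar>J\<bar> / 4 < \<bar>rho n * I n\<bar> \<and>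
   (\<exists>w. fourier_multiplier \<sigma> (%x. s n x *R e) w \<and> Lp_norm p w <= ennreal (K (r n) / rho n))"
  by (rule eventually_happens'[OF sequentially_bot]) (intro eventually_conj r1 ev1 ev2 ev3)
 then obtain n w where n: "1 <= r n" and n1: "M * (T * T * sqrt (En h) * eta n) < \<bar>J\<bar> / 4" and n2: "\<bar>J\<bar> / 4 < \<bar>rho n * I n\<bar>"
  and w1: "fourier_multiplier \<sigma> (%x. s n x *R e) w" and w2: "Lp_norm p w <= ennreal (K (r n) / rho n)" by (elim exE conjE) (rule that)
 have rho1: "1 <= rho n" using n by (simp add: rho_def)
 have rho0: "0 < rho n" using rho1 by simp
 have ss: "schwartz (s n)"
  unfolding s_def by (intro schwartz_Re schwartz_fourier schwartz_complex_of_real schwartz_twin_bump delta)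
 have fs: "schwartz (f n)" unfolding f_def by (intro schwartz_add schwartz_cmult frs n q)
 have f0: "(LBINT x. f n x) = 0"
  unfolding f_def using schwartz_integrable[OF frs(1)[OF n]] schwartz_integrable[OF q(1)] frs(2)[OF n] q(2) by simp
 define G where "G = Lp_norm top (%x. onorm (frechet_derivative (%x. s n x *R e) (at x)))"
 have G1: "G <= ennreal (real DIM('a) * C1)"
  unfolding G_def by (rule Linf_gradient_le[OF ss e]) (use C1(2)[OF rho1] C1(1) in \<open>auto simp: s_def\<close>)
 have "I n \<noteq> 0" using n2 J0 by auto
 \<comment> \<open>A field with zero gradient is constant, and the commutator of a constant field is
   0, contrary to \<open>I n \<noteq> 0\<close>.\<close>
 have G0: "0 < G"
 proof (rule ccontr)
  assume "\<not> 0 < G"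
  then have "Lp_norm top (%x. onorm (frechet_derivative (%x. s n x *R e) (at x))) = 0"
   unfolding G_def by (simp add: not_gr_zero)
  from Linf_gradient_eq_0[OF ss e this] have "s n x = s n y" for x y .
  then have "commutator_integrand g (%x. s n x *R e) (f n) h z = 0" for z
   unfolding commutator_integrand_def case_prod_beta by (simp only: diff_self inner_zero_left mult_zero_left flip: scaleR_diff_left) simp
  then have "commutator_integrand g (%x. s n x *R e) (f n) h = (%z. 0)" by (rule ext)
  then have "I n = 0" unfolding I_def by simp
  then show False using \<open>I n \<noteq> 0\<close> by simp
 qed
 define A where "A = G + Lp_norm p w"
 have AL: "A <= ennreal (L n / rho n)"
 proof -
  have "A <= ennreal (real DIM('a) * C1) + ennreal (K (r n) / rho n)" unfolding A_def by (intro add_mono G1 w2)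
  also have "... = ennreal (L n / rho n)"
   using C1(1) K(2)[of "r n"] rho0 by (subst ennreal_plus[symmetric]) (auto simp: L_def add_divide_distrib)
  finally show ?thesis .
 qed
 then have At: "A < top" using ennreal_less_top[of "L n / rho n"] by (rule order_le_less_trans)
 have L0: "0 <= L n" unfolding L_def using C1(1) K(2)[of "r n"] rho0 by (intro add_nonneg_nonneg mult_nonneg_nonneg) auto
 have A0: "0 < enn2real A" using At G0 unfolding enn2real_positive_iff A_def by (auto simp: add_pos_nonneg)
 have A1: "enn2real A <= L n / rho n"
  using enn2real_mono[OF AL ennreal_less_top] L0 rho0 by simp
 have ef: "energy_norm (dilate t g) u = T * sqrt (En u)" if "schwartz u" "(LBINT x. u x) = 0" for u
  unfolding fourier_energy(2)[OF pf t that] T_def En_def real_sqrt_mult ..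
 define B where "B = enn2real A * energy_norm (dilate t g) (f n) * energy_norm (dilate t g) h"
 have B_eq: "B = enn2real A * (T * sqrt (En (f n))) * (T * sqrt (En h))" unfolding B_def ef[OF fs f0] ef[OF h] ..
 have Ef: "0 < En (f n)" using c0(2)[OF n] by (simp add: f_def)
 have B0: "0 < B" unfolding B_eq using A0 T Ef Eq(2) by simp
 have "M * B <= \<bar>I n\<bar>"
 proof (cases "0 <= M")
  case True
  have "B <= (L n / rho n) * (T * sqrt (En (f n))) * (T * sqrt (En h))"
   unfolding B_eq using A1 T Ef Eq(2) by (intro mult_right_mono) auto
  also have "... = T * T * sqrt (En h) * eta n / rho n" by (simp add: eta_def)
  finally have "M * B <= M * (T * T * sqrt (En h) * eta n) / rho n" using mult_left_mono[OF _ True] by fastforce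
  also have "... <= \<bar>rho n * I n\<bar> / rho n" using n1 n2 rho0 by (intro divide_right_mono) auto
  also have "... = \<bar>I n\<bar>" using rho0 by (simp add: abs_mult)
  finally show ?thesis .
 next
  case False
  then have "M * B <= 0" using B0 by (simp add: mult_nonpos_nonneg)
  then show ?thesis by simp
 qed
 then have "M <= \<bar>I n\<bar> / B" using B0 by (simp add: pos_le_divide_eq)
 moreover have "integrable lborel2 (commutator_integrand g (%x. s n x *R e) (f n) h)"
  unfolding s_def f_def fr_def q_def by (rule commutator_integrable[OF g delta e k h(1) _ rho0]) (erule bd)
 moreover have "smooth_on UNIV (%x. s n x *R e)"
  by (rule schwartz_smooth[OF schwartz_bounded_linear[OF bounded_linear_scaleR_left ss]])
 ultimately show ?thesis
  using fs f0 h w1 At B0 unfolding A_def G_def B_def I_def Let_def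
  by (intro exI[of _ "%x. s n x *R e"] exI[of _ w] exI[of _ "f n"] exI[of _ h]) (intro conjI)
qed

section \<open>Packet energies and general facts on radial potentials\<close>

lemma fourier_real_0: "fourier_real u 0 = cor (LBINT x. u x)"
 by (simp add: fourier_eq integral_complex_of_real)

lemma fourier_real_nonzero_near_0:
 fixes a :: "'a::euclidean_space => real"
 assumes a: "schwartz a" and a0: "(LBINT x. a x) \<noteq> 0"
 shows "\<exists>s>0. \<forall>xi. norm xi < s --> fourier_real a xi \<noteq> 0"
proof -
 have "isCont (fourier_real a) 0"
  by (intro fourier_isCont schwartz_integrable schwartz_complex_of_real a)
 then have "\<forall>\<^sub>F xi in nhds 0. fourier_real a xi \<noteq> 0"
  using a0 unfolding isCont_def tendsto_at_iff_tendsto_nhds by (intro tendsto_imp_eventually_ne[where c = "fourier_real a 0"]) (auto simp: fourier_real_0)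
 then show ?thesis unfolding eventually_nhds_metric by (simp add: dist_norm)
qed

text \<open>One power of the decay of each factor pays for the linear growth of
  \<open>D (x - y)\<close>.\<close>

lemma decays_pair_bound:
 fixes a b D :: "'a::euclidean_space => real"
 assumes a: "decays a" and b: "decays b" and D: "\<And>z. \<bar>D z\<bar> <= c * (1 + norm z)"
 shows "\<exists>C. \<forall>x y. \<bar>a x * D (x - y) * b y\<bar> <= C / (1 + norm (x, y)) ^ N"
proof -
 obtain A where A: "A > 0" "\<And>x. norm (a x) <= A / (1 + norm x) ^ (N + 1)" using decaysE[OF a, where n = "N + 1"] by blast
 obtain B where B: "B > 0" "\<And>x. norm (b x) <= B / (1 + norm x) ^ (N + 1)" using decaysE[OF b, where n = "N + 1"] by blast
 have c: "0 <= c" using D[of 0] abs_ge_zero[of "D 0"] by simp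
 have eq: "(A / X ^ (N + 1)) * (c * (X * Y)) * (B / Y ^ (N + 1)) = (A * c * B) / (X * Y) ^ N" if "0 < X" "0 < Y" for X Y :: real
  using that by (simp add: power_mult_distrib field_simps)
 have "\<bar>a x * D (x - y) * b y\<bar> <= (A * c * B) / (1 + norm (x, y)) ^ N" for x y
 proof -
  have p: "0 < 1 + norm x" "0 < 1 + norm y" "0 < 1 + norm (x, y)" by (intro add_pos_nonneg; simp)+
  have "norm (x, y) <= norm x + norm y" using norm_triangle_ineq[of "(x, 0)" "(0, y)"] by simp
  also have "... <= norm x + norm y + norm x * norm y" by simp
  finally have n: "1 + norm (x, y) <= (1 + norm x) * (1 + norm y)" by (simp add: algebra_simps)
  have "\<bar>a x * D (x - y) * b y\<bar> <= (A / (1 + norm x) ^ (N + 1)) * (c * ((1 + norm x) * (1 + norm y))) * (B / (1 + norm y) ^ (N + 1))"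
   unfolding abs_mult using A B c p D[of "x - y"] mult_left_mono[OF one_plus_norm_diff_le[of x y] c]
   by (intro mult_mono) auto
  also have "... = (A * c * B) / ((1 + norm x) * (1 + norm y)) ^ N"
   by (rule eq[OF p(1,2)])
  also have "... <= (A * c * B) / (1 + norm (x, y)) ^ N"
   using A B c p n by (intro divide_left_mono power_mono mult_pos_pos zero_less_power) auto
  finally show ?thesis .
 qed
 then show ?thesis by blast
qed

lemma schwartz_sum:
 fixes f :: "'b => 'a::euclidean_space => real"
 assumes "\<And>b. b \<in> A ==> schwartz (f b)"
 shows "schwartz (%x. \<Sum>b\<in>A. f b x)"
proof -
 have 0: "schwartz (%x::'a. 0 :: real)" using schwartz_cmult[OF schwartz_bump[of 1], of 0, where 'a = 'a] by simp
 show ?thesis using assms by (induction A rule: infinite_finite_induct) (simp_all add: 0 schwartz_add)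
qed

text \<open>The transform of the packet is a difference of two translates of that of
  \<open>k\<close>, with weight \<open>(xi \<bullet> e) / (2 * rho)\<close>. The bound for each
  translate has two parts: \<open>m\<close> follows the shifted frequency \<open>eta\<close>, so
  translation leaves its integral unchanged, while \<open>W\<close> stays at \<open>xi\<close> and
  accounts for the low frequencies, where \<open>ghat\<close> may be large.\<close>

lemma packet_energy_le:
 fixes k m W :: "'a::euclidean_space => real"
 assumes k: "schwartz k" and e: "e \<in> Basis" and rho: "0 < rho"
  and m: "integrable lborel m" and W: "integrable lborel W" and i: "integrable lborel (%xi. G xi * (norm (fourier_real (packet rho e k) xi))^2)"
  and le: "\<And>xi eta. xi \<noteq> 0 ==> eta \<in> {xi - rho *R e, xi + rho *R e} ==> G xi * (xi \<bullet> e)^2 * (norm (fourier_real k eta))^2 <= rho^2 * (c * (m eta + W xi))"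
  and G: "\<And>xi. xi \<noteq> 0 ==> 0 <= G xi"
 shows "(LBINT xi. G xi * (norm (fourier_real (packet rho e k) xi))^2) <= c * ((LBINT xi. m xi) + (LBINT xi. W xi))"
proof -
 have mt: "integrable lborel (%xi. m (xi - rho *R e))" "integrable lborel (%xi. m (xi + rho *R e))"
  "(LBINT xi. m (xi - rho *R e)) = (LBINT xi. m xi)" "(LBINT xi. m (xi + rho *R e)) = (LBINT xi. m xi)"
  using lborel_integrable_translate[OF m] lborel_integral_translate[of m "- (rho *R e)"] lborel_integral_translate[of m "rho *R e"]
   lborel_integrable_translate[OF m, of "- (rho *R e)"] by auto
 have "(LBINT xi. G xi * (norm (fourier_real (packet rho e k) xi))^2) <= (LBINT xi. (c / 2) * (m (xi - rho *R e) + m (xi + rho *R e) + 2 * W xi))"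
 proof (rule integral_mono_AE[OF i])
  show "integrable lborel (%xi. (c / 2) * (m (xi - rho *R e) + m (xi + rho *R e) + 2 * W xi))"
   using mt W by (intro integrable_mult_right Bochner_Integration.integrable_add) auto
  have "AE xi in lborel. xi \<noteq> (0::'a)" by (rule AE_lborel_singleton)
  then show "AE xi in lborel. G xi * (norm (fourier_real (packet rho e k) xi))^2 <= (c / 2) * (m (xi - rho *R e) + m (xi + rho *R e) + 2 * W xi)"
  proof eventually_elim
   case (elim xi)
   define x y where "x = fourier_real k (xi - rho *R e)" and "y = fourier_real k (xi + rho *R e)"
   have "(norm (x - y))^2 <= (norm x + norm y)^2" by (intro power_mono norm_triangle_ineq4) simp
   also have "... <= 2 * ((norm x)^2 + (norm y)^2)" using sum_squares_bound[of "norm x" "norm y"] by (simp add: power2_sum)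
   finally have "((xi \<bullet> e) / (2 * rho))^2 * (norm (x - y))^2 <= ((xi \<bullet> e) / (2 * rho))^2 * (2 * ((norm x)^2 + (norm y)^2))"
    by (rule mult_left_mono) simp
   then have "G xi * (((xi \<bullet> e) / (2 * rho))^2 * (norm (x - y))^2) <= G xi * (((xi \<bullet> e) / (2 * rho))^2 * (2 * ((norm x)^2 + (norm y)^2)))"
    by (rule mult_left_mono[OF _ G[OF elim]])
   also have "... = (G xi * (xi \<bullet> e)^2 * (norm x)^2 + G xi * (xi \<bullet> e)^2 * (norm y)^2) / (2 * rho^2)"
    using rho by (simp add: power_divide power_mult_distrib divide_simps) (simp add: algebra_simps)
   also have "... <= (rho^2 * (c * (m (xi - rho *R e) + W xi)) + rho^2 * (c * (m (xi + rho *R e) + W xi))) / (2 * rho^2)"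
    unfolding x_def y_def by (intro divide_right_mono add_mono le elim) auto
   also have "... = (c / 2) * (m (xi - rho *R e) + m (xi + rho *R e) + 2 * W xi)"
    using rho by (simp add: field_simps)
   finally show ?case
    unfolding fourier_packet[OF k e rho] norm_mult norm_of_real power_mult_distrib power2_abs x_def y_def by simp
  qed
 qed
 also have "... = c * ((LBINT xi. m xi) + (LBINT xi. W xi))"
  using mt W by (simp add: field_simps)
 finally show ?thesis .
qed

locale radial_potential =
 fixes g :: "'a::euclidean_space => real" and ghat :: "real => real"
 assumes smooth: "smooth_on (- {0}) g"
  and radial: "\<And>x y. x \<noteq> 0 ==> norm x = norm y ==> g x = g y"
  and pf: "potential_fourier g (%xi. ghat (norm xi))"
  and noninc: "antimono_on {0<..} ghat"
  and nonconst: "\<exists>x y. x \<noteq> 0 \<and> y \<noteq> 0 \<and> g x \<noteq> g y"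
  and decay: "((%r. r^2 * ghat r) \<longlongrightarrow> 0) at_top"
begin

lemma ghat_mono: "0 < r ==> r <= s ==> ghat s <= ghat r"
 using noninc by (auto simp: monotone_on_def)

text \<open>By monotonicity a negative value would persist, and \<open>r^2 * ghat r\<close> would
  stay below a negative constant instead of tending to 0.\<close>

lemma ghat_nonneg:
 assumes r: "0 < r"
 shows "0 <= ghat r"
proof (rule ccontr)
 assume n: "\<not> 0 <= ghat r"
 then have "\<forall>\<^sub>F s in at_top. ghat r < s^2 * ghat s" by (intro order_tendstoD(1)[OF decay]) simp
 moreover have "\<forall>\<^sub>F s in at_top. max 1 r <= s" by (rule eventually_ge_at_top)
 ultimately obtain s where s: "ghat r < s^2 * ghat s" "max 1 r <= s"
  using eventually_happens'[OF trivial_limit_at_top_linorder eventually_conj] by blast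
 have "s^2 * ghat s <= 1 * ghat s" using s ghat_mono[OF r, of s] n by (intro mult_right_mono_neg) auto
 then show False using s ghat_mono[OF r, of s] by simp
qed

lemma g_even: "g (- x) = g x"
 by (cases "x = 0") (auto intro: radial)

lemma g_tempered: "tempered g"
 using pf by (simp add: potential_fourier_def)

lemma g_isCont: "z \<noteq> 0 ==> isCont g z"
 using dir_deriv_off_0(1)[OF smooth, of "SOME b. b \<in> Basis"] by (auto intro: differentiable_imp_continuous_within SOME_Basis)

text \<open>Otherwise monotonicity and nonnegativity force \<open>ghat\<close> to vanish on the
  whole positive axis. Then \<open>g\<close> annihilates every test with vanishing moments and is
  constant off 0, contrary to \<open>nonconst\<close>.\<close>

lemma ghat_pos_near_0: "\<exists>s>0. \<forall>r. 0 < r \<and> r < s --> 0 < ghat r"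
proof (rule ccontr)
 assume n: "\<not> ?thesis"
 have z: "ghat r = 0" if r: "0 < r" for r
 proof -
  obtain r' where "0 < r'" "r' < r" "\<not> 0 < ghat r'" using n r by blast
  then show ?thesis using ghat_mono[of r' r] ghat_nonneg[OF r] by simp
 qed
 have "AE xi in lborel. xi \<noteq> (0::'a)" by (rule AE_lborel_singleton)
 then have z0: "(LBINT xi. cor (ghat (norm xi)) * F xi) = 0" for F :: "'a => complex"
  by (intro integral_eq_zero_AE) (auto elim!: eventually_mono simp: z)
 obtain x y where xy: "x \<noteq> 0" "y \<noteq> 0" "g x \<noteq> g y" using nonconst by blast
 have "g x = g y"
 proof (rule affine_annihilator[OF g_tempered _ _ _ xy(1,2)])
  fix psi :: "'a => complex"
  assume "schwartz psi" "(LBINT x. psi x) = 0" "\<And>b. b \<in> Basis ==> (LBINT x. cor (b \<bullet> x) * psi x) = 0"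
  from potential_fourier_pairing(2)[OF pf this] show "(LBINT x. cor (g x) * psi x) = 0" unfolding z0 .
 qed (auto intro: g_isCont g_even)
 then show False using xy by simp
qed

lemma ghat_measurable [measurable]: "(%xi::'a. ghat (c * norm xi)) \<in> borel_measurable borel" if "0 < c"
proof -
 \<comment> \<open>\<open>ghat\<close> is monotone on the positive axis only; the exponential
   transports this to the whole line.\<close>
 have "mono (%s. - ghat (exp s))" by (intro monoI) (simp add: ghat_mono)
 then have "(%s. - ghat (exp s)) \<in> borel_measurable borel" by (rule borel_measurable_mono)
 then have [measurable]: "(%s. ghat (exp s)) \<in> borel_measurable borel" by simp
 have "(%xi::'a. if xi = 0 then ghat 0 else ghat (exp (ln (c * norm xi)))) \<in> borel_measurable borel" by measurable
 also have "(%xi::'a. if xi = 0 then ghat 0 else ghat (exp (ln (c * norm xi)))) = (%xi. ghat (c * norm xi))"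
  using that by (auto simp: fun_eq_iff)
 finally show ?thesis .
qed

text \<open>The integrand is positive on an open set near 0. The hyperplane
  \<open>xi \<bullet> e = 0\<close> is left out because transforms of derivatives along
  \<open>e\<close> vanish on it.\<close>

lemma energy_pos:
 fixes u :: "'a => real"
 assumes c: "0 < c" and e: "e \<in> Basis" and u: "schwartz u" "(LBINT x. u x) = 0"
  and s: "0 < s" "\<And>xi. xi \<bullet> e \<noteq> 0 ==> norm xi < s ==> fourier_real u xi \<noteq> 0"
 shows "0 < spectral_energy ghat c u"
proof -
 obtain s0 where s0: "0 < s0" "\<And>r. 0 < r ==> r < s0 ==> 0 < ghat r" using ghat_pos_near_0 by blast
 define S where "S = {xi. xi \<bullet> e \<noteq> 0} \<inter> ball 0 (min s (s0 / c))"
 show ?thesis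
 proof (rule integral_pos_open[OF fourier_energy(1)[OF pf c u], where S = S])
  show "0 <= ghat (c * norm xi) * (norm (fourier_real u xi))^2" for xi
   using c u by (cases "xi = 0") (auto simp: fourier_real_0 ghat_nonneg)
  have "open {xi. xi \<bullet> e \<noteq> 0}" by (intro open_Collect_neq continuous_intros)
  then show "open S" unfolding S_def by (intro open_Int) auto
  have "(min s (s0 / c) / 2) *R e \<in> S" using s s0 c e by (auto simp: S_def min_def)
  then show "S \<noteq> {}" by blast
  fix xi assume xi: "xi \<in> S"
  then have "xi \<noteq> 0" "c * norm xi < s0" using c by (auto simp: S_def pos_less_divide_eq mult.commute)
  then show "0 < ghat (c * norm xi) * (norm (fourier_real u xi))^2"
   using xi s(2)[of xi] s0(2)[of "c * norm xi"] c by (simp add: S_def)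
 qed
qed

text \<open>\<open>norm xi ^ 2\<close> times a bump vanishes to second order at 0 and is an
  admissible test, so integrability is part of \<open>potential_fourier\<close>. A dilation supplies
  the factor \<open>c\<close>.\<close>

lemma ghat_integrable_near_0:
 assumes R: "0 < R" and c: "0 < c"
 shows "integrable lborel (%xi::'a. indicator (cball 0 R) xi * (norm xi)^2 * ghat (c * norm xi))"
proof -
 have 1: "integrable lborel (%xi::'a. indicator (cball 0 R) xi * (norm xi)^2 * ghat (norm xi))" if R: "0 < R" for R
 proof -
  have gm: "(%xi::'a. ghat (norm xi)) \<in> borel_measurable borel" using ghat_measurable[of 1] by simp
  define phi where "phi xi = cor (xi \<bullet> xi * bump (2 * R) xi)" for xi :: 'a
  have "schwartz (%xi::'a. \<Sum>b\<in>Basis. (xi \<bullet> b) * ((xi \<bullet> b) * bump (2 * R) xi))"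
  proof (rule schwartz_sum)
   fix b :: 'a
   have m: "moderate (%x::'a. x \<bullet> b)" using moderate_of_real_inner[of b, where 'b = real] by (simp add: inner_commute)
   show "schwartz (%xi. xi \<bullet> b * (xi \<bullet> b * bump (2 * R) xi))"
    using R by (intro schwartz_moderate_mult[OF m] schwartz_bump) simp
  qed
  also have "(%xi::'a. \<Sum>b\<in>Basis. (xi \<bullet> b) * ((xi \<bullet> b) * bump (2 * R) xi)) = (%xi. xi \<bullet> xi * bump (2 * R) xi)"
  proof
   fix xi :: 'a
   show "(\<Sum>b\<in>Basis. (xi \<bullet> b) * ((xi \<bullet> b) * bump (2 * R) xi)) = xi \<bullet> xi * bump (2 * R) xi"
    unfolding euclidean_inner[of xi xi] sum_distrib_right mult.assoc ..
  qed
  finally have s: "schwartz (%xi::'a. xi \<bullet> xi * bump (2 * R) xi)" .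
  then have phi: "schwartz phi" unfolding phi_def by (rule schwartz_complex_of_real)
  have d: "dir_deriv b phi 0 = 0" for b
  proof -
   have "((%xi::'a. xi \<bullet> xi) has_derivative (%h. 0)) (at 0)" by (auto intro!: derivative_eq_intros)
   moreover have "(bump (2 * R) has_derivative (%h. dir_deriv h (bump (2 * R)) 0)) (at (0::'a))"
    using R by (intro has_derivative_dir_deriv schwartz_differentiable schwartz_bump) simp
   ultimately have "((%xi::'a. xi \<bullet> xi * bump (2 * R) xi) has_derivative (%h. 0)) (at 0)"
    using has_derivative_mult by fastforce
   then have "(phi has_derivative (%h. cor 0)) (at 0)" unfolding phi_def by (rule has_derivative_of_real)
   then show ?thesis by (simp add: dir_deriv_eq)
  qed
  have "phi 0 = 0" by (simp add: phi_def)
  then have "integrable lborel (%xi. cor (ghat (norm xi)) * phi xi)"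
   using pf phi d unfolding potential_fourier_def by (simp add: dir_deriv_def[abs_def])
  then have i: "integrable lborel (%xi. norm (cor (ghat (norm xi)) * phi xi))" by (rule integrable_norm)
  \<comment> \<open>The minimum of \<open>bump (2 * R)\<close> on the ball of radius
    \<open>R\<close>, from \<open>(2 * R)^2 - R^2 = 3 * R^2\<close>.\<close>
  define b0 where "b0 = exp (- (1 / (3 * R^2)))"
  have b: "b0 <= bump (2 * R) xi" if "xi \<in> cball 0 R" for xi :: 'a
  proof -
   have "xi \<bullet> xi <= R^2" using that by (simp add: dot_square_norm power_mono)
   then have 1: "3 * R^2 <= (2 * R)^2 - xi \<bullet> xi" by (simp add: power_mult_distrib)
   have 2: "0 < 3 * R^2" using R by simp
   have p: "0 < (2 * R)^2 - xi \<bullet> xi" using 1 2 by linarith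
   show ?thesis unfolding b0_def bump_def flat_exp_def if_P[OF p] poly_1 mult_1 exp_le_cancel_iff neg_le_iff_le
    by (rule frac_le[OF _ order_refl 2 1]) simp
  qed
  show ?thesis
  proof (rule integrable_dom[OF integrable_mult_right[OF i, of "1 / b0"]])
   show "AE xi in lborel. norm (indicator (cball 0 R) xi * (norm xi)^2 * ghat (norm xi)) <= norm (1 / b0 * norm (cor (ghat (norm xi)) * phi xi))"
   proof (rule AE_I2)
    fix xi :: 'a
    have b0: "0 < b0" by (simp add: b0_def)
    show "norm (indicator (cball 0 R) xi * (norm xi)^2 * ghat (norm xi)) <= norm (1 / b0 * norm (cor (ghat (norm xi)) * phi xi))"
    proof (cases "xi \<in> cball 0 R")
     case True
     have "b0 * ((norm xi)^2 * \<bar>ghat (norm xi)\<bar>) <= bump (2 * R) xi * ((norm xi)^2 * \<bar>ghat (norm xi)\<bar>)"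
      by (intro mult_right_mono b True) simp
     then show ?thesis using True b0 bump_nonneg[of "2 * R" xi]
      by (simp add: phi_def norm_mult norm_power abs_mult dot_square_norm pos_le_divide_eq mult_ac)
    qed simp
   qed
  qed (use gm in \<open>auto intro!: borel_measurable_times borel_measurable_indicator\<close>)
 qed
 have "integrable lborel (%xi::'a. (1 / c^2) * (indicator (cball 0 (c * R)) (0 + c *R xi) * (norm (0 + c *R xi))^2 * ghat (norm (0 + c *R xi))))"
  using R c by (intro integrable_mult_right lborel_integrable_affine 1) auto
 also have "(%xi::'a. (1 / c^2) * (indicator (cball 0 (c * R)) (0 + c *R xi) * (norm (0 + c *R xi))^2 * ghat (norm (0 + c *R xi))))
   = (%xi. indicator (cball 0 R) xi * (norm xi)^2 * ghat (c * norm xi))"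
  using c by (auto simp: fun_eq_iff power_mult_distrib indicator_def)
 finally show ?thesis .
qed

text \<open>The interface between the two cases and the conclusion: everything in
  \<open>commutator_unbounded\<close> that depends on the choice of \<open>delta\<close>,
  \<open>k\<close>, \<open>h\<close> and the radii, with \<open>delta <= 1 / 2\<close> for the
  multiplier estimate.\<close>

definition test_data :: "real => 'a => real => ('a => real) => ('a => real) => (nat => real) => bool" where
 "test_data t e delta k h r \<longleftrightarrow> 0 < delta \<and> delta <= 1 / 2 \<and> schwartz k \<and> schwartz h \<and> (LBINT x. h x) = 0 \<and>
  (\<exists>C. \<forall>u\<in>{k, dir_deriv e k}. \<forall>x y. \<bar>u x * dir_deriv e g (x - y) * h y\<bar> <= C / (1 + norm (x, y)) ^ (DIM('a \<times> 'a) + 1)) \<and>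
  (\<integral>(x, y). Re (fourier_real (bump delta) x) * (k x * dir_deriv e g (x - y) * h y) \<partial>lborel2) \<noteq> 0 \<and>
  filterlim r at_top sequentially \<and>
  (\<exists>c. \<forall>n. spectral_energy ghat t (packet (r n + 1 / 2) e k) <= c * ghat (t * r n)) \<and>
  0 < spectral_energy ghat t h \<and>
  0 < spectral_energy ghat t (dir_deriv e k)"

end

section \<open>The case of fast decay: \<open>g\<close> as an absolutely convergent cosine
  integral\<close>

lemma tempered_diff:
 fixes f g :: "'a::euclidean_space => real"
 assumes "tempered f" "tempered g"
 shows "tempered (%x. f x - g x)"
proof -
 obtain M N where M: "integrable lborel (%x. (1 / (1 + norm x) ^ M) *R f x)" and N: "integrable lborel (%x. (1 / (1 + norm x) ^ N) *R g x)"
  and [measurable]: "f \<in> borel_measurable borel" "g \<in> borel_measurable borel" using assms unfolding tempered_def by blast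
 have le: "\<bar>u / (1 + norm x) ^ (M + N)\<bar> <= \<bar>(1 / (1 + norm x) ^ m) *R u\<bar>" if "m <= M + N" for u m and x :: 'a
 proof -
  have "\<bar>u\<bar> / (1 + norm x) ^ (M + N) <= \<bar>u\<bar> / (1 + norm x) ^ m"
   by (intro divide_left_mono power_increasing that mult_pos_pos zero_less_power add_pos_nonneg) auto
  then show ?thesis by (simp add: abs_mult)
 qed
 have "integrable lborel (%x. f x / (1 + norm x) ^ (M + N))" "integrable lborel (%x. g x / (1 + norm x) ^ (M + N))"
  by (rule integrable_dom[OF M], measurable, use le[of M] in \<open>auto intro!: AE_I2\<close>)
   (rule integrable_dom[OF N], measurable, use le[of N] in \<open>auto intro!: AE_I2\<close>)
 from Bochner_Integration.integrable_diff[OF this]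
 have "integrable lborel (%x. (1 / (1 + norm x) ^ (M + N)) *R (f x - g x))" by (simp add: diff_divide_distrib)
 then show ?thesis unfolding tempered_def by auto
qed

lemma tempered_polynomially_bounded:
 fixes u :: "'a::euclidean_space => real"
 assumes [measurable]: "u \<in> borel_measurable borel" and bd: "\<And>x. \<bar>u x\<bar> <= C * (1 + norm x) ^ m"
 shows "tempered u"
proof -
 have C: "0 <= C" using bd[of 0] abs_ge_zero[of "u 0"] by simp
 have "integrable lborel (%x. (1 / (1 + norm x) ^ (m + (DIM('a) + 1))) *R u x)"
 proof (rule integrable_dom[OF integrable_mult_right[OF tensor_weight_integrable, of C]])
  show "AE x in lborel. norm ((1 / (1 + norm x) ^ (m + (DIM('a) + 1))) *R u x) <= norm (C * tensor_weight x)"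
  proof (rule AE_I2)
   fix x :: 'a
   have p: "0 < (1 + norm x) ^ n" for n by (intro zero_less_power add_pos_nonneg) auto
   have "norm ((1 / (1 + norm x) ^ (m + (DIM('a) + 1))) *R u x) <= 1 / (1 + norm x) ^ (m + (DIM('a) + 1)) * (C * (1 + norm x) ^ m)"
    using bd[of x] less_imp_le[OF p] by (simp add: abs_mult divide_right_mono)
   also have "... = C * (1 / (1 + norm x) ^ (DIM('a) + 1))"
    unfolding power_add[of _ m] using p[of m] by (simp del: power_Suc add: field_simps)
   also have "... <= C * tensor_weight x" by (rule mult_left_mono[OF inverse_norm_power_le_tensor_weight C])
   finally show "norm ((1 / (1 + norm x) ^ (m + (DIM('a) + 1))) *R u x) <= norm (C * tensor_weight x)" by simp
  qed
 qed measurable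
 with assms(1) show ?thesis unfolding tempered_def by (intro conjI exI)
qed

text \<open>The first bound is quadratic for small arguments and serves low frequencies; the second
  is linear and serves high ones.\<close>

lemma abs_cos_diff_le: "\<bar>cos a - cos b\<bar> <= \<bar>a + b\<bar> * \<bar>a - b\<bar> / 2" "\<bar>cos a - cos b\<bar> <= \<bar>a - b\<bar>" for a b :: real
proof -
 have "cos a - cos b = 2 * sin ((a + b) / 2) * sin ((b - a) / 2)" by (rule cos_diff_cos)
 then have eq: "\<bar>cos a - cos b\<bar> = 2 * (\<bar>sin ((a + b) / 2)\<bar> * \<bar>sin ((b - a) / 2)\<bar>)" by (simp add: abs_mult)
 have s: "\<bar>sin ((b - a) / 2)\<bar> <= \<bar>a - b\<bar> / 2" using abs_sin_x_le_abs_x[of "(b - a) / 2"] by simp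
 have "\<bar>sin ((a + b) / 2)\<bar> * \<bar>sin ((b - a) / 2)\<bar> <= (\<bar>a + b\<bar> / 2) * (\<bar>a - b\<bar> / 2)"
  by (intro mult_mono s) (use abs_sin_x_le_abs_x[of "(a + b) / 2"] in auto)
 then show "\<bar>cos a - cos b\<bar> <= \<bar>a + b\<bar> * \<bar>a - b\<bar> / 2" unfolding eq by simp
 have "\<bar>sin ((a + b) / 2)\<bar> * \<bar>sin ((b - a) / 2)\<bar> <= 1 * (\<bar>a - b\<bar> / 2)"
  by (intro mult_mono s) auto
 then show "\<bar>cos a - cos b\<bar> <= \<bar>a - b\<bar>" unfolding eq by simp
qed

lemma fourier_real_dir_deriv:
 fixes u :: "'a::euclidean_space => real"
 assumes u: "schwartz u" and e: "e \<in> Basis"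
 shows "fourier_real (dir_deriv e u) xi = 2 * pi * \<i> * cor (xi \<bullet> e) * fourier_real u xi"
proof -
 have "(%x. cor (dir_deriv e u x)) = dir_deriv e (%x. cor (u x))"
  by (rule ext) (rule dir_deriv_bounded_linear[OF bounded_linear_of_real schwartz_differentiable[OF u], symmetric])
 then show ?thesis using fourier_dir_deriv[OF schwartz_complex_of_real[OF u] e, of xi] by simp
qed

lemma integral_pair_mult:
 fixes f :: "'a::euclidean_space => 'c::{real_normed_field, banach, second_countable_topology}" and g :: "'b::euclidean_space => 'c"
 assumes f: "integrable lborel f" and g: "integrable lborel g"
 shows "(\<integral>(x, y). f x * g y \<partial>lborel2) = (LBINT x. f x) * (LBINT y. g y)"
 using lborel_pair.integral_fst'[OF integrable_pair_mult[OF f g]] by simp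

locale fast_radial_potential = radial_potential g ghat for g :: "'a::euclidean_space => real" and ghat +
 fixes t C :: real and e :: 'a
 assumes t: "0 < t" and e: "e \<in> Basis" and fast: "\<And>r. 1 <= r ==> r ^ (DIM('a) + 2) * ghat (t * r) <= C"
begin

definition "G xi = ghat (norm xi)" for xi :: 'a

text \<open>A common majorant for \<open>ker\<close>, its increments and \<open>dker\<close>. Near 0
  only the second moment of \<open>ghat\<close> is integrable in general; far out one power of
  \<open>norm xi\<close> is needed for the derivative in \<open>z\<close>.\<close>

definition "weight xi = (if norm xi <= t then (norm xi)^2 else norm xi) * G xi" for xi :: 'a

text \<open>The cosine kernel, renormalised by subtracting its value at \<open>z = 0\<close> for low
  frequencies. The subtracted term does not depend on \<open>z\<close> and is invisible to tests of
  zero mean.\<close>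

definition "ker z xi = G xi * (cos (2 * pi * (z \<bullet> xi)) - of_bool (norm xi <= t))" for z xi :: 'a

text \<open>A continuous function that will turn out to equal \<open>g\<close> off 0 up to an
  additive constant.\<close>

definition "regular z = (LBINT xi. ker z xi)" for z :: 'a

definition "dker z xi = - (2 * pi * (xi \<bullet> e) * sin (2 * pi * (z \<bullet> xi)) * G xi)" for z xi :: 'a

lemma G_measurable [measurable]: "G \<in> borel_measurable borel"
 unfolding G_def using ghat_measurable[of 1] by simp

lemma G_nonneg: "xi \<noteq> 0 ==> 0 <= G xi"
 by (simp add: G_def ghat_nonneg)

lemma weight_nonneg: "0 <= weight xi"
 using G_nonneg[of xi] t by (cases "xi = 0") (auto simp: weight_def)

text \<open>Low frequencies are covered by \<open>ghat_integrable_near_0\<close>. For high ones the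
  \<open>d + 2\<close> powers in \<open>fast\<close> split into one for the factor
  \<open>norm xi\<close> and \<open>d + 1\<close> for integrability.\<close>

lemma weight_integrable: "integrable lborel weight"
proof -
 let ?d = "DIM('a) + 1"
 define c where "c = \<bar>C\<bar> * t ^ (DIM('a) + 2) * (1 + 1 / t) ^ ?d"
 have c: "0 <= c" using t by (simp add: c_def)
 define U where "U xi = (if norm xi <= t then 0 else norm xi * G xi)" for xi :: 'a
 have [measurable]: "U \<in> borel_measurable borel" unfolding U_def by measurable
 have "\<bar>U xi\<bar> <= c * tensor_weight xi" for xi
 proof (cases "norm xi <= t")
  case True
  then show ?thesis using c tensor_weight_nonneg[of xi] by (simp add: U_def)
 next
  case False
  define s where "s = norm xi"
  have s: "t < s" "0 < s" using False t by (auto simp: s_def)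
  have "(s / t) ^ (DIM('a) + 2) * ghat (t * (s / t)) <= \<bar>C\<bar>" using fast[of "s / t"] s t by (simp add: pos_le_divide_eq)
  then have "s ^ (DIM('a) + 2) * ghat s <= \<bar>C\<bar> * t ^ (DIM('a) + 2)"
   using s t by (simp add: power_divide pos_divide_le_eq mult.commute)
  then have 1: "s ^ ?d * (s * ghat s) <= \<bar>C\<bar> * t ^ (DIM('a) + 2)" by (simp add: mult_ac)
  have "1 + s <= (1 + 1 / t) * s" using s t by (simp add: field_simps)
  then have "(1 + s) ^ ?d <= ((1 + 1 / t) * s) ^ ?d" using s by (intro power_mono) auto
  then have "(1 + s) ^ ?d * (s * ghat s) <= ((1 + 1 / t) * s) ^ ?d * (s * ghat s)"
   using s by (intro mult_right_mono) (auto simp: ghat_nonneg)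
  also have "... = (1 + 1 / t) ^ ?d * (s ^ ?d * (s * ghat s))" by (simp only: power_mult_distrib mult.assoc)
  also have "... <= (1 + 1 / t) ^ ?d * (\<bar>C\<bar> * t ^ (DIM('a) + 2))" by (rule mult_left_mono[OF 1]) (use t in simp)
  also have "... = c" by (simp add: c_def)
  finally have "s * ghat s <= c * (1 / (1 + s) ^ ?d)" using s by (simp add: pos_le_divide_eq mult.commute del: power_Suc power_Suc2)
  also have "... <= c * tensor_weight xi" unfolding s_def by (rule mult_left_mono[OF inverse_norm_power_le_tensor_weight c])
  finally show ?thesis using False s ghat_nonneg[of s] by (simp add: U_def G_def s_def)
 qed
 then have "norm (U xi) <= norm (c * tensor_weight xi)" for xi using order_trans[OF _ abs_ge_self] by auto
 then have "integrable lborel U"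
  by (intro integrable_dom[OF integrable_mult_right[OF tensor_weight_integrable, of c]] AE_I2) auto
 then have "integrable lborel (%xi. indicator (cball 0 t) xi * (norm xi)^2 * ghat (1 * norm xi) + U xi)"
  using ghat_integrable_near_0[OF t, of 1] by (intro Bochner_Integration.integrable_add) auto
 also have "(%xi. indicator (cball 0 t) xi * (norm xi)^2 * ghat (1 * norm xi) + U xi) = weight"
  by (auto simp: fun_eq_iff weight_def U_def G_def)
 finally show ?thesis .
qed

lemma ker_measurable [measurable]: "ker z \<in> borel_measurable borel" "dker z \<in> borel_measurable borel"
 unfolding ker_def dker_def by measurable

lemma abs_inner_le: "\<bar>z \<bullet> xi\<bar> <= norm z * norm (xi::'a)"
 by (rule Cauchy_Schwarz_ineq2)

lemma ker_bound: "\<bar>ker z xi\<bar> <= (2 * pi^2 + 1 / t) * (1 + norm z) ^ 2 * weight xi"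
proof (cases "xi = 0")
 case False
 have z1: "(norm z)^2 <= (1 + norm z)^2" "1 <= (1 + norm z)^2" by (simp_all add: power_mono)
 show ?thesis
 proof (cases "norm xi <= t")
  case True
  have "\<bar>cos (2 * pi * (z \<bullet> xi)) - cos 0\<bar> <= \<bar>2 * pi * (z \<bullet> xi) + 0\<bar> * \<bar>2 * pi * (z \<bullet> xi) - 0\<bar> / 2" by (rule abs_cos_diff_le)
  also have "... = 2 * pi^2 * \<bar>z \<bullet> xi\<bar>^2" by (simp add: abs_mult power2_eq_square)
  also have "... <= 2 * pi^2 * (norm z * norm xi)^2" by (intro mult_left_mono power_mono abs_inner_le) auto
  also have "... = 2 * pi^2 * (norm z)^2 * (norm xi)^2" by (simp add: power_mult_distrib)
  also have "... <= (2 * pi^2 + 1 / t) * (1 + norm z)^2 * (norm xi)^2" using t z1 by (intro mult_right_mono mult_mono) auto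
  finally have "\<bar>cos (2 * pi * (z \<bullet> xi)) - 1\<bar> * G xi <= (2 * pi^2 + 1 / t) * (1 + norm z)^2 * (norm xi)^2 * G xi"
   using G_nonneg[OF False] by (intro mult_right_mono) auto
  then show ?thesis using True G_nonneg[OF False] by (simp add: ker_def weight_def abs_mult mult_ac)
 next
  case 2: False
  have "1 <= (1 / t) * norm xi" using 2 t by (simp add: pos_le_divide_eq)
  also have "... <= ((2 * pi^2 + 1 / t) * (1 + norm z)^2) * norm xi"
   using t mult_mono[of "1 / t" "2 * pi^2 + 1 / t" 1 "(1 + norm z)^2"] z1 by (intro mult_right_mono) auto
  finally have "\<bar>cos (2 * pi * (z \<bullet> xi))\<bar> <= ((2 * pi^2 + 1 / t) * (1 + norm z)^2) * norm xi"
   using abs_cos_le_one[of "2 * pi * (z \<bullet> xi)"] by linarith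
  from mult_right_mono[OF this G_nonneg[OF False]] show ?thesis
   using 2 G_nonneg[OF False] by (simp add: ker_def weight_def abs_mult mult_ac)
 qed
qed (use t in \<open>simp add: ker_def weight_def\<close>)

text \<open>This Lipschitz bound in \<open>z\<close> gives both the continuity of
  \<open>regular\<close> and the domination of its difference quotients.\<close>

lemma ker_diff_bound: "\<bar>ker z xi - ker y xi\<bar> <= (2 * pi^2 * (norm z + norm y) + 2 * pi) * norm (z - y) * weight xi"
proof (cases "xi = 0")
 case False
 let ?a = "2 * pi * (z \<bullet> xi)" and ?b = "2 * pi * (y \<bullet> xi)"
 have d: "\<bar>?a - ?b\<bar> <= 2 * pi * (norm (z - y) * norm xi)"
  using abs_inner_le[of "z - y" xi] by (simp add: inner_diff_left abs_mult right_diff_distrib[symmetric])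
 have "\<bar>cos ?a - cos ?b\<bar> <= (2 * pi^2 * (norm z + norm y) + 2 * pi) * norm (z - y) * (if norm xi <= t then (norm xi)^2 else norm xi)"
 proof (cases "norm xi <= t")
  case True
  have "\<bar>?a + ?b\<bar> <= 2 * pi * ((norm z + norm y) * norm xi)"
   using abs_inner_le[of "z + y" xi] mult_right_mono[OF norm_triangle_ineq[of z y], of "norm xi"]
   by (simp add: inner_add_left abs_mult distrib_left[symmetric])
  from mult_mono[OF this d] have "\<bar>?a + ?b\<bar> * \<bar>?a - ?b\<bar> / 2 <= 2 * pi^2 * (norm z + norm y) * norm (z - y) * (norm xi)^2"
   by (simp add: power2_eq_square mult_ac)
  also have "... <= (2 * pi^2 * (norm z + norm y) + 2 * pi) * norm (z - y) * (norm xi)^2" by (intro mult_right_mono) auto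
  finally show ?thesis using abs_cos_diff_le(1)[of ?a ?b] True by simp
 next
  case 2: False
  have "2 * pi * (norm (z - y) * norm xi) <= (2 * pi^2 * (norm z + norm y) + 2 * pi) * norm (z - y) * norm xi"
   unfolding mult.assoc[symmetric] by (intro mult_right_mono) auto
  then show ?thesis using abs_cos_diff_le(2)[of ?a ?b] d 2 by simp
 qed
 from mult_right_mono[OF this G_nonneg[OF False]] show ?thesis
  using G_nonneg[OF False] by (simp add: ker_def weight_def right_diff_distrib[symmetric] abs_mult mult_ac)
qed (simp add: ker_def weight_def)

lemma dker_bound: "\<bar>dker z xi\<bar> <= 4 * pi^2 * (1 + norm z) * weight xi"
proof (cases "xi = 0")
 case False
 have e1: "\<bar>xi \<bullet> e\<bar> <= norm xi" using Basis_le_norm[OF e] .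
 have pp: "2 * pi <= 4 * pi^2" using pi_gt3 by (simp add: power2_eq_square)
 have "\<bar>2 * pi * (xi \<bullet> e) * sin (2 * pi * (z \<bullet> xi))\<bar> <= 4 * pi^2 * (1 + norm z) * (if norm xi <= t then (norm xi)^2 else norm xi)"
 proof (cases "norm xi <= t")
  case True
  have "\<bar>sin (2 * pi * (z \<bullet> xi))\<bar> <= 2 * pi * (norm z * norm xi)"
   using abs_sin_x_le_abs_x[of "2 * pi * (z \<bullet> xi)"] abs_inner_le[of z xi] by (auto simp: abs_mult intro: order_trans)
  then have "\<bar>2 * pi * (xi \<bullet> e) * sin (2 * pi * (z \<bullet> xi))\<bar> <= 2 * pi * norm xi * (2 * pi * (norm z * norm xi))"
   unfolding abs_mult using e1 by (intro mult_mono) auto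
  also have "... = 4 * pi^2 * norm z * (norm xi)^2" by (simp add: power2_eq_square)
  also have "... <= 4 * pi^2 * (1 + norm z) * (norm xi)^2" by (intro mult_right_mono) auto
  finally show ?thesis using True by simp
 next
  case 2: False
  have "\<bar>2 * pi * (xi \<bullet> e) * sin (2 * pi * (z \<bullet> xi))\<bar> <= 2 * pi * norm xi * 1"
   unfolding abs_mult using e1 by (intro mult_mono) auto
  also have "... <= 4 * pi^2 * (1 + norm z) * norm xi"
   using pp mult_mono[OF pp, of 1 "1 + norm z"] by (simp add: mult_right_mono)
  finally show ?thesis using 2 by simp
 qed
 from mult_right_mono[OF this G_nonneg[OF False]] show ?thesis
  using G_nonneg[OF False] by (simp add: dker_def weight_def abs_mult mult_ac)
qed (simp add: dker_def weight_def)

lemma ker_integrable: "integrable lborel (ker z)" and dker_integrable: "integrable lborel (dker z)"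
 by (rule integrable_dom[OF integrable_mult_right[OF weight_integrable, of "(2 * pi^2 + 1 / t) * (1 + norm z) ^ 2"]],
   measurable, use ker_bound in \<open>auto intro!: AE_I2 order_trans[OF _ abs_ge_self]\<close>)
  (rule integrable_dom[OF integrable_mult_right[OF weight_integrable, of "4 * pi^2 * (1 + norm z)"]],
   measurable, use dker_bound in \<open>auto intro!: AE_I2 order_trans[OF _ abs_ge_self]\<close>)

lemma regular_bound: "\<bar>regular z\<bar> <= ((2 * pi^2 + 1 / t) * (LBINT xi. weight xi)) * (1 + norm z) ^ 2"
proof -
 have "\<bar>regular z\<bar> <= (LBINT xi. (2 * pi^2 + 1 / t) * (1 + norm z) ^ 2 * weight xi)"
  unfolding regular_def by (intro integral_abs_bound_integral ker_integrable integrable_mult_right weight_integrable ker_bound)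
 then show ?thesis by (simp add: mult_ac)
qed

lemma regular_isCont: "isCont regular z"
proof -
 let ?w = "(LBINT xi. weight xi)"
 have le: "norm (regular y - regular z) <= (2 * pi^2 * (norm y + norm z) + 2 * pi) * norm (y - z) * ?w" for y
 proof -
  have "norm (regular y - regular z) = \<bar>(LBINT xi. ker y xi - ker z xi)\<bar>"
   unfolding regular_def by (simp add: ker_integrable)
  also have "... <= (LBINT xi. (2 * pi^2 * (norm y + norm z) + 2 * pi) * norm (y - z) * weight xi)"
   by (intro integral_abs_bound_integral ker_integrable Bochner_Integration.integrable_diff integrable_mult_right weight_integrable ker_diff_bound)
  finally show ?thesis by simp
 qed
 have "((%y. (2 * pi^2 * (norm y + norm z) + 2 * pi) * norm (y - z) * ?w) \<longlongrightarrow> (2 * pi^2 * (norm z + norm z) + 2 * pi) * norm (z - z) * ?w) (at z)"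
  by (intro tendsto_intros)
 then have "((%y. regular y - regular z) \<longlongrightarrow> 0) (at z)"
  by (intro Lim_null_comparison[OF always_eventually[OF allI[OF le]]]) simp
 then show ?thesis unfolding isCont_def by (rule LIM_zero_cancel)
qed

lemma regular_tempered: "tempered regular"
proof (rule tempered_polynomially_bounded[OF _ regular_bound])
 show "regular \<in> borel_measurable borel"
  by (rule borel_measurable_continuous_onI) (simp add: continuous_on_eq_continuous_at regular_isCont)
qed

text \<open>By Fubini the pairing becomes an integral of \<open>G\<close> against the symmetrised
  transform of \<open>psi\<close>, since the cosine is the mean of two characters; the subtracted
  low-frequency term drops out because \<open>psi\<close> has mean 0.\<close>

lemma regular_pairing:
 fixes psi :: "'a => complex"
 assumes psi: "schwartz psi" and m0: "(LBINT x. psi x) = 0"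
  and i: "integrable lborel (%xi. cor (G xi) * fourier psi (- xi))"
 shows "(LBINT x. cor (regular x) * psi x) = (LBINT xi. cor (G xi) * fourier psi (- xi))"
proof -
 have [measurable]: "psi \<in> borel_measurable borel" by (rule schwartz_measurable[OF psi])
 have psii: "integrable lborel psi" by (rule schwartz_integrable[OF psi])
 let ?c = "2 * pi^2 + 1 / t"
 have dom: "integrable lborel2 (%(x, xi). norm ((1 + norm x) ^ 2 *R psi x) * (?c * weight xi))"
  by (intro integrable_pair_mult integrable_norm integrable_mult_norm_power psi integrable_mult_right weight_integrable)
 have Fi: "integrable lborel2 (%(x, xi). cor (ker x xi) * psi x)"
 proof (rule integrable_dom[OF dom])
  show "(%(x, xi). cor (ker x xi) * psi x) \<in> borel_measurable lborel2"
   unfolding ker_def by measurable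
  show "AE z in lborel2. norm (case z of (x, xi) => cor (ker x xi) * psi x)
    <= norm (case z of (x, xi) => norm ((1 + norm x) ^ 2 *R psi x) * (?c * weight xi))"
  proof (rule AE_I2)
   fix z :: "'a \<times> 'a"
   obtain x xi where z: "z = (x, xi)" by (cases z)
   have "\<bar>ker x xi\<bar> * norm (psi x) <= (?c * (1 + norm x) ^ 2 * weight xi) * norm (psi x)" by (intro mult_right_mono ker_bound) simp
   then show "norm (case z of (x, xi) => cor (ker x xi) * psi x)
    <= norm (case z of (x, xi) => norm ((1 + norm x) ^ 2 *R psi x) * (?c * weight xi))"
    using t weight_nonneg[of xi] by (simp add: z norm_mult abs_mult mult_ac)
  qed
 qed
 have ei: "integrable lborel (%x. psi x * fkernel xi x)" for xi by (rule integrable_mult_fkernel[OF psii])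
 have inner: "(LBINT x. cor (ker x xi) * psi x) = (cor (G xi) * fourier psi xi + cor (G xi) * fourier psi (- xi)) / 2" for xi
 proof -
  have "cor (ker x xi) * psi x = cor (G xi) * ((psi x * fkernel xi x + psi x * fkernel (- xi) x) / 2 - of_bool (norm xi <= t) * psi x)" for x
  proof -
   have "fkernel xi x + fkernel (- xi) x = 2 * cor (cos (2 * pi * (x \<bullet> xi)))"
    unfolding fkernel_minus_left by (simp add: fkernel_def complex_eq_iff inner_commute)
   then show ?thesis unfolding distrib_left[symmetric] by (simp add: ker_def algebra_simps)
  qed
  then have "(LBINT x. cor (ker x xi) * psi x)
    = (LBINT x. cor (G xi) * ((psi x * fkernel xi x + psi x * fkernel (- xi) x) / 2 - of_bool (norm xi <= t) * psi x))" by simp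
  also have "... = cor (G xi) * ((fourier psi xi + fourier psi (- xi)) / 2)"
   using ei[of xi] ei[of "- xi"] psii m0 by (simp add: fourier_eq)
  finally show ?thesis by (simp add: algebra_simps)
 qed
 have i': "integrable lborel (%xi. cor (G xi) * fourier psi xi)"
  using lborel_integrable_reflect[OF i] by (simp add: G_def)
 have "(LBINT x. cor (regular x) * psi x) = (LBINT x. (LBINT xi. cor (ker x xi) * psi x))"
  using ker_integrable by (simp add: regular_def)
 also have "... = (LBINT xi. (LBINT x. cor (ker x xi) * psi x))"
  by (rule lborel_pair.Fubini_integral[OF Fi, symmetric])
 also have "... = ((LBINT xi. cor (G xi) * fourier psi xi) + (LBINT xi. cor (G xi) * fourier psi (- xi))) / 2"
  unfolding inner using i i' by simp
 also have "(LBINT xi. cor (G xi) * fourier psi xi) = (LBINT xi. cor (G xi) * fourier psi (- xi))"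
  using lborel_integral_reflect[of "%xi. cor (G xi) * fourier psi xi"] by (simp add: G_def)
 finally show ?thesis by simp
qed

lemma regular_minus: "regular (- z) = regular z"
 by (simp add: regular_def ker_def)

text \<open>\<open>g\<close> and \<open>regular\<close> have the same pairings with all tests of
  vanishing moments, so \<open>affine_annihilator\<close> applies to their difference.\<close>

lemma g_minus_regular:
 assumes "x \<noteq> 0" "y \<noteq> 0"
 shows "g x - regular x = g y - regular y"
proof (rule affine_annihilator[where u = "%x. g x - regular x", OF tempered_diff[OF g_tempered regular_tempered] _ _ _ assms])
 show "isCont (%x. g x - regular x) x" if "x \<noteq> 0" for x
  by (intro continuous_diff g_isCont regular_isCont that)
 show "g (- x) - regular (- x) = g x - regular x" for x by (simp add: g_even regular_minus)
 fix psi :: "'a => complex"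
 assume a: "schwartz psi" "(LBINT x. psi x) = 0" "\<And>b. b \<in> Basis ==> (LBINT x. cor (b \<bullet> x) * psi x) = 0"
 note p = potential_fourier_pairing[OF pf a, folded G_def]
 have "integrable lborel (%x. cor (g x) * psi x)" "integrable lborel (%x. cor (regular x) * psi x)"
  by (intro tempered_schwartz_integrable g_tempered regular_tempered a)+
 then have eq: "(LBINT x. cor (g x - regular x) * psi x)
   = (LBINT x. cor (g x) * psi x) - (LBINT x. cor (regular x) * psi x)"
  by (simp add: left_diff_distrib)
 from p(2) regular_pairing[OF a(1,2) p(1), symmetric]
 have eq2: "(LBINT x. cor (g x) * psi x) = (LBINT x. cor (regular x) * psi x)" by (rule trans)
 show "(LBINT x. cor (g x - regular x) * psi x) = 0"
  unfolding eq eq2 by simp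
qed

text \<open>Off 0 the increments of \<open>g\<close> are those of \<open>regular\<close>, which may
  be differentiated under the integral sign. This represents the derivative of \<open>g\<close> by
  the integrable kernel \<open>dker\<close>, whence its at most linear growth.\<close>

lemma dir_deriv_g:
 assumes z: "z \<noteq> 0"
 shows "dir_deriv e g z = (LBINT xi. dker z xi)"
proof -
 define s where "s n = 1 / real (Suc n)" for n
 have s: "s \<longlonglongrightarrow> 0" "\<And>n. 0 < s n" "\<And>n. s n <= 1" using inverse_Suc_tendsto_0 by (simp_all add: s_def[abs_def])
 have diff: "((%n. (f (s n) - f 0) / s n) \<longlonglongrightarrow> D)" if "(f has_real_derivative D) (at 0)" for f and D :: real
 proof -
  have "((%h. (f (0 + h) - f 0) / h) \<longlongrightarrow> D) (at 0)" using that by (simp add: DERIV_def)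
  moreover have "filterlim s (at 0) sequentially"
   unfolding filterlim_at using s(1) s(2) by (auto intro!: always_eventually simp: less_imp_neq[symmetric] dest: less_imp_neq)
  ultimately have "(%n. (f (0 + s n) - f 0) / s n) \<longlonglongrightarrow> D" by (rule filterlim_compose)
  then show ?thesis by simp
 qed
 have "((%s. g (z + s *R e)) has_real_derivative dir_deriv e g z) (at 0)"
  unfolding has_real_derivative_iff_has_vector_derivative by (rule has_vector_derivative_along[OF dir_deriv_off_0(1)[OF smooth e z]])
 from diff[OF this] have 1: "(%n. (g (z + s n *R e) - g z) / s n) \<longlonglongrightarrow> dir_deriv e g z" by simp
 have ze: "\<forall>\<^sub>F n in sequentially. z + s n *R e \<noteq> 0"
 proof -
  have "(%n. z + s n *R e) \<longlonglongrightarrow> z + 0 *R e" by (intro tendsto_intros s)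
  then show ?thesis using z by (intro tendsto_imp_eventually_ne) auto
 qed
 have 2: "(%n. (LBINT xi. (ker (z + s n *R e) xi - ker z xi) / s n)) \<longlonglongrightarrow> (LBINT xi. dker z xi)"
 proof (rule integral_dominated_convergence[where w = "%xi. (2 * pi^2 * (2 * norm z + 1) + 2 * pi) * weight xi"])
  show "integrable lborel (%xi. (2 * pi^2 * (2 * norm z + 1) + 2 * pi) * weight xi)"
   by (intro integrable_mult_right weight_integrable)
  show "AE xi in lborel. (%n. (ker (z + s n *R e) xi - ker z xi) / s n) \<longlonglongrightarrow> dker z xi"
  proof (rule AE_I2)
   fix xi :: 'a
   have "((%s. ker (z + s *R e) xi) has_real_derivative dker z xi) (at 0)"
    unfolding ker_def dker_def inner_add_left by (auto intro!: derivative_eq_intros simp: inner_commute)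
   from diff[OF this] show "(%n. (ker (z + s n *R e) xi - ker z xi) / s n) \<longlonglongrightarrow> dker z xi" by simp
  qed
  show "AE xi in lborel. norm ((ker (z + s n *R e) xi - ker z xi) / s n) <= (2 * pi^2 * (2 * norm z + 1) + 2 * pi) * weight xi" for n
  proof (rule AE_I2)
   fix xi :: 'a
   have "norm (z + s n *R e) <= norm z + 1" using norm_triangle_ineq[of z "s n *R e"] s(2,3)[of n] e by simp
   then have "2 * pi^2 * (norm (z + s n *R e) + norm z) + 2 * pi <= 2 * pi^2 * (2 * norm z + 1) + 2 * pi" by (intro add_right_mono mult_left_mono) auto
   then have le: "(2 * pi^2 * (norm (z + s n *R e) + norm z) + 2 * pi) * (s n * weight xi) <= (2 * pi^2 * (2 * norm z + 1) + 2 * pi) * (s n * weight xi)"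
    using s(2)[of n] weight_nonneg[of xi] by (intro mult_right_mono) auto
   then show "norm ((ker (z + s n *R e) xi - ker z xi) / s n) <= (2 * pi^2 * (2 * norm z + 1) + 2 * pi) * weight xi"
    using order_trans[OF _ le, of "\<bar>ker (z + s n *R e) xi - ker z xi\<bar>"] ker_diff_bound[of "z + s n *R e" xi z] s(2)[of n] e
    by (simp add: pos_divide_le_eq mult_ac)
  qed
 qed auto
 have "\<forall>\<^sub>F n in sequentially. (LBINT xi. (ker (z + s n *R e) xi - ker z xi) / s n) = (g (z + s n *R e) - g z) / s n"
  using ze
 proof eventually_elim
  case (elim n)
  have A: "(LBINT xi. (ker (z + s n *R e) xi - ker z xi) / s n) = (regular (z + s n *R e) - regular z) / s n"
   unfolding regular_def by (simp add: ker_integrable)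
  have B: "regular (z + s n *R e) - regular z = g (z + s n *R e) - g z" using g_minus_regular[OF elim z] by linarith
  show ?case unfolding A B ..
 qed
 from LIMSEQ_unique[OF Lim_transform_eventually[OF 2 this] 1] show ?thesis by simp
qed

text \<open>With \<open>k = beta\<close> the packet has its spectrum exactly within 1/2 of the two
  frequencies. The choice of \<open>h\<close> as minus the derivative of \<open>beta^2\<close> turns
  \<open>J\<close> into an energy of \<open>h\<close> by Parseval, and that energy is
  positive.\<close>

lemma test_data_exists: "\<exists>delta k h r. test_data t e delta k h r"
proof -
 define beta where "beta x = Re (fourier_real (bump (1 / 2)) x)" for x :: 'a
 have bs: "schwartz (bump (1 / 2) :: 'a => real)" by (rule schwartz_bump) simp
 have beta: "schwartz beta" unfolding beta_def by (intro schwartz_Re schwartz_fourier schwartz_complex_of_real bs)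
 have betac: "cor (beta x) = fourier_real (bump (1 / 2)) x" for x
  unfolding beta_def by (rule fourier_real_even) simp
 have Fbeta: "fourier_real beta xi = cor (bump (1 / 2) xi)" for xi
  unfolding betac using fourier_inversion[OF schwartz_complex_of_real[OF bs], of xi] by simp
 \<comment> \<open>The mean of \<open>beta\<close> is the value of its transform, the bump, at
   0.\<close>
 have beta0: "(LBINT x. beta x) \<noteq> 0"
  using Fbeta[of 0] bump_pos[of "0::'a" "1 / 2"] by (simp add: fourier_real_0 del: of_real_0)
 define a where "a x = beta x * beta x" for x
 have a: "schwartz a" unfolding a_def by (intro schwartz_mult beta)
 have a0: "(LBINT x. a x) \<noteq> 0"
 proof -
  have "0 < (LBINT x. a x)"
  proof (rule integral_pos_open[OF schwartz_integrable[OF a], where S = "{x. beta x \<noteq> 0}"])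
   show "open {x. beta x \<noteq> 0}" by (intro open_Collect_neq schwartz_continuous_on beta continuous_on_const)
   show "{x. beta x \<noteq> 0} \<noteq> {}"
   proof
    assume "{x. beta x \<noteq> 0} = {}"
    then have "beta = (%x. 0)" by auto
    then show False using beta0 by simp
   qed
  qed (auto simp: a_def zero_less_mult_iff linorder_neq_iff)
  then show ?thesis by simp
 qed
 define h where "h x = - dir_deriv e a x" for x
 have h: "schwartz h" unfolding h_def by (intro schwartz_minus schwartz_dir_deriv a e)
 have h0: "(LBINT x. h x) = 0" unfolding h_def using integral_dir_deriv_schwartz[OF a e] by simp
 note Fd = fourier_real_dir_deriv[OF _ e]
 have Fh: "fourier_real h xi = - (2 * pi * \<i> * cor (xi \<bullet> e) * fourier_real a xi)" for xi
  unfolding h_def of_real_minus fourier_minus Fd[OF a] ..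
 have pos: "0 < spectral_energy ghat c h" if "0 < c" for c
 proof -
  obtain s where "0 < s" "\<And>xi. norm xi < s ==> fourier_real a xi \<noteq> 0" using fourier_real_nonzero_near_0[OF a a0] by blast
  then show ?thesis by (intro energy_pos[OF that e h h0, of s]) (auto simp: Fh)
 qed
 have posq: "0 < spectral_energy ghat t (dir_deriv e beta)"
 proof -
  obtain s where "0 < s" "\<And>xi. norm xi < s ==> fourier_real beta xi \<noteq> 0" using fourier_real_nonzero_near_0[OF beta beta0] by blast
  then show ?thesis
   by (intro energy_pos[OF t e schwartz_dir_deriv[OF beta e] integral_dir_deriv_schwartz[OF beta e], of s]) (auto simp: Fd[OF beta])
 qed
 define w where "w = 4 * pi^2 * (LBINT xi. weight xi)"
 have w0: "0 <= w" unfolding w_def by (intro mult_nonneg_nonneg Bochner_Integration.integral_nonneg weight_nonneg) auto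
 \<comment> \<open>The second summand covers the immaterial value at 0, where no representation is
   available.\<close>
 have Dgb: "\<bar>dir_deriv e g z\<bar> <= (w + \<bar>dir_deriv e g 0\<bar>) * (1 + norm z)" for z
 proof (cases "z = 0")
  case False
  have "\<bar>dir_deriv e g z\<bar> <= (LBINT xi. 4 * pi^2 * (1 + norm z) * weight xi)"
   unfolding dir_deriv_g[OF False] by (intro integral_abs_bound_integral dker_integrable integrable_mult_right weight_integrable dker_bound)
  also have "... = w * (1 + norm z)" by (simp add: w_def)
  also have "... <= (w + \<bar>dir_deriv e g 0\<bar>) * (1 + norm z)" by (intro mult_right_mono) auto
  finally show ?thesis .
 qed (use w0 in simp)
 have bd: "\<exists>C. \<forall>u\<in>{beta, dir_deriv e beta}. \<forall>x y. \<bar>u x * dir_deriv e g (x - y) * h y\<bar> <= C / (1 + norm (x, y)) ^ (DIM('a \<times> 'a) + 1)"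
 proof -
  define N where "N = DIM('a \<times> 'a) + 1"
  obtain C1 C2 where C: "\<And>x y. \<bar>beta x * dir_deriv e g (x - y) * h y\<bar> <= C1 / (1 + norm (x, y)) ^ N"
   "\<And>x y. \<bar>dir_deriv e beta x * dir_deriv e g (x - y) * h y\<bar> <= C2 / (1 + norm (x, y)) ^ N"
   using decays_pair_bound[OF schwartz_decays[OF beta] schwartz_decays[OF h] Dgb, of N]
    decays_pair_bound[OF schwartz_decays[OF schwartz_dir_deriv[OF beta e]] schwartz_decays[OF h] Dgb, of N] by auto
  have M: "C1 / (1 + norm z) ^ N <= max C1 C2 / (1 + norm z) ^ N" "C2 / (1 + norm z) ^ N <= max C1 C2 / (1 + norm z) ^ N" for z :: "'a \<times> 'a"
   by (intro divide_right_mono zero_le_power; simp)+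
  then show ?thesis unfolding N_def[symmetric] using order_trans[OF C(1) M(1)] order_trans[OF C(2) M(2)] by (intro exI[of _ "max C1 C2"]) auto
 qed
 have J: "(\<integral>(x, y). beta x * (beta x * dir_deriv e g (x - y) * h y) \<partial>lborel2) = spectral_energy ghat 1 h"
 proof -
  have [measurable]: "a \<in> borel_measurable borel" "h \<in> borel_measurable borel" by (intro schwartz_measurable a h)+
  have [measurable]: "(fst :: 'a \<times> 'a => 'a) \<in> borel_measurable borel" "(snd :: 'a \<times> 'a => 'a) \<in> borel_measurable borel"
   by (auto intro!: borel_measurable_continuous_onI continuous_intros)
  define A where "A p = a (fst p) * h (snd p)" for p
  have [measurable]: "A \<in> borel_measurable borel" unfolding A_def by measurable
  have dom: "integrable lborel2 (%(p, xi). ((1 + norm (fst p)) ^ 1 * \<bar>a (fst p)\<bar> * ((1 + norm (snd p)) ^ 1 * \<bar>h (snd p)\<bar>)) * (4 * pi^2 * weight xi))"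
  proof (intro integrable_pair_mult integrable_mult_right weight_integrable)
   have "integrable lborel (%x. (1 + norm x) ^ 1 * \<bar>u x\<bar>)" if "schwartz u" for u :: "'a => real"
    using integrable_abs[OF integrable_mult_norm_power[OF that, of 1]] by (simp add: abs_mult)
   from integrable_pair_mult[OF this[OF a] this[OF h]]
   show "integrable lborel (%p. (1 + norm (fst p)) ^ 1 * \<bar>a (fst p)\<bar> * ((1 + norm (snd p)) ^ 1 * \<bar>h (snd p)\<bar>))"
    unfolding lborel_prod by (simp add: case_prod_beta')
  qed
  have Fi: "integrable lborel2 (%(p, xi). A p * dker (fst p - snd p) xi)"
  proof (rule integrable_dom[OF dom])
   show "(%(p, xi). A p * dker (fst p - snd p) xi) \<in> borel_measurable lborel2"
    unfolding dker_def by measurable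
   show "AE z in lborel2. norm (case z of (p, xi) => A p * dker (fst p - snd p) xi)
    <= norm (case z of (p, xi) => ((1 + norm (fst p)) ^ 1 * \<bar>a (fst p)\<bar> * ((1 + norm (snd p)) ^ 1 * \<bar>h (snd p)\<bar>)) * (4 * pi^2 * weight xi))"
   proof (rule AE_I2)
    fix z :: "('a \<times> 'a) \<times> 'a"
    obtain x y xi where z: "z = ((x, y), xi)" by (cases z) auto
    have "\<bar>dker (x - y) xi\<bar> <= 4 * pi^2 * ((1 + norm x) * (1 + norm y)) * weight xi"
     by (intro order_trans[OF dker_bound] mult_right_mono mult_left_mono one_plus_norm_diff_le weight_nonneg) simp
    then have "\<bar>a x * h y\<bar> * \<bar>dker (x - y) xi\<bar> <= \<bar>a x * h y\<bar> * (4 * pi^2 * ((1 + norm x) * (1 + norm y)) * weight xi)"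
     by (rule mult_left_mono) simp
    then show "norm (case z of (p, xi) => A p * dker (fst p - snd p) xi)
     <= norm (case z of (p, xi) => ((1 + norm (fst p)) ^ 1 * \<bar>a (fst p)\<bar> * ((1 + norm (snd p)) ^ 1 * \<bar>h (snd p)\<bar>)) * (4 * pi^2 * weight xi))"
     using weight_nonneg[of xi] by (simp add: z A_def abs_mult mult_ac)
   qed
  qed
  \<comment> \<open>The kernel \<open>dker\<close> is an imaginary part of a product of characters,
    so the double integral factors into transforms of \<open>a\<close> and \<open>h\<close>; the
    factor \<open>xi \<bullet> e\<close> of \<open>dker\<close> completes the square of that of
    \<open>h\<close>.\<close>
  have inner: "(LBINT p. A p * dker (fst p - snd p) xi) = ghat (1 * norm xi) * (norm (fourier_real h xi))^2" for xi
  proof -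
   have i: "integrable lborel (%x. cor (a x) * fkernel (- xi) x)" "integrable lborel (%x. cor (h x) * fkernel xi x)"
    by (intro integrable_mult_fkernel schwartz_integrable schwartz_complex_of_real a h)+
   define Q where "Q p = (cor (a (fst p)) * fkernel (- xi) (fst p)) * (cor (h (snd p)) * fkernel xi (snd p))" for p
   have Qi: "integrable lborel Q" and Q: "(LBINT p. Q p) = cnj (fourier_real a xi) * fourier_real h xi"
    using integrable_pair_mult[OF i] integral_pair_mult[OF i] unfolding lborel_prod Q_def
    by (simp_all add: case_prod_beta' fourier_eq[symmetric] fourier_real_minus)
   have "A p * dker (fst p - snd p) xi = - (2 * pi * (xi \<bullet> e) * G xi) * Im (Q p)" for p
   proof -
    have "fkernel (- xi) (fst p) * fkernel xi (snd p) = cis (2 * pi * ((fst p - snd p) \<bullet> xi))"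
     unfolding fkernel_def cis_mult by (simp add: inner_diff_left inner_commute algebra_simps)
    then have "Q p = cor (A p) * cis (2 * pi * ((fst p - snd p) \<bullet> xi))" by (simp add: Q_def A_def mult_ac)
    then show ?thesis by (simp add: dker_def)
   qed
   then have "(LBINT p. A p * dker (fst p - snd p) xi) = - (2 * pi * (xi \<bullet> e) * G xi) * (LBINT p. Im (Q p))" by simp
   also have "(LBINT p. Im (Q p)) = Im (cnj (fourier_real a xi) * fourier_real h xi)"
    using integral_bounded_linear[OF bounded_linear_Im Qi] by (simp add: Q)
   also have "cnj (fourier_real a xi) * fourier_real h xi = - (2 * pi * \<i> * cor (xi \<bullet> e)) * cor ((norm (fourier_real a xi))^2)"
    unfolding Fh complex_norm_square by (simp add: mult_ac)
   finally show ?thesis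
    by (simp add: Fh G_def norm_mult power_mult_distrib) (simp add: power2_eq_square)
  qed
  have "(\<integral>(x, y). beta x * (beta x * dir_deriv e g (x - y) * h y) \<partial>lborel2) = (LBINT p. A p * dir_deriv e g (fst p - snd p))"
   unfolding lborel_prod A_def a_def by (simp add: case_prod_beta' mult_ac)
  also have "... = (LBINT p. (LBINT xi. A p * dker (fst p - snd p) xi))"
  proof (rule integral_cong_AE)
   have [measurable]: "dir_deriv e g \<in> borel_measurable borel" by (rule measurable_off_0) (rule dir_deriv_off_0(2)[OF smooth e])
   show "(%p. A p * dir_deriv e g (fst p - snd p)) \<in> borel_measurable lborel" by measurable
   show "(%p. (LBINT xi. A p * dker (fst p - snd p) xi)) \<in> borel_measurable lborel"
    using lborel_pair.integrable_fst'[OF Fi] by simp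
   show "AE p in lborel. A p * dir_deriv e g (fst p - snd p) = (LBINT xi. A p * dker (fst p - snd p) xi)"
    using AE_pair_neq by eventually_elim (simp add: dir_deriv_g)
  qed
  also have "... = (LBINT xi. (LBINT p. A p * dker (fst p - snd p) xi))"
   by (rule lborel_pair.Fubini_integral[OF Fi, symmetric])
  finally show ?thesis unfolding inner .
 qed
 \<comment> \<open>The factor 4 comes from \<open>norm xi <= 2 * rho\<close> on the spectrum of the
   packet. No separate low-frequency part is needed, so \<open>W\<close> is 0 below.\<close>
 define m where "m x = 4 * (bump (1 / 2) x)^2" for x :: 'a
 have mi: "integrable lborel m"
  unfolding m_def power2_eq_square by (intro integrable_mult_right schwartz_integrable schwartz_mult bs)
 have E: "spectral_energy ghat t (packet (r + 1 / 2) e beta)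
   <= ghat (t * r) * ((LBINT x. m x) + (LBINT x. (%x::'a. 0) x))" if r: "1 <= r" for r
 proof (rule packet_energy_le[OF beta e _ mi])
  have rho: "0 < r + 1 / 2" using r by simp
  show "integrable lborel (%xi. ghat (t * norm xi) * (norm (fourier_real (packet (r + 1 / 2) e beta) xi))^2)"
   by (rule fourier_energy(1)[OF pf t schwartz_packet[OF beta e rho] packet_integral[OF beta e rho]])
  fix xi eta :: 'a assume xi: "xi \<noteq> 0" and eta: "eta \<in> {xi - (r + 1 / 2) *R e, xi + (r + 1 / 2) *R e}"
  show "ghat (t * norm xi) * (xi \<bullet> e)^2 * (norm (fourier_real beta eta))^2 <= (r + 1 / 2)^2 * (ghat (t * r) * (m eta + 0))"
  proof (cases "norm eta < 1 / 2")
   case True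
   have "norm ((r + 1 / 2) *R e) = r + 1 / 2" using e r by simp
   then have n: "r <= norm xi" "norm xi <= 2 * (r + 1 / 2)"
    using eta True r norm_triangle_ineq3[of xi "(r + 1 / 2) *R e"] norm_triangle_ineq3[of xi "- ((r + 1 / 2) *R e)"] by auto
   have "\<bar>xi \<bullet> e\<bar> <= 2 * (r + 1 / 2)" using Basis_le_norm[OF e, of xi] n by simp
   then have "(xi \<bullet> e)^2 <= (2 * (r + 1 / 2))^2" by (metis abs_ge_zero power2_abs power_mono)
   moreover have "ghat (t * norm xi) <= ghat (t * r)" using n r t by (intro ghat_mono) auto
   moreover have "0 <= ghat (t * r)" using r t by (intro ghat_nonneg) simp
   ultimately have "ghat (t * norm xi) * (xi \<bullet> e)^2 * (norm (fourier_real beta eta))^2 <= ghat (t * r) * (2 * (r + 1 / 2))^2 * (norm (fourier_real beta eta))^2"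
    by (intro mult_right_mono mult_mono) auto
   also have "... = (r + 1 / 2)^2 * (ghat (t * r) * (m eta + 0))" unfolding power_mult_distrib by (simp add: Fbeta m_def)
   finally show ?thesis .
  next
   case False
   then show ?thesis using bump_eq_0[of "1 / 2" eta] by (simp add: Fbeta m_def)
  qed
 qed (use r t in \<open>auto intro: ghat_nonneg\<close>)
 have "filterlim (%n. real (Suc n)) at_top sequentially"
  by (rule filterlim_compose[OF filterlim_real_sequentially filterlim_Suc])
 moreover have "\<exists>c. \<forall>n. spectral_energy ghat t (packet (real (Suc n) + 1 / 2) e beta) <= c * ghat (t * real (Suc n))"
 proof (intro exI allI)
  show "spectral_energy ghat t (packet (real (Suc n) + 1 / 2) e beta) <= (LBINT x. m x) * ghat (t * real (Suc n))" for n
   using E[of "real (Suc n)"] by (simp add: mult.commute[of "ghat _"])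
 qed
 moreover have "(\<integral>(x, y). beta x * (beta x * dir_deriv e g (x - y) * h y) \<partial>lborel2) \<noteq> 0"
  unfolding J using pos[of 1] by simp
 ultimately have "test_data t e (1 / 2) beta h (%n. real (Suc n))"
  unfolding test_data_def beta_def[symmetric] using beta h h0 bd pos[OF t] posq by (intro conjI) simp_all
 then show ?thesis by blast
qed

end

section \<open>The case of slow decay: bumps with disjoint supports\<close>

lemma has_derivative_along_ray:
 fixes g :: "'a::euclidean_space => real"
 assumes "g differentiable (at (s *R e))"
 shows "((%s. g (s *R e)) has_derivative (%h. h * dir_deriv e g (s *R e))) (at s within S)"
proof -
 note D = has_derivative_dir_deriv[OF assms]
 have "((%s. s *R e) has_derivative (%h. h *R e)) (at s within S)" by (auto intro!: derivative_eq_intros)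
 from has_derivative_compose[OF this D]
 have "((%s. g (s *R e)) has_derivative (%h. dir_deriv (h *R e) g (s *R e))) (at s within S)" .
 moreover have "dir_deriv (h *R e) g (s *R e) = h * dir_deriv e g (s *R e)" for h
  using linear_scale[OF bounded_linear.linear[OF has_derivative_bounded_linear[OF D]], of h e] by simp
 ultimately show ?thesis by simp
qed

context radial_potential
begin

lemma dir_deriv_odd:
 assumes e: "e \<in> Basis" and z: "z \<noteq> 0"
 shows "dir_deriv e g (- z) = - dir_deriv e g z"
proof -
 have "(%x. g ((- 1) *R x + 0)) = g" by (simp add: g_even)
 then show ?thesis
  using dir_deriv_affine[where f = g and c = "- 1" and x = z and a = 0 and b = e] dir_deriv_off_0(1)[OF smooth e, of "- z"] z by simp
qed

text \<open>Otherwise \<open>g\<close> is constant along the ray, and radial symmetry makes it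
  constant off 0.\<close>

lemma dir_deriv_nonzero_on_ray:
 assumes e: "e \<in> Basis"
 shows "\<exists>zeta>0. dir_deriv e g (zeta *R e) \<noteq> 0"
proof (rule ccontr)
 assume n: "\<not> ?thesis"
 have e0: "e \<noteq> 0" using e by auto
 have "\<exists>c. \<forall>s\<in>{0<..}. g (s *R e) = c"
 proof (rule has_derivative_zero_constant)
  fix s :: real assume "s \<in> {0<..}"
  then show "((%s. g (s *R e)) has_derivative (%h. 0)) (at s within {0<..})"
   using has_derivative_along_ray[OF dir_deriv_off_0(1)[OF smooth e], of s e "{0<..}"] n e0 by auto
 qed simp
 then obtain c where c: "\<And>s. 0 < s ==> g (s *R e) = c" by auto
 have "g x = c" if "x \<noteq> 0" for x
  using radial[OF that, of "norm x *R e"] c[of "norm x"] e that by simp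
 then show False using nonconst by auto
qed

text \<open>The supremum of \<open>phi\<close> over \<open>{1..r0}\<close> need not be attained,
  since \<open>ghat\<close> may jump; a point above half of it is taken instead, which explains the
  factor 2. On \<open>{1..n}\<close> the function stays below \<open>n ^ K * ghat t\<close>, so
  exceeding that value forces \<open>r >= n\<close>.\<close>

lemma record_radii:
 assumes t: "0 < t" and slow: "\<And>C. \<exists>r\<ge>1. C < r ^ K * ghat (t * r)"
 shows "\<exists>r. real n <= r \<and> 1 <= r \<and> 1 <= r ^ K * ghat (t * r) \<and> (\<forall>s\<in>{1..r}. s ^ K * ghat (t * s) <= 2 * (r ^ K * ghat (t * r)))"
proof -
 define phi where "phi r = r ^ K * ghat (t * r)" for r
 have le: "phi s <= b ^ K * ghat t" if "1 <= s" "s <= b" for s b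
  unfolding phi_def using that t ghat_mono[of t "t * s"] ghat_nonneg[OF t] ghat_nonneg[of "t * s"] by (intro mult_mono power_mono) auto
 obtain r0 where r0: "1 <= r0" "2 * max 1 (real n ^ K * ghat t) < phi r0" using slow unfolding phi_def by blast
 define S where "S = Sup (phi ` {1..r0})"
 have bdd: "bdd_above (phi ` {1..r0})" by (rule bdd_aboveI2[where M = "r0 ^ K * ghat t"]) (use le in auto)
 have S: "phi s <= S" if "s \<in> {1..r0}" for s unfolding S_def by (rule cSUP_upper[OF that bdd])
 have "S / 2 < S" using S[of r0] r0 by simp
 then have "\<exists>y\<in>phi ` {1..r0}. S / 2 < y"
  using r0 bdd by (subst less_cSup_iff[symmetric]) (auto simp: S_def[symmetric])
 then obtain r where r: "r \<in> {1..r0}" "S / 2 < phi r" by blast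
 then have b: "max 1 (real n ^ K * ghat t) < phi r" using S[of r0] r0 by auto
 moreover have "real n <= r" using le[of r "real n"] b r by fastforce
 ultimately show ?thesis using r S unfolding phi_def[symmetric] by (intro exI[of _ r]) force
qed

text \<open>\<open>k\<close> is a bump at \<open>zeta *R e\<close>, and \<open>h\<close> is a bump
  at 0 minus its copy at \<open>(2 * zeta) *R e\<close>, which gives mean 0. The differences
  \<open>x - y\<close> lie near \<open>zeta *R e\<close> or its negative. As the derivative of
  \<open>g\<close> is odd, the two contributions to \<open>J\<close> have the same sign.\<close>

lemma slow_test_data_exists:
 assumes t: "0 < t" and e: "e \<in> Basis" and slow: "\<And>C. \<exists>r\<ge>1. C < r ^ (DIM('a) + 2) * ghat (t * r)"
 shows "\<exists>delta k h r. test_data t e delta k h r"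
proof -
 \<comment> \<open>Any exponent would serve the estimates of this case; \<open>d + 2\<close> is
   dictated by the complementary one.\<close>
 define K where "K = DIM('a) + 2"
 define Dg where "Dg = dir_deriv e g"
 have e1: "norm e = 1" and e0: "e \<noteq> 0" using e by auto
 have "\<exists>r. \<forall>n. real n <= r n \<and> 1 <= r n \<and> 1 <= r n ^ K * ghat (t * r n) \<and>
   (\<forall>s\<in>{1..r n}. s ^ K * ghat (t * s) <= 2 * (r n ^ K * ghat (t * r n)))"
  by (rule choice) (intro allI record_radii[OF t slow[folded K_def]])
 then obtain r where r: "\<And>n. real n <= r n" "\<And>n. 1 <= r n" "\<And>n. 1 <= r n ^ K * ghat (t * r n)"
  "\<And>n s. s \<in> {1..r n} ==> s ^ K * ghat (t * s) <= 2 * (r n ^ K * ghat (t * r n))"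
  by blast
 obtain zeta where zeta: "0 < zeta" "Dg (zeta *R e) \<noteq> 0" using dir_deriv_nonzero_on_ray[OF e] unfolding Dg_def by blast
 have Dc: "isCont Dg z" if "z \<noteq> 0" for z unfolding Dg_def by (rule dir_deriv_off_0(2)[OF smooth e that])
 define D0 where "D0 = Dg (zeta *R e)"
 have "\<forall>\<^sub>F z in nhds (zeta *R e). 0 < Dg z * D0"
 proof (rule order_tendstoD(1))
  have "isCont (%z. Dg z * D0) (zeta *R e)" using Dc[of "zeta *R e"] zeta e0 by (intro continuous_intros) auto
  then show "((%z. Dg z * D0) \<longlongrightarrow> D0 * D0) (nhds (zeta *R e))"
   using tendsto_at_iff_tendsto_nhds[of "%z. Dg z * D0" "zeta *R e"] unfolding isCont_def D0_def by simp
  show "0 < D0 * D0" using zeta(2) by (auto simp: D0_def zero_less_mult_iff linorder_neq_iff)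
 qed
 then obtain kappa where kappa: "0 < kappa" "\<And>z. norm (z - zeta *R e) < kappa ==> 0 < Dg z * D0"
  unfolding eventually_nhds_metric by (auto simp: dist_norm)
 \<comment> \<open>Each bound has its role: \<open>kappa / 2\<close> keeps the sign of the
   derivative of \<open>g\<close>, \<open>zeta / 4\<close> keeps \<open>x - y\<close> away from 0,
   and 1 keeps the support of \<open>k\<close> in the region where \<open>beta\<close> is
   positive.\<close>
 define eta where "eta = min 1 (min (zeta / 4) (kappa / 2))"
 have eta: "0 < eta" "eta <= 1" "2 * eta <= zeta / 2" "2 * eta <= kappa" using zeta kappa unfolding eta_def by auto
 \<comment> \<open>So small that for \<open>norm x <= zeta + 1\<close> the phase
   \<open>2 * pi * (x \<bullet> xi)\<close> is at most \<open>pi / 4\<close> on the bump; its cosine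
   is then positive, and so is \<open>beta x\<close>.\<close>
 define delta where "delta = min (1 / 2) (1 / (8 * (zeta + 1)))"
 have delta: "0 < delta" "delta <= 1 / 2" "delta <= 1 / (8 * (zeta + 1))" using zeta unfolding delta_def by auto
 define beta where "beta x = Re (fourier_real (bump delta) x)" for x :: 'a
 have betas: "schwartz beta" unfolding beta_def by (intro schwartz_Re schwartz_fourier schwartz_complex_of_real schwartz_bump delta)
 have betapos: "0 < beta x" if x: "norm x <= zeta + 1" for x
 proof -
  have i: "integrable lborel (%xi. cor (bump delta xi) * fkernel x xi)"
   by (intro integrable_mult_fkernel schwartz_integrable schwartz_complex_of_real schwartz_bump delta)
  have eq: "Re (cor (bump delta xi) * fkernel x xi) = bump delta xi * cos (2 * pi * (x \<bullet> xi))" for xi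
   by (simp add: fkernel_def)
  have c: "0 < cos (2 * pi * (x \<bullet> xi))" if "norm xi < delta" for xi
  proof -
   have "\<bar>x \<bullet> xi\<bar> <= (zeta + 1) * (1 / (8 * (zeta + 1)))"
    using x that delta(3) zeta(1) by (intro order_trans[OF Cauchy_Schwarz_ineq2] mult_mono) auto
   also have "... = 1 / 8" using zeta by (simp add: field_simps)
   finally have "2 * pi * \<bar>x \<bullet> xi\<bar> <= 2 * pi * (1 / 8)" by (intro mult_left_mono) auto
   also have "... < pi / 2" by simp
   finally have "\<bar>2 * pi * (x \<bullet> xi)\<bar> < pi / 2" by (simp add: abs_mult)
   then have "- (pi / 2) < 2 * pi * (x \<bullet> xi)" "2 * pi * (x \<bullet> xi) < pi / 2" unfolding abs_less_iff by linarith+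
   then show ?thesis by (rule cos_gt_zero_pi)
  qed
  have "0 < (LBINT xi. bump delta xi * cos (2 * pi * (x \<bullet> xi)))"
  proof (rule integral_pos_open[where S = "ball 0 delta"])
   show "integrable lborel (%xi. bump delta xi * cos (2 * pi * (x \<bullet> xi)))"
    using integrable_Re[OF i] unfolding eq .
   show "0 <= bump delta xi * cos (2 * pi * (x \<bullet> xi))" for xi
    using c[of xi] bump_nonneg[of delta xi] bump_eq_0[OF delta(1), of xi] by (cases "norm xi < delta") auto
   show "0 < bump delta xi * cos (2 * pi * (x \<bullet> xi))" if "xi \<in> ball 0 delta" for xi
    using c[of xi] bump_pos[of xi delta] that by simp
  qed (use delta in auto)
  then show ?thesis using integral_Re[OF i] unfolding beta_def fourier_eq eq by simp
 qed
 define k where "k x = bump eta (x - zeta *R e)" for x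
 define h where "h y = bump eta y - bump eta (y - (2 * zeta) *R e)" for y
 define q where "q = dir_deriv e k"
 have k: "schwartz k" unfolding k_def by (rule schwartz_bump_shift[OF eta(1)])
 have h: "schwartz h" unfolding h_def by (intro schwartz_diff schwartz_bump schwartz_bump_shift eta)
 have q: "schwartz q" unfolding q_def by (rule schwartz_dir_deriv[OF k e])
 have tr: "(LBINT x. bump eta (x - a)) = (LBINT x. bump eta (x::'a))" for a :: 'a
  using lborel_integral_translate[of "bump eta" "- a"] by simp
 have h0: "(LBINT x. h x) = 0"
  unfolding h_def using schwartz_integrable[OF schwartz_bump[OF eta(1), where 'a = 'a]] schwartz_integrable[OF schwartz_bump_shift(1)[OF eta(1), of "(2 * zeta) *R e"]]
  by (simp add: tr)
 have k0: "(LBINT x. k x) \<noteq> 0" unfolding k_def tr using bump_integral_pos[OF eta(1), where 'a = 'a] by simp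
 have ksup: "norm (x - zeta *R e) < eta" if "k x \<noteq> 0" for x
  using that bump_eq_0[OF eta(1), of "x - zeta *R e"] by (force simp: k_def)
 have qsup: "norm (x - zeta *R e) <= eta" if "q x \<noteq> 0" for x
 proof (rule ccontr)
  assume "\<not> norm (x - zeta *R e) <= eta"
  then have "x \<in> {x. eta < norm (x - zeta *R e)}" by simp
  moreover have "open {x. eta < norm (x - zeta *R e)}" by (intro open_Collect_less continuous_intros)
  ultimately have "(k has_derivative (%h. 0)) (at x)"
   using ksup by (intro has_derivative_transform_within_open[OF has_derivative_const[of 0 "at x"]]) fastforce+
  then show False using that by (simp add: q_def dir_deriv_eq)
 qed
 define Ks where "Ks = cball (zeta *R e) (2 * eta) \<union> cball (- (zeta *R e)) (2 * eta)"
 have K0: "z \<noteq> 0" if "z \<in> Ks" for z using that eta zeta e1 by (auto simp: Ks_def dist_norm)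
 have "compact (Dg ` Ks)"
  by (rule compact_continuous_image) (auto simp: Ks_def[symmetric] intro!: continuous_at_imp_continuous_on Dc K0, simp add: Ks_def compact_Un)
 then obtain c where c: "0 < c" "\<And>z. z \<in> Ks ==> \<bar>Dg z\<bar> <= c"
  using compact_imp_bounded[of "Dg ` Ks"] unfolding bounded_pos by auto
 \<comment> \<open>Replaces the possibly singular derivative of \<open>g\<close> by a bounded
   function without changing the products with \<open>k\<close> or \<open>q\<close> and
   \<open>h\<close>, because all relevant differences lie in the compact set
   \<open>Ks\<close>.\<close>
 define D' where "D' z = (if z \<in> Ks then Dg z else 0)" for z
 have D'b: "\<bar>D' z\<bar> <= c * (1 + norm z)" for z
  using c mult_left_mono[of 1 "1 + norm z" c] by (auto simp: D'_def intro: order_trans[OF c(2)])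
 have inK: "x - y \<in> Ks" if "norm (x - zeta *R e) <= eta" "h y \<noteq> 0" for x y
 proof -
  have "norm y < eta \<or> norm (y - (2 * zeta) *R e) < eta"
   using that(2) bump_eq_0[OF eta(1), of y] bump_eq_0[OF eta(1), of "y - (2 * zeta) *R e"] by (force simp: h_def)
  then show ?thesis
  proof
   assume "norm y < eta"
   then have "norm ((x - zeta *R e) - y) <= 2 * eta" using that(1) norm_triangle_ineq4[of "x - zeta *R e" y] by linarith
   then show ?thesis by (simp add: Ks_def dist_norm norm_minus_commute algebra_simps)
  next
   assume "norm (y - (2 * zeta) *R e) < eta"
   then have "norm ((x - zeta *R e) - (y - (2 * zeta) *R e)) <= 2 * eta"
    using that(1) norm_triangle_ineq4[of "x - zeta *R e" "y - (2 * zeta) *R e"] by linarith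
   moreover have "(x - zeta *R e) - (y - (2 * zeta) *R e) = (x - y) - (- (zeta *R e))" by (simp add: algebra_simps scaleR_add_left[symmetric])
   ultimately show ?thesis unfolding Ks_def by (simp only: Un_iff mem_cball dist_norm norm_minus_commute) simp
  qed
 qed
 have DD': "u x * Dg (x - y) * h y = u x * D' (x - y) * h y" if "u \<in> {k, q}" for u x y
 proof (cases "u x = 0 \<or> h y = 0")
  case False
  then have "norm (x - zeta *R e) <= eta" using that ksup[of x] qsup[of x] by auto
  then show ?thesis using inK[of x y] False by (simp add: D'_def)
 qed auto
 have DDk: "k x * Dg (x - y) * h y = k x * D' (x - y) * h y" for x y by (rule DD') simp
 have bd: "\<exists>C. \<forall>u\<in>{k, q}. \<forall>x y. \<bar>u x * Dg (x - y) * h y\<bar> <= C / (1 + norm (x, y)) ^ (DIM('a \<times> 'a) + 1)"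
 proof -
  define N where "N = DIM('a \<times> 'a) + 1"
  obtain C1 C2 where C: "\<And>x y. \<bar>k x * D' (x - y) * h y\<bar> <= C1 / (1 + norm (x, y)) ^ N"
   "\<And>x y. \<bar>q x * D' (x - y) * h y\<bar> <= C2 / (1 + norm (x, y)) ^ N"
   using decays_pair_bound[OF schwartz_decays[OF k] schwartz_decays[OF h] D'b, of N]
    decays_pair_bound[OF schwartz_decays[OF q] schwartz_decays[OF h] D'b, of N] by auto
  have M: "C1 / (1 + norm z) ^ N <= max C1 C2 / (1 + norm z) ^ N" "C2 / (1 + norm z) ^ N <= max C1 C2 / (1 + norm z) ^ N" for z :: "'a \<times> 'a"
   by (intro divide_right_mono zero_le_power; simp)+
  have "\<bar>u x * Dg (x - y) * h y\<bar> <= max C1 C2 / (1 + norm (x, y)) ^ N" if u: "u \<in> {k, q}" for u x y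
   unfolding DD'[OF u] using u order_trans[OF C(1) M(1)] order_trans[OF C(2) M(2)] by auto
  then show ?thesis unfolding N_def by blast
 qed
 define J where "J = (\<integral>(x, y). beta x * (k x * Dg (x - y) * h y) \<partial>lborel2)"
 \<comment> \<open>The factor \<open>D0\<close> normalises the sign, so that the integrand is
   nonnegative everywhere and positive on an open set.\<close>
 have "0 < (LBINT z. beta (fst z) * (k (fst z) * Dg (fst z - snd z) * h (snd z)) * D0)"
 proof (rule integral_pos_open[where S = "ball (zeta *R e) eta \<times> ball 0 eta"])
  have [measurable]: "k \<in> borel_measurable borel" "h \<in> borel_measurable borel" "beta \<in> borel_measurable borel" by (intro schwartz_measurable k h betas)+
  have [measurable]: "(fst :: 'a \<times> 'a => 'a) \<in> borel_measurable borel" "(snd :: 'a \<times> 'a => 'a) \<in> borel_measurable borel"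
   by (auto intro!: borel_measurable_continuous_onI continuous_intros)
  have [measurable]: "Dg \<in> borel_measurable borel" by (rule measurable_off_0) (rule Dc)
  obtain B where B: "B > 0" "\<And>x. \<bar>beta x\<bar> <= B" using schwartz_bounded[OF betas] by auto
  have "integrable lborel (%z. k (fst z) * h (snd z))"
   using integrable_pair_mult[OF schwartz_integrable[OF k] schwartz_integrable[OF h]] unfolding lborel_prod by (simp add: case_prod_beta')
  then have i: "integrable lborel (%z. B * c * \<bar>D0\<bar> * \<bar>k (fst z) * h (snd z)\<bar>)" by (intro integrable_mult_right integrable_abs)
  show "integrable lborel (%z. beta (fst z) * (k (fst z) * Dg (fst z - snd z) * h (snd z)) * D0)"
  proof (rule integrable_dom[OF i])
   show "AE z in lborel. norm (beta (fst z) * (k (fst z) * Dg (fst z - snd z) * h (snd z)) * D0) <= norm (B * c * \<bar>D0\<bar> * \<bar>k (fst z) * h (snd z)\<bar>)"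
   proof (rule AE_I2)
    fix z :: "'a \<times> 'a"
    have "\<bar>D' (fst z - snd z)\<bar> <= c" using c by (auto simp: D'_def)
    then have "\<bar>beta (fst z)\<bar> * \<bar>D' (fst z - snd z)\<bar> * (\<bar>D0\<bar> * \<bar>k (fst z) * h (snd z)\<bar>) <= B * c * (\<bar>D0\<bar> * \<bar>k (fst z) * h (snd z)\<bar>)"
     using B by (intro mult_right_mono mult_mono) auto
    then show "norm (beta (fst z) * (k (fst z) * Dg (fst z - snd z) * h (snd z)) * D0) <= norm (B * c * \<bar>D0\<bar> * \<bar>k (fst z) * h (snd z)\<bar>)"
     unfolding DDk using B c by (simp add: abs_mult mult_ac)
   qed
  qed measurable
  have pos1: "0 < Dg (x - y) * D0" if "norm (x - zeta *R e) < eta" "norm y < eta" for x y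
  proof (rule kappa(2))
   show "norm (x - y - zeta *R e) < kappa" using norm_triangle_ineq4[of "x - zeta *R e" y] that eta(4) by (simp add: algebra_simps)
  qed
  \<comment> \<open>For the second bump of \<open>h\<close> the reversed difference
    \<open>y - x\<close> is near \<open>zeta *R e\<close>; oddness flips the sign, which the minus
    sign in \<open>h\<close> compensates.\<close>
  have pos2: "Dg (x - y) * D0 < 0" if "norm (x - zeta *R e) < eta" "norm (y - (2 * zeta) *R e) < eta" for x y
  proof -
   have "y - x - zeta *R e = (y - (2 * zeta) *R e) - (x - zeta *R e)" by (simp add: algebra_simps scaleR_add_left[symmetric])
   moreover have "norm ((y - (2 * zeta) *R e) - (x - zeta *R e)) < 2 * eta"
    using norm_triangle_ineq4[of "y - (2 * zeta) *R e" "x - zeta *R e"] that by linarith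
   ultimately have n: "norm (y - x - zeta *R e) < 2 * eta" by (simp only:)
   then have "0 < Dg (y - x) * D0" using eta(4) by (intro kappa(2)) simp
   moreover have "y - x \<noteq> 0" using n eta(3) zeta e1 by auto
   then have "Dg (- (y - x)) = - Dg (y - x)" unfolding Dg_def by (rule dir_deriv_odd[OF e])
   ultimately show ?thesis by simp
  qed
  have t2: "0 <= - (bump eta (y - (2 * zeta) *R e) * (Dg (x - y) * D0))" if "norm (x - zeta *R e) < eta" for x y
   using pos2[OF that, of y] bump_nonneg[of eta "y - (2 * zeta) *R e"] bump_eq_0[OF eta(1), of "y - (2 * zeta) *R e"]
   by (cases "norm (y - (2 * zeta) *R e) < eta") (auto simp: mult_nonneg_nonpos)
  have t1: "0 <= bump eta y * (Dg (x - y) * D0)" if "norm (x - zeta *R e) < eta" for x y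
   using pos1[OF that, of y] bump_nonneg[of eta y] bump_eq_0[OF eta(1), of y] by (cases "norm y < eta") auto
  have eq: "beta x * (k x * Dg (x - y) * h y) * D0 = beta x * k x * (bump eta y * (Dg (x - y) * D0) + - (bump eta (y - (2 * zeta) *R e) * (Dg (x - y) * D0)))" for x y
   by (simp add: h_def algebra_simps)
  have nx: "norm x <= zeta + 1" if "norm (x - zeta *R e) < eta" for x
   using norm_triangle_ineq[of "x - zeta *R e" "zeta *R e"] that eta(2) zeta(1) e1 by simp
  show "0 <= beta (fst z) * (k (fst z) * Dg (fst z - snd z) * h (snd z)) * D0" for z
  proof (cases "k (fst z) = 0")
   case False
   note n = ksup[OF False]
   have "0 <= beta (fst z)" "0 <= k (fst z)" using betapos[OF nx[OF n]] by (simp_all add: k_def bump_nonneg)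
   then show ?thesis unfolding eq
    by (rule mult_nonneg_nonneg[OF mult_nonneg_nonneg add_nonneg_nonneg[OF t1[OF n] t2[OF n]]])
  qed simp
  show "0 < beta (fst z) * (k (fst z) * Dg (fst z - snd z) * h (snd z)) * D0" if "z \<in> ball (zeta *R e) eta \<times> ball 0 eta" for z
  proof -
   have n: "norm (fst z - zeta *R e) < eta" "norm (snd z) < eta" using that by (auto simp: dist_norm norm_minus_commute)
   have "0 < k (fst z)" unfolding k_def by (rule bump_pos[OF n(1)])
   then show ?thesis unfolding eq
    by (rule mult_pos_pos[OF mult_pos_pos[OF betapos[OF nx[OF n(1)]]] add_pos_nonneg[OF mult_pos_pos[OF bump_pos[OF n(2)] pos1[OF n]] t2[OF n(1)]]])
  qed
  show "ball (zeta *R e) eta \<times> ball 0 eta \<noteq> ({} :: ('a \<times> 'a) set)" using eta(1) by auto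
 qed (simp add: open_Times)
 then have J: "J \<noteq> 0" unfolding J_def lborel_prod by (auto simp: case_prod_beta')
 have posq: "0 < spectral_energy ghat t q"
 proof -
  obtain s where "0 < s" "\<And>xi. norm xi < s ==> fourier_real k xi \<noteq> 0" using fourier_real_nonzero_near_0[OF k k0] by blast
  then show ?thesis unfolding q_def
   by (intro energy_pos[OF t e schwartz_dir_deriv[OF k e] integral_dir_deriv_schwartz[OF k e], of s]) (auto simp: fourier_real_dir_deriv[OF k e])
 qed
 have posh: "0 < spectral_energy ghat t h"
 proof -
  have bs: "schwartz (bump eta :: 'a => real)" by (rule schwartz_bump[OF eta(1)])
  have "(LBINT x. bump eta (x::'a)) \<noteq> 0" using bump_integral_pos[OF eta(1), where 'a = 'a] by simp
  then obtain s where s: "0 < s" "\<And>xi::'a. norm xi < s ==> fourier_real (bump eta) xi \<noteq> 0" using fourier_real_nonzero_near_0[OF bs] by blast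
  have Fh: "fourier_real h xi = (1 - fkernel xi ((2 * zeta) *R e)) * fourier_real (bump eta) xi" for xi
  proof -
   have "fourier_real h xi = fourier_real (bump eta) xi - fourier_real (%y. bump eta (y - (2 * zeta) *R e)) xi"
    unfolding h_def of_real_diff
    by (intro fourier_diff schwartz_integrable schwartz_complex_of_real bs schwartz_bump_shift eta)
   also have "fourier_real (%y. bump eta (y - (2 * zeta) *R e)) xi = fkernel xi ((2 * zeta) *R e) * fourier_real (bump eta) xi"
    using fourier_translate[of "%x. cor (bump eta x)" "- ((2 * zeta) *R e)" xi] by (simp add: fkernel_minus_right)
   finally show ?thesis by (simp add: algebra_simps)
  qed
  \<comment> \<open>The phase is nonzero and smaller than \<open>pi\<close> in modulus, so its sine
    cannot vanish. Hence the transform of \<open>h\<close> is nonzero near 0 off the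
    hyperplane.\<close>
  have "fkernel xi ((2 * zeta) *R e) \<noteq> 1" if "xi \<bullet> e \<noteq> 0" "norm xi < 1 / (4 * zeta)" for xi
  proof
   assume "fkernel xi ((2 * zeta) *R e) = 1"
   then have "Im (fkernel xi ((2 * zeta) *R e)) = Im 1" by simp
   then have s0: "sin (2 * pi * (2 * zeta * (xi \<bullet> e))) = 0" by (simp add: fkernel_def)
   have "\<bar>xi \<bullet> e\<bar> < 1 / (4 * zeta)" using Basis_le_norm[OF e, of xi] that(2) by simp
   then have "4 * zeta * \<bar>xi \<bullet> e\<bar> < 1" using zeta(1) by (simp add: pos_less_divide_eq mult_ac)
   then have "pi * (4 * zeta * \<bar>xi \<bullet> e\<bar>) < pi * 1" by (intro mult_strict_left_mono) auto
   then have "\<bar>2 * pi * (2 * zeta * (xi \<bullet> e))\<bar> < pi" using zeta(1) by (simp add: abs_mult)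
   then have "- pi < 2 * pi * (2 * zeta * (xi \<bullet> e))" "2 * pi * (2 * zeta * (xi \<bullet> e)) < pi" unfolding abs_less_iff by linarith+
   then have "2 * pi * (2 * zeta * (xi \<bullet> e)) = 0" using s0 by (rule sin_eq_0_pi)
   then show False using that(1) zeta(1) by simp
  qed
  then show ?thesis using s zeta(1) by (intro energy_pos[OF t e h h0, of "min s (1 / (4 * zeta))"]) (auto simp: Fh)
 qed
 have kF: "schwartz (fourier_real k)" by (intro schwartz_fourier schwartz_complex_of_real k)
 obtain Cb where Cb: "Cb > 0" "\<And>xi. norm (fourier_real k xi) <= Cb" using schwartz_bounded[OF kF] by auto
 obtain Ck where Ck: "Ck > 0" "\<And>xi. norm (fourier_real k xi) <= Ck / (1 + norm xi) ^ K"
  using decaysE[OF schwartz_decays[OF kF], where n = K] by blast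
 \<comment> \<open>Majorant for \<open>norm xi >= 1\<close>. The \<open>K + 2\<close> powers absorb
   \<open>K\<close> from comparing \<open>ghat (t * norm xi)\<close> with
   \<open>ghat (t * r n)\<close> and two from comparing \<open>norm xi\<close> with
   \<open>rho\<close>.\<close>
 define m where "m xi = 2 * Cb * norm ((1 + norm xi) ^ (K + 2) *R fourier_real k xi)" for xi
 \<comment> \<open>Majorant for \<open>norm xi < 1\<close>, where \<open>ghat\<close> may be
   unbounded but its second moment is integrable.\<close>
 define W where "W xi = Ck^2 * (indicator (cball 0 1) xi * (norm xi)^2 * ghat (t * norm xi))" for xi :: 'a
 have mi: "integrable lborel m" unfolding m_def by (intro integrable_mult_right integrable_norm integrable_mult_norm_power kF)
 have Wi: "integrable lborel W" unfolding W_def using t by (intro integrable_mult_right ghat_integrable_near_0) auto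
 have E: "spectral_energy ghat t (packet (r n + 1 / 2) e k)
   <= ghat (t * r n) * ((LBINT xi. m xi) + (LBINT xi. W xi))" for n
 proof (rule packet_energy_le[OF k e _ mi Wi])
  define rho where "rho = r n + 1 / 2"
  have rho: "0 < rho" "1 <= rho" "r n <= rho" "r n <= rho - 1 / 2" using r(2)[of n] by (auto simp: rho_def)
  have gr: "0 <= ghat (t * r n)" using r(2)[of n] t by (intro ghat_nonneg) simp
  show "integrable lborel (%xi. ghat (t * norm xi) * (norm (fourier_real (packet (r n + 1 / 2) e k) xi))^2)"
   unfolding rho_def[symmetric] by (rule fourier_energy(1)[OF pf t schwartz_packet[OF k e rho(1)] packet_integral[OF k e rho(1)]])
  fix xi eta :: 'a assume xi: "xi \<noteq> 0" and eta: "eta \<in> {xi - (r n + 1 / 2) *R e, xi + (r n + 1 / 2) *R e}"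
  have gxi: "0 <= ghat (t * norm xi)" using xi t by (intro ghat_nonneg) simp
  have nrho: "norm (rho *R e) = rho" using rho e1 by simp
  have tri: "norm xi <= rho + norm eta" "rho <= norm xi + norm eta"
   using eta nrho norm_triangle_ineq[of eta "rho *R e"] norm_triangle_ineq[of eta "- (rho *R e)"] norm_triangle_ineq4[of xi eta]
    norm_triangle_ineq4[of eta xi] unfolding rho_def[symmetric] by (auto simp: norm_minus_commute)
  have xe: "(xi \<bullet> e)^2 <= (norm xi)^2" using Basis_le_norm[OF e, of xi] by (metis abs_ge_zero power2_abs power_mono)
  have pK: "1 <= (1 + norm eta) ^ K" by (rule one_le_power) simp
  have m0: "0 <= m eta" using Cb by (simp add: m_def)
  have W0: "0 <= W xi" using gxi by (simp add: W_def)
  show "ghat (t * norm xi) * (xi \<bullet> e)^2 * (norm (fourier_real k eta))^2 <= (r n + 1 / 2)^2 * (ghat (t * r n) * (m eta + W xi))"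
   unfolding rho_def[symmetric]
  proof (cases "1 <= norm xi")
   case True
   \<comment> \<open>Below \<open>r n\<close> the near-record property is used, with
     \<open>r n <= norm xi * (1 + norm eta)\<close>; above it, monotonicity.\<close>
   have gx: "ghat (t * norm xi) <= 2 * (1 + norm eta) ^ K * ghat (t * r n)"
   proof (cases "norm xi <= r n")
    case T: True
    have "norm xi + norm eta <= norm xi * (1 + norm eta)" using True mult_right_mono[OF True, of "norm eta"] by (simp add: algebra_simps)
    then have "r n ^ K <= (norm xi * (1 + norm eta)) ^ K" using tri rho r(2)[of n] by (intro power_mono) auto
    then have "2 * (r n ^ K * ghat (t * r n)) <= 2 * ((norm xi * (1 + norm eta)) ^ K * ghat (t * r n))"
     using gr by (intro mult_left_mono mult_right_mono) auto
    moreover have "norm xi ^ K * ghat (t * norm xi) <= 2 * (r n ^ K * ghat (t * r n))" using T True by (intro r(4)) auto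
    ultimately have "norm xi ^ K * ghat (t * norm xi) <= norm xi ^ K * (2 * (1 + norm eta) ^ K * ghat (t * r n))"
     by (simp add: power_mult_distrib mult_ac)
    then show ?thesis using xi by simp
   next
    case False
    have "ghat (t * norm xi) <= 1 * ghat (t * r n)" using ghat_mono[of "t * r n" "t * norm xi"] False r(2)[of n] t by simp
    also have "... <= 2 * (1 + norm eta) ^ K * ghat (t * r n)"
     by (rule mult_right_mono[OF _ gr]) (use pK in linarith)
    finally show ?thesis .
   qed
   have "rho + norm eta <= rho * (1 + norm eta)" using mult_right_mono[OF rho(2), of "norm eta"] by (simp add: algebra_simps)
   then have "norm xi <= rho * (1 + norm eta)" using tri by simp
   then have "(norm xi)^2 <= (rho * (1 + norm eta))^2" by (intro power_mono) auto
   then have x2: "(xi \<bullet> e)^2 <= (rho * (1 + norm eta))^2" using xe by simp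
   have "(norm (fourier_real k eta))^2 <= Cb * norm (fourier_real k eta)" unfolding power2_eq_square by (intro mult_right_mono Cb) simp
   then have "ghat (t * norm xi) * (xi \<bullet> e)^2 * (norm (fourier_real k eta))^2
     <= (2 * (1 + norm eta) ^ K * ghat (t * r n)) * (rho * (1 + norm eta))^2 * (Cb * norm (fourier_real k eta))"
    using gx x2 gr Cb by (intro mult_mono mult_nonneg_nonneg) auto
   also have "... = rho^2 * (ghat (t * r n) * m eta)"
    unfolding m_def power_add by (simp add: power_mult_distrib abs_mult mult_ac)
   also have "... <= rho^2 * (ghat (t * r n) * (m eta + W xi))" using W0 gr by (intro mult_left_mono) auto
   finally show "ghat (t * norm xi) * (xi \<bullet> e)^2 * (norm (fourier_real k eta))^2 <= rho^2 * (ghat (t * r n) * (m eta + W xi))" .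
  next
   case False
   \<comment> \<open>A low frequency \<open>xi\<close> means \<open>r n <= 1 + norm eta\<close>,
     deep in the tail of the transform of \<open>k\<close>. The tail is at most a multiple of
     \<open>1 / r n ^ K\<close>, and this is at most \<open>ghat (t * r n)\<close> by the choice of
     the radii.\<close>
   define x where "x = 1 / (1 + norm eta) ^ K"
   have "r n <= 1 + norm eta" using tri False rho by simp
   then have pw: "r n ^ K <= (1 + norm eta) ^ K" using r(2)[of n] by (intro power_mono) auto
   have rp: "0 < r n ^ K" using r(2)[of n] by (intro zero_less_power) simp
   have "x <= 1 / r n ^ K" unfolding x_def using pw rp by (intro divide_left_mono mult_pos_pos) auto
   also have "... <= ghat (t * r n)" using r(3)[of n] rp by (simp add: pos_divide_le_eq mult.commute)
   finally have xg: "x <= ghat (t * r n)" .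
   have "0 <= 1 / y \<and> 1 / y <= 1" if "1 <= y" for y :: real using that by simp
   from this[OF pK] have x01: "0 <= x" "x <= 1" unfolding x_def by blast+
   have "(norm (fourier_real k eta))^2 <= (Ck * x)^2" using Ck(2)[of eta] by (intro power_mono) (auto simp: x_def)
   also have "... <= Ck^2 * x"
    unfolding power_mult_distrib by (rule mult_left_mono) (use x01 in \<open>simp_all add: power2_eq_square mult_left_le\<close>)
   also have "... <= Ck^2 * ghat (t * r n)" by (rule mult_left_mono[OF xg]) simp
   finally have "ghat (t * norm xi) * (xi \<bullet> e)^2 * (norm (fourier_real k eta))^2 <= ghat (t * norm xi) * (norm xi)^2 * (Ck^2 * ghat (t * r n))"
    using gxi xe by (intro mult_mono) auto
   also have "... = 1 * (ghat (t * r n) * W xi)" using False by (simp add: W_def mult_ac)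
   also have "... <= rho^2 * (ghat (t * r n) * (m eta + W xi))"
    using gr W0 m0 one_le_power[OF rho(2), of 2] by (intro mult_mono) auto
   finally show "ghat (t * norm xi) * (xi \<bullet> e)^2 * (norm (fourier_real k eta))^2 <= rho^2 * (ghat (t * r n) * (m eta + W xi))" .
  qed
 qed (use r(2)[of n] t in \<open>auto intro: ghat_nonneg\<close>)
 have "filterlim r at_top sequentially"
  by (rule filterlim_at_top_mono[OF filterlim_real_sequentially]) (simp add: r(1))
 moreover have "\<exists>c. \<forall>n. spectral_energy ghat t (packet (r n + 1 / 2) e k) <= c * ghat (t * r n)"
  using E by (intro exI[of _ "(LBINT xi. m xi) + (LBINT xi. W xi)"]) (simp add: mult.commute)
 ultimately have "test_data t e delta k h r"
  unfolding test_data_def beta_def[symmetric] Dg_def[symmetric] J_def[symmetric] q_def[symmetric] using delta k h h0 bd posh posq J by blast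
 then show ?thesis by blast
qed

end

theorem theorem2p3:
  fixes g :: "'a::euclidean_space \<Rightarrow> real"
    and ghat :: "real \<Rightarrow> real"
    and \<sigma> :: "real \<Rightarrow> ennreal"
    and p :: ennreal
    and t M :: real
  assumes smooth: "smooth_on (- {0}) g"
    and radial: "\<And>x y. x \<noteq> 0 \<Longrightarrow> norm x = norm y \<Longrightarrow> g x = g y"
    and cpd: "cond_pos_def (\<lambda>x y. g (x - y))"
    and ghat: "potential_fourier g (\<lambda>\<xi>. ghat (norm \<xi>))"
    and ghat_noninc: "antimono_on {0<..} ghat"
    and nonconst: "\<exists>x y. x \<noteq> 0 \<and> y \<noteq> 0 \<and> g x \<noteq> g y"
    and t: "t > 0"
    and p: "1 \<le> p"
    and decay: "((\<lambda>r. r\<^sup>2 * ghat r) \<longlongrightarrow> 0) at_top"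
    and sigma_measurable: "\<sigma> \<in> borel_measurable (restrict_space borel {0..})"
    and sigma_ge_2: "2 \<le> p \<Longrightarrow> weighted_decay ghat t (\<lambda>r. Linf_on {r - 1..r + 1} \<sigma>)"
    and sigma_less_2: "p < 2 \<Longrightarrow>
      \<exists>R\<ge>0. \<exists>D :: nat \<Rightarrow> real \<Rightarrow> real.
        (AE r in lborel. R < r \<longrightarrow> \<sigma> r < top) \<and>
        (\<forall>n\<le>DIM('a) + 1. weak_deriv_on {R<..} n (\<lambda>r. enn2real (\<sigma> r)) (D n)) \<and>
        weighted_decay ghat t
          (\<lambda>r. Max ((\<lambda>n. Linf_on {r - 1..r + 1} (\<lambda>s. ennreal \<bar>D n s\<bar>)) ` {..DIM('a) + 1}))"
    and M: "M \<ge> 0"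
  shows "\<exists>(v :: 'a \<Rightarrow> 'a) (w :: 'a \<Rightarrow> 'a) (f :: 'a \<Rightarrow> real) (h :: 'a \<Rightarrow> real).
    smooth_on UNIV v \<and>
    schwartz f \<and> (\<integral>x. f x \<partial>lborel) = 0 \<and>
    schwartz h \<and> (\<integral>x. h x \<partial>lborel) = 0 \<and>
    fourier_multiplier \<sigma> v w \<and>
    integrable (lborel \<Otimes>\<^sub>M lborel) (commutator_integrand g v f h) \<and>
    (let N = \<bar>\<integral>z. commutator_integrand g v f h z \<partial>(lborel \<Otimes>\<^sub>M lborel)\<bar>;
         A = Lp_norm top (\<lambda>x. onorm (frechet_derivative v (at x))) + Lp_norm p w;
         B = enn2real A * energy_norm (dilate t g) f * energy_norm (dilate t g) h
     in A < top \<and> 0 < B \<and> N / B \<ge> M)"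
proof -
 interpret radial_potential g ghat
  using smooth radial ghat ghat_noninc nonconst decay by unfold_locales
 obtain e :: 'a where e: "e \<in> Basis" using nonempty_Basis by blast
 have "\<exists>delta k h r. test_data t e delta k h r"
 proof (cases "\<exists>C. \<forall>r\<ge>1. r ^ (DIM('a) + 2) * ghat (t * r) <= C")
  case True
  then obtain C where "\<And>r. 1 <= r ==> r ^ (DIM('a) + 2) * ghat (t * r) <= C" by blast
  then interpret fast_radial_potential g ghat t C e using t e by unfold_locales
  show ?thesis by (rule test_data_exists)
 next
  case False
  then have "\<exists>r\<ge>1. C < r ^ (DIM('a) + 2) * ghat (t * r)" for C by (force simp: not_le)
  then show ?thesis by (rule slow_test_data_exists[OF t e])
 qed
 then obtain delta k h r where td: "test_data t e delta k h r" by blast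
 note td = td[unfolded test_data_def]
 have delta: "0 < delta" "delta <= 1 / 2" and k: "schwartz k" and h: "schwartz h" "(LBINT x. h x) = 0"
  and J: "(\<integral>(x, y). Re (fourier_real (bump delta) x) * (k x * dir_deriv e g (x - y) * h y) \<partial>lborel2) \<noteq> 0"
  and r: "filterlim r at_top sequentially"
  and pos: "0 < spectral_energy ghat t h"
   "0 < spectral_energy ghat t (dir_deriv e k)"
  using td by blast+
 obtain C where C: "\<And>u x y. u \<in> {k, dir_deriv e k} ==> \<bar>u x * dir_deriv e g (x - y) * h y\<bar> <= C / (1 + norm (x, y)) ^ (DIM('a \<times> 'a) + 1)"
  using td by blast
 obtain c where c: "\<And>n. spectral_energy ghat t (packet (r n + 1 / 2) e k) <= c * ghat (t * r n)"
  using td by blast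
 have tr: "filterlim (%r. t * r) at_top at_top" by (rule filterlim_tendsto_pos_mult_at_top[OF tendsto_const t filterlim_ident])
 \<comment> \<open>The decay hypothesis makes \<open>ghat\<close> itself tend to 0, which the
   additive 1 in the multiplier bounds requires.\<close>
 have "((%r. r^2 * ghat r / r^2) \<longlongrightarrow> 0) at_top"
  by (rule tendsto_divide_0[OF decay]) (intro filterlim_at_top_imp_at_infinity filterlim_pow_at_top filterlim_ident, simp)
 then have "(ghat \<longlongrightarrow> 0) at_top"
  by (rule Lim_transform_eventually) (use eventually_gt_at_top[of 0] in \<open>eventually_elim, simp\<close>)
 then have "((%r. sqrt (ghat (t * r))) \<longlongrightarrow> sqrt 0) at_top"
  by (intro tendsto_real_sqrt filterlim_compose[OF _ tr])
 then have s0: "((%r. sqrt (ghat (t * r))) \<longlongrightarrow> 0) at_top" by simp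
 have nn: "\<forall>\<^sub>F r in at_top. 0 <= ghat (t * r)"
  using eventually_gt_at_top[of 0] by eventually_elim (simp add: ghat_nonneg t)
 have "\<exists>K. ((%r. sqrt (ghat (t * r)) * K r) \<longlongrightarrow> 0) at_top \<and> (\<forall>r. 0 <= K r) \<and>
  (\<forall>\<^sub>F r in at_top. \<exists>w. fourier_multiplier \<sigma> (%x. Re (fourier_real (twin_bump delta (r + 1 / 2) e) x) *R e) w \<and>
   Lp_norm p w <= ennreal (K r / (r + 1 / 2)))"
  by (rule multiplier_Lp[OF sigma_measurable delta e p s0 nn]) (rule sigma_ge_2, assumption, rule sigma_less_2, assumption)
 then obtain K where K: "((%r. sqrt (ghat (t * r)) * K r) \<longlongrightarrow> 0) at_top" "\<And>r. 0 <= K r"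
  and w: "\<forall>\<^sub>F r in at_top. \<exists>w. fourier_multiplier \<sigma> (%x. Re (fourier_real (twin_bump delta (r + 1 / 2) e) x) *R e) w \<and>
   Lp_norm p w <= ennreal (K r / (r + 1 / 2))"
  by (elim exE conjE) (rule that, auto)
 show ?thesis
  by (rule commutator_unbounded[OF smooth ghat t _ decay delta(1) e K(1) _ w k h _ J r _ pos])
   (erule ghat_nonneg, rule K(2), erule C, rule c)
qed

end
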